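(* Let $D$ be a division ring, let $\mathcal{A}$ be an ultramatricial $D$-ring, and let $N$ be an extremal pseudo-rank function on $\mathcal{A}$ such that the completion $\mathcal{Q}$ of $\mathcal{A}$ with respect to $N$ is a continuous factor. Then there is an isomorphism of $D$-rings $\mathcal{Q}\cong\mathcal{M}_D$.
   Context: Rings are unital. A ring $R$ is (von Neumann) regular if for each $x\in R$ there is $y\in R$ with $x=xyx$. A pseudo-rank function on a unital ring $R$ is a function $N\colon R\to[0,1]$ such that: $N(1)=1$; $N(a+b)\le N(a)+N(b)$; $N(ab)\le N(a)$ and $N(ab)\le N(b)$ for all $a,b\in R$; and $N(e+f)=N(e)+N(f)$ for orthogonal idempotents $e,f$. It is a rank function if in addition $N(x)=0$ implies $x=0$. It induces the pseudo-metric $d(x,y)=N(x-y)$; if $R$ is regular, the (Hausdorff) completion of $R$ with respect to $N$, i.e. in this pseudo-metric, is a regular ring, complete with respect to the unique continuous extension of $N$, which is a rank function. A pseudo-rank function on a regular ring is extremal if it is an extreme point of the convex set $\mathbb{P}(R)$ of all pseudo-rank functions on $R$. A continuous factor is a simple, regular, right and left self-injective ring of type $II_f$ (i.e. directly finite and of type $II$; type $II$ means that there is a faithful directly finite idempotent but no nonzero abelian idempotent, where an idempotent $e$ of a ring $\mathcal{Q}$ is abelian if all idempotents of $e\mathcal{Q}e$ are central in $e\mathcal{Q}e$). A continuous factor $\mathcal{Q}$ has a unique rank function $N_{\mathcal{Q}}$, it is complete in the $N_{\mathcal{Q}}$-metric, and $N_{\mathcal{Q}}(\mathcal{Q})=[0,1]$.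 A $D$-ring is a unital ring $R$ together with a unital ring homomorphism $\iota\colon D\to R$. A morphism of $D$-rings $(R_1,\iota_1)\to(R_2,\iota_2)$ is a ring homomorphism $\varphi\colon R_1\to R_2$ with $\iota_2=\varphi\circ\iota_1$. A matricial $D$-ring is a $D$-ring isomorphic as a $D$-ring to a finite direct product $M_{n_1}(D)\times\cdots\times M_{n_r}(D)$ with its canonical $D$-ring structure (scalar diagonal matrices in each factor). An ultramatricial $D$-ring is a $D$-ring isomorphic as a $D$-ring to a direct limit of a sequence $(\mathcal{A}_n,\varphi_n)$ of matricial $D$-rings $\mathcal{A}_n$ and $D$-ring homomorphisms $\varphi_n\colon\mathcal{A}_n\to\mathcal{A}_{n+1}$. The completion of a $D$-ring is a $D$-ring via the canonical map. $\mathcal{M}_D$ is the completion of $\varinjlim_n M_{2^n}(D)$ (with respect to the block diagonal embeddings $x\mapsto\begin{pmatrix}x&0\\0&x\end{pmatrix}$) in the metric induced by its unique rank function. *)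

theory Defs
  imports
    Complex_Main
    "HOL-Library.FuncSet"
    "HOL-Algebra.QuotRing"
    "HOL-Algebra.Chinese_Remainder"
    "Jordan_Normal_Form.Matrix"
begin

text \<open>
  The division ring \<open>D\<close> is a type \<open>'d\<close> of class \<^class>\<open>division_ring\<close>;
  all other rings are \<open>HOL-Algebra\<close> rings, with their own carriers.
\<close>

section \<open>Regular rings and continuous factors\<close>

definition regular_ring :: "('a, 'm) ring_scheme \<Rightarrow> bool" where
  "regular_ring R \<longleftrightarrow> ring R \<and>
     (\<forall>x \<in> carrier R. \<exists>y \<in> carrier R. x = x \<otimes>\<^bsub>R\<^esub> y \<otimes>\<^bsub>R\<^esub> x)"

definition simple_ring :: "('a, 'm) ring_scheme \<Rightarrow> bool" where
  "simple_ring R \<longleftrightarrow> ring R \<and> \<one>\<^bsub>R\<^esub> \<noteq> \<zero>\<^bsub>R\<^esub> \<and>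
     (\<forall>I. ideal I R \<longrightarrow> I = {\<zero>\<^bsub>R\<^esub>} \<or> I = carrier R)"

definition opposite_ring :: "('a, 'm) ring_scheme \<Rightarrow> ('a, 'm) ring_scheme" where
  "opposite_ring R = R\<lparr>monoid.mult := \<lambda>x y. y \<otimes>\<^bsub>R\<^esub> x\<rparr>"

text \<open>The locale \<^locale>\<open>module\<close> only covers modules over commutative rings.\<close>

definition left_module :: "('a, 'm) ring_scheme \<Rightarrow> ('a, 'b) module \<Rightarrow> bool" where
  "left_module R M \<longleftrightarrow> ring R \<and> abelian_group M \<and>
     (\<forall>a \<in> carrier R. \<forall>x \<in> carrier M. a \<odot>\<^bsub>M\<^esub> x \<in> carrier M) \<and>
     (\<forall>a \<in> carrier R. \<forall>b \<in> carrier R. \<forall>x \<in> carrier M.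
        (a \<oplus>\<^bsub>R\<^esub> b) \<odot>\<^bsub>M\<^esub> x = a \<odot>\<^bsub>M\<^esub> x \<oplus>\<^bsub>M\<^esub> b \<odot>\<^bsub>M\<^esub> x) \<and>
     (\<forall>a \<in> carrier R. \<forall>x \<in> carrier M. \<forall>y \<in> carrier M.
        a \<odot>\<^bsub>M\<^esub> (x \<oplus>\<^bsub>M\<^esub> y) = a \<odot>\<^bsub>M\<^esub> x \<oplus>\<^bsub>M\<^esub> a \<odot>\<^bsub>M\<^esub> y) \<and>
     (\<forall>a \<in> carrier R. \<forall>b \<in> carrier R. \<forall>x \<in> carrier M.
        (a \<otimes>\<^bsub>R\<^esub> b) \<odot>\<^bsub>M\<^esub> x = a \<odot>\<^bsub>M\<^esub> (b \<odot>\<^bsub>M\<^esub> x)) \<and>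
     (\<forall>x \<in> carrier M. \<one>\<^bsub>R\<^esub> \<odot>\<^bsub>M\<^esub> x = x)"

definition left_module_hom ::
  "('a, 'm) ring_scheme \<Rightarrow> ('a, 'b) module \<Rightarrow> ('a, 'c) module \<Rightarrow> ('b \<Rightarrow> 'c) set" where
  "left_module_hom R M M' = {f. f \<in> carrier M \<rightarrow> carrier M' \<and>
     (\<forall>x \<in> carrier M. \<forall>y \<in> carrier M. f (x \<oplus>\<^bsub>M\<^esub> y) = f x \<oplus>\<^bsub>M'\<^esub> f y) \<and>
     (\<forall>a \<in> carrier R. \<forall>x \<in> carrier M. f (a \<odot>\<^bsub>M\<^esub> x) = a \<odot>\<^bsub>M'\<^esub> f x)}"

definition regular_module :: "('a, 'm) ring_scheme \<Rightarrow> ('a, 'a) module" where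
  "regular_module R = \<lparr>carrier = carrier R, monoid.mult = monoid.mult R, one = one R,
     zero = zero R, add = add R, smult = monoid.mult R\<rparr>"

text \<open>
  A module \<open>E\<close> is injective if homomorphisms into it extend along monomorphisms.  The test
  modules \<open>M\<close>, \<open>M'\<close> have to live in some HOL type \<open>'n\<close>.  For the self-injectivity of \<open>R\<close> this
  is the type of the elements of \<open>R\<close>: it contains all inclusions of a left ideal into \<open>R\<close>, and
  by Baer's criterion these already decide injectivity, so that no test module in another type
  can make a difference.
\<close>

definition injective_left_module ::
  "'n itself \<Rightarrow> ('a, 'm) ring_scheme \<Rightarrow> ('a, 'b) module \<Rightarrow> bool" where
  "injective_left_module _ R E \<longleftrightarrow> left_module R E \<and>
     (\<forall>(M :: ('a, 'n) module) (M' :: ('a, 'n) module).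
        \<forall>i \<in> left_module_hom R M M'. \<forall>g \<in> left_module_hom R M E.
          left_module R M \<longrightarrow> left_module R M' \<longrightarrow> inj_on i (carrier M) \<longrightarrow>
          (\<exists>h \<in> left_module_hom R M' E. \<forall>x \<in> carrier M. h (i x) = g x))"

definition left_self_injective :: "('a, 'm) ring_scheme \<Rightarrow> bool" where
  "left_self_injective R \<longleftrightarrow> injective_left_module TYPE('a) R (regular_module R)"

text \<open>Right \<open>R\<close>-modules are left modules over the opposite ring.\<close>

definition right_self_injective :: "('a, 'm) ring_scheme \<Rightarrow> bool" where
  "right_self_injective R \<longleftrightarrow> left_self_injective (opposite_ring R)"

definition idempotents :: "('a, 'm) ring_scheme \<Rightarrow> 'a set" where
  "idempotents R = {e \<in> carrier R. e \<otimes>\<^bsub>R\<^esub> e = e}"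

definition central :: "('a, 'm) ring_scheme \<Rightarrow> 'a \<Rightarrow> bool" where
  "central R z \<longleftrightarrow> z \<in> carrier R \<and> (\<forall>x \<in> carrier R. z \<otimes>\<^bsub>R\<^esub> x = x \<otimes>\<^bsub>R\<^esub> z)"

definition corner_ring :: "('a, 'm) ring_scheme \<Rightarrow> 'a \<Rightarrow> ('a, 'm) ring_scheme" where
  "corner_ring R e =
     R\<lparr>carrier := (\<lambda>x. e \<otimes>\<^bsub>R\<^esub> x \<otimes>\<^bsub>R\<^esub> e) ` carrier R, one := e\<rparr>"

definition directly_finite_ring :: "('a, 'm) ring_scheme \<Rightarrow> bool" where
  "directly_finite_ring R \<longleftrightarrow>
     (\<forall>x \<in> carrier R. \<forall>y \<in> carrier R. x \<otimes>\<^bsub>R\<^esub> y = \<one>\<^bsub>R\<^esub> \<longrightarrow> y \<otimes>\<^bsub>R\<^esub> x = \<one>\<^bsub>R\<^esub>)"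

definition directly_finite_idempotent :: "('a, 'm) ring_scheme \<Rightarrow> 'a \<Rightarrow> bool" where
  "directly_finite_idempotent R e \<longleftrightarrow>
     e \<in> idempotents R \<and> directly_finite_ring (corner_ring R e)"

definition abelian_idempotent :: "('a, 'm) ring_scheme \<Rightarrow> 'a \<Rightarrow> bool" where
  "abelian_idempotent R e \<longleftrightarrow> e \<in> idempotents R \<and>
     (\<forall>f \<in> idempotents (corner_ring R e). central (corner_ring R e) f)"

text \<open>
  Another convention asks that \<open>eR\<close> be a faithful module.  For simple \<open>R\<close>, the only case used
  here, either condition says \<open>e \<noteq> 0\<close>.
\<close>

definition faithful_idempotent :: "('a, 'm) ring_scheme \<Rightarrow> 'a \<Rightarrow> bool" where
  "faithful_idempotent R e \<longleftrightarrow> e \<in> idempotents R \<and>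
     (\<forall>f \<in> idempotents R. central R f \<longrightarrow> e \<otimes>\<^bsub>R\<^esub> f = \<zero>\<^bsub>R\<^esub> \<longrightarrow> f = \<zero>\<^bsub>R\<^esub>)"

definition type_II :: "('a, 'm) ring_scheme \<Rightarrow> bool" where
  "type_II R \<longleftrightarrow> (\<exists>e. faithful_idempotent R e \<and> directly_finite_idempotent R e) \<and>
     (\<forall>e. abelian_idempotent R e \<longrightarrow> e = \<zero>\<^bsub>R\<^esub>)"

definition type_II_f :: "('a, 'm) ring_scheme \<Rightarrow> bool" where
  "type_II_f R \<longleftrightarrow> directly_finite_ring R \<and> type_II R"

definition continuous_factor :: "('a, 'm) ring_scheme \<Rightarrow> bool" where
  "continuous_factor R \<longleftrightarrow> simple_ring R \<and> regular_ring R \<and>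
     right_self_injective R \<and> left_self_injective R \<and> type_II_f R"


section \<open>Pseudo-rank functions and completions\<close>

text \<open>
  Functions on \<open>R\<close> are taken in \<open>carrier R \<rightarrow>\<^sub>E {0..1}\<close>, so that
  equality of pseudo-rank functions is equality on the carrier.
\<close>

definition pseudo_rank_functions :: "('a, 'm) ring_scheme \<Rightarrow> ('a \<Rightarrow> real) set" where
  "pseudo_rank_functions R = {N \<in> carrier R \<rightarrow>\<^sub>E {0..1}.
     N \<one>\<^bsub>R\<^esub> = 1 \<and>
     (\<forall>a \<in> carrier R. \<forall>b \<in> carrier R. N (a \<oplus>\<^bsub>R\<^esub> b) \<le> N a + N b) \<and>
     (\<forall>a \<in> carrier R. \<forall>b \<in> carrier R. N (a \<otimes>\<^bsub>R\<^esub> b) \<le> N a \<and> N (a \<otimes>\<^bsub>R\<^esub> b) \<le> N b) \<and>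
     (\<forall>e \<in> idempotents R. \<forall>f \<in> idempotents R.
        e \<otimes>\<^bsub>R\<^esub> f = \<zero>\<^bsub>R\<^esub> \<longrightarrow> f \<otimes>\<^bsub>R\<^esub> e = \<zero>\<^bsub>R\<^esub> \<longrightarrow> N (e \<oplus>\<^bsub>R\<^esub> f) = N e + N f)}"

definition rank_functions :: "('a, 'm) ring_scheme \<Rightarrow> ('a \<Rightarrow> real) set" where
  "rank_functions R = {N \<in> pseudo_rank_functions R. \<forall>x \<in> carrier R. N x = 0 \<longrightarrow> x = \<zero>\<^bsub>R\<^esub>}"

text \<open>
  This unfolds \<open>extreme_point_of\<close> (see \<open>HOL-Analysis.Polytope\<close>), which needs a real vector
  space type, for the convex set \<^term>\<open>pseudo_rank_functions R\<close>.
\<close>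

definition extremal_pseudo_rank_function ::
  "('a, 'm) ring_scheme \<Rightarrow> ('a \<Rightarrow> real) \<Rightarrow> bool" where
  "extremal_pseudo_rank_function R N \<longleftrightarrow> N \<in> pseudo_rank_functions R \<and>
     (\<forall>P \<in> pseudo_rank_functions R. \<forall>Q \<in> pseudo_rank_functions R. \<forall>t :: real.
        0 < t \<longrightarrow> t < 1 \<longrightarrow> (\<forall>x \<in> carrier R. N x = (1 - t) * P x + t * Q x) \<longrightarrow> P = Q)"

text \<open>
  The completion in the pseudo-metric \<open>N (x - y)\<close>: Cauchy sequences modulo null sequences.
\<close>

definition cauchy_sequences :: "('a, 'm) ring_scheme \<Rightarrow> ('a \<Rightarrow> real) \<Rightarrow> (nat \<Rightarrow> 'a) set" where
  "cauchy_sequences R N = {s. range s \<subseteq> carrier R \<and>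
     (\<forall>\<epsilon>>0. \<exists>K. \<forall>m\<ge>K. \<forall>n\<ge>K. N (s m \<ominus>\<^bsub>R\<^esub> s n) < \<epsilon>)}"

definition cauchy_ring :: "('a, 'm) ring_scheme \<Rightarrow> ('a \<Rightarrow> real) \<Rightarrow> (nat \<Rightarrow> 'a) ring" where
  "cauchy_ring R N = \<lparr>carrier = cauchy_sequences R N,
     monoid.mult = (\<lambda>s t n. s n \<otimes>\<^bsub>R\<^esub> t n), one = (\<lambda>n. \<one>\<^bsub>R\<^esub>),
     zero = (\<lambda>n. \<zero>\<^bsub>R\<^esub>), add = (\<lambda>s t n. s n \<oplus>\<^bsub>R\<^esub> t n)\<rparr>"

definition null_sequences :: "('a, 'm) ring_scheme \<Rightarrow> ('a \<Rightarrow> real) \<Rightarrow> (nat \<Rightarrow> 'a) set" where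
  "null_sequences R N = {s. range s \<subseteq> carrier R \<and> (\<lambda>n. N (s n)) \<longlonglongrightarrow> 0}"

definition completion :: "('a, 'm) ring_scheme \<Rightarrow> ('a \<Rightarrow> real) \<Rightarrow> (nat \<Rightarrow> 'a) set ring" where
  "completion R N = cauchy_ring R N Quot null_sequences R N"

definition completion_map ::
  "('a, 'm) ring_scheme \<Rightarrow> ('a \<Rightarrow> real) \<Rightarrow> 'a \<Rightarrow> (nat \<Rightarrow> 'a) set" where
  "completion_map R N x = null_sequences R N +>\<^bsub>cauchy_ring R N\<^esub> (\<lambda>n. x)"


section \<open>\<open>D\<close>-rings\<close>

definition type_ring :: "'d::ring_1 itself \<Rightarrow> 'd ring" where
  "type_ring _ = \<lparr>carrier = UNIV, monoid.mult = (*), one = 1, zero = 0, add = (+)\<rparr>"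

definition D_ring :: "('a, 'm) ring_scheme \<Rightarrow> ('d::division_ring \<Rightarrow> 'a) \<Rightarrow> bool" where
  "D_ring R \<iota> \<longleftrightarrow> ring R \<and> \<iota> \<in> Ring.ring_hom (type_ring TYPE('d)) R"

definition D_ring_hom ::
  "('a, 'm) ring_scheme \<Rightarrow> ('d::division_ring \<Rightarrow> 'a) \<Rightarrow>
   ('b, 'n) ring_scheme \<Rightarrow> ('d \<Rightarrow> 'b) \<Rightarrow> ('a \<Rightarrow> 'b) set" where
  "D_ring_hom R \<iota> S \<kappa> = {\<phi> \<in> Ring.ring_hom R S. \<kappa> = \<phi> \<circ> \<iota>}"

definition D_ring_isomorphic ::
  "('a, 'm) ring_scheme \<Rightarrow> ('d::division_ring \<Rightarrow> 'a) \<Rightarrow>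
   ('b, 'n) ring_scheme \<Rightarrow> ('d \<Rightarrow> 'b) \<Rightarrow> bool" where
  "D_ring_isomorphic R \<iota> S \<kappa> \<longleftrightarrow> D_ring R \<iota> \<and> D_ring S \<kappa> \<and>
     (\<exists>\<phi> \<in> D_ring_hom R \<iota> S \<kappa>. bij_betw \<phi> (carrier R) (carrier S))"

definition matrix_ring :: "'d::division_ring itself \<Rightarrow> nat \<Rightarrow> 'd mat ring" where
  "matrix_ring _ n = ring_mat TYPE('d) n ()"

definition scalar_matrix :: "nat \<Rightarrow> 'd::division_ring \<Rightarrow> 'd mat" where
  "scalar_matrix n d = d \<cdot>\<^sub>m 1\<^sub>m n"

definition matricial_D_ring ::
  "('a, 'm) ring_scheme \<Rightarrow> ('d::division_ring \<Rightarrow> 'a) \<Rightarrow> bool" where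
  "matricial_D_ring R \<iota> \<longleftrightarrow>
     (\<exists>ns. ns \<noteq> [] \<and> (\<forall>n \<in> set ns. 0 < n) \<and>
        D_ring_isomorphic R \<iota>
          (RDirProd_list (map (matrix_ring TYPE('d)) ns))
          (\<lambda>d. map (\<lambda>n. scalar_matrix n d) ns))"


section \<open>Direct limits of sequences\<close>

text \<open>
  \<open>transition \<phi> n k = \<phi> (n + k - 1) \<circ> \<dots> \<circ> \<phi> n\<close> maps the \<open>n\<close>-th ring to the \<open>(n + k)\<close>-th.
  The direct limit consists of the classes of pairs \<open>(n, x)\<close>, \<open>x\<close> in the \<open>n\<close>-th ring, where two
  pairs are equivalent if they have the same image at some later stage.  Classes are added
  and multiplied by means of representatives at a common stage.
\<close>

primrec transition :: "(nat \<Rightarrow> 'b \<Rightarrow> 'b) \<Rightarrow> nat \<Rightarrow> nat \<Rightarrow> 'b \<Rightarrow> 'b" where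
  "transition \<phi> n 0 x = x"
| "transition \<phi> n (Suc k) x = \<phi> (n + k) (transition \<phi> n k x)"

definition limit_class ::
  "(nat \<Rightarrow> 'b ring) \<Rightarrow> (nat \<Rightarrow> 'b \<Rightarrow> 'b) \<Rightarrow> nat \<Rightarrow> 'b \<Rightarrow> (nat \<times> 'b) set" where
  "limit_class R \<phi> n x = {(m, y). y \<in> carrier (R m) \<and>
     (\<exists>j k. n + j = m + k \<and> transition \<phi> n j x = transition \<phi> m k y)}"

definition direct_limit ::
  "(nat \<Rightarrow> 'b ring) \<Rightarrow> (nat \<Rightarrow> 'b \<Rightarrow> 'b) \<Rightarrow> (nat \<times> 'b) set ring" where
  "direct_limit R \<phi> = \<lparr>carrier = {limit_class R \<phi> n x | n x. x \<in> carrier (R n)},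
     monoid.mult = (\<lambda>X Y. \<Union>{limit_class R \<phi> n (x \<otimes>\<^bsub>R n\<^esub> y) | n x y. (n, x) \<in> X \<and> (n, y) \<in> Y}),
     one = limit_class R \<phi> 0 \<one>\<^bsub>R 0\<^esub>,
     zero = limit_class R \<phi> 0 \<zero>\<^bsub>R 0\<^esub>,
     add = (\<lambda>X Y. \<Union>{limit_class R \<phi> n (x \<oplus>\<^bsub>R n\<^esub> y) | n x y. (n, x) \<in> X \<and> (n, y) \<in> Y})\<rparr>"

definition direct_limit_structure ::
  "(nat \<Rightarrow> 'b ring) \<Rightarrow> (nat \<Rightarrow> 'b \<Rightarrow> 'b) \<Rightarrow> (nat \<Rightarrow> 'd::division_ring \<Rightarrow> 'b) \<Rightarrow>
   'd \<Rightarrow> (nat \<times> 'b) set" where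
  "direct_limit_structure R \<phi> \<kappa> d = limit_class R \<phi> 0 (\<kappa> 0 d)"

text \<open>
  Every matricial \<open>D\<close>-ring has an isomorphic copy in the type \<open>'d mat list\<close> (namely the product
  of matrix rings in its definition), so it is no restriction to form the sequence there.
\<close>

definition ultramatricial_D_ring ::
  "('a, 'm) ring_scheme \<Rightarrow> ('d::division_ring \<Rightarrow> 'a) \<Rightarrow> bool" where
  "ultramatricial_D_ring A \<iota> \<longleftrightarrow>
     (\<exists>(R :: nat \<Rightarrow> 'd mat list ring) \<kappa> \<phi>.
        (\<forall>n. matricial_D_ring (R n) (\<kappa> n)) \<and>
        (\<forall>n. \<phi> n \<in> D_ring_hom (R n) (\<kappa> n) (R (Suc n)) (\<kappa> (Suc n))) \<and>
        D_ring_isomorphic A \<iota> (direct_limit R \<phi>) (direct_limit_structure R \<phi> \<kappa>))"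


section \<open>The ring \<open>\<M>\<^sub>D\<close>\<close>

definition block_diagonal :: "nat \<Rightarrow> 'd::division_ring mat \<Rightarrow> 'd mat" where
  "block_diagonal n x = four_block_mat x (0\<^sub>m (2^n) (2^n)) (0\<^sub>m (2^n) (2^n)) x"

definition dyadic_limit :: "'d::division_ring itself \<Rightarrow> (nat \<times> 'd mat) set ring" where
  "dyadic_limit _ = direct_limit (\<lambda>n. matrix_ring TYPE('d) (2^n)) block_diagonal"

definition dyadic_limit_structure :: "'d::division_ring \<Rightarrow> (nat \<times> 'd mat) set" where
  "dyadic_limit_structure =
     direct_limit_structure (\<lambda>n. matrix_ring TYPE('d) (2^n)) block_diagonal
       (\<lambda>n. scalar_matrix (2^n))"

definition dyadic_rank :: "'d::division_ring itself \<Rightarrow> (nat \<times> 'd mat) set \<Rightarrow> real" where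
  "dyadic_rank _ = (THE N. N \<in> rank_functions (dyadic_limit TYPE('d)))"

definition M_D :: "'d::division_ring itself \<Rightarrow> (nat \<Rightarrow> (nat \<times> 'd mat) set) set ring" where
  "M_D _ = completion (dyadic_limit TYPE('d)) (dyadic_rank TYPE('d))"

definition M_D_structure :: "'d::division_ring \<Rightarrow> (nat \<Rightarrow> (nat \<times> 'd mat) set) set" where
  "M_D_structure =
     completion_map (dyadic_limit TYPE('d)) (dyadic_rank TYPE('d)) \<circ> dyadic_limit_structure"

end

theory Submission
  imports Defs
begin

text \<open>
  The completion only remembers which matrix rings are embedded in each other approximately, and
  for an extremal pseudo-rank function of type \<open>II\<close> this information is always the same.
  
  A unital \<open>D\<close>-ring homomorphism between finite products of matrix rings over \<open>D\<close> is, up to an inner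
  automorphism that fixes the scalars, block diagonal: each block of the target is filled with copies
  of blocks of the source (\<open>D_hom_conjugate_standard\<close>).  Hence \<open>A\<close> is the limit of a sequence of
  products of matrix rings along block diagonal homomorphisms, and a pseudo-rank function \<open>N\<close> on \<open>A\<close> is
  given by the ranks \<open>wt n i\<close> of the minimal idempotents in the block \<open>i\<close> of the level \<open>n\<close>: the
  rank of an element is the sum of the ranks of its blocks with these weights (\<open>rank_like_eq\<close>).  This
  also determines the rank function of the dyadic limit, where the weight of the only block of the
  level \<open>m\<close> has to be \<open>1 / 2 ^ m\<close>.
  
  Two facts about the weights are used.
  
  \<^item> If \<open>N\<close> is extremal, then the normalized ranks of a fixed element in the blocks of late levels
    concentrate at its rank (\<open>concentration\<close>).  They form a reverse martingale, and reweighting the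
    blocks by the limit of such a martingale would split \<open>N\<close> into a convex combination.
  
  \<^item> If moreover the completion has no nonzero abelian idempotent, then the total weight of the blocks
    tends to \<open>0\<close>, so that blocks of bounded size are negligible (\<open>sum_wt_tendsto_0\<close>).  Otherwise
    the concentrated normalized ranks, being fractions with bounded denominators, leave only finitely
    many values for \<open>N\<close>, and an idempotent of least positive rank is abelian in the completion.
  
  Consequently a late level of \<open>A\<close> is covered by copies of \<open>M_{2^m}(D)\<close> up to a small error, and a late
  level of the dyadic limit is covered by copies of the blocks of a level of \<open>A\<close>, in the
  proportions that the weights prescribe.  A counting argument (\<open>matching\<close>) arranges these copies so
  that they extend given ones up to a set of rows of small weight, and matrices that differ only in
  such rows are close in the rank metric (\<open>rank_agree_off\<close>).  Going back and forth gives an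
  approximate intertwining of the two sequences with summable errors (\<open>intertwining_sequence\<close>), and
  thus an isomorphism of the completions (\<open>completion_isomorphic\<close>).
\<close>

section \<open>Rank of matrices over a division ring\<close>

lemma matrix_mult_assoc:
  fixes A :: "'i \<Rightarrow> 'j \<Rightarrow> 'd::semiring_0"
  shows "(\<Sum>k\<in>K. (\<Sum>j\<in>J. A i j * B j k) * C k l) = (\<Sum>j\<in>J. A i j * (\<Sum>k\<in>K. B j k * C k l))"
  unfolding sum_distrib_left sum_distrib_right
  by (subst sum.swap) (simp add: mult.assoc)

lemma sum_lessThan_add:
  fixes f :: "nat \<Rightarrow> 'a::comm_monoid_add"
  shows "(\<Sum>a<s+t. f a) = (\<Sum>a<s. f a) + (\<Sum>a<t. f (s + a))"
  by (induction t) (auto simp: add.assoc)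

lemma sum_delta_left:
  fixes f :: "'i \<Rightarrow> 'd::semiring_1"
  assumes "finite I"
  shows "(\<Sum>i\<in>I. of_bool (p = i) * f i) = (if p \<in> I then f p else 0)"
    and "(\<Sum>i\<in>I. of_bool (i = p) * f i) = (if p \<in> I then f p else 0)"
    and "(\<Sum>i\<in>I. f i * of_bool (p = i)) = (if p \<in> I then f p else 0)"
    and "(\<Sum>i\<in>I. f i * of_bool (i = p)) = (if p \<in> I then f p else 0)"
proof -
  have "(\<Sum>i\<in>I. of_bool (p = i) * f i) = (\<Sum>i\<in>I. if p = i then f i else 0)"
       "(\<Sum>i\<in>I. of_bool (i = p) * f i) = (\<Sum>i\<in>I. if p = i then f i else 0)"
       "(\<Sum>i\<in>I. f i * of_bool (p = i)) = (\<Sum>i\<in>I. if p = i then f i else 0)"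
       "(\<Sum>i\<in>I. f i * of_bool (i = p)) = (\<Sum>i\<in>I. if p = i then f i else 0)"
    by (auto intro!: sum.cong)
  then show "(\<Sum>i\<in>I. of_bool (p = i) * f i) = (if p \<in> I then f p else 0)"
    and "(\<Sum>i\<in>I. of_bool (i = p) * f i) = (if p \<in> I then f p else 0)"
    and "(\<Sum>i\<in>I. f i * of_bool (p = i)) = (if p \<in> I then f p else 0)"
    and "(\<Sum>i\<in>I. f i * of_bool (i = p)) = (if p \<in> I then f p else 0)"
    using assms by (simp_all add: sum.delta')
qed

definition sub_division_ring :: "'d::division_ring set \<Rightarrow> bool" where
  "sub_division_ring K \<longleftrightarrow> 0 \<in> K \<and> 1 \<in> K \<and>
     (\<forall>x\<in>K. \<forall>y\<in>K. x + y \<in> K \<and> x * y \<in> K) \<and> (\<forall>x\<in>K. - x \<in> K \<and> inverse x \<in> K)"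

lemma sub_division_ring_UNIV: "sub_division_ring UNIV"
  by (simp add: sub_division_ring_def)

lemma sub_division_ring_sum:
  assumes "sub_division_ring K" "\<And>i. i \<in> I \<Longrightarrow> f i \<in> K"
  shows "sum f I \<in> K"
  using assms(2)
  by (induction I rule: infinite_finite_induct) (use assms(1) in \<open>auto simp: sub_division_ring_def\<close>)

text \<open>
  Gaussian elimination, one column at a time: a nonzero column has a pivot, and subtracting
  the rank one matrix through that pivot clears its row and its column.  Clearing the row keeps
  the new column of \<open>V\<close> independent of the others, clearing the column does this for \<open>W\<close>.  The
  subring \<open>K\<close> matters for matrices that commute with the scalars: there \<open>K\<close> is the center.
\<close>

lemma full_rank_factorization:
  fixes M :: "'i \<Rightarrow> 'j \<Rightarrow> 'd::division_ring"
  assumes I: "finite I" and J: "finite J" and K: "sub_division_ring K"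
    and M: "\<forall>i\<in>I. \<forall>j\<in>J. M i j \<in> K"
  shows "\<exists>(s::nat) V W U X.
    (\<forall>i\<in>I. \<forall>j\<in>J. M i j = (\<Sum>a<s. V i a * W a j)) \<and>
    (\<forall>a<s. \<forall>b<s. (\<Sum>i\<in>I. U a i * V i b) = of_bool (a = b)) \<and>
    (\<forall>a<s. \<forall>b<s. (\<Sum>j\<in>J. W a j * X j b) = of_bool (a = b)) \<and>
    (\<forall>a<s. (\<forall>i\<in>I. V i a \<in> K \<and> U a i \<in> K) \<and> (\<forall>j\<in>J. W a j \<in> K \<and> X j a \<in> K))"
  using J M
proof (induction J arbitrary: M rule: finite_induct)
  case empty
  show ?case by (rule exI[of _ 0]) auto
next
  case (insert q J)
  have K0: "0 \<in> K" "1 \<in> K" and Kadd: "\<And>x y. x \<in> K \<Longrightarrow> y \<in> K \<Longrightarrow> x + y \<in> K"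
    and Kmult: "\<And>x y. x \<in> K \<Longrightarrow> y \<in> K \<Longrightarrow> x * y \<in> K" and Kneg: "\<And>x. x \<in> K \<Longrightarrow> - x \<in> K"
    and Kinv: "\<And>x. x \<in> K \<Longrightarrow> inverse x \<in> K"
    using K by (auto simp: sub_division_ring_def)
  have Kdiff: "\<And>x y. x \<in> K \<Longrightarrow> y \<in> K \<Longrightarrow> x - y \<in> K" using Kadd Kneg by fastforce
  have Ksum: "\<And>f S. (\<And>i. i \<in> S \<Longrightarrow> f i \<in> K) \<Longrightarrow> sum f S \<in> K"
    by (rule sub_division_ring_sum[OF K]) 
  show ?case
  proof (cases "\<forall>i\<in>I. M i q = 0")
    case True
    obtain s :: nat and V W U X where
      f: "\<forall>i\<in>I. \<forall>j\<in>J. M i j = (\<Sum>a<s. V i a * W a j)" 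
      "\<forall>a<s. \<forall>b<s. (\<Sum>i\<in>I. U a i * V i b) = of_bool (a = b)"
      "\<forall>a<s. \<forall>b<s. (\<Sum>j\<in>J. W a j * X j b) = of_bool (a = b)"
      "\<forall>a<s. (\<forall>i\<in>I. V i a \<in> K \<and> U a i \<in> K) \<and> (\<forall>j\<in>J. W a j \<in> K \<and> X j a \<in> K)"
      using insert.IH[of M] insert.prems by (blast intro: insertI2)
    have q1: "(\<Sum>j\<in>J. (if j = q then 0 else W a j) * (if j = q then 0 else X j b)) = (\<Sum>j\<in>J. W a j * X j b)" for a b
      using insert.hyps by (intro sum.cong) auto
    have q2: "(\<Sum>a<s. V i a * (if j = q then 0 else W a j)) = M i j" if "i \<in> I" "j \<in> insert q J" for i j
      using f(1) True that insert.hyps by (cases "j = q") auto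
    have q3: "(\<Sum>j\<in>insert q J. (if j = q then 0 else W a j) * (if j = q then 0 else X j b)) = of_bool (a = b)"
      if "a < s" "b < s" for a b
      using f(3) that insert.hyps by (simp add: q1)
    show ?thesis
      apply (rule exI[of _ s], rule exI[of _ V], rule exI[of _ "\<lambda>a j. if j = q then 0 else W a j"],
          rule exI[of _ U], rule exI[of _ "\<lambda>j a. if j = q then 0 else X j a"])
      using q2 q3 f(2) f(4) K0 by (simp only: Ball_def) simp
  next
    case False
    then obtain p where p: "p \<in> I" "M p q \<noteq> 0" by auto
    define c where "c = inverse (M p q)"
    have c: "M p q * c = 1" "c * M p q = 1" "c \<in> K" using p insert.prems Kinv by (auto simp: c_def)
    define M' where "M' i j = M i j - M i q * c * M p j" for i j
    have M'K: "\<forall>i\<in>I. \<forall>j\<in>J. M' i j \<in> K"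
      unfolding M'_def using p insert.prems c by (intro ballI Kdiff Kmult) auto
    from insert.IH[of M', OF M'K]
    obtain s :: nat and V W U X where
      f1: "\<And>i j. i\<in>I \<Longrightarrow> j\<in>J \<Longrightarrow> M' i j = (\<Sum>a<s. V i a * W a j)" and
      f2: "\<And>a b. a<s \<Longrightarrow> b<s \<Longrightarrow> (\<Sum>i\<in>I. U a i * V i b) = of_bool (a = b)" and
      f3: "\<And>a b. a<s \<Longrightarrow> b<s \<Longrightarrow> (\<Sum>j\<in>J. W a j * X j b) = of_bool (a = b)" and
      f4: "\<And>a. a<s \<Longrightarrow> (\<forall>i\<in>I. V i a \<in> K \<and> U a i \<in> K) \<and> (\<forall>j\<in>J. W a j \<in> K \<and> X j a \<in> K)"
      by (elim exE conjE) blast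
    have Vp: "V p b = 0" if b: "b < s" for b
    proof -
      have "V p b = (\<Sum>a<s. V p a * (\<Sum>j\<in>J. W a j * X j b))"
        using b by (simp add: f3 sum_delta_left)
      also have "\<dots> = (\<Sum>j\<in>J. (\<Sum>a<s. V p a * W a j) * X j b)"
        by (rule matrix_mult_assoc[symmetric])
      also have "\<dots> = (\<Sum>j\<in>J. M' p j * X j b)" using p by (intro sum.cong) (auto simp: f1)
      also have "\<dots> = 0" by (intro sum.neutral) (auto simp: M'_def c)
      finally show ?thesis .
    qed
    define V1 where "V1 i a = (if a = s then M i q * c else V i a)" for i a
    define W1 where "W1 a j = (if a = s then M p j else if j = q then 0 else W a j)" for a j
    define U1 where "U1 a i = (if a = s then of_bool (i = p)
       else U a i - (\<Sum>k\<in>I. U a k * (M k q * c)) * of_bool (i = p))" for a i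
    define X1 where "X1 j a = (if a = s then c * of_bool (j = q)
       else if j = q then - (c * (\<Sum>j\<in>J. M p j * X j a)) else X j a)" for j a
    have qJ: "q \<notin> J" by fact
    have g1: "M i j = (\<Sum>a<Suc s. V1 i a * W1 a j)" if "i\<in>I" "j\<in>insert q J" for i j
    proof (cases "j = q")
      case True
      then show ?thesis using c by (simp add: V1_def W1_def mult.assoc)
    next
      case False
      with that have j: "j \<in> J" by auto
      have "(\<Sum>a<Suc s. V1 i a * W1 a j) = M' i j + M i q * c * M p j"
        using False f1[OF that(1) j] by (simp add: V1_def W1_def)
      then show ?thesis by (simp add: M'_def)
    qed
    have g2: "(\<Sum>i\<in>I. U1 a i * V1 i b) = of_bool (a = b)" if "a<Suc s" "b<Suc s" for a b
    proof -
      have *: "(\<Sum>i\<in>I. of_bool (i = p) * V1 i b) = of_bool (s = b)"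
        using I p that c by (auto simp: sum_delta_left V1_def Vp)
      show ?thesis
      proof (cases "a = s")
        case True
        then show ?thesis using * by (simp add: U1_def)
      next
        case False
        then have as: "a < s" using that by simp
        have "(\<Sum>i\<in>I. U1 a i * V1 i b) = (\<Sum>i\<in>I. U a i * V1 i b)
           - (\<Sum>k\<in>I. U a k * (M k q * c)) * (\<Sum>i\<in>I. of_bool (i = p) * V1 i b)"
          using False unfolding sum_distrib_left[of "sum _ _"] by (simp add: U1_def left_diff_distrib sum_subtractf mult.assoc)
        also have "\<dots> = of_bool (a = b)"
        proof (cases "b = s")
          case True
          then show ?thesis unfolding * using as by (simp add: V1_def)
        next
          case False
          then show ?thesis unfolding * using as that f2[of a b] by (simp add: V1_def)
        qed
        finally show ?thesis .
      qed
    qed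
    have g3: "(\<Sum>j\<in>insert q J. W1 a j * X1 j b) = of_bool (a = b)" if "a<Suc s" "b<Suc s" for a b
    proof -
      have e: "(\<Sum>j\<in>insert q J. W1 a j * X1 j b) = W1 a q * X1 q b + (\<Sum>j\<in>J. W1 a j * X1 j b)"
        using insert.hyps by simp
      show ?thesis
      proof (cases "b = s")
        case True
        have z: "(\<Sum>j\<in>J. W1 a j * X1 j b) = 0"
          using qJ True by (intro sum.neutral) (auto simp: X1_def)
        show ?thesis unfolding e z using True c by (simp add: W1_def X1_def)
      next
        case False
        then have bs: "b < s" using that by simp
        have z: "(\<Sum>j\<in>J. W1 a j * X1 j b) = (\<Sum>j\<in>J. (if a = s then M p j else W a j) * X j b)"
          using qJ False by (intro sum.cong) (auto simp: X1_def W1_def)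
        show ?thesis
        proof (cases "a = s")
          case True
          have "M p q * (c * (\<Sum>j\<in>J. M p j * X j b)) = (\<Sum>j\<in>J. M p j * X j b)"
            using c by (simp add: mult.assoc[symmetric])
          then show ?thesis unfolding e z using True False by (simp add: W1_def X1_def)
        next
          case aF: False
          then show ?thesis unfolding e z using that False f3[of a b] by (simp add: W1_def)
        qed
      qed
    qed
    have g4: "V1 i a \<in> K" "U1 a i \<in> K" if "a<Suc s" "i \<in> I" for a i
    proof -
      have "U a i \<in> K \<and> (\<Sum>k\<in>I. U a k * (M k q * c)) \<in> K" if "a < s"
        using f4[OF that] \<open>i \<in> I\<close> insert.prems c by (auto intro!: Ksum Kmult)
      then show "V1 i a \<in> K" "U1 a i \<in> K" using that f4[of a] insert.prems c K0
        by (auto simp: V1_def U1_def intro!: Kmult Kdiff)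
    qed
    have g5: "W1 a j \<in> K" "X1 j a \<in> K" if "a<Suc s" "j \<in> insert q J" for a j
    proof -
      have "(\<Sum>k\<in>J. M p k * X k a) \<in> K" if "a < s"
        using f4[OF that] p insert.prems c by (auto intro!: Ksum Kmult)
      then show "W1 a j \<in> K" "X1 j a \<in> K" using that f4[of a] insert.prems c K0 p
        by (auto simp: W1_def X1_def intro!: Kmult Kneg)
    qed
    show ?thesis
      apply (rule exI[of _ "Suc s"], rule exI[of _ V1], rule exI[of _ W1], rule exI[of _ U1], rule exI[of _ X1])
      by (intro conjI allI impI ballI) (rule g1 g2 g3 g4 g5; assumption)+
  qed
qed

text \<open>
  Division rings have invariant basis number: eliminating with a pivot in row \<open>p\<close> of \<open>A\<close> removes
  one row of \<open>A\<close> and one of the intermediate indices.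
\<close>

lemma card_le_if_right_inverse:
  fixes A :: "'i \<Rightarrow> 'k \<Rightarrow> 'd::division_ring" and B :: "'k \<Rightarrow> 'i \<Rightarrow> 'd"
  assumes "finite I" "finite S"
    and "\<And>i j. i \<in> I \<Longrightarrow> j \<in> I \<Longrightarrow> (\<Sum>k\<in>S. A i k * B k j) = of_bool (i = j)"
  shows "card I \<le> card S"
  using assms
proof (induction I arbitrary: A S rule: finite_induct)
  case empty
  then show ?case by simp
next
  case (insert p I)
  have "\<exists>q\<in>S. A p q \<noteq> 0"
  proof (rule ccontr)
    assume "\<not> ?thesis"
    then have "(\<Sum>k\<in>S. A p k * B k p) = 0" by (intro sum.neutral) auto
    then show False using insert.prems(2)[of p p] by simp
  qed
  then obtain q where q: "q \<in> S" "A p q \<noteq> 0" by auto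
  define A' where "A' i k = A i k - A i q * inverse (A p q) * A p k" for i k
  have "(\<Sum>k\<in>S-{q}. A' i k * B k j) = of_bool (i = j)" if "i \<in> I" "j \<in> I" for i j
  proof -
    have "(\<Sum>k\<in>S-{q}. A' i k * B k j) = (\<Sum>k\<in>S. A' i k * B k j)"
      using q insert.prems(1) by (intro sum.mono_neutral_left) (auto simp: A'_def mult.assoc)
    also have "\<dots> = (\<Sum>k\<in>S. A i k * B k j) - A i q * inverse (A p q) * (\<Sum>k\<in>S. A p k * B k j)"
      unfolding sum_distrib_left by (simp add: A'_def left_diff_distrib sum_subtractf mult.assoc)
    also have "\<dots> = of_bool (i = j)"
      using insert.prems(2)[of i j] insert.prems(2)[of p j] that insert.hyps by auto
    finally show ?thesis .
  qed
  then have "card I \<le> card (S - {q})" using insert.IH[of "S - {q}" A'] insert.prems by blast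
  then show ?case using q insert by (simp add: card_Diff_singleton card_gt_0_iff Suc_le_eq)
    (metis Suc_pred card_gt_0_iff empty_iff le_imp_less_Suc)
qed

text \<open>
  A full rank factorization attains this minimum, as its factors have one-sided inverses.
\<close>

definition mrank :: "'i set \<Rightarrow> 'j set \<Rightarrow> ('i \<Rightarrow> 'j \<Rightarrow> 'd::division_ring) \<Rightarrow> nat" where
  "mrank I J M = (LEAST s. \<exists>V W. \<forall>i\<in>I. \<forall>j\<in>J. M i j = (\<Sum>a<s. V i a * W a j))"

lemma mrank_le:
  assumes "\<And>i j. i \<in> I \<Longrightarrow> j \<in> J \<Longrightarrow> M i j = (\<Sum>a<s. V i a * W a j)"
  shows "mrank I J M \<le> s"
  unfolding mrank_def by (rule Least_le) (use assms in blast)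

lemma mrank_cong:
  assumes "\<And>i j. i \<in> I \<Longrightarrow> j \<in> J \<Longrightarrow> M i j = M' i j"
  shows "mrank I J M = mrank I J M'"
  unfolding mrank_def by (rule arg_cong[of _ _ Least]) (use assms in auto)

lemma mrank_attained:
  fixes M :: "'i \<Rightarrow> 'j \<Rightarrow> 'd::division_ring"
  assumes "finite I" "finite J"
  obtains V W where "\<And>i j. i \<in> I \<Longrightarrow> j \<in> J \<Longrightarrow> M i j = (\<Sum>a<mrank I J M. V i a * W a j)"
proof -
  have "\<exists>(s::nat) V W. \<forall>i\<in>I. \<forall>j\<in>J. M i j = (\<Sum>a<s. V i a * W a j)"
    using full_rank_factorization[OF assms sub_division_ring_UNIV, of M] by blast
  then have "\<exists>V W. \<forall>i\<in>I. \<forall>j\<in>J. M i j = (\<Sum>a<mrank I J M. V i a * W a j)"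
    unfolding mrank_def by (rule LeastI_ex)
  then show ?thesis using that by blast
qed

lemma le_mrank:
  fixes M :: "'i \<Rightarrow> 'j \<Rightarrow> 'd::division_ring"
  assumes "finite I" "finite J" "finite S"
    and UMX: "\<And>a b. a \<in> S \<Longrightarrow> b \<in> S \<Longrightarrow> (\<Sum>i\<in>I. U a i * (\<Sum>j\<in>J. M i j * X j b)) = of_bool (a = b)"
  shows "card S \<le> mrank I J M"
proof -
  obtain V W where f: "\<And>i j. i \<in> I \<Longrightarrow> j \<in> J \<Longrightarrow> M i j = (\<Sum>a<mrank I J M. V i a * W a j)"
    using mrank_attained[OF assms(1,2), of M] by blast
  have "(\<Sum>k<mrank I J M. (\<Sum>i\<in>I. U a i * V i k) * (\<Sum>j\<in>J. W k j * X j b)) = of_bool (a = b)"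
    if "a \<in> S" "b \<in> S" for a b
  proof -
    have "(\<Sum>k<mrank I J M. (\<Sum>i\<in>I. U a i * V i k) * (\<Sum>j\<in>J. W k j * X j b))
       = (\<Sum>i\<in>I. U a i * (\<Sum>k<mrank I J M. V i k * (\<Sum>j\<in>J. W k j * X j b)))"
      by (rule matrix_mult_assoc)
    also have "\<dots> = (\<Sum>i\<in>I. U a i * (\<Sum>j\<in>J. (\<Sum>k<mrank I J M. V i k * W k j) * X j b))"
      by (simp add: matrix_mult_assoc)
    also have "\<dots> = (\<Sum>i\<in>I. U a i * (\<Sum>j\<in>J. M i j * X j b))"
      by (intro sum.cong refl arg_cong2[of _ _ _ _ times]) (auto simp: f)
    finally show ?thesis using UMX[OF that] by simp
  qed
  then have "card S \<le> card {..<mrank I J M}"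
    by (intro card_le_if_right_inverse[where A = "\<lambda>a k. \<Sum>i\<in>I. U a i * V i k"
          and B = "\<lambda>k b. \<Sum>j\<in>J. W k j * X j b"]) (use assms(3) in auto)
  then show ?thesis by simp
qed

lemma mrank_factorization:
  fixes M :: "'i \<Rightarrow> 'j \<Rightarrow> 'd::division_ring"
  assumes "finite I" "finite J"
  obtains V W U X where "\<And>i j. i \<in> I \<Longrightarrow> j \<in> J \<Longrightarrow> M i j = (\<Sum>a<mrank I J M. V i a * W a j)"
    and "\<And>a b. a < mrank I J M \<Longrightarrow> b < mrank I J M \<Longrightarrow> (\<Sum>i\<in>I. U a i * V i b) = of_bool (a = b)"
    and "\<And>a b. a < mrank I J M \<Longrightarrow> b < mrank I J M \<Longrightarrow> (\<Sum>j\<in>J. W a j * X j b) = of_bool (a = b)"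
proof -
  have "\<forall>i\<in>I. \<forall>j\<in>J. M i j \<in> UNIV" by simp
  from full_rank_factorization[OF assms sub_division_ring_UNIV this]
  obtain s :: nat and V W U X where
      f1: "\<And>i j. i\<in>I \<Longrightarrow> j\<in>J \<Longrightarrow> M i j = (\<Sum>a<s. V i a * W a j)" and
      f2: "\<And>a b. a<s \<Longrightarrow> b<s \<Longrightarrow> (\<Sum>i\<in>I. U a i * V i b) = of_bool (a = b)" and
      f3: "\<And>a b. a<s \<Longrightarrow> b<s \<Longrightarrow> (\<Sum>j\<in>J. W a j * X j b) = of_bool (a = b)"
    by (elim exE conjE) blast
  have "mrank I J M \<le> s" by (rule mrank_le) (rule f1)
  moreover have "card {..<s} \<le> mrank I J M"
  proof (rule le_mrank[OF assms])
    fix a b assume ab: "a \<in> {..<s}" "b \<in> {..<s}"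
    have "(\<Sum>i\<in>I. U a i * (\<Sum>j\<in>J. M i j * X j b)) = (\<Sum>i\<in>I. U a i * (\<Sum>j\<in>J. (\<Sum>a<s. V i a * W a j) * X j b))"
      by (intro sum.cong refl arg_cong2[of _ _ _ _ times]) (auto simp: f1)
    also have "\<dots> = (\<Sum>i\<in>I. U a i * (\<Sum>k<s. V i k * (\<Sum>j\<in>J. W k j * X j b)))"
      by (simp add: matrix_mult_assoc)
    also have "\<dots> = (\<Sum>i\<in>I. U a i * V i b)"
      using ab by (simp add: f3 sum_delta_left)
    finally show "(\<Sum>i\<in>I. U a i * (\<Sum>j\<in>J. M i j * X j b)) = of_bool (a = b)" using f2 ab by simp
  qed auto
  ultimately have "s = mrank I J M" by simp
  with f1 f2 f3 show ?thesis using that by blast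
qed

lemma mrank_add_le:
  fixes M :: "'i \<Rightarrow> 'j \<Rightarrow> 'd::division_ring"
  assumes "finite I" "finite J"
  shows "mrank I J (\<lambda>i j. M i j + M' i j) \<le> mrank I J M + mrank I J M'"
proof -
  obtain V W where f: "\<And>i j. i \<in> I \<Longrightarrow> j \<in> J \<Longrightarrow> M i j = (\<Sum>a<mrank I J M. V i a * W a j)"
    using mrank_attained[OF assms, of M] by blast
  obtain V' W' where f': "\<And>i j. i \<in> I \<Longrightarrow> j \<in> J \<Longrightarrow> M' i j = (\<Sum>a<mrank I J M'. V' i a * W' a j)"
    using mrank_attained[OF assms, of M'] by blast
  let ?s = "mrank I J M"
  show ?thesis
    by (rule mrank_le[where V = "\<lambda>i a. if a < ?s then V i a else V' i (a - ?s)"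
          and W = "\<lambda>a j. if a < ?s then W a j else W' (a - ?s) j"])
      (simp add: sum_lessThan_add f f')
qed

lemma mrank_mult_le:
  fixes M :: "'i \<Rightarrow> 'j \<Rightarrow> 'd::division_ring"
  assumes "finite I" "finite J" "finite L"
  shows "mrank I L (\<lambda>i l. \<Sum>j\<in>J. M i j * M' j l) \<le> mrank I J M"
    and "mrank I L (\<lambda>i l. \<Sum>j\<in>J. M i j * M' j l) \<le> mrank J L M'"
proof -
  obtain V W where f: "\<And>i j. i \<in> I \<Longrightarrow> j \<in> J \<Longrightarrow> M i j = (\<Sum>a<mrank I J M. V i a * W a j)"
    using mrank_attained[OF assms(1,2), of M] by blast
  obtain V' W' where f': "\<And>i j. i \<in> J \<Longrightarrow> j \<in> L \<Longrightarrow> M' i j = (\<Sum>a<mrank J L M'. V' i a * W' a j)"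
    using mrank_attained[OF assms(2,3), of M'] by blast
  show "mrank I L (\<lambda>i l. \<Sum>j\<in>J. M i j * M' j l) \<le> mrank I J M"
    by (rule mrank_le[where V = V and W = "\<lambda>a l. \<Sum>j\<in>J. W a j * M' j l"])
      (simp add: matrix_mult_assoc[symmetric] f)
  show "mrank I L (\<lambda>i l. \<Sum>j\<in>J. M i j * M' j l) \<le> mrank J L M'"
    by (rule mrank_le[where V = "\<lambda>i a. \<Sum>j\<in>J. M i j * V' j a" and W = W'])
      (simp add: matrix_mult_assoc f')
qed

lemma mrank_one:
  assumes "finite I"
  shows "mrank I I (\<lambda>i j. of_bool (i = j) :: 'd::division_ring) = card I"
proof (rule antisym)
  obtain h where h: "bij_betw h {..<card I} I"
    using assms ex_bij_betw_nat_finite by (metis atLeast0LessThan)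
  have "(of_bool (i = j) :: 'd) = (\<Sum>a<card I. of_bool (i = h a) * of_bool (h a = j))"
    if "i \<in> I" "j \<in> I" for i j
    using sum.reindex_bij_betw[OF h, of "\<lambda>k. of_bool (i = k) * of_bool (k = j) :: 'd"]
    by (simp add: sum_delta_left[OF assms] that del: of_bool_eq_iff)
  then show "mrank I I (\<lambda>i j. of_bool (i = j) :: 'd) \<le> card I" by (rule mrank_le)
  show "card I \<le> mrank I I (\<lambda>i j. of_bool (i = j) :: 'd)"
    by (rule le_mrank[OF assms assms assms, where U = "\<lambda>a i. of_bool (a = i)" and X = "\<lambda>a i. of_bool (a = i)"])
      (simp add: sum_delta_left[OF assms] assms)
qed

lemma mrank_eq_0_iff:
  fixes M :: "'i \<Rightarrow> 'j \<Rightarrow> 'd::division_ring"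
  assumes "finite I" "finite J"
  shows "mrank I J M = 0 \<longleftrightarrow> (\<forall>i\<in>I. \<forall>j\<in>J. M i j = 0)"
proof
  assume 0: "mrank I J M = 0"
  obtain V W where f: "\<And>i j. i \<in> I \<Longrightarrow> j \<in> J \<Longrightarrow> M i j = (\<Sum>a<mrank I J M. V i a * W a j)"
    using mrank_attained[OF assms, of M] by blast
  then show "\<forall>i\<in>I. \<forall>j\<in>J. M i j = 0" using 0 by simp
next
  assume "\<forall>i\<in>I. \<forall>j\<in>J. M i j = 0"
  then have "mrank I J M \<le> 0" by (intro mrank_le) auto
  then show "mrank I J M = 0" by simp
qed

text \<open>
  Full rank factorizations \<open>e = VW\<close>, \<open>f = V'W'\<close> of orthogonal idempotents satisfy \<open>WV = 1\<close>,
  \<open>W'V' = 1\<close>, \<open>WV' = 0\<close> and \<open>W'V = 0\<close>, so that the stacked \<open>W\<close>, \<open>W'\<close> are a left inverse of the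
  juxtaposed \<open>V\<close>, \<open>V'\<close>.
\<close>

lemma mrank_orthogonal_idempotents:
  fixes e :: "'i \<Rightarrow> 'i \<Rightarrow> 'd::division_ring"
  assumes I: "finite I"
    and ee: "\<And>i j. i \<in> I \<Longrightarrow> j \<in> I \<Longrightarrow> (\<Sum>k\<in>I. e i k * e k j) = e i j"
    and ff: "\<And>i j. i \<in> I \<Longrightarrow> j \<in> I \<Longrightarrow> (\<Sum>k\<in>I. f i k * f k j) = f i j"
    and ef: "\<And>i j. i \<in> I \<Longrightarrow> j \<in> I \<Longrightarrow> (\<Sum>k\<in>I. e i k * f k j) = 0"
    and fe: "\<And>i j. i \<in> I \<Longrightarrow> j \<in> I \<Longrightarrow> (\<Sum>k\<in>I. f i k * e k j) = 0"
  shows "mrank I I (\<lambda>i j. e i j + f i j) = mrank I I e + mrank I I f"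
proof (rule antisym)
  show "mrank I I (\<lambda>i j. e i j + f i j) \<le> mrank I I e + mrank I I f"
    by (rule mrank_add_le[OF I I])
  let ?s = "mrank I I e" and ?t = "mrank I I f"
  obtain V W U X where 
    e1: "\<And>i j. i \<in> I \<Longrightarrow> j \<in> I \<Longrightarrow> e i j = (\<Sum>a<?s. V i a * W a j)" and
    e2: "\<And>a b. a < ?s \<Longrightarrow> b < ?s \<Longrightarrow> (\<Sum>i\<in>I. U a i * V i b) = of_bool (a = b)" and
    e3: "\<And>a b. a < ?s \<Longrightarrow> b < ?s \<Longrightarrow> (\<Sum>j\<in>I. W a j * X j b) = of_bool (a = b)"
    using mrank_factorization[OF I I, of e] by blast
  obtain V' W' U' X' where 
    f1: "\<And>i j. i \<in> I \<Longrightarrow> j \<in> I \<Longrightarrow> f i j = (\<Sum>a<?t. V' i a * W' a j)" and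
    f2: "\<And>a b. a < ?t \<Longrightarrow> b < ?t \<Longrightarrow> (\<Sum>i\<in>I. U' a i * V' i b) = of_bool (a = b)" and
    f3: "\<And>a b. a < ?t \<Longrightarrow> b < ?t \<Longrightarrow> (\<Sum>j\<in>I. W' a j * X' j b) = of_bool (a = b)"
    using mrank_factorization[OF I I, of f] by blast
  \<comment> \<open>recover the factors from the products\<close>
  have W: "(\<Sum>i\<in>I. U a i * e i j) = W a j" if "a < ?s" "j \<in> I" for a j
  proof -
    have "(\<Sum>i\<in>I. U a i * e i j) = (\<Sum>i\<in>I. U a i * (\<Sum>b<?s. V i b * W b j))"
      using that by (intro sum.cong) (auto simp: e1)
    also have "\<dots> = (\<Sum>b<?s. (\<Sum>i\<in>I. U a i * V i b) * W b j)" by (rule matrix_mult_assoc[symmetric])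
    finally show ?thesis using that by (simp add: e2 sum_delta_left)
  qed
  have W': "(\<Sum>i\<in>I. U' a i * f i j) = W' a j" if "a < ?t" "j \<in> I" for a j
  proof -
    have "(\<Sum>i\<in>I. U' a i * f i j) = (\<Sum>i\<in>I. U' a i * (\<Sum>b<?t. V' i b * W' b j))"
      using that by (intro sum.cong) (auto simp: f1)
    also have "\<dots> = (\<Sum>b<?t. (\<Sum>i\<in>I. U' a i * V' i b) * W' b j)" by (rule matrix_mult_assoc[symmetric])
    finally show ?thesis using that by (simp add: f2 sum_delta_left)
  qed
  have V: "(\<Sum>j\<in>I. e i j * X j b) = V i b" if "b < ?s" "i \<in> I" for i b
  proof -
    have "(\<Sum>j\<in>I. e i j * X j b) = (\<Sum>j\<in>I. (\<Sum>a<?s. V i a * W a j) * X j b)"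
      using that by (intro sum.cong) (auto simp: e1)
    also have "\<dots> = (\<Sum>a<?s. V i a * (\<Sum>j\<in>I. W a j * X j b))" by (rule matrix_mult_assoc)
    finally show ?thesis using that by (simp add: e3 sum_delta_left)
  qed
  have V': "(\<Sum>j\<in>I. f i j * X' j b) = V' i b" if "b < ?t" "i \<in> I" for i b
  proof -
    have "(\<Sum>j\<in>I. f i j * X' j b) = (\<Sum>j\<in>I. (\<Sum>a<?t. V' i a * W' a j) * X' j b)"
      using that by (intro sum.cong) (auto simp: f1)
    also have "\<dots> = (\<Sum>a<?t. V' i a * (\<Sum>j\<in>I. W' a j * X' j b))" by (rule matrix_mult_assoc)
    finally show ?thesis using that by (simp add: f3 sum_delta_left)
  qed
  have red: "(\<Sum>j\<in>I. (\<Sum>i\<in>I. u i * g i j) * (\<Sum>k\<in>I. h j k * x k)) = (\<Sum>i\<in>I. u i * (\<Sum>k\<in>I. (\<Sum>j\<in>I. g i j * h j k) * x k))"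
    for u x :: "'i \<Rightarrow> 'd" and g h
    by (subst matrix_mult_assoc[where A = "\<lambda>_. u" and l = undefined and C = "\<lambda>j _. \<Sum>k\<in>I. h j k * x k"])
      (subst matrix_mult_assoc[where C = "\<lambda>k _. x k" and l = undefined], rule refl)
  have WV: "(\<Sum>j\<in>I. W a j * V j b) = of_bool (a = b)" if "a < ?s" "b < ?s" for a b
  proof -
    have "(\<Sum>j\<in>I. W a j * V j b) = (\<Sum>j\<in>I. (\<Sum>i\<in>I. U a i * e i j) * (\<Sum>k\<in>I. e j k * X k b))"
      using that by (intro sum.cong refl) (simp add: W V)
    also have "\<dots> = (\<Sum>i\<in>I. U a i * (\<Sum>k\<in>I. (\<Sum>j\<in>I. e i j * e j k) * X k b))" by (rule red)
    also have "\<dots> = (\<Sum>i\<in>I. U a i * V i b)" using that by (simp add: ee V)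
    finally show ?thesis using that e2 by simp
  qed
  have WV'': "(\<Sum>j\<in>I. W' a j * V' j b) = of_bool (a = b)" if "a < ?t" "b < ?t" for a b
  proof -
    have "(\<Sum>j\<in>I. W' a j * V' j b) = (\<Sum>j\<in>I. (\<Sum>i\<in>I. U' a i * f i j) * (\<Sum>k\<in>I. f j k * X' k b))"
      using that by (intro sum.cong refl) (simp add: W' V')
    also have "\<dots> = (\<Sum>i\<in>I. U' a i * (\<Sum>k\<in>I. (\<Sum>j\<in>I. f i j * f j k) * X' k b))" by (rule red)
    also have "\<dots> = (\<Sum>i\<in>I. U' a i * V' i b)" using that by (simp add: ff V')
    finally show ?thesis using that f2 by simp
  qed
  have WV': "(\<Sum>j\<in>I. W a j * V' j b) = 0" if "a < ?s" "b < ?t" for a b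
  proof -
    have "(\<Sum>j\<in>I. W a j * V' j b) = (\<Sum>j\<in>I. (\<Sum>i\<in>I. U a i * e i j) * (\<Sum>k\<in>I. f j k * X' k b))"
      using that by (intro sum.cong refl) (simp add: W V')
    also have "\<dots> = (\<Sum>i\<in>I. U a i * (\<Sum>k\<in>I. (\<Sum>j\<in>I. e i j * f j k) * X' k b))" by (rule red)
    finally show ?thesis by (simp add: ef)
  qed
  have W'V: "(\<Sum>j\<in>I. W' a j * V j b) = 0" if "a < ?t" "b < ?s" for a b
  proof -
    have "(\<Sum>j\<in>I. W' a j * V j b) = (\<Sum>j\<in>I. (\<Sum>i\<in>I. U' a i * f i j) * (\<Sum>k\<in>I. e j k * X k b))"
      using that by (intro sum.cong refl) (simp add: W' V)
    also have "\<dots> = (\<Sum>i\<in>I. U' a i * (\<Sum>k\<in>I. (\<Sum>j\<in>I. f i j * e j k) * X k b))" by (rule red)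
    finally show ?thesis by (simp add: fe)
  qed
  define V2 where "V2 i a = (if a < ?s then V i a else V' i (a - ?s))" for i a
  define W2 where "W2 a i = (if a < ?s then W a i else W' (a - ?s) i)" for i a
  have WV2: "(\<Sum>j\<in>I. W2 a j * V2 j b) = of_bool (a = b)" if "a < ?s + ?t" "b < ?s + ?t" for a b
  proof -
    consider "a < ?s" "b < ?s" | "a < ?s" "\<not> b < ?s" "b - ?s < ?t" | "\<not> a < ?s" "a - ?s < ?t" "b < ?s"
      | "\<not> a < ?s" "a - ?s < ?t" "\<not> b < ?s" "b - ?s < ?t"
    proof -
      have "a < ?s \<or> a - ?s < ?t" "b < ?s \<or> b - ?s < ?t"
        using \<open>a < ?s + ?t\<close> \<open>b < ?s + ?t\<close> by linarith+
      then show ?thesis using that by blast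
    qed
    then show ?thesis
    proof cases
      case 4
      then show ?thesis using WV''[of "a - ?s" "b - ?s"] that
        by (simp add: W2_def V2_def eq_diff_iff)
    qed (auto simp: W2_def V2_def WV WV' W'V)
  qed
  have "card {..<?s + ?t} \<le> mrank I I (\<lambda>i j. e i j + f i j)"
  proof (rule le_mrank[OF I I])
    fix a b assume ab: "a \<in> {..<?s + ?t}" "b \<in> {..<?s + ?t}"
    have eq: "e i j + f i j = (\<Sum>c<?s+?t. V2 i c * W2 c j)" if "i \<in> I" "j \<in> I" for i j
      using that by (simp add: sum_lessThan_add e1 f1 V2_def W2_def)
    have "(\<Sum>i\<in>I. W2 a i * (\<Sum>j\<in>I. (e i j + f i j) * V2 j b)) =
        (\<Sum>i\<in>I. W2 a i * (\<Sum>j\<in>I. (\<Sum>c<?s+?t. V2 i c * W2 c j) * V2 j b))"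
      by (intro sum.cong refl arg_cong2[of _ _ _ _ times]) (auto simp: eq)
    also have "\<dots> = (\<Sum>i\<in>I. W2 a i * (\<Sum>c<?s+?t. V2 i c * (\<Sum>j\<in>I. W2 c j * V2 j b)))"
      by (simp add: matrix_mult_assoc)
    also have "\<dots> = (\<Sum>i\<in>I. W2 a i * V2 i b)"
      using ab by (simp add: WV2 sum_delta_left)
    finally show "(\<Sum>i\<in>I. W2 a i * (\<Sum>j\<in>I. (e i j + f i j) * V2 j b)) = of_bool (a = b)"
      using WV2 ab by simp
  qed auto
  then show "?s + ?t \<le> mrank I I (\<lambda>i j. e i j + f i j)" by simp
qed

(* Rows are pairs, but they are handled as single objects. *)
declare split_paired_All [simp del] split_paired_Ex [simp del]

section \<open>Finite products of matrix rings\<close>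

text \<open>
  The product of the matrix rings of sizes \<open>ns ! 0\<close>, \<open>ns ! 1\<close>, \<dots> is realised by block diagonal
  matrices.  The \<open>p\<close>-th row of the \<open>i\<close>-th block is \<open>(i, p)\<close>, so that a block diagonal matrix is
  a function on pairs of rows that is supported on pairs in a common block.
\<close>

type_synonym row = "nat \<times> nat"
type_synonym 'd bmat = "row \<Rightarrow> row \<Rightarrow> 'd"

definition brows :: "nat list \<Rightarrow> row set" where
  "brows ns = {(i, p). i < length ns \<and> p < ns ! i}"

definition block :: "nat list \<Rightarrow> nat \<Rightarrow> row set" where
  "block ns i = {r \<in> brows ns. fst r = i}"

definition bmats :: "nat list \<Rightarrow> 'd::division_ring bmat set" where
  "bmats ns = {x. \<forall>r s. x r s \<noteq> 0 \<longrightarrow> r \<in> brows ns \<and> s \<in> brows ns \<and> fst r = fst s}"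

definition bmult :: "nat list \<Rightarrow> 'd::division_ring bmat \<Rightarrow> 'd bmat \<Rightarrow> 'd bmat" where
  "bmult ns x y = (\<lambda>r s. \<Sum>t\<in>brows ns. x r t * y t s)"

definition badd :: "'d::division_ring bmat \<Rightarrow> 'd bmat \<Rightarrow> 'd bmat" where
  "badd x y = (\<lambda>r s. x r s + y r s)"

definition bdiff :: "'d::division_ring bmat \<Rightarrow> 'd bmat \<Rightarrow> 'd bmat" where
  "bdiff x y = (\<lambda>r s. x r s - y r s)"

definition bdiag :: "row set \<Rightarrow> 'd::division_ring \<Rightarrow> 'd bmat" where
  "bdiag Z d = (\<lambda>r s. if r = s \<and> r \<in> Z then d else 0)"

definition bunit :: "row \<Rightarrow> row \<Rightarrow> 'd::division_ring bmat" where
  "bunit r s = (\<lambda>r' s'. if r' = r \<and> s' = s then 1 else 0)"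

definition block_ring :: "'d::division_ring itself \<Rightarrow> nat list \<Rightarrow> 'd bmat ring" where
  "block_ring _ ns = \<lparr>carrier = bmats ns, monoid.mult = bmult ns, one = bdiag (brows ns) 1,
     zero = (\<lambda>r s. 0), add = badd\<rparr>"

lemma block_ring_simps [simp]:
  "carrier (block_ring T ns) = bmats ns" "monoid.mult (block_ring T ns) = bmult ns"
  "one (block_ring T ns) = bdiag (brows ns) 1" "zero (block_ring T ns) = (\<lambda>r s. 0)"
  "add (block_ring T ns) = badd"
  by (simp_all add: block_ring_def)

lemma brows_eq_Sigma: "brows ns = Sigma {..<length ns} (\<lambda>i. {..<ns ! i})"
  by (auto simp: brows_def)

lemma finite_brows [simp]: "finite (brows ns)"
  by (auto simp: brows_eq_Sigma)

lemma block_eq: "i < length ns \<Longrightarrow> block ns i = Pair i ` {..<ns ! i}"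
  by (auto simp: block_def brows_def)

lemma block_subset: "block ns i \<subseteq> brows ns"
  by (auto simp: block_def)

lemma finite_block [simp]: "finite (block ns i)"
  by (rule finite_subset[OF block_subset finite_brows])

lemma card_block: "i < length ns \<Longrightarrow> card (block ns i) = ns ! i"
  by (simp add: block_eq card_image inj_on_def)

lemma sum_brows: "(\<Sum>r\<in>brows ns. f r) = (\<Sum>i<length ns. \<Sum>r\<in>block ns i. f r)"
proof -
  have "(\<Sum>r\<in>brows ns. f r) = (\<Sum>i<length ns. \<Sum>p<ns ! i. f (i, p))"
    unfolding brows_eq_Sigma by (subst sum.Sigma) auto
  also have "\<dots> = (\<Sum>i<length ns. \<Sum>r\<in>block ns i. f r)"
    by (intro sum.cong refl) (simp add: block_eq sum.reindex inj_on_def)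
  finally show ?thesis .
qed

lemma bmatsI: "(\<And>r s. x r s \<noteq> 0 \<Longrightarrow> r \<in> brows ns \<and> s \<in> brows ns \<and> fst r = fst s) \<Longrightarrow> x \<in> bmats ns"
  by (auto simp: bmats_def)

lemma bmats_zero: "x \<in> bmats ns \<Longrightarrow> r \<notin> brows ns \<or> s \<notin> brows ns \<or> fst r \<noteq> fst s \<Longrightarrow> x r s = 0"
  by (auto simp: bmats_def)

lemma zero_bmats [simp]: "(\<lambda>r s. 0) \<in> bmats ns"
  by (simp add: bmats_def)

lemma badd_closed [simp]:
  assumes "x \<in> bmats ns" "y \<in> bmats ns"
  shows "badd x y \<in> bmats ns"
proof (rule bmatsI)
  fix r s assume "badd x y r s \<noteq> 0"
  then have "x r s \<noteq> 0 \<or> y r s \<noteq> 0" by (auto simp: badd_def)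
  then show "r \<in> brows ns \<and> s \<in> brows ns \<and> fst r = fst s"
    using assms unfolding bmats_def by blast
qed

lemma bdiff_closed [simp]:
  assumes "x \<in> bmats ns" "y \<in> bmats ns"
  shows "bdiff x y \<in> bmats ns"
proof (rule bmatsI)
  fix r s assume "bdiff x y r s \<noteq> 0"
  then have "x r s \<noteq> 0 \<or> y r s \<noteq> 0" by (auto simp: bdiff_def)
  then show "r \<in> brows ns \<and> s \<in> brows ns \<and> fst r = fst s"
    using assms unfolding bmats_def by blast
qed

lemma bmult_closed [simp]: "x \<in> bmats ns \<Longrightarrow> y \<in> bmats ns \<Longrightarrow> bmult ns x y \<in> bmats ns"
proof (rule bmatsI)
  fix r s assume "x \<in> bmats ns" "y \<in> bmats ns" and "bmult ns x y r s \<noteq> 0"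
  then obtain t where "t \<in> brows ns" "x r t * y t s \<noteq> 0"
    unfolding bmult_def by (meson sum.neutral)
  then have "x r t \<noteq> 0" "y t s \<noteq> 0" by auto
  with \<open>x \<in> bmats ns\<close> \<open>y \<in> bmats ns\<close>
  show "r \<in> brows ns \<and> s \<in> brows ns \<and> fst r = fst s" unfolding bmats_def mem_Collect_eq by metis
qed

lemma bdiag_closed [simp]: "Z \<subseteq> brows ns \<Longrightarrow> bdiag Z d \<in> bmats ns"
  by (auto simp: bmats_def bdiag_def split: if_splits)

lemma bunit_closed [simp]: "r \<in> brows ns \<Longrightarrow> s \<in> brows ns \<Longrightarrow> fst r = fst s \<Longrightarrow> bunit r s \<in> bmats ns"
  by (auto simp: bmats_def bunit_def split: if_splits)

lemma bdiag_mult_left: "x \<in> bmats ns \<Longrightarrow> bmult ns (bdiag Z d) x = (\<lambda>r s. if r \<in> Z then d * x r s else 0)"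
proof (intro ext)
  fix r s assume x: "x \<in> bmats ns"
  have "bmult ns (bdiag Z d) x r s = (\<Sum>t\<in>brows ns. if r = t then (if r \<in> Z then d * x r s else 0) else 0)"
    unfolding bmult_def by (intro sum.cong) (auto simp: bdiag_def)
  also have "\<dots> = (if r \<in> Z then d * x r s else 0)"
    using x by (auto simp: sum.delta bmats_def)
  finally show "bmult ns (bdiag Z d) x r s = (if r \<in> Z then d * x r s else 0)" .
qed

lemma bdiag_mult_right: "x \<in> bmats ns \<Longrightarrow> bmult ns x (bdiag Z d) = (\<lambda>r s. if s \<in> Z then x r s * d else 0)"
proof (intro ext)
  fix r s assume x: "x \<in> bmats ns"
  have "bmult ns x (bdiag Z d) r s = (\<Sum>t\<in>brows ns. if s = t then (if s \<in> Z then x r s * d else 0) else 0)"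
    unfolding bmult_def by (intro sum.cong) (auto simp: bdiag_def)
  also have "\<dots> = (if s \<in> Z then x r s * d else 0)"
    using x by (auto simp: sum.delta bmats_def)
  finally show "bmult ns x (bdiag Z d) r s = (if s \<in> Z then x r s * d else 0)" .
qed

lemma bmult_assoc: "bmult ns (bmult ns x y) z = bmult ns x (bmult ns y z)"
  unfolding bmult_def by (simp add: matrix_mult_assoc)

lemma bmult_badd_left: "bmult ns (badd x y) z = badd (bmult ns x z) (bmult ns y z)"
  by (simp add: bmult_def badd_def distrib_right sum.distrib)

lemma bmult_badd_right: "bmult ns z (badd x y) = badd (bmult ns z x) (bmult ns z y)"
  by (simp add: bmult_def badd_def distrib_left sum.distrib)

lemma bdiag_one_mult [simp]:
  "x \<in> bmats ns \<Longrightarrow> bmult ns (bdiag (brows ns) 1) x = x"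
  "x \<in> bmats ns \<Longrightarrow> bmult ns x (bdiag (brows ns) 1) = x"
  by (auto simp: bdiag_mult_left bdiag_mult_right fun_eq_iff bmats_def)

lemma ring_block_ring: "ring (block_ring T ns)"
proof (rule ringI)
  show "abelian_group (block_ring T ns)"
  proof (rule abelian_groupI)
    fix x :: "'a bmat" assume "x \<in> carrier (block_ring T ns)"
    then have "bdiff (\<lambda>r s. 0) x \<in> bmats ns" by simp
    moreover have "badd (bdiff (\<lambda>r s. 0) x) x = (\<lambda>r s. 0)" by (simp add: badd_def bdiff_def)
    ultimately show "\<exists>y\<in>carrier (block_ring T ns). y \<oplus>\<^bsub>block_ring T ns\<^esub> x = \<zero>\<^bsub>block_ring T ns\<^esub>"
      by auto
  qed (auto simp: badd_def[abs_def] add_ac intro: badd_closed[unfolded badd_def])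
  show "monoid (block_ring T ns)"
    by (rule monoidI) (simp_all add: bmult_assoc)
qed (simp_all add: bmult_badd_left bmult_badd_right)

lemma bunit_mult: "s \<in> brows ns \<Longrightarrow> bmult ns (bunit r s) (bunit s t) = (bunit r t :: 'd::division_ring bmat)"
proof (intro ext)
  fix a b assume s: "s \<in> brows ns"
  have "bmult ns (bunit r s) (bunit s t) a b = (\<Sum>k\<in>brows ns. if k = s then bunit r t a b else (0::'d))"
    unfolding bmult_def by (intro sum.cong) (auto simp: bunit_def)
  then show "bmult ns (bunit r s) (bunit s t) a b = (bunit r t :: 'd bmat) a b" using s by simp
qed

lemma bunit_eq_bdiag: "bunit r r = bdiag {r} 1"
  by (auto simp: bunit_def bdiag_def fun_eq_iff)

lemma bdiag_mult_bdiag: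
  "Z' \<subseteq> brows ns \<Longrightarrow> bmult ns (bdiag Z d) (bdiag Z' d') = bdiag (Z \<inter> Z') (d * d')"
  by (subst bdiag_mult_left[OF bdiag_closed]) (auto simp: bdiag_def fun_eq_iff)

section \<open>Rank functions on finite products of matrix rings\<close>

text \<open>
  The properties shared by pseudo-rank functions, by their pullbacks along homomorphisms that do
  not preserve the unit, and by the rank of a single block.
\<close>

definition rank_like :: "nat list \<Rightarrow> ('d::division_ring bmat \<Rightarrow> real) \<Rightarrow> bool" where
  "rank_like ns P \<longleftrightarrow>
     (\<forall>x\<in>bmats ns. \<forall>y\<in>bmats ns. P (bmult ns x y) \<le> P x \<and> P (bmult ns x y) \<le> P y \<and>
        P (badd x y) \<le> P x + P y) \<and>
     (\<forall>e\<in>bmats ns. \<forall>f\<in>bmats ns. bmult ns e e = e \<longrightarrow> bmult ns f f = f \<longrightarrow>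
        bmult ns e f = (\<lambda>r s. 0) \<longrightarrow> bmult ns f e = (\<lambda>r s. 0) \<longrightarrow> P (badd e f) = P e + P f)"

text \<open>
  For the pseudo-rank functions below, the rank of the minimal idempotents in the block \<open>i\<close>.
\<close>

definition weight :: "('d::division_ring bmat \<Rightarrow> real) \<Rightarrow> nat \<Rightarrow> real" where
  "weight P i = P (bunit (i, 0) (i, 0))"

definition brank :: "nat list \<Rightarrow> nat \<Rightarrow> 'd::division_ring bmat \<Rightarrow> nat" where
  "brank ns i x = mrank (block ns i) (block ns i) x"

lemma rank_like_zero: "rank_like ns P \<Longrightarrow> P (\<lambda>r s. 0) = 0"
proof -
  assume P: "rank_like ns P"
  have "bmult ns (\<lambda>r s. 0) (\<lambda>r s. 0) = (\<lambda>r s. 0 :: 'a)" "badd (\<lambda>r s. 0) (\<lambda>r s. 0) = (\<lambda>r s. 0 :: 'a)"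
    by (simp_all add: bmult_def badd_def)
  then have "P (\<lambda>r s. 0) = P (\<lambda>r s. 0) + P (\<lambda>r s. 0)"
    using P zero_bmats[of ns] unfolding rank_like_def by metis
  then show ?thesis by simp
qed

lemma rank_like_mult:
  assumes "rank_like ns P" "x \<in> bmats ns" "y \<in> bmats ns"
  shows "P (bmult ns x y) \<le> P x" "P (bmult ns x y) \<le> P y"
  using assms unfolding rank_like_def by auto

lemma rank_like_add:
  assumes "rank_like ns P" "x \<in> bmats ns" "y \<in> bmats ns"
  shows "P (badd x y) \<le> P x + P y" 
  using assms unfolding rank_like_def by auto

lemma rank_like_nonneg:
  assumes "rank_like ns P" "x \<in> bmats ns"
  shows "0 \<le> P x"
proof -
  have "bmult ns (\<lambda>r s. 0) x = (\<lambda>r s. 0)" by (simp add: bmult_def)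
  then show ?thesis
    using rank_like_mult(2)[OF assms(1) zero_bmats assms(2)] rank_like_zero[OF assms(1)] by simp
qed

text \<open>
  The diagonal matrix units of a block are equivalent idempotents.
\<close>

lemma rank_like_bunit:
  assumes P: "rank_like ns P" and r: "r \<in> brows ns"
  shows "P (bunit r r) = weight P (fst r)"
proof -
  define r0 where "r0 = (fst r, 0::nat)"
  have r0: "r0 \<in> brows ns" "fst r0 = fst r" using r by (auto simp: brows_def r0_def)
  have "P (bunit a a) \<le> P (bunit b b)" if "a \<in> brows ns" "b \<in> brows ns" "fst a = fst b" for a b
  proof -
    have "bunit a a = bmult ns (bunit a b) (bmult ns (bunit b b) (bunit b a :: 'a bmat))"
      using that by (simp add: bunit_mult)
    then have "P (bunit a a) \<le> P (bmult ns (bunit b b) (bunit b a))"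
      using rank_like_mult(2)[OF P] that by simp
    also have "\<dots> \<le> P (bunit b b)"
      using rank_like_mult(1)[OF P] that by simp
    finally show ?thesis .
  qed
  then have "P (bunit r r) = P (bunit r0 r0)" using r r0 by (intro antisym) auto
  then show ?thesis by (simp add: weight_def r0_def)
qed

lemma rank_like_bdiag:
  assumes P: "rank_like ns P" and Z: "Z \<subseteq> brows ns"
  shows "P (bdiag Z 1) = (\<Sum>r\<in>Z. weight P (fst r))"
proof -
  have "finite Z" by (rule finite_subset[OF Z finite_brows])
  then show ?thesis using Z
  proof (induction Z rule: finite_induct)
    case empty
    have "bdiag {} 1 = (\<lambda>r s. 0 :: 'a)" by (auto simp: bdiag_def)
    then show ?case using rank_like_zero[OF P] by simp
  next
    case (insert r Z)
    have 0: "bdiag {} d = (\<lambda>r s. 0 :: 'a)" for d by (auto simp: bdiag_def)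
    have "bdiag (insert r Z) 1 = badd (bdiag {r} 1) (bdiag Z 1 :: 'a bmat)"
      using insert.hyps by (auto simp: badd_def bdiag_def fun_eq_iff)
    moreover have "P (badd (bdiag {r} 1) (bdiag Z 1)) = P (bdiag {r} 1) + P (bdiag Z 1)"
      using P insert unfolding rank_like_def
      by (auto simp: bdiag_mult_bdiag 0)
    ultimately show ?case
      using insert rank_like_bunit[OF P, of r] by (simp add: bunit_eq_bdiag)
  qed
qed

lemma mrank_le_card:
  fixes M :: "'i \<Rightarrow> 'j \<Rightarrow> 'd::division_ring"
  assumes "finite I" "finite J"
  shows "mrank I J M \<le> card I"
proof -
  have "mrank I J M = mrank I J (\<lambda>i j. \<Sum>k\<in>I. of_bool (i = k) * M k j)"
    by (rule mrank_cong) (simp add: sum_delta_left assms)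
  also have "\<dots> \<le> mrank I I (\<lambda>i j. of_bool (i = j) :: 'd)"
    by (rule mrank_mult_le(1)) (use assms in auto)
  finally show ?thesis by (simp add: mrank_one assms)
qed

text \<open>
  Full rank factorizations of all blocks, with the intermediate indices identified with the first
  rows of each block.
\<close>

lemma bmat_factorization:
  fixes x :: "'d::division_ring bmat"
  assumes x: "x \<in> bmats ns"
  defines "Z \<equiv> {r \<in> brows ns. snd r < brank ns (fst r) x}"
  shows "\<exists>v\<in>bmats ns. \<exists>w\<in>bmats ns. \<exists>u\<in>bmats ns. \<exists>z\<in>bmats ns.
     x = bmult ns v w \<and> bmult ns u v = bdiag Z 1 \<and> bmult ns w z = bdiag Z 1 \<and>
     bmult ns v (bdiag Z 1) = v"
proof -
  let ?k = "\<lambda>i. brank ns i x"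
  define FF where "FF i V W U X \<longleftrightarrow>
      (\<forall>r\<in>block ns i. \<forall>s\<in>block ns i. x r s = (\<Sum>a<?k i. V r a * W a s)) \<and>
      (\<forall>a<?k i. \<forall>b<?k i. (\<Sum>r\<in>block ns i. U a r * V r b) = of_bool (a = b)) \<and>
      (\<forall>a<?k i. \<forall>b<?k i. (\<Sum>r\<in>block ns i. W a r * X r b) = of_bool (a = b))" for i V W U X
  have "\<exists>V W U X. FF i V W U X" for i
  proof (rule mrank_factorization[OF finite_block finite_block, of ns i ns i x])
    fix V W U X
    assume "\<And>r s. r \<in> block ns i \<Longrightarrow> s \<in> block ns i \<Longrightarrow> x r s = (\<Sum>a<mrank (block ns i) (block ns i) x. V r a * W a s)"
      and "\<And>a b. a < mrank (block ns i) (block ns i) x \<Longrightarrow> b < mrank (block ns i) (block ns i) x \<Longrightarrow>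
          (\<Sum>r\<in>block ns i. U a r * V r b) = of_bool (a = b)"
      and "\<And>a b. a < mrank (block ns i) (block ns i) x \<Longrightarrow> b < mrank (block ns i) (block ns i) x \<Longrightarrow>
          (\<Sum>r\<in>block ns i. W a r * X r b) = of_bool (a = b)"
    then have "FF i V W U X" unfolding FF_def brank_def by blast
    then show ?thesis by blast
  qed
  then obtain V W U X where F: "\<And>i. FF i (V i) (W i) (U i) (X i)" by metis
  define ok where "ok r s \<longleftrightarrow> r \<in> brows ns \<and> s \<in> brows ns \<and> fst r = fst s" for r s
  define v where "v r s = (if ok r s \<and> s \<in> Z then V (fst r) r (snd s) else 0)" for r s
  define w where "w r s = (if ok r s \<and> r \<in> Z then W (fst r) (snd r) s else 0)" for r s
  define u where "u r s = (if ok r s \<and> r \<in> Z then U (fst r) (snd r) s else 0)" for r s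
  define z where "z r s = (if ok r s \<and> s \<in> Z then X (fst r) r (snd s) else 0)" for r s
  have cl: "v \<in> bmats ns" "w \<in> bmats ns" "u \<in> bmats ns" "z \<in> bmats ns"
    by (auto simp: bmats_def v_def w_def u_def z_def ok_def split: if_splits)
  have blk: "(\<Sum>t\<in>brows ns. f t) = (\<Sum>t\<in>block ns i. f t)"
    if "\<And>t. t \<in> brows ns \<Longrightarrow> fst t \<noteq> i \<Longrightarrow> f t = 0" for f :: "row \<Rightarrow> 'd" and i
    by (rule sum.mono_neutral_right) (use that in \<open>auto simp: block_def\<close>)
  have kle: "?k i \<le> ns ! i" if "i < length ns" for i
    using mrank_le_card[of "block ns i" "block ns i" x] card_block[OF that] by (simp add: brank_def)
  have "x r s = bmult ns v w r s" for r s
  proof (cases "ok r s")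
    case True
    let ?i = "fst r"
    have i: "?i < length ns" using True by (auto simp: ok_def brows_def)
    have "bmult ns v w r s = (\<Sum>t\<in>brows ns. v r t * w t s)" by (simp add: bmult_def)
    also have "\<dots> = (\<Sum>t\<in>Pair ?i ` {..<?k ?i}. v r t * w t s)"
    proof (rule sum.mono_neutral_right)
      show "Pair ?i ` {..<?k ?i} \<subseteq> brows ns" using kle[OF i] i by (auto simp: brows_def)
      show "\<forall>t\<in>brows ns - Pair ?i ` {..<?k ?i}. v r t * w t s = 0"
      proof
        fix t assume t: "t \<in> brows ns - Pair ?i ` {..<?k ?i}"
        have "fst t \<noteq> fst r \<or> t \<notin> Z"
          using t by (cases t) (auto simp: Z_def)
        then show "v r t * w t s = 0" by (auto simp: v_def ok_def)
      qed
    qed simp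
    also have "\<dots> = (\<Sum>a<?k ?i. v r (?i, a) * w (?i, a) s)"
      by (simp add: sum.reindex inj_on_def)
    also have "\<dots> = (\<Sum>a<?k ?i. V ?i r a * W ?i a s)"
    proof (intro sum.cong refl)
      fix a assume a: "a \<in> {..<?k ?i}"
      then have "(?i, a) \<in> Z" "(?i, a) \<in> brows ns" using kle[OF i] i by (auto simp: Z_def brows_def)
      then show "v r (?i, a) * w (?i, a) s = V ?i r a * W ?i a s"
        using True by (simp add: v_def w_def ok_def)
    qed
    also have "\<dots> = x r s"
      using F[of ?i] True unfolding FF_def by (auto simp: ok_def block_def)
    finally show ?thesis ..
  next
    case False
    then have "y r s = 0" if "y \<in> bmats ns" for y :: "'d bmat"
      using bmats_zero[OF that, of r s] by (auto simp: ok_def)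
    from this[OF x] this[OF bmult_closed[OF cl(1,2)]] show ?thesis by simp
  qed
  then have "x = bmult ns v w" by (auto simp: fun_eq_iff)
  moreover have "bmult ns u v r s = bdiag Z 1 r s" for r s
  proof (cases "ok r s \<and> r \<in> Z \<and> s \<in> Z")
    case True
    let ?i = "fst r"
    have "bmult ns u v r s = (\<Sum>t\<in>block ns ?i. u r t * v t s)"
      unfolding bmult_def by (rule blk) (auto simp: u_def ok_def)
    also have "\<dots> = (\<Sum>t\<in>block ns ?i. U ?i (snd r) t * V ?i t (snd s))"
      using True by (intro sum.cong refl) (auto simp: u_def v_def ok_def block_def)
    also have "\<dots> = of_bool (snd r = snd s)"
      using F[of ?i] True unfolding FF_def by (auto simp: Z_def ok_def)
    also have "\<dots> = bdiag Z 1 r s" using True by (auto simp: bdiag_def ok_def prod_eq_iff)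
    finally show ?thesis .
  next
    case False
    have "bmult ns u v r s = 0"
    proof -
      have 0: "u r t * v t s = 0" for t using False by (auto simp: u_def v_def ok_def)
      show ?thesis by (simp only: bmult_def 0 sum.neutral_const)
    qed
    moreover have "bdiag Z 1 r s = (0::'d)" using False by (auto simp: bdiag_def ok_def Z_def)
    ultimately show ?thesis by simp
  qed
  then have "bmult ns u v = bdiag Z 1" by (auto simp: fun_eq_iff)
  moreover have "bmult ns w z r s = bdiag Z 1 r s" for r s
  proof (cases "ok r s \<and> r \<in> Z \<and> s \<in> Z")
    case True
    let ?i = "fst r"
    have "bmult ns w z r s = (\<Sum>t\<in>block ns ?i. w r t * z t s)"
      unfolding bmult_def by (rule blk) (auto simp: w_def ok_def)
    also have "\<dots> = (\<Sum>t\<in>block ns ?i. W ?i (snd r) t * X ?i t (snd s))"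
      using True by (intro sum.cong refl) (auto simp: w_def z_def ok_def block_def)
    also have "\<dots> = of_bool (snd r = snd s)"
      using F[of ?i] True unfolding FF_def by (auto simp: Z_def ok_def)
    also have "\<dots> = bdiag Z 1 r s" using True by (auto simp: bdiag_def ok_def prod_eq_iff)
    finally show ?thesis .
  next
    case False
    have "bmult ns w z r s = 0"
    proof -
      have 0: "w r t * z t s = 0" for t using False by (auto simp: w_def z_def ok_def)
      show ?thesis by (simp only: bmult_def 0 sum.neutral_const)
    qed
    moreover have "bdiag Z 1 r s = (0::'d)" using False by (auto simp: bdiag_def ok_def Z_def)
    ultimately show ?thesis by simp
  qed
  then have "bmult ns w z = bdiag Z 1" by (auto simp: fun_eq_iff)
  moreover have "bmult ns v (bdiag Z 1) = v"
    using cl by (auto simp: bdiag_mult_right fun_eq_iff v_def)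
  ultimately show ?thesis using cl by blast
qed

lemma block_ring_regular:
  assumes x: "x \<in> bmats ns"
  shows "\<exists>y\<in>bmats ns. x = bmult ns (bmult ns x y) x"
proof -
  let ?Z = "{r \<in> brows ns. snd r < brank ns (fst r) x}"
  obtain v w u z where cl: "v \<in> bmats ns" "w \<in> bmats ns" "u \<in> bmats ns" "z \<in> bmats ns"
    and f: "x = bmult ns v w" "bmult ns u v = bdiag ?Z 1" "bmult ns w z = bdiag ?Z 1" 
     "bmult ns v (bdiag ?Z 1) = v"
    using bmat_factorization[OF x] by blast
  have "bmult ns (bmult ns x (bmult ns z u)) x = bmult ns (bmult ns (bmult ns v (bmult ns w z)) (bmult ns u v)) w"
    by (simp add: f(1) bmult_assoc)
  also have "\<dots> = x" by (simp only: f(2-4)) (simp add: f(1))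
  finally show ?thesis using cl by (intro bexI[of _ "bmult ns z u"]) auto
qed

text \<open>
  By the factorization, \<open>x\<close> is equivalent to a diagonal idempotent with as many ones in the
  \<open>i\<close>-th block as the rank of that block.
\<close>

theorem rank_like_eq:
  assumes P: "rank_like ns P" and x: "x \<in> bmats ns"
  shows "P x = (\<Sum>i<length ns. real (brank ns i x) * weight P i)"
proof -
  define Z where "Z = {r \<in> brows ns. snd r < brank ns (fst r) x}"
  obtain v w u z where cl: "v \<in> bmats ns" "w \<in> bmats ns" "u \<in> bmats ns" "z \<in> bmats ns"
    and f: "x = bmult ns v w" "bmult ns u v = bdiag Z 1" "bmult ns w z = bdiag Z 1" 
     "bmult ns v (bdiag Z 1) = v"
    using bmat_factorization[OF x] unfolding Z_def by blast
  have Z: "Z \<subseteq> brows ns" by (auto simp: Z_def)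
  have ZZ: "bmult ns (bdiag Z 1) (bdiag Z 1) = (bdiag Z 1 :: 'a bmat)"
    using Z by (simp add: bdiag_mult_bdiag)
  have "x = bmult ns (bmult ns v (bdiag Z 1)) w" by (simp only: f)
  then have "P x \<le> P (bdiag Z 1)"
    using rank_like_mult[OF P, of "bmult ns v (bdiag Z 1)" w] rank_like_mult[OF P, of v "bdiag Z 1"] cl Z
    by simp
  moreover have "bdiag Z 1 = bmult ns (bmult ns u v) (bmult ns w z)" by (simp only: f ZZ)
  then have "bdiag Z 1 = bmult ns (bmult ns u x) z" by (simp add: f(1) bmult_assoc)
  then have "P (bdiag Z 1) \<le> P x"
    using rank_like_mult[OF P, of "bmult ns u x" z] rank_like_mult[OF P, of u x] cl x
    by simp
  ultimately have "P x = P (bdiag Z 1)" by simp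
  also have "\<dots> = (\<Sum>r\<in>Z. weight P (fst r))" by (rule rank_like_bdiag[OF P Z])
  also have "\<dots> = (\<Sum>r\<in>brows ns. if r \<in> Z then weight P (fst r) else 0)"
    by (rule sum.mono_neutral_cong_left) (use Z in auto)
  also have "\<dots> = (\<Sum>i<length ns. \<Sum>r\<in>block ns i. if r \<in> Z then weight P (fst r) else 0)"
    by (rule sum_brows)
  also have "\<dots> = (\<Sum>i<length ns. real (brank ns i x) * weight P i)"
  proof (intro sum.cong refl)
    fix i assume i: "i \<in> {..<length ns}"
    have k: "brank ns i x \<le> ns ! i"
      using mrank_le_card[of "block ns i" "block ns i" x] i by (simp add: brank_def card_block)
    have "(\<Sum>r\<in>block ns i. if r \<in> Z then weight P (fst r) else 0) = (\<Sum>r\<in>Pair i ` {..<brank ns i x}. weight P i)"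
      by (rule sum.mono_neutral_cong_right)
        (use i k in \<open>auto simp: block_eq Z_def brows_def image_iff\<close>)
    also have "\<dots> = real (brank ns i x) * weight P i"
      by (simp add: card_image inj_on_def)
    finally show "(\<Sum>r\<in>block ns i. if r \<in> Z then weight P (fst r) else 0) = real (brank ns i x) * weight P i" .
  qed
  finally show ?thesis .
qed

lemma sum_brows_block:
  assumes "\<And>t. t \<in> brows ns \<Longrightarrow> fst t \<noteq> i \<Longrightarrow> f t = (0::'a::comm_monoid_add)"
  shows "(\<Sum>t\<in>brows ns. f t) = (\<Sum>t\<in>block ns i. f t)"
  by (rule sum.mono_neutral_right) (use assms in \<open>auto simp: block_def\<close>)

lemma bmult_block:
  assumes "x \<in> bmats ns" "fst r = i"
  shows "bmult ns x y r s = (\<Sum>t\<in>block ns i. x r t * y t s)"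
  unfolding bmult_def
proof (rule sum_brows_block)
  fix t assume "t \<in> brows ns" "fst t \<noteq> i"
  then have "x r t = 0" using assms by (intro bmats_zero) auto
  then show "x r t * y t s = 0" by simp
qed

lemma rank_like_brank: "rank_like ns (\<lambda>x. real (brank ns i x) :: real)"
  unfolding rank_like_def
proof (intro conjI ballI impI)
  fix x y :: "'a bmat" assume x: "x \<in> bmats ns" and y: "y \<in> bmats ns"
  have "brank ns i (bmult ns x y) = mrank (block ns i) (block ns i) (\<lambda>r s. \<Sum>t\<in>block ns i. x r t * y t s)"
    unfolding brank_def by (rule mrank_cong) (rule bmult_block[OF x], auto simp: block_def)
  then show "real (brank ns i (bmult ns x y)) \<le> brank ns i x" "real (brank ns i (bmult ns x y)) \<le> brank ns i y"
    using mrank_mult_le[of "block ns i" "block ns i" "block ns i" x y] by (auto simp: brank_def)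
  show "real (brank ns i (badd x y)) \<le> real (brank ns i x) + real (brank ns i y)"
    using mrank_add_le[of "block ns i" "block ns i" x y] by (simp add: brank_def badd_def)
next
  fix e f :: "'a bmat" assume e: "e \<in> bmats ns" and f: "f \<in> bmats ns"
    and *: "bmult ns e e = e" "bmult ns f f = f" "bmult ns e f = (\<lambda>r s. 0)" "bmult ns f e = (\<lambda>r s. 0)"
  have p: "(\<Sum>t\<in>block ns i. x r t * y t s) = bmult ns x y r s" if "r \<in> block ns i" "x \<in> bmats ns" for x y :: "'a bmat" and r s
    using bmult_block[OF that(2)] that(1) by (auto simp: block_def)
  have "mrank (block ns i) (block ns i) (\<lambda>r s. e r s + f r s) = brank ns i e + brank ns i f"
    unfolding brank_def by (rule mrank_orthogonal_idempotents) (simp_all add: p e f *)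
  then show "real (brank ns i (badd e f)) = real (brank ns i e) + real (brank ns i f)"
    by (simp add: brank_def badd_def)
qed

lemma brank_one: "i < length ns \<Longrightarrow> brank ns i (bdiag (brows ns) 1) = ns ! i"
proof -
  assume i: "i < length ns"
  have "brank ns i (bdiag (brows ns) (1::'a)) = mrank (block ns i) (block ns i) (\<lambda>r s. of_bool (r = s) :: 'a)"
    unfolding brank_def by (rule mrank_cong) (auto simp: bdiag_def block_def)
  then show ?thesis using i by (simp add: mrank_one card_block)
qed

lemma brank_le: "i < length ns \<Longrightarrow> brank ns i x \<le> ns ! i"
  using mrank_le_card[of "block ns i" "block ns i" x] by (simp add: brank_def card_block)

lemma brank_eq_0_iff: "brank ns i x = 0 \<longleftrightarrow> (\<forall>r\<in>block ns i. \<forall>s\<in>block ns i. x r s = 0)"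
  by (simp add: brank_def mrank_eq_0_iff)

lemma brank_bunit:
  assumes "j < length ns" "0 < ns ! i" "i < length ns"
  shows "brank ns i (bunit (j, 0) (j, 0) :: 'd::division_ring bmat) = of_bool (i = j)"
proof (cases "i = j")
  case False
  then have "brank ns i (bunit (j, 0) (j, 0) :: 'd bmat) = 0"
    by (auto simp: brank_eq_0_iff bunit_def block_def)
  then show ?thesis using False by simp
next
  case True
  let ?P = "\<lambda>x::'d bmat. real (brank ns i x)"
  have "?P (bdiag (brows ns) 1) = (\<Sum>k<length ns. real (brank ns k (bdiag (brows ns) (1::'d))) * weight ?P k)"
    by (rule rank_like_eq[OF rank_like_brank]) simp
  also have "\<dots> = real (ns ! i) * weight ?P i"
  proof -
    have "weight ?P k = 0" if "k \<noteq> i" for k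
      using that by (auto simp: weight_def brank_eq_0_iff bunit_def block_def)
    then have "(\<Sum>k<length ns. real (brank ns k (bdiag (brows ns) (1::'d))) * weight ?P k) =
        (\<Sum>k<length ns. if k = i then real (ns ! i) * weight ?P i else 0)"
      by (intro sum.cong) (auto simp: brank_one)
    then show ?thesis using assms by simp
  qed
  finally have "weight ?P i = 1" using assms by (simp add: brank_one)
  then show ?thesis using True by (simp add: weight_def)
qed

lemma rank_like_sum_weights:
  assumes "rank_like ns P"
  shows "(\<Sum>i<length ns. real (ns ! i) * weight P i) = P (bdiag (brows ns) 1)"
  by (simp add: rank_like_eq[OF assms] brank_one)

lemma weight_nonneg:
  assumes "rank_like ns P" "i < length ns" "0 < ns ! i"
  shows "0 \<le> weight P i"
  using rank_like_nonneg[OF assms(1)] assms by (simp add: weight_def brows_def)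

section \<open>Block diagonal homomorphisms\<close>

text \<open>
  A standard homomorphism between products of matrix rings puts copies of the blocks of the
  source along the diagonal of each block of the target, possibly leaving some rows of the target
  uncovered.  It is encoded by the partial equivalence relation of lying in the same copy, together
  with the map that sends a covered row to the row of the source of which it is a copy.  In this
  encoding the copies need no names, and homomorphisms compose by composing the maps.
\<close>

type_synonym labelling = "(row \<Rightarrow> row) \<times> (row \<Rightarrow> row \<Rightarrow> bool)"

definition labelling :: "nat list \<Rightarrow> nat list \<Rightarrow> labelling \<Rightarrow> bool" where
  "labelling ns' ns L \<longleftrightarrow> (case L of (\<pi>, E) \<Rightarrow>
     (\<forall>r s. E r s \<longrightarrow> r \<in> brows ns' \<and> s \<in> brows ns' \<and> fst r = fst s \<and> E s r \<and>
        \<pi> r \<in> brows ns \<and> fst (\<pi> r) = fst (\<pi> s)) \<and>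
     (\<forall>r s t. E r s \<longrightarrow> E s t \<longrightarrow> E r t) \<and>
     (\<forall>r s. E r s \<longrightarrow> \<pi> r = \<pi> s \<longrightarrow> r = s) \<and>
     (\<forall>r \<rho>. E r r \<longrightarrow> \<rho> \<in> brows ns \<longrightarrow> fst \<rho> = fst (\<pi> r) \<longrightarrow> (\<exists>s. E r s \<and> \<pi> s = \<rho>)))"

definition pull :: "labelling \<Rightarrow> 'd::division_ring bmat \<Rightarrow> 'd bmat" where
  "pull L x = (\<lambda>r s. if snd L r s then x (fst L r) (fst L s) else 0)"

definition copies :: "nat list \<Rightarrow> labelling \<Rightarrow> nat \<Rightarrow> nat \<Rightarrow> nat" where
  "copies ns' L i j = card {r \<in> block ns' j. snd L r r \<and> fst L r = (i, 0)}"

definition lcomp :: "labelling \<Rightarrow> labelling \<Rightarrow> labelling" where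
  "lcomp L L' = (fst L \<circ> fst L', \<lambda>r s. snd L' r s \<and> snd L (fst L' r) (fst L' s))"

definition total_labelling :: "nat list \<Rightarrow> nat list \<Rightarrow> labelling \<Rightarrow> bool" where
  "total_labelling ns' ns L \<longleftrightarrow> labelling ns' ns L \<and> (\<forall>r\<in>brows ns'. snd L r r)"

definition sizes :: "nat list \<Rightarrow> bool" where
  "sizes ns \<longleftrightarrow> ns \<noteq> [] \<and> (\<forall>i<length ns. 0 < ns ! i)"

lemma labellingD:
  assumes "labelling ns' ns L"
  shows "snd L r s \<Longrightarrow> r \<in> brows ns'" "snd L r s \<Longrightarrow> s \<in> brows ns'" "snd L r s \<Longrightarrow> fst r = fst s"
    "snd L r s \<Longrightarrow> snd L s r" "snd L r s \<Longrightarrow> fst L r \<in> brows ns" "snd L r s \<Longrightarrow> fst L s \<in> brows ns"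
    "snd L r s \<Longrightarrow> fst (fst L r) = fst (fst L s)"
    "snd L r s \<Longrightarrow> snd L s t \<Longrightarrow> snd L r t"
    "snd L r s \<Longrightarrow> fst L r = fst L s \<Longrightarrow> r = s"
    "snd L r r \<Longrightarrow> \<rho> \<in> brows ns \<Longrightarrow> fst \<rho> = fst (fst L r) \<Longrightarrow> (\<exists>s. snd L r s \<and> fst L s = \<rho>)"
    "snd L r s \<Longrightarrow> snd L r r" "snd L r s \<Longrightarrow> snd L s s"
proof -
  obtain \<pi> E where L: "L = (\<pi>, E)" by (cases L)
  have *: "\<And>r s. E r s \<Longrightarrow> r \<in> brows ns' \<and> s \<in> brows ns' \<and> fst r = fst s \<and> E s r \<and>
        \<pi> r \<in> brows ns \<and> fst (\<pi> r) = fst (\<pi> s)" "\<And>r s t. E r s \<Longrightarrow> E s t \<Longrightarrow> E r t"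
    "\<And>r s. E r s \<Longrightarrow> \<pi> r = \<pi> s \<Longrightarrow> r = s" 
    "\<And>r \<rho>. E r r \<Longrightarrow> \<rho> \<in> brows ns \<Longrightarrow> fst \<rho> = fst (\<pi> r) \<Longrightarrow> (\<exists>s. E r s \<and> \<pi> s = \<rho>)"
    using assms unfolding labelling_def L by blast+
  show "snd L r s \<Longrightarrow> r \<in> brows ns'" "snd L r s \<Longrightarrow> s \<in> brows ns'" "snd L r s \<Longrightarrow> fst r = fst s"
    "snd L r s \<Longrightarrow> snd L s r" "snd L r s \<Longrightarrow> fst L r \<in> brows ns" "snd L r s \<Longrightarrow> fst L s \<in> brows ns"
    "snd L r s \<Longrightarrow> fst (fst L r) = fst (fst L s)"
    "snd L r s \<Longrightarrow> snd L s t \<Longrightarrow> snd L r t"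
    "snd L r s \<Longrightarrow> fst L r = fst L s \<Longrightarrow> r = s"
    "snd L r r \<Longrightarrow> \<rho> \<in> brows ns \<Longrightarrow> fst \<rho> = fst (fst L r) \<Longrightarrow> (\<exists>s. snd L r s \<and> fst L s = \<rho>)"
    "snd L r s \<Longrightarrow> snd L r r" "snd L r s \<Longrightarrow> snd L s s"
    unfolding L fst_conv snd_conv by (blast dest: *)+
qed

lemma labellingI:
  assumes "\<And>r s. E r s \<Longrightarrow> r \<in> brows ns' \<and> s \<in> brows ns' \<and> fst r = fst s \<and> E s r \<and>
        \<pi> r \<in> brows ns \<and> fst (\<pi> r) = fst (\<pi> s)" "\<And>r s t. E r s \<Longrightarrow> E s t \<Longrightarrow> E r t"
    "\<And>r s. E r s \<Longrightarrow> \<pi> r = \<pi> s \<Longrightarrow> r = s" 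
    "\<And>r \<rho>. E r r \<Longrightarrow> \<rho> \<in> brows ns \<Longrightarrow> fst \<rho> = fst (\<pi> r) \<Longrightarrow> (\<exists>s. E r s \<and> \<pi> s = \<rho>)"
  shows "labelling ns' ns (\<pi>, E)"
  unfolding labelling_def prod.case using assms by blast

lemma pull_closed [simp]: "labelling ns' ns L \<Longrightarrow> pull L x \<in> bmats ns'"
  by (rule bmatsI) (auto simp: pull_def split: if_splits dest: labellingD)

lemma pull_badd: "pull L (badd x y) = badd (pull L x) (pull L y)"
  by (auto simp: pull_def badd_def fun_eq_iff)

lemma pull_bdiff: "pull L (bdiff x y) = bdiff (pull L x) (pull L y)"
  by (auto simp: pull_def bdiff_def fun_eq_iff)

lemma pull_zero: "pull L (\<lambda>r s. 0) = (\<lambda>r s. 0)"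
  by (auto simp: pull_def fun_eq_iff)

lemma labelling_bij_copy:
  assumes L: "labelling ns' ns L" and r: "snd L r r"
  shows "bij_betw (fst L) {s. snd L r s} (block ns (fst (fst L r)))"
  unfolding bij_betw_def
proof
  show "inj_on (fst L) {s. snd L r s}"
  proof (rule inj_onI)
    fix s t assume st: "s \<in> {s. snd L r s}" "t \<in> {s. snd L r s}" "fst L s = fst L t"
    then have "snd L s t" using labellingD(8)[OF L, of s r t] labellingD(4)[OF L, of r s] by simp
    then show "s = t" using labellingD(9)[OF L] st(3) by simp
  qed
  show "fst L ` {s. snd L r s} = block ns (fst (fst L r))"
  proof (intro equalityI subsetI)
    fix \<rho> assume "\<rho> \<in> fst L ` {s. snd L r s}"
    then obtain s where "snd L r s" "\<rho> = fst L s" by blast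
    then show "\<rho> \<in> block ns (fst (fst L r))"
      using labellingD(6,7)[OF L, of r s] by (simp add: block_def)
  next
    fix \<rho> assume "\<rho> \<in> block ns (fst (fst L r))"
    then obtain s where "snd L r s" "fst L s = \<rho>"
      using labellingD(10)[OF L r, of \<rho>] by (auto simp: block_def)
    then show "\<rho> \<in> fst L ` {s. snd L r s}" by blast
  qed
qed

lemma pull_bmult:
  assumes L: "labelling ns' ns L" and x: "x \<in> bmats ns"
  shows "pull L (bmult ns x y) = bmult ns' (pull L x) (pull L y)"
proof (intro ext)
  fix r s
  show "pull L (bmult ns x y) r s = bmult ns' (pull L x) (pull L y) r s"
  proof (cases "snd L r s")
    case True
    have r: "snd L r r" by (rule labellingD(11)[OF L True])
    have "bmult ns' (pull L x) (pull L y) r s = (\<Sum>t\<in>{t. snd L r t}. x (fst L r) (fst L t) * y (fst L t) (fst L s))"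
      unfolding bmult_def
    proof (rule sum.mono_neutral_cong_right)
      fix t assume "t \<in> {t. snd L r t}"
      then have "snd L r t" "snd L t s" using labellingD(4,8)[OF L] True by blast+
      then show "pull L x r t * pull L y t s = x (fst L r) (fst L t) * y (fst L t) (fst L s)"
        by (simp add: pull_def)
    next
      show "{t. snd L r t} \<subseteq> brows ns'" using labellingD(2)[OF L] by blast
    qed (simp_all add: pull_def)
    also have "\<dots> = (\<Sum>\<tau>\<in>block ns (fst (fst L r)). x (fst L r) \<tau> * y \<tau> (fst L s))"
      by (rule sum.reindex_bij_betw[OF labelling_bij_copy[OF L r], of "\<lambda>\<tau>. x (fst L r) \<tau> * y \<tau> (fst L s)"])
    also have "\<dots> = bmult ns x y (fst L r) (fst L s)" by (rule bmult_block[OF x refl, symmetric])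
    finally show ?thesis using True by (simp add: pull_def)
  next
    case False
    have 0: "pull L x r t * pull L y t s = 0" for t
      using False labellingD(8)[OF L, of r t s] by (auto simp: pull_def)
    have "bmult ns' (pull L x) (pull L y) r s = 0"
      by (simp only: bmult_def 0 sum.neutral_const)
    then show ?thesis using False by (simp add: pull_def)
  qed
qed

lemma pull_bdiag:
  assumes L: "labelling ns' ns L"
  shows "pull L (bdiag Z d) = bdiag {r. snd L r r \<and> fst L r \<in> Z} d"
proof (intro ext)
  fix r s
  show "pull L (bdiag Z d) r s = bdiag {r. snd L r r \<and> fst L r \<in> Z} d r s"
    using labellingD(9)[OF L, of r s] labellingD(11)[OF L, of r s] by (auto simp: pull_def bdiag_def)
qed

lemma pull_bdiag_brows:
  assumes L: "labelling ns' ns L"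
  shows "pull L (bdiag (brows ns) d) = bdiag {r. snd L r r} d"
proof -
  have "{r. snd L r r \<and> fst L r \<in> brows ns} = {r. snd L r r}" using labellingD(5)[OF L] by blast
  then show ?thesis by (simp add: pull_bdiag[OF L])
qed

lemma pull_total:
  assumes "total_labelling ns' ns L"
  shows "pull L (bdiag (brows ns) d) = bdiag (brows ns') d"
proof -
  have L: "labelling ns' ns L" and "\<forall>r\<in>brows ns'. snd L r r"
    using assms by (auto simp: total_labelling_def)
  then have "{r. snd L r r} = brows ns'" using labellingD(1)[OF L] by blast
  then show ?thesis by (simp add: pull_bdiag_brows[OF L])
qed

lemma labelling_lcomp:
  assumes L: "labelling ns' ns L" and L': "labelling ns'' ns' L'"
  shows "labelling ns'' ns (lcomp L L')"
  unfolding lcomp_def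
proof (rule labellingI, goal_cases)
  case (1 r s)
  then have 2: "snd L' r s" "snd L (fst L' r) (fst L' s)" by auto
  show ?case using labellingD(1-4)[OF L' 2(1)] labellingD(4-7)[OF L 2(2)] by (simp add: 2)
next
  case (2 r s t)
  then show ?case using labellingD(8)[OF L', of r s t] labellingD(8)[OF L, of "fst L' r" "fst L' s" "fst L' t"] by simp
next
  case (3 r s)
  then show ?case using labellingD(9)[OF L', of r s] labellingD(9)[OF L, of "fst L' r" "fst L' s"] by simp
next
  case (4 r \<rho>)
  then obtain s' where s': "snd L (fst L' r) s'" "fst L s' = \<rho>"
    using labellingD(10)[OF L, of "fst L' r" \<rho>] by auto
  then have "s' \<in> brows ns'" "fst s' = fst (fst L' r)"
    using labellingD(2,3)[OF L s'(1)] by auto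
  with 4 obtain s where "snd L' r s" "fst L' s = s'"
    using labellingD(10)[OF L', of r s'] by auto
  with s' show ?case unfolding comp_def by blast
qed

lemma pull_lcomp: "pull (lcomp L L') x = pull L' (pull L x)"
  by (auto simp: pull_def lcomp_def fun_eq_iff)

lemma total_labelling_lcomp:
  assumes "total_labelling ns' ns L" and "total_labelling ns'' ns' L'"
  shows "total_labelling ns'' ns (lcomp L L')"
proof -
  have "snd (lcomp L L') r r" if "r \<in> brows ns''" for r
    using assms that labellingD(5)[of ns'' ns' L' r r] by (auto simp: total_labelling_def lcomp_def)
  then show ?thesis using assms by (auto simp: total_labelling_def intro: labelling_lcomp)
qed

lemma rank_like_pull:
  assumes P: "rank_like ns' P" and L: "labelling ns' ns L"
  shows "rank_like ns (\<lambda>x. P (pull L x))"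
  unfolding rank_like_def
proof (intro conjI ballI impI)
  fix x y :: "'a bmat" assume x: "x \<in> bmats ns" and y: "y \<in> bmats ns"
  show "P (pull L (bmult ns x y)) \<le> P (pull L x)" "P (pull L (bmult ns x y)) \<le> P (pull L y)"
    using rank_like_mult[OF P pull_closed[OF L] pull_closed[OF L]] by (simp_all add: pull_bmult[OF L x])
  show "P (pull L (badd x y)) \<le> P (pull L x) + P (pull L y)"
    using rank_like_add[OF P pull_closed[OF L] pull_closed[OF L]] by (simp add: pull_badd)
next
  fix e f :: "'a bmat" assume e: "e \<in> bmats ns" and f: "f \<in> bmats ns"
    and "bmult ns e e = e" "bmult ns f f = f" "bmult ns e f = (\<lambda>r s. 0)" "bmult ns f e = (\<lambda>r s. 0)"
  then have "bmult ns' (pull L e) (pull L e) = pull L e" "bmult ns' (pull L f) (pull L f) = pull L f"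
    "bmult ns' (pull L e) (pull L f) = (\<lambda>r s. 0)" "bmult ns' (pull L f) (pull L e) = (\<lambda>r s. 0)"
    by (simp_all add: pull_bmult[OF L, symmetric] pull_zero)
  then show "P (pull L (badd e f)) = P (pull L e) + P (pull L f)"
    using P pull_closed[OF L, of e] pull_closed[OF L, of f] unfolding rank_like_def pull_badd by blast
qed

lemma brank_bdiag:
  assumes j: "j < length ns" "0 < ns ! j" and Z: "Z \<subseteq> brows ns"
  shows "brank ns j (bdiag Z 1 :: 'd::division_ring bmat) = card (Z \<inter> block ns j)"
proof -
  have fin: "finite Z" by (rule finite_subset[OF Z finite_brows])
  let ?P = "\<lambda>x::'d bmat. real (brank ns j x)"
  have "?P (bdiag Z 1) = (\<Sum>r\<in>Z. weight ?P (fst r))"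
    by (rule rank_like_bdiag[OF rank_like_brank Z])
  also have "\<dots> = (\<Sum>r\<in>Z. if r \<in> block ns j then 1 else 0)"
  proof (intro sum.cong refl)
    fix r assume "r \<in> Z"
    then have "r \<in> brows ns" using Z by auto
    then have "fst r < length ns" "r \<in> block ns j \<longleftrightarrow> fst r = j" by (auto simp: brows_def block_def)
    then show "weight ?P (fst r) = (if r \<in> block ns j then 1 else 0)"
      using brank_bunit[of "fst r" ns j, where ?'d = 'd] j by (auto simp: weight_def)
  qed
  also have "\<dots> = real (card (Z \<inter> block ns j))"
    using fin by (simp add: sum.If_cases Int_def)
  finally show ?thesis by simp
qed

lemma weight_pull:
  assumes P: "rank_like ns' P" and L: "labelling ns' ns L"
  shows "weight (\<lambda>x. P (pull L x)) i = (\<Sum>j<length ns'. real (copies ns' L i j) * weight P j)"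
proof -
  let ?Z = "{r. snd L r r \<and> fst L r = (i, 0)}"
  have Z: "?Z \<subseteq> brows ns'" using labellingD(1)[OF L] by blast
  have "weight (\<lambda>x. P (pull L x)) i = P (bdiag ?Z 1)"
    by (simp add: weight_def bunit_eq_bdiag pull_bdiag[OF L])
  also have "\<dots> = (\<Sum>r\<in>?Z. weight P (fst r))" by (rule rank_like_bdiag[OF P Z])
  also have "\<dots> = (\<Sum>r\<in>brows ns'. if r \<in> ?Z then weight P (fst r) else 0)"
    by (rule sum.mono_neutral_cong_left) (use Z in auto)
  also have "\<dots> = (\<Sum>j<length ns'. \<Sum>r\<in>block ns' j. if r \<in> ?Z then weight P (fst r) else 0)"
    by (rule sum_brows)
  also have "\<dots> = (\<Sum>j<length ns'. real (copies ns' L i j) * weight P j)"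
  proof (intro sum.cong refl)
    fix j
    have "(\<Sum>r\<in>block ns' j. if r \<in> ?Z then weight P (fst r) else 0) = (\<Sum>r\<in>block ns' j \<inter> ?Z. weight P j)"
      by (rule sum.mono_neutral_cong_right) (auto simp: block_def)
    also have "block ns' j \<inter> ?Z = {r \<in> block ns' j. snd L r r \<and> fst L r = (i, 0)}" by auto
    finally show "(\<Sum>r\<in>block ns' j. if r \<in> ?Z then weight P (fst r) else 0) = real (copies ns' L i j) * weight P j"
      by (simp add: copies_def)
  qed
  finally show ?thesis .
qed

lemma brank_pull_bunit:
  assumes L: "labelling ns' ns L" and j: "j < length ns'" "0 < ns' ! j"
  shows "brank ns' j (pull L (bunit \<rho> \<rho> :: 'd::division_ring bmat)) = card {r \<in> block ns' j. snd L r r \<and> fst L r = \<rho>}"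
proof -
  let ?Z = "{r. snd L r r \<and> fst L r \<in> {\<rho>}}"
  have Z: "?Z \<subseteq> brows ns'" using labellingD(1)[OF L] by blast
  have eq: "?Z \<inter> block ns' j = {r \<in> block ns' j. snd L r r \<and> fst L r = \<rho>}" by auto
  show ?thesis by (simp only: bunit_eq_bdiag pull_bdiag[OF L] brank_bdiag[OF j Z] eq)
qed

lemma brank_pull:
  fixes x :: "'d::division_ring bmat"
  assumes L: "labelling ns' ns L" and j: "j < length ns'" "0 < ns' ! j" and x: "x \<in> bmats ns"
  shows "brank ns' j (pull L x) = (\<Sum>i<length ns. copies ns' L i j * brank ns i x)"
proof -
  let ?P = "\<lambda>x::'d bmat. real (brank ns' j (pull L x))"
  have "?P x = (\<Sum>i<length ns. real (brank ns i x) * weight ?P i)"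
    by (rule rank_like_eq[OF rank_like_pull[OF rank_like_brank L] x])
  also have "\<dots> = real (\<Sum>i<length ns. copies ns' L i j * brank ns i x)"
    by (simp add: weight_def brank_pull_bunit[OF L j] copies_def mult.commute)
  finally show ?thesis by linarith
qed

text \<open>
  The covered rows of a block are counted by the rank of the image of the unit, and the coefficients
  do not matter for this, so that rational matrices can be used.
\<close>

lemma card_covered:
  assumes L: "labelling ns' ns L" and j: "j < length ns'" "0 < ns' ! j"
  shows "card {r \<in> block ns' j. snd L r r} = (\<Sum>i<length ns. copies ns' L i j * ns ! i)"
proof -
  have "{r. snd L r r} \<subseteq> brows ns'" using labellingD(1)[OF L] by blast
  then have "card ({r. snd L r r} \<inter> block ns' j) = brank ns' j (bdiag {r. snd L r r} 1 :: rat bmat)"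
    using brank_bdiag[OF j] by metis
  also have "\<dots> = brank ns' j (pull L (bdiag (brows ns) 1 :: rat bmat))" by (simp add: pull_bdiag_brows[OF L])
  also have "\<dots> = (\<Sum>i<length ns. copies ns' L i j * brank ns i (bdiag (brows ns) 1 :: rat bmat))"
    by (rule brank_pull[OF L j]) simp
  also have "\<dots> = (\<Sum>i<length ns. copies ns' L i j * ns ! i)" by (simp add: brank_one)
  also have "{r. snd L r r} \<inter> block ns' j = {r \<in> block ns' j. snd L r r}" by auto
  finally show ?thesis .
qed

lemma copies_total:
  assumes L: "total_labelling ns' ns L" and j: "j < length ns'" "0 < ns' ! j"
  shows "(\<Sum>i<length ns. copies ns' L i j * ns ! i) = ns' ! j"
proof -
  have "labelling ns' ns L" using L by (simp add: total_labelling_def)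
  moreover have "{r \<in> block ns' j. snd L r r} = block ns' j"
    using L block_subset by (auto simp: total_labelling_def)
  ultimately show ?thesis using card_covered[of ns' ns L j] j by (simp add: card_block)
qed

text \<open>
  The matrices obtained from two labellings that agree on pairs of rows outside \<open>Z\<close> differ only in
  the rows and columns in \<open>Z\<close>.  This bounds the rank of the difference uniformly in the source.
\<close>

definition agree_off :: "nat list \<Rightarrow> labelling \<Rightarrow> labelling \<Rightarrow> row set \<Rightarrow> bool" where
  "agree_off ns L L' Z \<longleftrightarrow> (\<forall>r\<in>brows ns - Z. \<forall>s\<in>brows ns - Z. fst r = fst s \<longrightarrow>
     (snd L r s \<longleftrightarrow> snd L' r s) \<and> (snd L r s \<longrightarrow> fst L r = fst L' r))"

lemma rank_agree_off:
  assumes P: "rank_like ns' P" and L: "labelling ns' ns L" and L': "labelling ns' ns L'"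
    and Z: "Z \<subseteq> brows ns'" and ag: "agree_off ns' L L' Z"
  shows "P (bdiff (pull L x) (pull L' x)) \<le> 2 * (\<Sum>r\<in>Z. weight P (fst r))"
proof -
  define y where "y = bdiff (pull L x) (pull L' x)"
  let ?D = "bdiag Z 1 :: 'a bmat" and ?D' = "bdiag (brows ns' - Z) 1 :: 'a bmat"
  have y: "y \<in> bmats ns'" unfolding y_def by (intro bdiff_closed pull_closed[OF L] pull_closed[OF L'])
  have 0: "y r s = 0" if "r \<notin> Z" "s \<notin> Z" for r s
  proof (cases "r \<in> brows ns' \<and> s \<in> brows ns' \<and> fst r = fst s")
    case True
    then have rs: "r \<in> brows ns' - Z" "s \<in> brows ns' - Z" "fst r = fst s" "fst s = fst r" using that by auto
    have 1: "snd L r s \<longleftrightarrow> snd L' r s" "snd L r s \<Longrightarrow> fst L r = fst L' r" "snd L s r \<Longrightarrow> fst L s = fst L' s"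
      using ag rs unfolding agree_off_def by blast+
    show ?thesis using 1 labellingD(4)[OF L, of r s] by (auto simp: y_def bdiff_def pull_def)
  next
    case False
    then show ?thesis using bmats_zero[OF y] by auto
  qed
  have "y r s = badd (bmult ns' ?D y) (bmult ns' ?D' (bmult ns' y ?D)) r s" for r s
  proof -
    have "bmult ns' y ?D \<in> bmats ns'" using y Z by simp
    then show ?thesis using 0[of r s] bmats_zero[OF y, of r s]
      by (auto simp: badd_def bdiag_mult_left bdiag_mult_right y)
  qed
  then have eq: "y = badd (bmult ns' ?D y) (bmult ns' ?D' (bmult ns' y ?D))" by (intro ext)
  have "P y \<le> P (bmult ns' ?D y) + P (bmult ns' ?D' (bmult ns' y ?D))"
    by (subst eq) (rule rank_like_add[OF P], use y Z in auto)
  also have "P (bmult ns' ?D y) \<le> P ?D"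
    by (rule rank_like_mult(1)[OF P]) (use y Z in auto)
  also have "P (bmult ns' ?D' (bmult ns' y ?D)) \<le> P (bmult ns' y ?D)"
    by (rule rank_like_mult(2)[OF P]) (use y Z in auto)
  also have "P (bmult ns' y ?D) \<le> P ?D"
    by (rule rank_like_mult(2)[OF P]) (use y Z in auto)
  finally show ?thesis using rank_like_bdiag[OF P Z] by (simp add: y_def)
qed

section \<open>Homomorphisms are block diagonal up to conjugation\<close>

text \<open>
  In a full rank factorization of an idempotent, \<open>V\<close> can be cancelled on the left and \<open>W\<close> on the
  right of \<open>V(WV)W = VW\<close>.
\<close>

lemma idempotent_factorization:
  fixes g :: "'i \<Rightarrow> 'i \<Rightarrow> 'd::division_ring"
  assumes I: "finite I" and K: "sub_division_ring K"
    and gK: "\<forall>i\<in>I. \<forall>j\<in>I. g i j \<in> K"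
    and gg: "\<And>i j. i \<in> I \<Longrightarrow> j \<in> I \<Longrightarrow> (\<Sum>k\<in>I. g i k * g k j) = g i j"
  shows "\<exists>(s::nat) V W. (\<forall>i\<in>I. \<forall>j\<in>I. g i j = (\<Sum>a<s. V i a * W a j)) \<and>
    (\<forall>a<s. \<forall>b<s. (\<Sum>i\<in>I. W a i * V i b) = of_bool (a = b)) \<and>
    (\<forall>a<s. \<forall>i\<in>I. V i a \<in> K \<and> W a i \<in> K)"
proof -
  from full_rank_factorization[OF I I K gK]
  obtain s :: nat and V W U X where
      f1: "\<And>i j. i\<in>I \<Longrightarrow> j\<in>I \<Longrightarrow> g i j = (\<Sum>a<s. V i a * W a j)" and
      f2: "\<And>a b. a<s \<Longrightarrow> b<s \<Longrightarrow> (\<Sum>i\<in>I. U a i * V i b) = of_bool (a = b)" and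
      f3: "\<And>a b. a<s \<Longrightarrow> b<s \<Longrightarrow> (\<Sum>j\<in>I. W a j * X j b) = of_bool (a = b)" and
      f4: "\<And>a. a<s \<Longrightarrow> (\<forall>i\<in>I. V i a \<in> K \<and> U a i \<in> K) \<and> (\<forall>j\<in>I. W a j \<in> K \<and> X j a \<in> K)"
    by (elim exE conjE) blast
  have W: "(\<Sum>i\<in>I. U a i * g i j) = W a j" if "a < s" "j \<in> I" for a j
  proof -
    have "(\<Sum>i\<in>I. U a i * g i j) = (\<Sum>i\<in>I. U a i * (\<Sum>b<s. V i b * W b j))"
      using that by (intro sum.cong) (auto simp: f1)
    also have "\<dots> = (\<Sum>b<s. (\<Sum>i\<in>I. U a i * V i b) * W b j)" by (rule matrix_mult_assoc[symmetric])
    finally show ?thesis using that by (simp add: f2 sum_delta_left)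
  qed
  have V: "(\<Sum>j\<in>I. g i j * X j b) = V i b" if "b < s" "i \<in> I" for i b
  proof -
    have "(\<Sum>j\<in>I. g i j * X j b) = (\<Sum>j\<in>I. (\<Sum>a<s. V i a * W a j) * X j b)"
      using that by (intro sum.cong) (auto simp: f1)
    also have "\<dots> = (\<Sum>a<s. V i a * (\<Sum>j\<in>I. W a j * X j b))" by (rule matrix_mult_assoc)
    finally show ?thesis using that by (simp add: f3 sum_delta_left)
  qed
  have "(\<Sum>i\<in>I. W a i * V i b) = of_bool (a = b)" if "a < s" "b < s" for a b
  proof -
    have "(\<Sum>i\<in>I. W a i * V i b) = (\<Sum>j\<in>I. (\<Sum>i\<in>I. U a i * g i j) * V j b)"
      using that by (intro sum.cong refl) (simp add: W)
    also have "\<dots> = (\<Sum>i\<in>I. U a i * (\<Sum>j\<in>I. g i j * V j b))"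
      by (rule matrix_mult_assoc)
    also have "\<dots> = (\<Sum>i\<in>I. U a i * V i b)"
    proof (intro sum.cong refl arg_cong2[of _ _ _ _ times])
      fix i assume i: "i \<in> I"
      have "(\<Sum>j\<in>I. g i j * V j b) = (\<Sum>j\<in>I. g i j * (\<Sum>k\<in>I. g j k * X k b))"
        using that by (intro sum.cong refl) (simp add: V)
      also have "\<dots> = (\<Sum>k\<in>I. (\<Sum>j\<in>I. g i j * g j k) * X k b)"
        by (rule matrix_mult_assoc[symmetric])
      also have "\<dots> = V i b" using that i by (simp add: gg V)
      finally show "(\<Sum>j\<in>I. g i j * V j b) = V i b" .
    qed
    finally show ?thesis using that f2 by simp
  qed
  then show ?thesis using f1 f4 by (intro exI[of _ s] exI[of _ V] exI[of _ W]) blast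
qed

text \<open>
  A full system of matrix units decomposes the space: the images of the idempotents \<open>f (i, 0) (i, 0)\<close>
  have bases, and the other matrix units transport these to bases of the remaining summands.  The
  columns of \<open>P\<close> are these bases together, and \<open>P'\<close> is the inverse of \<open>P\<close>.
\<close>

lemma matrix_units_diagonalize:
  fixes f :: "row \<Rightarrow> row \<Rightarrow> 'i \<Rightarrow> 'i \<Rightarrow> 'd::division_ring"
  assumes I: "finite I" and K: "sub_division_ring K" and ns: "sizes ns"
    and fK: "\<And>\<rho> \<sigma> q q'. \<rho> \<in> brows ns \<Longrightarrow> \<sigma> \<in> brows ns \<Longrightarrow> fst \<rho> = fst \<sigma> \<Longrightarrow> q \<in> I \<Longrightarrow> q' \<in> I \<Longrightarrow> f \<rho> \<sigma> q q' \<in> K"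
    and mu: "\<And>\<rho> \<sigma> \<tau> \<upsilon> q q'. \<rho> \<in> brows ns \<Longrightarrow> \<sigma> \<in> brows ns \<Longrightarrow> \<tau> \<in> brows ns \<Longrightarrow> \<upsilon> \<in> brows ns \<Longrightarrow>
        fst \<rho> = fst \<sigma> \<Longrightarrow> fst \<tau> = fst \<upsilon> \<Longrightarrow> q \<in> I \<Longrightarrow> q' \<in> I \<Longrightarrow>
        (\<Sum>t\<in>I. f \<rho> \<sigma> q t * f \<tau> \<upsilon> t q') = (if \<sigma> = \<tau> then f \<rho> \<upsilon> q q' else 0)"
    and one: "\<And>q q'. q \<in> I \<Longrightarrow> q' \<in> I \<Longrightarrow> (\<Sum>\<rho>\<in>brows ns. f \<rho> \<rho> q q') = of_bool (q = q')"
  shows "\<exists>(s :: nat \<Rightarrow> nat) P P'.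
    (\<forall>x\<in>Sigma (brows ns) (\<lambda>\<rho>. {..<s (fst \<rho>)}). \<forall>y\<in>Sigma (brows ns) (\<lambda>\<rho>. {..<s (fst \<rho>)}).
        (\<Sum>q\<in>I. P' x q * P q y) = of_bool (x = y)) \<and>
    (\<forall>q\<in>I. \<forall>q'\<in>I. (\<Sum>x\<in>Sigma (brows ns) (\<lambda>\<rho>. {..<s (fst \<rho>)}). P q x * P' x q') = of_bool (q = q')) \<and>
    (\<forall>\<rho>\<in>brows ns. \<forall>\<sigma>\<in>brows ns. \<forall>q\<in>I. \<forall>q'\<in>I. fst \<rho> = fst \<sigma> \<longrightarrow>
        f \<rho> \<sigma> q q' = (\<Sum>a<s (fst \<rho>). P q (\<rho>, a) * P' (\<sigma>, a) q')) \<and>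
    (\<forall>x\<in>Sigma (brows ns) (\<lambda>\<rho>. {..<s (fst \<rho>)}). \<forall>q\<in>I. P q x \<in> K \<and> P' x q \<in> K)"
proof -
  define o0 where "o0 \<rho> = (fst \<rho>, 0::nat)" for \<rho> :: row
  have o0: "o0 \<rho> \<in> brows ns" "fst (o0 \<rho>) = fst \<rho>" if "\<rho> \<in> brows ns" for \<rho>
    using that ns by (auto simp: o0_def brows_def sizes_def)
  define FF where "FF i s V W \<longleftrightarrow> (\<forall>q\<in>I. \<forall>q'\<in>I. f (i,0) (i,0) q q' = (\<Sum>a<s. V q a * W a q')) \<and>
    (\<forall>a<s. \<forall>b<s. (\<Sum>q\<in>I. W a q * V q b) = of_bool (a = b)) \<and>
    (\<forall>a<s. \<forall>q\<in>I. V q a \<in> K \<and> W a q \<in> K)" for i and s :: nat and V W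
  have "\<exists>s V W. i < length ns \<longrightarrow> FF i s V W" for i
  proof (cases "i < length ns")
    case True
    then have i: "(i, 0) \<in> brows ns" using ns by (auto simp: brows_def sizes_def)
    have "\<exists>(s::nat) V W. FF i s V W"
      unfolding FF_def by (rule idempotent_factorization[OF I K]) (use i fK mu in auto)
    then show ?thesis by blast
  qed auto
  then obtain s V W where F: "\<And>i. i < length ns \<Longrightarrow> FF i (s i) (V i) (W i)" by metis
  have F': "\<rho> \<in> brows ns \<Longrightarrow> FF (fst \<rho>) (s (fst \<rho>)) (V (fst \<rho>)) (W (fst \<rho>))" for \<rho>
    by (rule F) (auto simp: brows_def)
  define P where "P q x = (\<Sum>t\<in>I. f (fst x) (o0 (fst x)) q t * V (fst (fst x)) t (snd x))" for q and x :: "row \<times> nat"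
  define P' where "P' x q = (\<Sum>t\<in>I. W (fst (fst x)) (snd x) t * f (o0 (fst x)) (fst x) t q)" for q and x :: "row \<times> nat"
  let ?\<Lambda> = "Sigma (brows ns) (\<lambda>\<rho>. {..<s (fst \<rho>)})"
  have gV: "(\<Sum>t'\<in>I. f (o0 \<rho>) (o0 \<rho>) t t' * V (fst \<rho>) t' b) = V (fst \<rho>) t b"
    if "\<rho> \<in> brows ns" "t \<in> I" "b < s (fst \<rho>)" for \<rho> t b
  proof -
    have "(\<Sum>t'\<in>I. f (o0 \<rho>) (o0 \<rho>) t t' * V (fst \<rho>) t' b) =
        (\<Sum>t'\<in>I. (\<Sum>a<s (fst \<rho>). V (fst \<rho>) t a * W (fst \<rho>) a t') * V (fst \<rho>) t' b)"
      using F'[OF that(1)] that unfolding FF_def o0_def by (intro sum.cong refl arg_cong2[of _ _ _ _ times]) simp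
    also have "\<dots> = (\<Sum>a<s (fst \<rho>). V (fst \<rho>) t a * (\<Sum>t'\<in>I. W (fst \<rho>) a t' * V (fst \<rho>) t' b))"
      by (rule matrix_mult_assoc)
    also have "\<dots> = (\<Sum>a<s (fst \<rho>). V (fst \<rho>) t a * of_bool (a = b))"
      using F'[OF that(1)] that unfolding FF_def by (intro sum.cong refl) simp
    finally show ?thesis using that by (simp add: sum_delta_left)
  qed
  have 1: "(\<Sum>q\<in>I. P' x q * P q y) = of_bool (x = y)" if xy: "x \<in> ?\<Lambda>" "y \<in> ?\<Lambda>" for x y
  proof -
    obtain \<rho> a \<sigma> b where x: "x = (\<rho>, a)" "y = (\<sigma>, b)" "\<rho> \<in> brows ns" "\<sigma> \<in> brows ns" "a < s (fst \<rho>)" "b < s (fst \<sigma>)"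
      using xy by (cases x, cases y) auto
    have "(\<Sum>q\<in>I. P' x q * P q y) =
       (\<Sum>t\<in>I. W (fst \<rho>) a t * (\<Sum>q\<in>I. f (o0 \<rho>) \<rho> t q * (\<Sum>t'\<in>I. f \<sigma> (o0 \<sigma>) q t' * V (fst \<sigma>) t' b)))"
      unfolding P_def P'_def x fst_conv snd_conv by (rule matrix_mult_assoc)
    also have "\<dots> = (\<Sum>t\<in>I. W (fst \<rho>) a t * (\<Sum>t'\<in>I. (\<Sum>q\<in>I. f (o0 \<rho>) \<rho> t q * f \<sigma> (o0 \<sigma>) q t') * V (fst \<sigma>) t' b))"
      by (simp add: matrix_mult_assoc)
    also have "\<dots> = (\<Sum>t\<in>I. W (fst \<rho>) a t * (\<Sum>t'\<in>I. (if \<rho> = \<sigma> then f (o0 \<rho>) (o0 \<sigma>) t t' else 0) * V (fst \<sigma>) t' b))"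
      using x o0 by (intro sum.cong refl arg_cong2[of _ _ _ _ times]) (simp add: mu)
    also have "\<dots> = of_bool (x = y)"
    proof (cases "\<rho> = \<sigma>")
      case True
      then have "(\<Sum>t\<in>I. W (fst \<rho>) a t * (\<Sum>t'\<in>I. (if \<rho> = \<sigma> then f (o0 \<rho>) (o0 \<sigma>) t t' else 0) * V (fst \<sigma>) t' b))
         = (\<Sum>t\<in>I. W (fst \<rho>) a t * V (fst \<rho>) t b)"
        using x by (intro sum.cong refl arg_cong2[of _ _ _ _ times]) (simp add: gV)
      also have "\<dots> = of_bool (a = b)" using F'[OF x(3)] x True unfolding FF_def by simp
      finally show ?thesis using True x by simp
    next
      case False
      then show ?thesis using x by simp
    qed
    finally show ?thesis .
  qed
  have 2: "f \<rho> \<sigma> q q' = (\<Sum>a<s (fst \<rho>). P q (\<rho>, a) * P' (\<sigma>, a) q')"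
    if "\<rho> \<in> brows ns" "\<sigma> \<in> brows ns" "fst \<rho> = fst \<sigma>" "q \<in> I" "q' \<in> I" for \<rho> \<sigma> q q'
  proof -
    have o: "o0 \<sigma> = o0 \<rho>" using that by (simp add: o0_def)
    have "(\<Sum>a<s (fst \<rho>). P q (\<rho>, a) * P' (\<sigma>, a) q') = 
      (\<Sum>t\<in>I. f \<rho> (o0 \<rho>) q t * (\<Sum>a<s (fst \<rho>). V (fst \<rho>) t a * (\<Sum>t'\<in>I. W (fst \<rho>) a t' * f (o0 \<rho>) \<sigma> t' q')))"
      unfolding P_def P'_def fst_conv snd_conv o that(3)[symmetric] by (rule matrix_mult_assoc)
    also have "\<dots> = (\<Sum>t\<in>I. f \<rho> (o0 \<rho>) q t * (\<Sum>t'\<in>I. (\<Sum>a<s (fst \<rho>). V (fst \<rho>) t a * W (fst \<rho>) a t') * f (o0 \<rho>) \<sigma> t' q'))"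
      by (simp add: matrix_mult_assoc)
    also have "\<dots> = (\<Sum>t\<in>I. f \<rho> (o0 \<rho>) q t * (\<Sum>t'\<in>I. f (o0 \<rho>) (o0 \<rho>) t t' * f (o0 \<rho>) \<sigma> t' q'))"
      using F'[OF that(1)] unfolding FF_def o0_def by (intro sum.cong refl arg_cong2[of _ _ _ _ times]) simp
    also have "\<dots> = (\<Sum>t\<in>I. f \<rho> (o0 \<rho>) q t * f (o0 \<rho>) \<sigma> t q')"
      using that o0 by (intro sum.cong refl arg_cong2[of _ _ _ _ times]) (simp add: mu)
    also have "\<dots> = f \<rho> \<sigma> q q'" using that o0 by (simp add: mu)
    finally show ?thesis ..
  qed
  have 3: "(\<Sum>x\<in>?\<Lambda>. P q x * P' x q') = of_bool (q = q')" if "q \<in> I" "q' \<in> I" for q q'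
  proof -
    have "(\<Sum>x\<in>?\<Lambda>. P q x * P' x q') = (\<Sum>\<rho>\<in>brows ns. \<Sum>a<s (fst \<rho>). P q (\<rho>, a) * P' (\<rho>, a) q')"
      by (subst sum.Sigma) (auto simp: split_def)
    also have "\<dots> = (\<Sum>\<rho>\<in>brows ns. f \<rho> \<rho> q q')" using that 2 by (intro sum.cong refl) simp
    finally show ?thesis using one that by simp
  qed
  have Kmult: "\<And>x y. x \<in> K \<Longrightarrow> y \<in> K \<Longrightarrow> x * y \<in> K" using K by (auto simp: sub_division_ring_def)
  have 4: "P q x \<in> K \<and> P' x q \<in> K" if "x \<in> ?\<Lambda>" "q \<in> I" for x q
  proof -
    obtain \<rho> a where x1: "x = (\<rho>, a)" by (rule prod.exhaust)
    then have x: "x = (\<rho>, a)" "\<rho> \<in> brows ns" "a < s (fst \<rho>)" using that(1) by simp_all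
    then show ?thesis
      unfolding P_def P'_def x fst_conv snd_conv using F'[OF x(2)] that o0 unfolding FF_def
      by (intro conjI sub_division_ring_sum[OF K] Kmult fK) auto
  qed
  show ?thesis
    by (intro exI[of _ s] exI[of _ P] exI[of _ P'] conjI ballI impI) (rule 1 2 3 4[THEN conjunct1] 4[THEN conjunct2]; assumption)+
qed

lemma center_sub_division_ring: "sub_division_ring {z::'d::division_ring. \<forall>d. z * d = d * z}"
  (is "sub_division_ring ?K")
proof -
  have "inverse z * d = d * inverse z" if z: "\<forall>d. z * d = d * z" for z d :: 'd
  proof (cases "z = 0")
    case False
    have "inverse z * d = inverse z * d * (z * inverse z)" using False by simp
    also have "\<dots> = inverse z * (d * z) * inverse z" by (simp only: mult.assoc)
    also have "d * z = z * d" using z by simp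
    also have "inverse z * (z * d) * inverse z = d * inverse z" using False by (simp add: mult.assoc[symmetric])
    finally show ?thesis .
  qed simp
  then have i: "inverse x \<in> ?K" if "x \<in> ?K" for x :: 'd using that unfolding mem_Collect_eq by blast
  have "x * y * d = d * (x * y)" if "\<forall>d. x * d = d * x" "\<forall>d. y * d = d * y" for x y d :: 'd
  proof -
    have "x * y * d = x * (d * y)" using that(2) by (simp only: mult.assoc)
    also have "\<dots> = x * d * y" by (simp only: mult.assoc)
    also have "\<dots> = d * (x * y)" using that(1) by (simp only: mult.assoc)
    finally show ?thesis .
  qed
  then have m: "x * y \<in> ?K" if "x \<in> ?K" "y \<in> ?K" for x y using that unfolding mem_Collect_eq by blast
  have "(x + y) * d = d * (x + y)" if "\<forall>d. x * d = d * x" "\<forall>d. y * d = d * y" for x y d :: 'd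
    by (simp only: distrib_left distrib_right that(1)[rule_format, of d] that(2)[rule_format, of d])
  then have a: "x + y \<in> ?K" if "x \<in> ?K" "y \<in> ?K" for x y using that unfolding mem_Collect_eq by blast
  have "- x * d = d * - x" if "\<forall>d. x * d = d * x" for x d :: 'd
    by (simp only: minus_mult_left[symmetric] minus_mult_right[symmetric] that[rule_format, of d])
  then have n: "- x \<in> ?K" if "x \<in> ?K" for x using that unfolding mem_Collect_eq by blast
  have z: "0 \<in> ?K" "1 \<in> ?K" by simp_all
  show ?thesis
    unfolding sub_division_ring_def by (intro conjI ballI; (rule z | (rule a m n i; assumption)))
qed

definition central_bmats :: "nat list \<Rightarrow> 'd::division_ring bmat set" where
  "central_bmats ns = {x \<in> bmats ns. \<forall>r s d. x r s * d = d * x r s}"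

lemma additive_bmats_eqI:
  fixes F G :: "'d::division_ring bmat \<Rightarrow> 'd bmat"
  assumes F: "\<And>x y. x \<in> bmats ns \<Longrightarrow> y \<in> bmats ns \<Longrightarrow> F (badd x y) = badd (F x) (F y)"
    and G: "\<And>x y. x \<in> bmats ns \<Longrightarrow> y \<in> bmats ns \<Longrightarrow> G (badd x y) = badd (G x) (G y)"
    and eq: "\<And>d r s. r \<in> brows ns \<Longrightarrow> s \<in> brows ns \<Longrightarrow> fst r = fst s \<Longrightarrow>
       F (bmult ns (bdiag (brows ns) d) (bunit r s)) = G (bmult ns (bdiag (brows ns) d) (bunit r s))"
    and x: "x \<in> bmats ns"
  shows "F x = G x"
proof -
  have 0: "H (\<lambda>r s. 0) = (\<lambda>r s. 0)" if "\<And>x y. x \<in> bmats ns \<Longrightarrow> y \<in> bmats ns \<Longrightarrow> H (badd x y) = badd (H x) (H y)"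
    for H :: "'d bmat \<Rightarrow> 'd bmat"
  proof -
    have "badd (\<lambda>r s. 0) (\<lambda>r s. 0) = (\<lambda>r s. 0 :: 'd)" by (simp add: badd_def)
    then have "badd (H (\<lambda>r s. 0)) (H (\<lambda>r s. 0)) = H (\<lambda>r s. 0)" using that[OF zero_bmats zero_bmats] by simp
    then show ?thesis by (simp add: badd_def fun_eq_iff)
  qed
  have "finite S \<Longrightarrow> S \<subseteq> brows ns \<times> brows ns \<Longrightarrow> x \<in> bmats ns \<Longrightarrow> (\<And>r s. (r, s) \<notin> S \<Longrightarrow> x r s = 0) \<Longrightarrow> F x = G x" for S x
  proof (induction S arbitrary: x rule: finite_induct)
    case empty
    then have "x = (\<lambda>r s. 0)" by (simp add: fun_eq_iff)
    then show ?case using 0[of F] 0[of G] F G by simp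
  next
    case (insert z S)
    obtain r s where z: "z = (r, s)" by (cases z)
    define y where "y r' s' = (if r' = r \<and> s' = s then 0 else x r' s')" for r' s'
    define m where "m r' s' = (if r' = r \<and> s' = s then x r s else 0)" for r' s'
    have y: "y \<in> bmats ns" using insert.prems(2) by (auto simp: y_def bmats_def)
    have "F y = G y"
    proof (rule insert.IH[OF _ y])
      show "S \<subseteq> brows ns \<times> brows ns" using insert.prems by auto
      fix r' s' assume "(r', s') \<notin> S"
      then show "y r' s' = 0" using insert.prems(3)[of r' s'] by (cases "r' = r \<and> s' = s") (auto simp: y_def z)
    qed
    moreover have m: "m \<in> bmats ns" using insert.prems(2) by (auto simp: m_def bmats_def)
    moreover have "F m = G m"
    proof (cases "fst r = fst s")
      case True
      have rs: "r \<in> brows ns" "s \<in> brows ns" using insert.prems z by auto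
      have "m = bmult ns (bdiag (brows ns) (x r s)) (bunit r s)"
        by (subst bdiag_mult_left[OF bunit_closed[OF rs True]]) (auto simp: m_def bunit_def fun_eq_iff rs)
      then show ?thesis using eq[OF rs True] by simp
    next
      case False
      then have "x r s = 0" using bmats_zero[OF insert.prems(2)] by auto
      then have "m = (\<lambda>r s. 0)" by (auto simp: m_def fun_eq_iff)
      then show ?thesis using 0[of F] 0[of G] F G by simp
    qed
    moreover have "x = badd m y" by (auto simp: m_def y_def badd_def fun_eq_iff)
    ultimately show ?case using F G y by simp
  qed
  from this[of "brows ns \<times> brows ns" x] show ?thesis using x bmats_zero[OF x] by auto
qed

lemma pull_bunit_eq:
  "pull L (bunit \<rho> \<sigma>) = (\<lambda>r s. if snd L r s \<and> fst L r = \<rho> \<and> fst L s = \<sigma> then 1 else 0)"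
  by (auto simp: pull_def bunit_def fun_eq_iff)

lemma central_bmats_commute:
  assumes "W \<in> central_bmats ns"
  shows "bmult ns W (bdiag (brows ns) d) = bmult ns (bdiag (brows ns) d) W"
proof (intro ext)
  fix r s
  have W: "W \<in> bmats ns" "\<And>r s d. W r s * d = d * W r s" using assms by (auto simp: central_bmats_def)
  show "bmult ns W (bdiag (brows ns) d) r s = bmult ns (bdiag (brows ns) d) W r s"
    unfolding bdiag_mult_left[OF W(1)] bdiag_mult_right[OF W(1)]
    using W(2)[of r s d] bmats_zero[OF W(1), of r s] by (cases "r \<in> brows ns"; cases "s \<in> brows ns") auto
qed

text \<open>
  The matrix units of the source commute with the scalars, so the entries of their images commute with
  all scalars, too.  On the block \<open>j\<close> of the target the images form a full system of matrix units,
  diagonalized by matrices \<open>P j\<close> and \<open>P' j\<close> whose intermediate index set \<open>\<Lambda> j\<close> consists of the pairs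
  \<open>(\<rho>, a)\<close> of a row of the source and the number of a copy.  As these matrices are inverse to each
  other, \<open>\<Lambda> j\<close> has as many elements as the block has rows.  A bijection \<open>b\<close> between the two index sets
  turns \<open>P\<close> into an invertible matrix \<open>W\<close> of the target and defines the labelling: \<open>b r = (\<rho>, a)\<close> means
  that \<open>r\<close> is the row \<open>\<rho>\<close> of the copy \<open>a\<close>.
\<close>

theorem D_hom_conjugate_standard:
  fixes \<phi> :: "'d::division_ring bmat \<Rightarrow> 'd bmat"
  assumes ns: "sizes ns" and ns': "sizes ns'"
    and hom: "\<phi> \<in> Ring.ring_hom (block_ring TYPE('d) ns) (block_ring TYPE('d) ns')"
    and scal: "\<And>d. \<phi> (bdiag (brows ns) d) = bdiag (brows ns') d"
  shows "\<exists>L W W'. total_labelling ns' ns L \<and> W \<in> central_bmats ns' \<and> W' \<in> central_bmats ns' \<and>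
    bmult ns' W W' = bdiag (brows ns') 1 \<and> bmult ns' W' W = bdiag (brows ns') 1 \<and>
    (\<forall>x\<in>bmats ns. \<phi> x = bmult ns' W (bmult ns' (pull L x) W'))"
proof -
  let ?K = "{z::'d. \<forall>d. z * d = d * z}"
  have cl: "\<phi> x \<in> bmats ns'" if "x \<in> bmats ns" for x
    using ring_hom_closed[OF hom] that by simp
  have mul: "\<phi> (bmult ns x y) = bmult ns' (\<phi> x) (\<phi> y)" if "x \<in> bmats ns" "y \<in> bmats ns" for x y
    using ring_hom_mult[OF hom] that by simp
  have add: "\<phi> (badd x y) = badd (\<phi> x) (\<phi> y)" if "x \<in> bmats ns" "y \<in> bmats ns" for x y
    using ring_hom_add[OF hom] that by simp
  define f where "f \<rho> \<sigma> = \<phi> (bunit \<rho> \<sigma>)" for \<rho> \<sigma>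
  have f_in: "f \<rho> \<sigma> \<in> bmats ns'" if "\<rho> \<in> brows ns" "\<sigma> \<in> brows ns" "fst \<rho> = fst \<sigma>" for \<rho> \<sigma>
    using that by (simp add: f_def cl)
  have phi0: "\<phi> (\<lambda>r s. 0) = (\<lambda>r s. 0)"
    using ring_hom_zero[OF hom ring_block_ring ring_block_ring] by simp
  have fK: "f \<rho> \<sigma> q q' \<in> ?K" if \<rho>: "\<rho> \<in> brows ns" "\<sigma> \<in> brows ns" "fst \<rho> = fst \<sigma>" for \<rho> \<sigma> q q'
  proof -
    have c: "bmult ns (bunit \<rho> \<sigma>) (bdiag (brows ns) d) = bmult ns (bdiag (brows ns) d) (bunit \<rho> \<sigma>)" for d :: 'd
      by (subst bdiag_mult_left[OF bunit_closed[OF \<rho>]], subst bdiag_mult_right[OF bunit_closed[OF \<rho>]])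
        (use \<rho> in \<open>auto simp: bunit_def fun_eq_iff\<close>)
    have "f \<rho> \<sigma> q q' * d = d * f \<rho> \<sigma> q q'" for d
    proof -
      have "bmult ns' (f \<rho> \<sigma>) (bdiag (brows ns') d) = bmult ns' (bdiag (brows ns') d) (f \<rho> \<sigma>)"
        using arg_cong[OF c[of d], of \<phi>] \<rho> by (simp add: mul scal f_def)
      then have "bmult ns' (f \<rho> \<sigma>) (bdiag (brows ns') d) q q' = bmult ns' (bdiag (brows ns') d) (f \<rho> \<sigma>) q q'" by simp
      then show ?thesis
        unfolding bdiag_mult_left[OF f_in[OF \<rho>]] bdiag_mult_right[OF f_in[OF \<rho>]]
        using bmats_zero[OF f_in[OF \<rho>], of q q'] by (cases "q \<in> brows ns'"; cases "q' \<in> brows ns'") auto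
    qed
    then show ?thesis by simp
  qed
  have mu: "bmult ns' (f \<rho> \<sigma>) (f \<tau> \<upsilon>) = (if \<sigma> = \<tau> then f \<rho> \<upsilon> else (\<lambda>r s. 0))"
    if "\<rho> \<in> brows ns" "\<sigma> \<in> brows ns" "\<tau> \<in> brows ns" "\<upsilon> \<in> brows ns" "fst \<rho> = fst \<sigma>" "fst \<tau> = fst \<upsilon>" for \<rho> \<sigma> \<tau> \<upsilon>
  proof -
    have "bmult ns (bunit \<rho> \<sigma>) (bunit \<tau> \<upsilon>) = (if \<sigma> = \<tau> then bunit \<rho> \<upsilon> else (\<lambda>r s. 0 :: 'd))"
    proof (cases "\<sigma> = \<tau>")
      case True
      then show ?thesis using bunit_mult[of \<tau> ns \<rho> \<upsilon>] that by simp
    next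
      case False
      have "bunit \<rho> \<sigma> r t * bunit \<tau> \<upsilon> t s = (0::'d)" for r s t using False by (auto simp: bunit_def)
      then show ?thesis using False by (simp only: bmult_def sum.neutral_const if_False)
    qed
    then show ?thesis unfolding f_def using that by (subst mul[symmetric]) (auto simp: phi0)
  qed
  have fsum: "S \<subseteq> brows ns \<Longrightarrow> \<phi> (bdiag S 1) q q' = (\<Sum>\<rho>\<in>S. f \<rho> \<rho> q q')" if "finite S" for S q q'
    using that
  proof (induction S rule: finite_induct)
    case empty
    have "bdiag {} 1 = (\<lambda>r s. 0 :: 'd)" by (auto simp: bdiag_def)
    then show ?case using phi0 by simp
  next
    case (insert r S)
    have "bdiag (insert r S) 1 = badd (bunit r r) (bdiag S 1 :: 'd bmat)"
      using insert.hyps by (auto simp: badd_def bdiag_def bunit_def fun_eq_iff)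
    then show ?case using insert add[of "bunit r r" "bdiag S 1"] by (simp add: f_def badd_def)
  qed
  define PP where "PP j s P P' \<longleftrightarrow>
    (\<forall>x\<in>Sigma (brows ns) (\<lambda>\<rho>. {..<s (fst \<rho>)}). \<forall>y\<in>Sigma (brows ns) (\<lambda>\<rho>. {..<s (fst \<rho>)}).
        (\<Sum>q\<in>block ns' j. P' x q * P q y) = of_bool (x = y)) \<and>
    (\<forall>q\<in>block ns' j. \<forall>q'\<in>block ns' j. (\<Sum>x\<in>Sigma (brows ns) (\<lambda>\<rho>. {..<s (fst \<rho>)}). P q x * P' x q') = of_bool (q = q')) \<and>
    (\<forall>\<rho>\<in>brows ns. \<forall>\<sigma>\<in>brows ns. \<forall>q\<in>block ns' j. \<forall>q'\<in>block ns' j. fst \<rho> = fst \<sigma> \<longrightarrow>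
        f \<rho> \<sigma> q q' = (\<Sum>a<s (fst \<rho>). P q (\<rho>, a) * P' (\<sigma>, a) q')) \<and>
    (\<forall>x\<in>Sigma (brows ns) (\<lambda>\<rho>. {..<s (fst \<rho>)}). \<forall>q\<in>block ns' j. P q x \<in> ?K \<and> P' x q \<in> ?K)"
    for j and s :: "nat \<Rightarrow> nat" and P :: "row \<Rightarrow> row \<times> nat \<Rightarrow> 'd" and P'
  have "\<exists>s P P'. PP j s P P'" for j
    unfolding PP_def
  proof (rule matrix_units_diagonalize[OF finite_block center_sub_division_ring ns])
    fix \<rho> \<sigma> q q' assume "\<rho> \<in> brows ns" "\<sigma> \<in> brows ns" "fst \<rho> = fst \<sigma>"
    then show "f \<rho> \<sigma> q q' \<in> ?K" by (rule fK)
  next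
    fix \<rho> \<sigma> \<tau> \<upsilon> q q'
    assume *: "\<rho> \<in> brows ns" "\<sigma> \<in> brows ns" "\<tau> \<in> brows ns" "\<upsilon> \<in> brows ns" "fst \<rho> = fst \<sigma>" "fst \<tau> = fst \<upsilon>"
      and q: "q \<in> block ns' j" "q' \<in> block ns' j"
    have "(\<Sum>t\<in>block ns' j. f \<rho> \<sigma> q t * f \<tau> \<upsilon> t q') = bmult ns' (f \<rho> \<sigma>) (f \<tau> \<upsilon>) q q'"
      using bmult_block[OF f_in[OF *(1,2,5)], of q j] q by (simp add: block_def)
    then show "(\<Sum>t\<in>block ns' j. f \<rho> \<sigma> q t * f \<tau> \<upsilon> t q') = (if \<sigma> = \<tau> then f \<rho> \<upsilon> q q' else 0)"
      using mu[OF *] by simp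
  next
    fix q q' assume q: "q \<in> block ns' j" "q' \<in> block ns' j"
    show "(\<Sum>\<rho>\<in>brows ns. f \<rho> \<rho> q q') = of_bool (q = q')"
    proof -
      have "(\<Sum>\<rho>\<in>brows ns. f \<rho> \<rho> q q') = bdiag (brows ns') 1 q q'"
        using fsum[OF finite_brows subset_refl] by (simp add: scal)
      also have "\<dots> = of_bool (q = q')" using q by (auto simp: bdiag_def block_def)
      finally show ?thesis .
    qed
  qed
  then obtain s P P' where "\<And>j. PP j (s j) (P j) (P' j)" by metis
  define \<Lambda> where "\<Lambda> j = Sigma (brows ns) (\<lambda>\<rho>. {..<s j (fst \<rho>)})" for j
  have PP1: "x \<in> \<Lambda> j \<Longrightarrow> y \<in> \<Lambda> j \<Longrightarrow> (\<Sum>q\<in>block ns' j. P' j x q * P j q y) = of_bool (x = y)" 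
    and PP2: "q \<in> block ns' j \<Longrightarrow> q' \<in> block ns' j \<Longrightarrow> (\<Sum>x\<in>\<Lambda> j. P j q x * P' j x q') = of_bool (q = q')"
    and PP3: "\<rho> \<in> brows ns \<Longrightarrow> \<sigma> \<in> brows ns \<Longrightarrow> q \<in> block ns' j \<Longrightarrow> q' \<in> block ns' j \<Longrightarrow> fst \<rho> = fst \<sigma> \<Longrightarrow>
        f \<rho> \<sigma> q q' = (\<Sum>a<s j (fst \<rho>). P j q (\<rho>, a) * P' j (\<sigma>, a) q')"
    and PP4: "x \<in> \<Lambda> j \<Longrightarrow> q \<in> block ns' j \<Longrightarrow> P j q x * d = d * P j q x"
    and PP5: "x \<in> \<Lambda> j \<Longrightarrow> q \<in> block ns' j \<Longrightarrow> P' j x q * d = d * P' j x q" for x y j q q' \<rho> \<sigma> d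
    using \<open>\<And>j. PP j (s j) (P j) (P' j)\<close> unfolding PP_def \<Lambda>_def by blast+
  have fin\<Lambda>: "finite (\<Lambda> j)" for j by (simp add: \<Lambda>_def)
  have "card (\<Lambda> j) = card (block ns' j)" for j
    using card_le_if_right_inverse[of "\<Lambda> j" "block ns' j" "P' j" "P j"]
      card_le_if_right_inverse[of "block ns' j" "\<Lambda> j" "P j" "P' j"] fin\<Lambda> PP1 PP2 by (simp add: antisym)
  then have "\<exists>b. bij_betw b (block ns' j) (\<Lambda> j)" for j
    using fin\<Lambda> by (intro finite_same_card_bij) auto
  then obtain b0 where b0: "\<And>j. bij_betw (b0 j) (block ns' j) (\<Lambda> j)" by metis
  define b where "b r = b0 (fst r) r" for r
  have b: "bij_betw b (block ns' j) (\<Lambda> j)" for j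
    using b0[of j] by (rule iffD1[OF bij_betw_cong, rotated]) (auto simp: b_def block_def)
  have b_in: "b r \<in> \<Lambda> (fst r)" if "r \<in> brows ns'" for r
    using bij_betw_apply[OF b, of r "fst r"] that by (simp add: block_def)
  have b_inj: "r = r'" if "r \<in> brows ns'" "r' \<in> brows ns'" "fst r = fst r'" "b r = b r'" for r r'
    using inj_onD[OF bij_betw_imp_inj_on[OF b, of "fst r"], of r r'] that by (simp add: block_def)
  have b_surj: "\<exists>r. r \<in> brows ns' \<and> fst r = j \<and> b r = x" if "x \<in> \<Lambda> j" for x j
  proof -
    from that have "x \<in> b ` block ns' j" by (simp add: bij_betw_imp_surj_on[OF b])
    then show ?thesis unfolding block_def by blast
  qed
  define E where "E r r' \<longleftrightarrow> r \<in> brows ns' \<and> r' \<in> brows ns' \<and> fst r = fst r' \<and> snd (b r) = snd (b r') \<and>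
     fst (fst (b r)) = fst (fst (b r'))" for r r'
  define L where "L = (\<lambda>r. fst (b r), E)"
  have bb: "fst (b r) \<in> brows ns" "snd (b r) < s (fst r) (fst (fst (b r)))" if "r \<in> brows ns'" for r
    using b_in[OF that] by (auto simp: \<Lambda>_def)
  have lab: "labelling ns' ns L"
    unfolding L_def
  proof (rule labellingI, goal_cases)
    case (1 r r') then show ?case using bb by (auto simp: E_def)
  next
    case (2 r r' t) then show ?case by (auto simp: E_def)
  next
    case (3 r r') then show ?case using b_inj[of r r'] by (auto simp: E_def prod_eq_iff)
  next
    case (4 r \<rho>)
    then have r: "r \<in> brows ns'" by (simp add: E_def)
    have "(\<rho>, snd (b r)) \<in> \<Lambda> (fst r)" using 4 bb[OF r] by (simp add: \<Lambda>_def)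
    then obtain r' where "r' \<in> brows ns'" "fst r' = fst r" "b r' = (\<rho>, snd (b r))"
      using b_surj by metis
    then have "E r r' \<and> fst (b r') = \<rho>" using r 4 by (simp add: E_def)
    then show ?case by blast
  qed
  have tot: "total_labelling ns' ns L"
    using lab by (auto simp: total_labelling_def L_def E_def)
  define W where "W r r' = (if r \<in> brows ns' \<and> r' \<in> brows ns' \<and> fst r = fst r' then P (fst r) r (b r') else 0)" for r r'
  define W' where "W' r r' = (if r \<in> brows ns' \<and> r' \<in> brows ns' \<and> fst r = fst r' then P' (fst r) (b r) r' else 0)" for r r'
  have WK: "W \<in> central_bmats ns'"
    unfolding central_bmats_def
  proof (safe intro!: bmatsI)
    fix r r' d
    show "W r r' * d = d * W r r'"
    proof (cases "r \<in> brows ns' \<and> r' \<in> brows ns' \<and> fst r = fst r'")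
      case True
      then have "b r' \<in> \<Lambda> (fst r)" "r \<in> block ns' (fst r)" using b_in[of r'] by (auto simp: block_def)
      then show ?thesis unfolding W_def if_P[OF True] by (rule PP4)
    qed (auto simp: W_def)
  qed (auto simp: W_def split: if_splits)
  have W'K: "W' \<in> central_bmats ns'"
    unfolding central_bmats_def
  proof (safe intro!: bmatsI)
    fix r r' d
    show "W' r r' * d = d * W' r r'"
    proof (cases "r \<in> brows ns' \<and> r' \<in> brows ns' \<and> fst r = fst r'")
      case True
      then have "b r \<in> \<Lambda> (fst r)" "r' \<in> block ns' (fst r)" using b_in[of r] by (auto simp: block_def)
      then show ?thesis unfolding W'_def if_P[OF True] by (rule PP5)
    qed (auto simp: W'_def)
  qed (auto simp: W'_def split: if_splits)
  have Wb: "W \<in> bmats ns'" "W' \<in> bmats ns'" using WK W'K by (auto simp: central_bmats_def)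
  have WW': "bmult ns' W W' = bdiag (brows ns') 1"
  proof (intro ext)
    fix r r'
    show "bmult ns' W W' r r' = bdiag (brows ns') 1 r r'"
    proof (cases "r \<in> brows ns' \<and> r' \<in> brows ns' \<and> fst r = fst r'")
      case True
      let ?j = "fst r"
      have "bmult ns' W W' r r' = (\<Sum>t\<in>block ns' ?j. W r t * W' t r')" by (rule bmult_block[OF Wb(1) refl])
      also have "\<dots> = (\<Sum>t\<in>block ns' ?j. P ?j r (b t) * P' ?j (b t) r')"
        using True by (intro sum.cong refl) (auto simp: W_def W'_def block_def)
      also have "\<dots> = (\<Sum>x\<in>\<Lambda> ?j. P ?j r x * P' ?j x r')"
        by (rule sum.reindex_bij_betw[OF b])
      also have "\<dots> = of_bool (r = r')" using PP2[of r ?j r'] True by (simp add: block_def)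
      finally show ?thesis using True by (simp add: bdiag_def)
    next
      case False
      then show ?thesis using bmats_zero[OF bmult_closed[OF Wb], of r r'] by (auto simp: bdiag_def)
    qed
  qed
  have W'W: "bmult ns' W' W = bdiag (brows ns') 1"
  proof (intro ext)
    fix r r'
    show "bmult ns' W' W r r' = bdiag (brows ns') 1 r r'"
    proof (cases "r \<in> brows ns' \<and> r' \<in> brows ns' \<and> fst r = fst r'")
      case True
      let ?j = "fst r"
      have "bmult ns' W' W r r' = (\<Sum>t\<in>block ns' ?j. W' r t * W t r')" by (rule bmult_block[OF Wb(2) refl])
      also have "\<dots> = (\<Sum>t\<in>block ns' ?j. P' ?j (b r) t * P ?j t (b r'))"
        using True by (intro sum.cong refl) (auto simp: W_def W'_def block_def)
      also have "\<dots> = of_bool (b r = b r')" using PP1[of "b r" ?j "b r'"] b_in[of r] b_in[of r'] True by simp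
      finally show ?thesis using True b_inj[of r r'] by (auto simp: bdiag_def)
    next
      case False
      then show ?thesis using bmats_zero[OF bmult_closed[OF Wb(2,1)], of r r'] by (auto simp: bdiag_def)
    qed
  qed
  define \<psi> where "\<psi> x = bmult ns' W (bmult ns' (pull L x) W')" for x
  have unit: "\<psi> (bunit \<rho> \<sigma>) = f \<rho> \<sigma>" if \<rho>: "\<rho> \<in> brows ns" "\<sigma> \<in> brows ns" "fst \<rho> = fst \<sigma>" for \<rho> \<sigma>
  proof (intro ext)
    fix r r'
    show "\<psi> (bunit \<rho> \<sigma>) r r' = f \<rho> \<sigma> r r'"
    proof (cases "r \<in> brows ns' \<and> r' \<in> brows ns' \<and> fst r = fst r'")
      case True
      let ?j = "fst r"
      let ?A = "{..<s ?j (fst \<rho>)}"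
      have "\<exists>t. t \<in> brows ns' \<and> fst t = ?j \<and> b t = (\<tau>, a)" if "a \<in> ?A" "\<tau> \<in> brows ns" "fst \<tau> = fst \<rho>" for a \<tau>
        using b_surj[of "(\<tau>, a)" ?j] that by (simp add: \<Lambda>_def)
      then have ex: "\<exists>t. t \<in> brows ns' \<and> fst t = ?j \<and> b t = (\<tau>, a)" if "a \<in> ?A" "\<tau> \<in> brows ns" "fst \<tau> = fst \<rho>" for a \<tau>
        using that by blast
      define t where "t \<tau> a = (SOME t. t \<in> brows ns' \<and> fst t = ?j \<and> b t = (\<tau>, a))" for \<tau> a
      have t: "\<And>a. a \<in> ?A \<Longrightarrow> t \<rho> a \<in> brows ns' \<and> fst (t \<rho> a) = ?j \<and> b (t \<rho> a) = (\<rho>, a)"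
        "\<And>a. a \<in> ?A \<Longrightarrow> t \<sigma> a \<in> brows ns' \<and> fst (t \<sigma> a) = ?j \<and> b (t \<sigma> a) = (\<sigma>, a)"
        unfolding t_def by (rule someI_ex[OF ex]; use \<rho> in simp)+
      have inner: "bmult ns' (pull L (bunit \<rho> \<sigma>)) W' q r' = (\<Sum>a\<in>?A. of_bool (q = t \<rho> a) * P' ?j (\<sigma>, a) r')"
        if q: "q \<in> block ns' ?j" for q
      proof -
        have qj: "q \<in> brows ns'" "fst q = ?j" using q by (auto simp: block_def)
        have "bmult ns' (pull L (bunit \<rho> \<sigma>)) W' q r' = (\<Sum>u\<in>block ns' ?j. pull L (bunit \<rho> \<sigma>) q u * W' u r')"
          using qj by (intro bmult_block[OF pull_closed[OF lab]]) simp
        also have "\<dots> = (\<Sum>a\<in>?A. of_bool (q = t \<rho> a) * P' ?j (\<sigma>, a) r')"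
        proof (cases "fst (b q) = \<rho>")
          case T: True
          let ?a = "snd (b q)"
          have a: "?a \<in> ?A" using bb[OF qj(1)] qj T by simp
          have qt: "q = t \<rho> ?a" using t(1)[OF a] qj T by (intro b_inj) (auto simp: prod_eq_iff)
          have "q = t \<rho> a' \<longleftrightarrow> a' = ?a" if "a' \<in> ?A" for a' using t(1)[OF that] qt by auto
          then have "(\<Sum>a\<in>?A. of_bool (q = t \<rho> a) * P' ?j (\<sigma>, a) r') = (\<Sum>a\<in>?A. of_bool (a = ?a) * P' ?j (\<sigma>, a) r')"
            by (intro sum.cong refl) simp
          also have "\<dots> = P' ?j (\<sigma>, ?a) r'" using a by (simp add: sum_delta_left)
          finally have R: "(\<Sum>a\<in>?A. of_bool (q = t \<rho> a) * P' ?j (\<sigma>, a) r') = P' ?j (\<sigma>, ?a) r'" .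
          let ?u = "t \<sigma> ?a"
          have u: "?u \<in> block ns' ?j" using t(2)[OF a] by (simp add: block_def)
          have "(snd L q u \<and> fst L q = \<rho> \<and> fst L u = \<sigma>) \<longleftrightarrow> u = ?u" if "u \<in> block ns' ?j" for u
          proof
            assume "snd L q u \<and> fst L q = \<rho> \<and> fst L u = \<sigma>"
            then show "u = ?u" using t(2)[OF a] that
              by (intro b_inj) (auto simp: L_def E_def block_def prod_eq_iff)
          next
            assume "u = ?u"
            then show "snd L q u \<and> fst L q = \<rho> \<and> fst L u = \<sigma>"
              using t(2)[OF a] qj T \<rho> by (auto simp: L_def E_def)
          qed
          then have "(\<Sum>u\<in>block ns' ?j. pull L (bunit \<rho> \<sigma>) q u * W' u r') = (\<Sum>u\<in>block ns' ?j. of_bool (u = ?u) * W' u r')"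
            by (intro sum.cong refl) (simp add: pull_bunit_eq)
          also have "\<dots> = W' ?u r'" using u by (simp add: sum_delta_left)
          also have "\<dots> = P' ?j (\<sigma>, ?a) r'" using t(2)[OF a] True by (auto simp: W'_def)
          finally show ?thesis using R by simp
        next
          case F: False
          then have "q \<noteq> t \<rho> a" if "a \<in> ?A" for a using t(1)[OF that] by auto
          then show ?thesis using F by (simp add: pull_bunit_eq L_def)
        qed
        finally show ?thesis .
      qed
      have "\<psi> (bunit \<rho> \<sigma>) r r' = (\<Sum>q\<in>block ns' ?j. W r q * bmult ns' (pull L (bunit \<rho> \<sigma>)) W' q r')"
        unfolding \<psi>_def by (rule bmult_block[OF Wb(1) refl])
      also have "\<dots> = (\<Sum>q\<in>block ns' ?j. W r q * (\<Sum>a\<in>?A. of_bool (q = t \<rho> a) * P' ?j (\<sigma>, a) r'))"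
        by (intro sum.cong refl) (simp add: inner)
      also have "\<dots> = (\<Sum>a\<in>?A. (\<Sum>q\<in>block ns' ?j. W r q * of_bool (q = t \<rho> a)) * P' ?j (\<sigma>, a) r')"
        by (rule matrix_mult_assoc[symmetric])
      also have "\<dots> = (\<Sum>a\<in>?A. P ?j r (\<rho>, a) * P' ?j (\<sigma>, a) r')"
      proof (intro sum.cong refl arg_cong2[of _ _ _ _ times])
        fix a assume a: "a \<in> ?A"
        have "t \<rho> a \<in> block ns' ?j" using t(1)[OF a] by (simp add: block_def)
        then have "(\<Sum>q\<in>block ns' ?j. W r q * of_bool (q = t \<rho> a)) = W r (t \<rho> a)" by (simp add: sum_delta_left)
        also have "\<dots> = P ?j r (\<rho>, a)" using t(1)[OF a] True by (simp add: W_def)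
        finally show "(\<Sum>q\<in>block ns' ?j. W r q * of_bool (q = t \<rho> a)) = P ?j r (\<rho>, a)" .
      qed
      also have "\<dots> = f \<rho> \<sigma> r r'"
        using PP3[of \<rho> \<sigma> r ?j r'] \<rho> True by (simp add: block_def)
      finally show ?thesis .
    next
      case False
      have "\<psi> (bunit \<rho> \<sigma>) \<in> bmats ns'" unfolding \<psi>_def by (intro bmult_closed pull_closed[OF lab] Wb)
      from bmats_zero[OF this, of r r'] bmats_zero[OF f_in[OF \<rho>], of r r'] False
      show ?thesis by auto
    qed
  qed
  have "\<phi> x = \<psi> x" if x: "x \<in> bmats ns" for x
  proof (rule additive_bmats_eqI[OF _ _ _ x])
    fix x y :: "'d bmat" assume "x \<in> bmats ns" "y \<in> bmats ns"
    then show "\<phi> (badd x y) = badd (\<phi> x) (\<phi> y)" by (rule add)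
    show "\<psi> (badd x y) = badd (\<psi> x) (\<psi> y)"
      by (simp add: \<psi>_def pull_badd bmult_badd_left bmult_badd_right)
  next
    fix d :: 'd and r r' :: row assume r: "r \<in> brows ns" "r' \<in> brows ns" "fst r = fst r'"
    let ?d = "bdiag (brows ns') d"
    have "\<psi> (bmult ns (bdiag (brows ns) d) (bunit r r')) = bmult ns' W (bmult ns' (bmult ns' ?d (pull L (bunit r r'))) W')"
      by (simp add: \<psi>_def pull_bmult[OF lab] pull_total[OF tot])
    also have "\<dots> = bmult ns' (bmult ns' W ?d) (bmult ns' (pull L (bunit r r')) W')"
      by (simp add: bmult_assoc)
    also have "\<dots> = bmult ns' ?d (\<psi> (bunit r r'))"
      by (simp add: central_bmats_commute[OF WK] bmult_assoc \<psi>_def)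
    also have "\<dots> = \<phi> (bmult ns (bdiag (brows ns) d) (bunit r r'))"
      using r by (simp add: unit[OF r] mul scal f_def)
    finally show "\<phi> (bmult ns (bdiag (brows ns) d) (bunit r r')) = \<psi> (bmult ns (bdiag (brows ns) d) (bunit r r'))" ..
  qed
  then show ?thesis using tot WK W'K WW' W'W unfolding \<psi>_def by blast
qed

section \<open>Matching copies\<close>

lemma extend_partial_injection:
  assumes "finite S" "finite Y" "card S \<le> card Y" "G \<subseteq> Y" "inj_on g G" "g ` G \<subseteq> S"
  shows "\<exists>h. inj_on h S \<and> h ` S \<subseteq> Y \<and> (\<forall>r\<in>G. h (g r) = r)"
proof -
  have G: "finite G" using assms finite_subset by blast
  have "card (S - g ` G) = card S - card G" "card (Y - G) = card Y - card G"
    using assms G by (simp_all add: card_Diff_subset card_image)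
  then have "card (S - g ` G) \<le> card (Y - G)" using assms(3) by simp
  then obtain k where k: "k ` (S - g ` G) \<subseteq> Y - G" "inj_on k (S - g ` G)"
    using card_le_inj[of "S - g ` G" "Y - G"] assms(1,2) by auto
  define h where "h x = (if x \<in> g ` G then inv_into G g x else k x)" for x
  have hg: "h (g r) = r" if "r \<in> G" for r using that assms(5) by (simp add: h_def)
  have h1: "h x \<in> G" if "x \<in> g ` G" for x using that hg by auto
  have h2: "h x \<in> Y - G" if "x \<in> S" "x \<notin> g ` G" for x using that k(1) by (auto simp: h_def)
  have "inj_on h S"
  proof (rule inj_onI)
    fix x y assume xy: "x \<in> S" "y \<in> S" "h x = h y"
    consider "x \<in> g ` G" "y \<in> g ` G" | "x \<notin> g ` G" "y \<notin> g ` G" | "x \<in> g ` G" "y \<notin> g ` G" | "x \<notin> g ` G" "y \<in> g ` G"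
      by blast
    then show "x = y"
    proof cases
      case 1
      then show ?thesis using xy(3) hg by auto
    next
      case 2
      then show ?thesis using xy k(2) by (auto simp: h_def inj_on_def)
    next
      case 3
      then show ?thesis using h1[of x] h2[of y] xy by auto
    next
      case 4
      then show ?thesis using h1[of y] h2[of x] xy by auto
    qed
  qed
  moreover have "h ` S \<subseteq> Y" using h1 h2 assms(4) by blast
  ultimately show ?thesis using hg by blast
qed

text \<open>
  \<open>L\<close> fills a block of the target with copies of the blocks of \<open>ns\<close>.  Prescribed numbers \<open>u j\<close> of
  copies of the blocks of \<open>bs\<close>, each of which contains copies of the blocks of \<open>ns\<close> by \<open>T\<close>, can be
  placed in it so that as many copies as possible of the blocks of \<open>ns\<close> coincide: match these
  copies first, and place the remaining rows arbitrarily.  A slot \<open>(b, r)\<close> is the row \<open>r\<close> in the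
  \<open>b\<close>-th copy of its block.
\<close>

lemma matching_in_block:
  fixes u :: "nat \<Rightarrow> nat"
  assumes L: "total_labelling cs ns L" and T: "labelling bs ns T"
    and ns: "sizes ns" and bs: "sizes bs" and l: "l < length cs"
    and u: "(\<Sum>j<length bs. u j * bs ! j) \<le> cs ! l"
  defines "S \<equiv> {(b, r). r \<in> brows bs \<and> b < u (fst r)}"
  shows "\<exists>h G g. inj_on h S \<and> h ` S \<subseteq> block cs l \<and> G \<subseteq> block cs l \<and>
    card (block cs l - G) \<le> (\<Sum>i<length ns. ns ! i * (copies cs L i l - (\<Sum>j<length bs. u j * copies bs T i j))) \<and>
    (\<forall>r\<in>G. g r \<in> S \<and> h (g r) = r \<and> fst T (snd (g r)) = fst L r \<and> snd T (snd (g r)) (snd (g r))) \<and>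
    (\<forall>r\<in>G. \<forall>s\<in>G. snd L r s \<longleftrightarrow> fst (g r) = fst (g s) \<and> snd T (snd (g r)) (snd (g s)))"
proof -
  have lab: "labelling cs ns L" and tot: "\<And>r. r \<in> brows cs \<Longrightarrow> snd L r r" 
    using L by (auto simp: total_labelling_def)
  \<comment> \<open>a copy of the block \<open>i\<close> is represented by its first row: \<open>K i\<close> lists the copies inside the
    prescribed ones, \<open>C i\<close> those of \<open>L\<close>\<close>
  define K where "K i = {(b, r) \<in> S. snd T r r \<and> fst T r = (i, 0)}" for i
  define C where "C i = {r \<in> block cs l. fst L r = (i, 0)}" for i
  have S_eq: "S = (\<Union>j<length bs. {..<u j} \<times> block bs j)"
    by (auto simp: S_def block_def brows_def)
  have card_S: "card S = (\<Sum>j<length bs. u j * bs ! j)"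
    unfolding S_eq by (subst card_UN_disjoint) (auto simp: block_def card_cartesian_product card_block[unfolded block_def])
  have finS: "finite S" unfolding S_eq by simp
  have "K i = (\<Union>j<length bs. {..<u j} \<times> {r \<in> block bs j. snd T r r \<and> fst T r = (i, 0)})" for i
    unfolding K_def S_eq by auto
  then have card_K: "card (K i) = (\<Sum>j<length bs. u j * copies bs T i j)" for i
    by (simp only:) (subst card_UN_disjoint, auto simp: block_def card_cartesian_product copies_def[unfolded block_def])
  have finK: "finite (K i)" for i by (rule finite_subset[OF _ finS]) (auto simp: K_def)
  have card_C: "card (C i) = copies cs L i l" for i
  proof -
    have "snd L r r" if "r \<in> block cs l" for r using tot[of r] that by (simp add: block_def)
    then have "C i = {r \<in> block cs l. snd L r r \<and> fst L r = (i, 0)}" unfolding C_def by blast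
    then show ?thesis by (simp add: copies_def)
  qed
  have finC: "finite (C i)" for i by (simp add: C_def)
  have "\<exists>C' m. C' \<subseteq> C i \<and> card (C i - C') = copies cs L i l - (\<Sum>j<length bs. u j * copies bs T i j) \<and>
      inj_on m C' \<and> m ` C' \<subseteq> K i" for i
  proof -
    obtain C' where C': "C' \<subseteq> C i" "card C' = min (card (C i)) (card (K i))"
      using obtain_subset_with_card_n[of "min (card (C i)) (card (K i))" "C i"] by auto
    have fC': "finite C'" by (rule finite_subset[OF C'(1) finC])
    obtain m where "m ` C' \<subseteq> K i" "inj_on m C'"
      using card_le_inj[of C' "K i"] C'(2) fC' finK[of i] by auto
    moreover have "card (C i - C') = card (C i) - card (K i)"
      using C' fC' by (simp add: card_Diff_subset)
    ultimately show ?thesis using C'(1) by (auto simp: card_C card_K)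
  qed
  then obtain C' m where C': "\<And>i. C' i \<subseteq> C i"
    and cC: "\<And>i. card (C i - C' i) = copies cs L i l - (\<Sum>j<length bs. u j * copies bs T i j)"
    and m: "\<And>i. inj_on (m i) (C' i)" "\<And>i. m i ` C' i \<subseteq> K i"
    by metis
  define tp where "tp r = fst (fst L r)" for r
  have tp: "tp r < length ns" "(tp r, 0) \<in> brows ns" if "r \<in> block cs l" for r
    using labellingD(5)[OF lab tot, of r] that ns by (auto simp: tp_def brows_def block_def sizes_def)
  have "\<exists>r0. snd L r r0 \<and> fst L r0 = (tp r, 0)" if "r \<in> block cs l" for r
    using labellingD(10)[OF lab tot, of r "(tp r, 0)"] tp[OF that] that by (auto simp: tp_def block_def)
  then obtain rep where rep: "\<And>r. r \<in> block cs l \<Longrightarrow> snd L r (rep r) \<and> fst L (rep r) = (tp r, 0)" by metis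
  have rep_C: "rep r \<in> C (tp r)" if "r \<in> block cs l" for r
    using rep[OF that] labellingD(2,3)[OF lab, of r "rep r"] that by (auto simp: C_def block_def)
  have rep_eq: "rep r = rep s \<longleftrightarrow> snd L r s" if "r \<in> block cs l" "s \<in> block cs l" for r s
  proof
    assume "rep r = rep s"
    then show "snd L r s" using rep[OF that(1)] rep[OF that(2)] labellingD(4)[OF lab, of s "rep s"]
        labellingD(8)[OF lab, of r "rep r" s] by simp
  next
    assume rs: "snd L r s"
    then have "tp r = tp s" using labellingD(7)[OF lab rs] by (simp add: tp_def)
    moreover have "snd L (rep r) (rep s)" 
      using rep[OF that(1)] rep[OF that(2)] rs labellingD(4)[OF lab, of r "rep r"]
        labellingD(8)[OF lab, of "rep r" r s] labellingD(8)[OF lab, of "rep r" s "rep s"] by simp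
    ultimately show "rep r = rep s"
      using labellingD(9)[OF lab, of "rep r" "rep s"] rep[OF that(1)] rep[OF that(2)] by simp
  qed
  \<comment> \<open>\<open>G\<close> is the union of the matched copies, and \<open>g\<close> sends a row to the corresponding row of the partner\<close>
  define G where "G = {r \<in> block cs l. rep r \<in> C' (tp r)}"
  define mm where "mm r = m (tp r) (rep r)" for r
  have mm: "mm r \<in> S \<and> snd T (snd (mm r)) (snd (mm r)) \<and> fst T (snd (mm r)) = (tp r, 0)" if "r \<in> G" for r
    using m(2)[of "tp r"] that by (force simp: G_def K_def mm_def)
  have "\<exists>r'. snd T (snd (mm r)) r' \<and> fst T r' = fst L r" if "r \<in> G" for r
    using labellingD(10)[OF T, of "snd (mm r)" "fst L r"] mm[OF that] that
      labellingD(5)[OF lab tot, of r] by (auto simp: G_def tp_def block_def)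
  then obtain r' where r': "\<And>r. r \<in> G \<Longrightarrow> snd T (snd (mm r)) (r' r) \<and> fst T (r' r) = fst L r" by metis
  define g where "g r = (fst (mm r), r' r)" for r
  have gS: "g r \<in> S" if "r \<in> G" for r
    using mm[OF that] r'[OF that] labellingD(2,3)[OF T, of "snd (mm r)" "r' r"]
    by (auto simp: g_def S_def split_def)
  have gT: "snd T (snd (g r)) (snd (g r))" "fst T (snd (g r)) = fst L r" if "r \<in> G" for r
    using r'[OF that] labellingD(12)[OF T, of "snd (mm r)" "r' r"] by (auto simp: g_def)
  have equiv: "snd L r s \<longleftrightarrow> fst (g r) = fst (g s) \<and> snd T (snd (g r)) (snd (g s))" if rs: "r \<in> G" "s \<in> G" for r s
  proof
    assume Lrs: "snd L r s"
    then have "tp r = tp s" using labellingD(7)[OF lab Lrs] by (simp add: tp_def)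
    moreover have "rep r = rep s" using rep_eq[of r s] Lrs rs by (simp add: G_def)
    ultimately have "mm r = mm s" by (simp add: mm_def)
    then show "fst (g r) = fst (g s) \<and> snd T (snd (g r)) (snd (g s))"
      using r'[OF rs(1)] r'[OF rs(2)] labellingD(4)[OF T, of "snd (mm r)" "r' r"]
        labellingD(8)[OF T, of "r' r" "snd (mm r)" "r' s"] by (simp add: g_def)
  next
    assume as: "fst (g r) = fst (g s) \<and> snd T (snd (g r)) (snd (g s))"
    then have "fst (mm r) = fst (mm s)" "snd T (r' r) (r' s)" by (auto simp: g_def)
    then have 1: "snd T (snd (mm r)) (snd (mm s))"
      using r'[OF rs(1)] r'[OF rs(2)] labellingD(4)[OF T, of "snd (mm s)" "r' s"]
        labellingD(8)[OF T, of "snd (mm r)" "r' r" "r' s"] labellingD(8)[OF T, of "snd (mm r)" "r' s" "snd (mm s)"] by simp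
    have ty: "tp r = tp s" using labellingD(7)[OF T 1] mm[OF rs(1)] mm[OF rs(2)] by simp
    then have "snd (mm r) = snd (mm s)"
      using labellingD(9)[OF T 1] mm[OF rs(1)] mm[OF rs(2)] by simp
    then have "mm r = mm s" using \<open>fst (mm r) = fst (mm s)\<close> by (simp add: prod_eq_iff)
    then have "rep r = rep s"
      using m(1)[of "tp r"] rs ty by (auto simp: mm_def G_def inj_on_def)
    then show "snd L r s" using rep_eq[of r s] rs by (simp add: G_def)
  qed
  have inj: "inj_on g G"
  proof (rule inj_onI)
    fix r s assume rs: "r \<in> G" "s \<in> G" "g r = g s"
    then have 1: "snd L r s" using equiv[OF rs(1,2)] gT(1)[OF rs(1)] by simp
    show "r = s" using labellingD(9)[OF lab 1] gT(2)[OF rs(1)] gT(2)[OF rs(2)] rs(3) by simp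
  qed
  have "card S \<le> card (block cs l)" using u l by (simp add: card_S card_block)
  moreover have "G \<subseteq> block cs l" by (auto simp: G_def)
  moreover have "g ` G \<subseteq> S" using gS by auto
  ultimately obtain h where h: "inj_on h S" "h ` S \<subseteq> block cs l" "\<forall>r\<in>G. h (g r) = r"
    using extend_partial_injection[OF finS finite_block _ _ inj] by blast
  have "card (block cs l - G) \<le> (\<Sum>i<length ns. ns ! i * (copies cs L i l - (\<Sum>j<length bs. u j * copies bs T i j)))"
  proof -
    have "block cs l - G \<subseteq> (\<Union>i<length ns. \<Union>r0\<in>C i - C' i. {r. snd L r0 r})"
    proof
      fix r assume r: "r \<in> block cs l - G"
      then have "rep r \<in> C (tp r) - C' (tp r)" "tp r < length ns"
        using rep_C[of r] tp[of r] by (auto simp: G_def)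
      moreover have "snd L (rep r) r" using rep[of r] r labellingD(4)[OF lab] by blast
      ultimately show "r \<in> (\<Union>i<length ns. \<Union>r0\<in>C i - C' i. {r. snd L r0 r})" by blast
    qed
    moreover have fin: "finite {r. snd L r0 r}" for r0
      by (rule finite_subset[OF _ finite_brows[of cs]]) (use labellingD(2)[OF lab] in blast)
    ultimately have "card (block cs l - G) \<le> card (\<Union>i<length ns. \<Union>r0\<in>C i - C' i. {r. snd L r0 r})"
      using finC by (intro card_mono) auto
    also have "\<dots> \<le> (\<Sum>i<length ns. card (\<Union>r0\<in>C i - C' i. {r. snd L r0 r}))"
      by (rule card_UN_le) simp
    also have "\<dots> \<le> (\<Sum>i<length ns. \<Sum>r0\<in>C i - C' i. card {r. snd L r0 r})"
      using finC by (intro sum_mono card_UN_le) simp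
    also have "\<dots> = (\<Sum>i<length ns. \<Sum>r0\<in>C i - C' i. ns ! i)"
    proof (intro sum.cong refl)
      fix i r0 assume i: "i \<in> {..<length ns}" and r0: "r0 \<in> C i - C' i"
      then have "snd L r0 r0" using tot by (auto simp: C_def block_def)
      from bij_betw_same_card[OF labelling_bij_copy[OF lab this]]
      show "card {r. snd L r0 r} = ns ! i" using i r0 by (simp add: C_def card_block)
    qed
    also have "\<dots> = (\<Sum>i<length ns. ns ! i * (copies cs L i l - (\<Sum>j<length bs. u j * copies bs T i j)))"
      by (simp add: cC mult.commute)
    finally show ?thesis .
  qed
  then show ?thesis
    using h gS gT equiv \<open>G \<subseteq> block cs l\<close> by (intro exI[of _ h] exI[of _ G] exI[of _ g]) blast
qed

text \<open>
  The blocks of the target are treated one at a time.  The exceptional set \<open>Z\<close> consists of the copies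
  under \<open>L\<close> of a block of \<open>ns\<close> for which no partner is left; the truncated difference counts them, and
  each contributes as many rows as the block has.
\<close>

theorem matching:
  fixes u :: "nat \<Rightarrow> nat \<Rightarrow> nat"
  assumes L: "total_labelling cs ns L" and T: "labelling bs ns T"
    and ns: "sizes ns" and bs: "sizes bs"
    and u: "\<And>l. l < length cs \<Longrightarrow> (\<Sum>j<length bs. u j l * bs ! j) \<le> cs ! l"
  shows "\<exists>\<chi> Z. labelling cs bs \<chi> \<and> (\<forall>j<length bs. \<forall>l<length cs. copies cs \<chi> j l = u j l) \<and>
    Z \<subseteq> brows cs \<and> agree_off cs (lcomp T \<chi>) L Z \<and>
    (\<forall>l<length cs. card (Z \<inter> block cs l) \<le>
       (\<Sum>i<length ns. ns ! i * (copies cs L i l - (\<Sum>j<length bs. u j l * copies bs T i j))))"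
proof -
  define S where "S l = {(b, r). r \<in> brows bs \<and> b < u (fst r) l}" for l
  define Q where "Q l h G g \<longleftrightarrow> inj_on h (S l) \<and> h ` S l \<subseteq> block cs l \<and> G \<subseteq> block cs l \<and>
    card (block cs l - G) \<le> (\<Sum>i<length ns. ns ! i * (copies cs L i l - (\<Sum>j<length bs. u j l * copies bs T i j))) \<and>
    (\<forall>r\<in>G. g r \<in> S l \<and> h (g r) = r \<and> fst T (snd (g r)) = fst L r \<and> snd T (snd (g r)) (snd (g r))) \<and>
    (\<forall>r\<in>G. \<forall>s\<in>G. snd L r s \<longleftrightarrow> fst (g r) = fst (g s) \<and> snd T (snd (g r)) (snd (g s)))" for l h G g
  have "\<exists>h G g. l < length cs \<longrightarrow> Q l h G g" for l
  proof (cases "l < length cs")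
    case True
    show ?thesis
      using matching_in_block[OF L T ns bs True u[OF True]] unfolding Q_def S_def by blast
  qed auto
  then obtain h G g where Q: "\<And>l. l < length cs \<Longrightarrow> Q l (h l) (G l) (g l)" by metis
  have Q1: "inj_on (h l) (S l)" and Q2: "h l ` S l \<subseteq> block cs l" and Q3: "G l \<subseteq> block cs l"
    and Q4: "card (block cs l - G l) \<le> (\<Sum>i<length ns. ns ! i * (copies cs L i l - (\<Sum>j<length bs. u j l * copies bs T i j)))"
    and Q5: "\<And>r. r \<in> G l \<Longrightarrow> g l r \<in> S l \<and> h l (g l r) = r \<and> fst T (snd (g l r)) = fst L r \<and> snd T (snd (g l r)) (snd (g l r))"
    and Q6: "\<And>r s. r \<in> G l \<Longrightarrow> s \<in> G l \<Longrightarrow> snd L r s \<longleftrightarrow> fst (g l r) = fst (g l s) \<and> snd T (snd (g l r)) (snd (g l s))"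
    if "l < length cs" for l
    using Q[OF that] unfolding Q_def by blast+
  define sl where "sl r = inv_into (S (fst r)) (h (fst r)) r" for r
  define D where "D = {r \<in> brows cs. r \<in> h (fst r) ` S (fst r)}"
  have len: "fst r < length cs" if "r \<in> brows cs" for r using that by (auto simp: brows_def)
  have slh: "h l x \<in> D" "sl (h l x) = x" "fst (h l x) = l" if "l < length cs" "x \<in> S l" for l x
  proof -
    have "h l x \<in> block cs l" using Q2[OF that(1)] that(2) by blast
    then show f: "fst (h l x) = l" and "h l x \<in> D" using that by (auto simp: D_def block_def)
    show "sl (h l x) = x" unfolding sl_def f using Q1[OF that(1)] that(2) by simp
  qed
  have hsl: "sl r \<in> S (fst r)" "h (fst r) (sl r) = r" if "r \<in> D" for r
    using that by (auto simp: D_def sl_def inv_into_into f_inv_into_f)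
  have Sb: "snd x \<in> brows bs" "fst x < u (fst (snd x)) l" if "x \<in> S l" for x l
    using that by (auto simp: S_def)
  define E where "E r s \<longleftrightarrow> r \<in> D \<and> s \<in> D \<and> fst r = fst s \<and> fst (sl r) = fst (sl s) \<and>
      fst (snd (sl r)) = fst (snd (sl s))" for r s
  define \<chi> where "\<chi> = (\<lambda>r. snd (sl r), E)"
  have lab: "labelling cs bs \<chi>"
    unfolding \<chi>_def
  proof (rule labellingI, goal_cases)
    case (1 r s)
    then show ?case using hsl[of r] Sb[of "sl r" "fst r"] by (auto simp: E_def D_def)
  next
    case (2 r s t)
    then show ?case by (auto simp: E_def)
  next
    case (3 r s)
    then have f: "fst (sl r) = fst (sl s)" "snd (sl r) = snd (sl s)" "r \<in> D" "s \<in> D" "fst r = fst s"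
      unfolding E_def by blast+
    have "sl r = sl s" by (rule prod_eqI) (rule f)+
    then have "h (fst r) (sl r) = h (fst s) (sl s)" by (simp only: f(5))
    then show ?case by (simp only: hsl(2)[OF f(3)] hsl(2)[OF f(4)])
  next
    case (4 r \<rho>)
    then have r: "r \<in> D" by (simp add: E_def)
    then have l: "fst r < length cs" using len by (simp add: D_def)
    have x: "(fst (sl r), \<rho>) \<in> S (fst r)" using hsl(1)[OF r] 4 by (auto simp: S_def)
    have "E r (h (fst r) (fst (sl r), \<rho>)) \<and> snd (sl (h (fst r) (fst (sl r), \<rho>))) = \<rho>"
      using r slh[OF l x] 4 by (simp add: E_def)
    then show ?case by blast
  qed
  have cop: "copies cs \<chi> j l = u j l" if j: "j < length bs" and l: "l < length cs" for j l
  proof -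
    have "{r \<in> block cs l. snd \<chi> r r \<and> fst \<chi> r = (j, 0)} = (\<lambda>b. h l (b, (j, 0))) ` {..<u j l}"
    proof (intro equalityI subsetI)
      fix r assume "r \<in> {r \<in> block cs l. snd \<chi> r r \<and> fst \<chi> r = (j, 0)}"
      then have r: "r \<in> D" "fst r = l" "snd (sl r) = (j, 0)" by (auto simp: \<chi>_def E_def block_def)
      then have "fst (sl r) < u j l" using hsl(1)[OF r(1)] Sb(2)[of "sl r" l] by simp
      moreover have "r = h l (fst (sl r), (j, 0))" using hsl(2)[OF r(1)] r by (metis prod.collapse)
      ultimately show "r \<in> (\<lambda>b. h l (b, (j, 0))) ` {..<u j l}" by blast
    next
      fix r assume "r \<in> (\<lambda>b. h l (b, (j, 0))) ` {..<u j l}"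
      then obtain b where b: "b < u j l" "r = h l (b, (j, 0))" by blast
      have x: "(b, (j, 0)) \<in> S l" using b j bs by (auto simp: S_def brows_def sizes_def)
      show "r \<in> {r \<in> block cs l. snd \<chi> r r \<and> fst \<chi> r = (j, 0)}"
        using slh[OF l x] b by (auto simp: \<chi>_def E_def block_def D_def)
    qed
    moreover have "inj_on (\<lambda>b. h l (b, (j, 0))) {..<u j l}"
    proof (rule inj_onI)
      fix b b' assume b: "b \<in> {..<u j l}" "b' \<in> {..<u j l}" "h l (b, (j, 0)) = h l (b', (j, 0))"
      have "(b, (j, 0)) \<in> S l" "(b', (j, 0)) \<in> S l" using b j bs by (auto simp: S_def brows_def sizes_def)
      then show "b = b'" using Q1[OF l] b(3) by (auto simp: inj_on_def)
    qed
    ultimately show ?thesis by (simp add: copies_def card_image)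
  qed
  define Z where "Z = {r \<in> brows cs. r \<notin> G (fst r)}"
  have slg: "sl r = g (fst r) r" "r \<in> D" if "r \<in> brows cs - Z" for r
  proof -
    have r: "r \<in> G (fst r)" "fst r < length cs" using that len by (auto simp: Z_def)
    from Q5[OF r(2,1)] slh[OF r(2), of "g (fst r) r"]
    show "sl r = g (fst r) r" "r \<in> D" by auto
  qed
  have "agree_off cs (lcomp T \<chi>) L Z"
    unfolding agree_off_def
  proof (intro ballI impI)
    fix r s assume rs: "r \<in> brows cs - Z" "s \<in> brows cs - Z" "fst r = fst s"
    have l: "fst r < length cs" and G: "r \<in> G (fst r)" "s \<in> G (fst r)" using rs len by (auto simp: Z_def)
    note A = slg[OF rs(1)] slg[OF rs(2)]
    have "snd (lcomp T \<chi>) r s \<longleftrightarrow> E r s \<and> snd T (snd (sl r)) (snd (sl s))" by (simp add: lcomp_def \<chi>_def)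
    also have "\<dots> \<longleftrightarrow> fst (sl r) = fst (sl s) \<and> snd T (snd (sl r)) (snd (sl s))"
      using A rs(3) labellingD(3)[OF T, of "snd (sl r)" "snd (sl s)"] by (auto simp: E_def)
    also have "\<dots> \<longleftrightarrow> snd L r s" using Q6[OF l G] A rs(3) by simp
    finally have 1: "snd (lcomp T \<chi>) r s \<longleftrightarrow> snd L r s" .
    have "fst (lcomp T \<chi>) r = fst L r" using Q5[OF l G(1)] A(1) by (simp add: lcomp_def \<chi>_def)
    with 1 show "(snd (lcomp T \<chi>) r s \<longleftrightarrow> snd L r s) \<and> (snd (lcomp T \<chi>) r s \<longrightarrow> fst (lcomp T \<chi>) r = fst L r)"
      by simp
  qed
  moreover have "Z \<inter> block cs l = block cs l - G l" for l by (auto simp: Z_def block_def)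
  then have "card (Z \<inter> block cs l) \<le>
       (\<Sum>i<length ns. ns ! i * (copies cs L i l - (\<Sum>j<length bs. u j l * copies bs T i j)))" if "l < length cs" for l
    using Q4[OF that] by simp
  moreover have "Z \<subseteq> brows cs" by (auto simp: Z_def)
  ultimately show ?thesis using lab cop by blast
qed

section \<open>Completions in pseudo-rank metrics\<close>

lemma inverse_Suc_less:
  assumes "(0::real) < \<epsilon>"
  shows "\<exists>L. \<forall>l\<ge>L. 1 / real (Suc l) < \<epsilon>"
proof -
  obtain L where L: "1 / real (Suc L) < \<epsilon>" using nat_approx_posE[OF assms] by blast
  have "1 / real (Suc l) \<le> 1 / real (Suc L)" if "l \<ge> L" for l using that by (simp add: frac_le)
  with L show ?thesis by (meson le_less_trans)
qed

locale pseudo_rank_ring = ring R for R (structure) +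
  fixes N :: "'a \<Rightarrow> real"
  assumes N: "N \<in> pseudo_rank_functions R"
begin

lemma N_range: "a \<in> carrier R \<Longrightarrow> 0 \<le> N a" "a \<in> carrier R \<Longrightarrow> N a \<le> 1"
  using N by (auto simp: pseudo_rank_functions_def PiE_def Pi_def)

lemma N_one: "N \<one> = 1"
  using N by (simp add: pseudo_rank_functions_def)

lemma N_add: "a \<in> carrier R \<Longrightarrow> b \<in> carrier R \<Longrightarrow> N (a \<oplus> b) \<le> N a + N b"
  using N by (simp add: pseudo_rank_functions_def)

lemma N_mult: "a \<in> carrier R \<Longrightarrow> b \<in> carrier R \<Longrightarrow> N (a \<otimes> b) \<le> N a" 
  "a \<in> carrier R \<Longrightarrow> b \<in> carrier R \<Longrightarrow> N (a \<otimes> b) \<le> N b" 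
  using N by (simp_all add: pseudo_rank_functions_def)

lemma N_orthogonal: "e \<in> idempotents R \<Longrightarrow> f \<in> idempotents R \<Longrightarrow> e \<otimes> f = \<zero> \<Longrightarrow> f \<otimes> e = \<zero> \<Longrightarrow>
    N (e \<oplus> f) = N e + N f"
  using N by (simp add: pseudo_rank_functions_def)

lemma N_zero: "N \<zero> = 0"
  using N_orthogonal[of \<zero> \<zero>] by (simp add: idempotents_def)

lemma N_minus: "a \<in> carrier R \<Longrightarrow> N (\<ominus> a) = N a"
  using N_mult(2)[of "\<ominus> \<one>" a] N_mult(2)[of "\<ominus> \<one>" "\<ominus> a"] by (simp add: l_minus)

lemma N_diff_commute: "a \<in> carrier R \<Longrightarrow> b \<in> carrier R \<Longrightarrow> N (a \<ominus> b) = N (b \<ominus> a)"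
  using N_minus[of "a \<ominus> b"] by (simp add: minus_eq minus_add a_comm)

lemma N_diff_le: "a \<in> carrier R \<Longrightarrow> b \<in> carrier R \<Longrightarrow> N (a \<ominus> b) \<le> N a + N b"
  using N_add[of a "\<ominus> b"] by (simp add: minus_eq N_minus)

lemma diff_add_diff: "a \<in> carrier R \<Longrightarrow> b \<in> carrier R \<Longrightarrow> c \<in> carrier R \<Longrightarrow> (a \<ominus> b) \<oplus> (b \<ominus> c) = a \<ominus> c"
  by (simp add: minus_eq a_assoc r_neg1)

lemma N_triangle:
  assumes "a \<in> carrier R" "b \<in> carrier R" "c \<in> carrier R"
  shows "N (a \<ominus> c) \<le> N (a \<ominus> b) + N (b \<ominus> c)"
  using N_add[of "a \<ominus> b" "b \<ominus> c"] assms by (simp add: diff_add_diff)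

lemma N_diff_ge:
  assumes "a \<in> carrier R" "b \<in> carrier R"
  shows "\<bar>N a - N b\<bar> \<le> N (a \<ominus> b)"
proof -
  have "N a \<le> N (a \<ominus> b) + N b" if "a \<in> carrier R" "b \<in> carrier R" for a b
    using N_add[of "a \<ominus> b" b] that by (simp add: minus_eq a_assoc l_neg)
  from this[of a b] this[of b a] show ?thesis using assms N_diff_commute[of a b] by auto
qed

lemma N_add_diff:
  assumes "a \<in> carrier R" "b \<in> carrier R" "a' \<in> carrier R" "b' \<in> carrier R"
  shows "N ((a \<oplus> b) \<ominus> (a' \<oplus> b')) \<le> N (a \<ominus> a') + N (b \<ominus> b')"
proof -
  have "(a \<oplus> b) \<ominus> (a' \<oplus> b') = (a \<ominus> a') \<oplus> (b \<ominus> b')"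
    using assms by (simp add: minus_eq minus_add a_ac)
  then show ?thesis using N_add[of "a \<ominus> a'" "b \<ominus> b'"] assms by simp
qed

lemma N_diff_diff:
  assumes "a \<in> carrier R" "b \<in> carrier R" "a' \<in> carrier R" "b' \<in> carrier R"
  shows "N ((a \<ominus> b) \<ominus> (a' \<ominus> b')) \<le> N (a \<ominus> a') + N (b \<ominus> b')"
proof -
  have "(a \<ominus> b) \<ominus> (a' \<ominus> b') = (a \<ominus> a') \<ominus> (b \<ominus> b')"
    using assms by (simp add: minus_eq minus_add a_ac)
  then show ?thesis using N_diff_le[of "a \<ominus> a'" "b \<ominus> b'"] assms by simp
qed

lemma N_mult_diff:
  assumes "a \<in> carrier R" "b \<in> carrier R" "a' \<in> carrier R" "b' \<in> carrier R"
  shows "N ((a \<otimes> b) \<ominus> (a' \<otimes> b')) \<le> N (a \<ominus> a') + N (b \<ominus> b')"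
proof -
  have eq: "(a \<otimes> b) \<ominus> (a' \<otimes> b') = (a \<ominus> a') \<otimes> b \<oplus> a' \<otimes> (b \<ominus> b')"
    using assms by (simp add: minus_eq l_distr r_distr l_minus r_minus a_assoc r_neg1)
  have "N ((a \<ominus> a') \<otimes> b \<oplus> a' \<otimes> (b \<ominus> b')) \<le> N ((a \<ominus> a') \<otimes> b) + N (a' \<otimes> (b \<ominus> b'))"
    using assms by (intro N_add) simp_all
  moreover have "N ((a \<ominus> a') \<otimes> b) \<le> N (a \<ominus> a')" "N (a' \<otimes> (b \<ominus> b')) \<le> N (b \<ominus> b')"
    using assms by (auto intro: N_mult)
  ultimately show ?thesis unfolding eq by linarith
qed

lemma cauchy_sequencesI:
  assumes "\<And>n. s n \<in> carrier R" "\<And>\<epsilon>. \<epsilon> > 0 \<Longrightarrow> \<exists>K. \<forall>m\<ge>K. \<forall>n\<ge>K. N (s m \<ominus> s n) < \<epsilon>"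
  shows "s \<in> cauchy_sequences R N"
  using assms by (auto simp: cauchy_sequences_def)

lemma cauchy_sequencesD:
  assumes "s \<in> cauchy_sequences R N"
  shows "s n \<in> carrier R" "\<epsilon> > 0 \<Longrightarrow> \<exists>K. \<forall>m\<ge>K. \<forall>n\<ge>K. N (s m \<ominus> s n) < \<epsilon>"
  using assms by (auto simp: cauchy_sequences_def)

lemma cauchy_const: "a \<in> carrier R \<Longrightarrow> (\<lambda>n. a) \<in> cauchy_sequences R N"
  by (rule cauchy_sequencesI) (auto simp: minus_eq r_neg N_zero)

lemma cauchy_op:
  assumes s: "s \<in> cauchy_sequences R N" and t: "t \<in> cauchy_sequences R N"
    and cl: "\<And>a b. a \<in> carrier R \<Longrightarrow> b \<in> carrier R \<Longrightarrow> f a b \<in> carrier R"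
    and f: "\<And>a b a' b'. a \<in> carrier R \<Longrightarrow> b \<in> carrier R \<Longrightarrow> a' \<in> carrier R \<Longrightarrow> b' \<in> carrier R \<Longrightarrow>
       N (f a b \<ominus> f a' b') \<le> N (a \<ominus> a') + N (b \<ominus> b')"
  shows "(\<lambda>n. f (s n) (t n)) \<in> cauchy_sequences R N"
proof (rule cauchy_sequencesI)
  fix \<epsilon> :: real assume \<epsilon>: "\<epsilon> > 0"
  obtain K where K: "\<forall>m\<ge>K. \<forall>n\<ge>K. N (s m \<ominus> s n) < \<epsilon>/2" using cauchy_sequencesD(2)[OF s, of "\<epsilon>/2"] \<epsilon> by auto
  obtain K' where K': "\<forall>m\<ge>K'. \<forall>n\<ge>K'. N (t m \<ominus> t n) < \<epsilon>/2" using cauchy_sequencesD(2)[OF t, of "\<epsilon>/2"] \<epsilon> by auto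
  have "N (f (s m) (t m) \<ominus> f (s n) (t n)) < \<epsilon>" if "m \<ge> max K K'" "n \<ge> max K K'" for m n
  proof -
    have "N (f (s m) (t m) \<ominus> f (s n) (t n)) \<le> N (s m \<ominus> s n) + N (t m \<ominus> t n)"
      by (intro f cauchy_sequencesD(1)[OF s] cauchy_sequencesD(1)[OF t])
    moreover have "N (s m \<ominus> s n) < \<epsilon>/2" "N (t m \<ominus> t n) < \<epsilon>/2" using K K' that by auto
    ultimately show ?thesis by linarith
  qed
  then show "\<exists>K. \<forall>m\<ge>K. \<forall>n\<ge>K. N (f (s m) (t m) \<ominus> f (s n) (t n)) < \<epsilon>" by blast
qed (intro cl cauchy_sequencesD(1)[OF s] cauchy_sequencesD(1)[OF t])

lemma cauchy_ring_simps [simp]: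
  "carrier (cauchy_ring R N) = cauchy_sequences R N"
  "monoid.mult (cauchy_ring R N) = (\<lambda>s t n. s n \<otimes> t n)" "one (cauchy_ring R N) = (\<lambda>n. \<one>)"
  "zero (cauchy_ring R N) = (\<lambda>n. \<zero>)" "add (cauchy_ring R N) = (\<lambda>s t n. s n \<oplus> t n)"
  by (simp_all add: cauchy_ring_def)

lemma ring_cauchy_ring: "ring (cauchy_ring R N)"
proof (rule ringI)
  note D = cauchy_sequencesD(1)
  show "abelian_group (cauchy_ring R N)"
  proof (rule abelian_groupI)
    fix s assume s: "s \<in> carrier (cauchy_ring R N)"
    have "(\<lambda>n. \<zero> \<ominus> s n) \<in> cauchy_sequences R N"
      by (rule cauchy_op[of "\<lambda>n. \<zero>" s "\<lambda>a b. a \<ominus> b"]) (use s cauchy_const N_diff_diff in auto)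
    moreover have "(\<lambda>n. (\<zero> \<ominus> s n) \<oplus> s n) = (\<lambda>n. \<zero>)"
      using D[of s] s by (auto simp: minus_eq l_neg)
    ultimately show "\<exists>t\<in>carrier (cauchy_ring R N). t \<oplus>\<^bsub>cauchy_ring R N\<^esub> s = \<zero>\<^bsub>cauchy_ring R N\<^esub>"
      by auto
  qed (auto simp: cauchy_const D a_ac intro!: cauchy_op[where f = "\<lambda>a b. a \<oplus> b"] N_add_diff)
  show "monoid (cauchy_ring R N)"
    by (rule monoidI) (auto simp: cauchy_const D m_assoc intro!: cauchy_op[where f = "\<lambda>a b. a \<otimes> b"] N_mult_diff)
qed (auto simp: cauchy_sequencesD(1) l_distr r_distr)

lemma a_inv_cauchy_ring:
  assumes "t \<in> cauchy_sequences R N"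
  shows "\<ominus>\<^bsub>cauchy_ring R N\<^esub> t = (\<lambda>n. \<ominus> t n)"
proof -
  interpret C: ring "cauchy_ring R N" by (rule ring_cauchy_ring)
  have "(\<lambda>n. \<zero> \<ominus> t n) \<in> cauchy_sequences R N"
    by (rule cauchy_op[of "\<lambda>n. \<zero>" t "\<lambda>a b. a \<ominus> b"]) (use assms cauchy_const N_diff_diff in auto)
  then have n: "(\<lambda>n. \<ominus> t n) \<in> cauchy_sequences R N"
    using cauchy_sequencesD(1)[OF assms] by (simp add: minus_eq)
  have "(\<lambda>n. \<ominus> t n \<oplus> t n) = (\<lambda>n. \<zero>)" using cauchy_sequencesD(1)[OF assms] by (simp add: l_neg)
  then show ?thesis using assms n by (intro C.minus_equality) simp_all
qed

lemma a_minus_cauchy_ring: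
  assumes "s \<in> cauchy_sequences R N" "t \<in> cauchy_sequences R N"
  shows "s \<ominus>\<^bsub>cauchy_ring R N\<^esub> t = (\<lambda>n. s n \<ominus> t n)"
  unfolding a_minus_def[of "cauchy_ring R N"] a_inv_cauchy_ring[OF assms(2)] by (simp add: minus_eq)

lemma null_subset: "null_sequences R N \<subseteq> cauchy_sequences R N"
proof
  fix s assume "s \<in> null_sequences R N"
  then have s: "\<And>n. s n \<in> carrier R" and l: "(\<lambda>n. N (s n)) \<longlonglongrightarrow> 0" by (auto simp: null_sequences_def)
  show "s \<in> cauchy_sequences R N"
  proof (rule cauchy_sequencesI)
    fix \<epsilon> :: real assume "\<epsilon> > 0"
    then obtain K where K: "\<And>n. n \<ge> K \<Longrightarrow> N (s n) < \<epsilon>/2"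
      using order_tendstoD(2)[OF l, of "\<epsilon>/2"] by (auto simp: eventually_sequentially)
    have "N (s m \<ominus> s n) < \<epsilon>" if "m \<ge> K" "n \<ge> K" for m n
      using N_diff_le[OF s[of m] s[of n]] K[OF that(1)] K[OF that(2)] by simp
    then show "\<exists>K. \<forall>m\<ge>K. \<forall>n\<ge>K. N (s m \<ominus> s n) < \<epsilon>" by blast
  qed (rule s)
qed

lemma null_le:
  assumes "s \<in> null_sequences R N" "\<And>n. t n \<in> carrier R" "\<And>n. N (t n) \<le> N (s n)"
  shows "t \<in> null_sequences R N"
proof -
  have "(\<lambda>n. N (t n)) \<longlonglongrightarrow> 0"
    by (rule tendsto_sandwich[of "\<lambda>n. 0" _ _ "\<lambda>n. N (s n)"])
      (use assms N_range in \<open>auto simp: null_sequences_def\<close>)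
  then show ?thesis using assms(2) by (auto simp: null_sequences_def)
qed

lemma null_diff:
  assumes "s \<in> null_sequences R N" "t \<in> null_sequences R N"
  shows "(\<lambda>n. s n \<ominus> t n) \<in> null_sequences R N"
proof -
  have c: "\<And>n. s n \<in> carrier R" "\<And>n. t n \<in> carrier R" using assms by (auto simp: null_sequences_def)
  have l: "(\<lambda>n. N (s n)) \<longlonglongrightarrow> 0" "(\<lambda>n. N (t n)) \<longlonglongrightarrow> 0"
    using assms unfolding null_sequences_def by blast+
  have l': "(\<lambda>n. N (s n) + N (t n)) \<longlonglongrightarrow> 0"
    using tendsto_add[OF l] by simp
  have bnd: "0 \<le> N (s n \<ominus> t n)" "N (s n \<ominus> t n) \<le> N (s n) + N (t n)" for n
    by (rule N_range minus_closed c N_diff_le)+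
  have "(\<lambda>n. N (s n \<ominus> t n)) \<longlonglongrightarrow> 0"
    by (rule tendsto_sandwich[of "\<lambda>n. 0" "\<lambda>n. N (s n \<ominus> t n)" _ "\<lambda>n. N (s n) + N (t n)", OF _ _ tendsto_const l']) (simp_all add: bnd)
  moreover have "range (\<lambda>n. s n \<ominus> t n) \<subseteq> carrier R" using c by blast
  ultimately show ?thesis by (simp add: null_sequences_def)
qed

lemma null_zero: "(\<lambda>n. \<zero>) \<in> null_sequences R N"
  by (auto simp: null_sequences_def N_zero)

lemma ideal_null: "ideal (null_sequences R N) (cauchy_ring R N)"
proof (rule idealI)
  interpret C: ring "cauchy_ring R N" by (rule ring_cauchy_ring)
  note D = cauchy_sequencesD(1)
  show "ring (cauchy_ring R N)" by (rule ring_cauchy_ring)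
  show "subgroup (null_sequences R N) (add_monoid (cauchy_ring R N))"
  proof (rule C.add.subgroupI)
    show "null_sequences R N \<subseteq> carrier (cauchy_ring R N)" using null_subset by simp
    show "null_sequences R N \<noteq> {}" using null_zero by auto
  next
    fix s assume s: "s \<in> null_sequences R N"
    have "\<ominus>\<^bsub>cauchy_ring R N\<^esub> s = (\<lambda>n. \<zero> \<ominus> s n)"
      using s null_subset cauchy_sequencesD(1)[of s] by (subst a_inv_cauchy_ring) (auto simp: minus_eq)
    also have "\<dots> \<in> null_sequences R N" by (rule null_diff[OF null_zero s])
    finally show "\<ominus>\<^bsub>cauchy_ring R N\<^esub> s \<in> null_sequences R N" .
  next
    fix s t assume s: "s \<in> null_sequences R N" and t: "t \<in> null_sequences R N"
    have c: "\<And>n. s n \<in> carrier R" "\<And>n. t n \<in> carrier R" using s t by (auto simp: null_sequences_def)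
    have "(\<lambda>n. s n \<oplus> t n) = (\<lambda>n. s n \<ominus> (\<zero> \<ominus> t n))" using c by (simp add: minus_eq)
    also have "\<dots> \<in> null_sequences R N" by (rule null_diff[OF s null_diff[OF null_zero t]])
    finally show "s \<oplus>\<^bsub>cauchy_ring R N\<^esub> t \<in> null_sequences R N" by simp
  qed
next
  note D = cauchy_sequencesD(1)
  fix s t assume s: "s \<in> null_sequences R N" and t: "t \<in> carrier (cauchy_ring R N)"
  have c: "\<And>n. s n \<in> carrier R" "\<And>n. t n \<in> carrier R" using s t D by (auto simp: null_sequences_def)
  show "t \<otimes>\<^bsub>cauchy_ring R N\<^esub> s \<in> null_sequences R N" "s \<otimes>\<^bsub>cauchy_ring R N\<^esub> t \<in> null_sequences R N"
    by (auto intro!: null_le[OF s] N_mult c)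
qed

lemma ring_completion: "ring (completion R N)"
  unfolding completion_def by (rule ideal.quotient_is_ring[OF ideal_null])

lemma zero_completion: "\<zero>\<^bsub>completion R N\<^esub> = null_sequences R N"
  unfolding completion_def FactRing_def by simp

lemma carrier_completion:
  "carrier (completion R N) = (\<lambda>s. null_sequences R N +>\<^bsub>cauchy_ring R N\<^esub> s) ` cauchy_sequences R N"
  unfolding completion_def FactRing_def A_RCOSETS_def' by auto

lemma coset_hom: "(+>\<^bsub>cauchy_ring R N\<^esub>) (null_sequences R N) \<in> Ring.ring_hom (cauchy_ring R N) (completion R N)"
  unfolding completion_def by (rule ideal.rcos_ring_hom[OF ideal_null])

lemma coset_null_iff:
  assumes "s \<in> cauchy_sequences R N"
  shows "null_sequences R N +>\<^bsub>cauchy_ring R N\<^esub> s = null_sequences R N \<longleftrightarrow> s \<in> null_sequences R N"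
proof -
  interpret C: ring "cauchy_ring R N" by (rule ring_cauchy_ring)
  interpret I: ideal "null_sequences R N" "cauchy_ring R N" by (rule ideal_null)
  show ?thesis
    using I.rcos_const_imp_mem[of s] I.a_rcos_const[of s] assms by auto
qed

lemma completion_map_hom: "completion_map R N \<in> Ring.ring_hom R (completion R N)"
proof -
  have 2: "(\<lambda>a n. a) \<in> Ring.ring_hom R (cauchy_ring R N)"
    by (rule ring_hom_memI) (auto simp: cauchy_const)
  have "completion_map R N = (+>\<^bsub>cauchy_ring R N\<^esub>) (null_sequences R N) \<circ> (\<lambda>a n. a)"
    by (auto simp: completion_map_def)
  then show ?thesis using ring_hom_trans[OF 2 coset_hom] by simp
qed

lemma coset_eq_iff:
  assumes "s \<in> cauchy_sequences R N" "t \<in> cauchy_sequences R N"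
  shows "null_sequences R N +>\<^bsub>cauchy_ring R N\<^esub> s = null_sequences R N +>\<^bsub>cauchy_ring R N\<^esub> t \<longleftrightarrow>
     (\<lambda>n. s n \<ominus> t n) \<in> null_sequences R N"
  using ring.quotient_eq_iff_same_a_r_cos[OF ring_cauchy_ring ideal_null, of s t] assms
  by (simp add: a_minus_cauchy_ring)

end

text \<open>
  The maps \<open>\<psi> k\<close> need not be homomorphisms, nor compatible with each other: it suffices that they
  become so in the limit.  A Cauchy sequence \<open>x\<close> in \<open>A\<close> and a Cauchy sequence \<open>t\<close> in \<open>T\<close> correspond
  to each other if \<open>\<psi> k (x l)\<close> is close to \<open>t l\<close> for large \<open>l\<close> and then large \<open>k\<close>.
\<close>

locale asymptotic_isomorphism = A: pseudo_rank_ring A N + T: pseudo_rank_ring T M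
  for A (structure) and N and T (structure) and M +
  fixes \<psi> :: "nat \<Rightarrow> 'a \<Rightarrow> 'c"
  assumes closed: "x \<in> carrier A \<Longrightarrow> \<psi> k x \<in> carrier T"
    and add: "x \<in> carrier A \<Longrightarrow> y \<in> carrier A \<Longrightarrow> \<forall>\<^sub>F k in sequentially. \<psi> k (x \<oplus>\<^bsub>A\<^esub> y) = \<psi> k x \<oplus>\<^bsub>T\<^esub> \<psi> k y"
    and mult: "x \<in> carrier A \<Longrightarrow> y \<in> carrier A \<Longrightarrow> \<forall>\<^sub>F k in sequentially. \<psi> k (x \<otimes>\<^bsub>A\<^esub> y) = \<psi> k x \<otimes>\<^bsub>T\<^esub> \<psi> k y"
    and one: "(\<lambda>k. M (\<psi> k \<one>\<^bsub>A\<^esub> \<ominus>\<^bsub>T\<^esub> \<one>\<^bsub>T\<^esub>)) \<longlonglongrightarrow> 0"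
    and rank: "x \<in> carrier A \<Longrightarrow> (\<lambda>k. M (\<psi> k x)) \<longlonglongrightarrow> N x"
    and cauchy: "x \<in> carrier A \<Longrightarrow> \<epsilon> > 0 \<Longrightarrow> \<exists>K. \<forall>k\<ge>K. \<forall>l\<ge>K. M (\<psi> k x \<ominus>\<^bsub>T\<^esub> \<psi> l x) < \<epsilon>"
    and dense: "t \<in> carrier T \<Longrightarrow> \<epsilon> > 0 \<Longrightarrow> \<exists>x\<in>carrier A. \<forall>\<^sub>F k in sequentially. M (\<psi> k x \<ominus>\<^bsub>T\<^esub> t) < \<epsilon>"
begin

lemma diff:
  assumes "x \<in> carrier A" "y \<in> carrier A"
  shows "\<forall>\<^sub>F k in sequentially. \<psi> k (x \<ominus>\<^bsub>A\<^esub> y) = \<psi> k x \<ominus>\<^bsub>T\<^esub> \<psi> k y"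
proof -
  have "(x \<ominus>\<^bsub>A\<^esub> y) \<oplus>\<^bsub>A\<^esub> y = x" using assms by (simp add: A.minus_eq A.a_assoc A.l_neg)
  then have "\<forall>\<^sub>F k in sequentially. \<psi> k x = \<psi> k (x \<ominus>\<^bsub>A\<^esub> y) \<oplus>\<^bsub>T\<^esub> \<psi> k y"
    using add[of "x \<ominus>\<^bsub>A\<^esub> y" y] assms by simp
  then show ?thesis
  proof eventually_elim
    case (elim k)
    have c: "\<psi> k (x \<ominus>\<^bsub>A\<^esub> y) \<in> carrier T" "\<psi> k y \<in> carrier T"
      by (intro closed A.minus_closed assms)+
    have "\<psi> k x \<ominus>\<^bsub>T\<^esub> \<psi> k y = (\<psi> k (x \<ominus>\<^bsub>A\<^esub> y) \<oplus>\<^bsub>T\<^esub> \<psi> k y) \<oplus>\<^bsub>T\<^esub> (\<ominus>\<^bsub>T\<^esub> \<psi> k y)"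
      by (simp only: elim T.minus_eq)
    also have "\<dots> = \<psi> k (x \<ominus>\<^bsub>A\<^esub> y) \<oplus>\<^bsub>T\<^esub> (\<psi> k y \<oplus>\<^bsub>T\<^esub> (\<ominus>\<^bsub>T\<^esub> \<psi> k y))"
      by (intro T.a_assoc T.a_inv_closed c)
    also have "\<dots> = \<psi> k (x \<ominus>\<^bsub>A\<^esub> y)"
      by (simp only: T.r_neg[OF c(2)] T.r_zero[OF c(1)])
    finally show ?case ..
  qed
qed

definition corr :: "(nat \<Rightarrow> 'a) \<Rightarrow> (nat \<Rightarrow> 'c) \<Rightarrow> bool" where
  "corr x t \<longleftrightarrow> x \<in> cauchy_sequences A N \<and> t \<in> cauchy_sequences T M \<and>
     (\<forall>\<epsilon>>0. \<exists>L. \<forall>l\<ge>L. \<forall>\<^sub>F k in sequentially. M (\<psi> k (x l) \<ominus>\<^bsub>T\<^esub> t l) < \<epsilon>)"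

lemma corr_op:
  assumes xt: "corr x t" and yu: "corr y u"
    and f: "(\<lambda>l. f (x l) (y l)) \<in> cauchy_sequences A N" and g: "(\<lambda>l. g (t l) (u l)) \<in> cauchy_sequences T M"
    and fg: "\<And>a b. a \<in> carrier A \<Longrightarrow> b \<in> carrier A \<Longrightarrow> \<forall>\<^sub>F k in sequentially. \<psi> k (f a b) = g (\<psi> k a) (\<psi> k b)"
    and lip: "\<And>a b a' b'. a \<in> carrier T \<Longrightarrow> b \<in> carrier T \<Longrightarrow> a' \<in> carrier T \<Longrightarrow> b' \<in> carrier T \<Longrightarrow>
       M (g a b \<ominus>\<^bsub>T\<^esub> g a' b') \<le> M (a \<ominus>\<^bsub>T\<^esub> a') + M (b \<ominus>\<^bsub>T\<^esub> b')"
  shows "corr (\<lambda>l. f (x l) (y l)) (\<lambda>l. g (t l) (u l))"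
  unfolding corr_def
proof (intro conjI allI impI)
  fix \<epsilon> :: real assume \<epsilon>: "\<epsilon> > 0"
  obtain L where L: "\<And>l. l \<ge> L \<Longrightarrow> \<forall>\<^sub>F k in sequentially. M (\<psi> k (x l) \<ominus>\<^bsub>T\<^esub> t l) < \<epsilon>/2"
    using xt \<epsilon> unfolding corr_def by (meson half_gt_zero)
  obtain L' where L': "\<And>l. l \<ge> L' \<Longrightarrow> \<forall>\<^sub>F k in sequentially. M (\<psi> k (y l) \<ominus>\<^bsub>T\<^esub> u l) < \<epsilon>/2"
    using yu \<epsilon> unfolding corr_def by (meson half_gt_zero)
  have c: "x l \<in> carrier A" "y l \<in> carrier A" "t l \<in> carrier T" "u l \<in> carrier T" for l
    using xt yu A.cauchy_sequencesD(1) T.cauchy_sequencesD(1) by (auto simp: corr_def)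
  have "\<forall>\<^sub>F k in sequentially. M (\<psi> k (f (x l) (y l)) \<ominus>\<^bsub>T\<^esub> g (t l) (u l)) < \<epsilon>" if l: "l \<ge> max L L'" for l
  proof -
    have "\<forall>\<^sub>F k in sequentially. M (\<psi> k (x l) \<ominus>\<^bsub>T\<^esub> t l) < \<epsilon>/2" "\<forall>\<^sub>F k in sequentially. M (\<psi> k (y l) \<ominus>\<^bsub>T\<^esub> u l) < \<epsilon>/2"
      using L[of l] L'[of l] l by auto
    with fg[OF c(1)[of l] c(2)[of l]] show ?thesis
    proof eventually_elim
      case (elim k)
      then show ?case
        using lip[OF closed[OF c(1)[of l]] closed[OF c(2)[of l]] c(3)[of l] c(4)[of l], of k k] by simp
    qed
  qed
  then show "\<exists>L. \<forall>l\<ge>L. \<forall>\<^sub>F k in sequentially. M (\<psi> k (f (x l) (y l)) \<ominus>\<^bsub>T\<^esub> g (t l) (u l)) < \<epsilon>" by blast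
qed (rule f g)+

lemma corr_add: "corr x t \<Longrightarrow> corr y u \<Longrightarrow> corr (\<lambda>l. x l \<oplus>\<^bsub>A\<^esub> y l) (\<lambda>l. t l \<oplus>\<^bsub>T\<^esub> u l)"
  by (rule corr_op[where f = "\<lambda>a b. a \<oplus>\<^bsub>A\<^esub> b" and g = "\<lambda>a b. a \<oplus>\<^bsub>T\<^esub> b"])
    (auto simp: corr_def intro!: A.cauchy_op[where f = "\<lambda>a b. a \<oplus>\<^bsub>A\<^esub> b"] T.cauchy_op[where f = "\<lambda>a b. a \<oplus>\<^bsub>T\<^esub> b"]
      A.N_add_diff T.N_add_diff add)

lemma corr_mult: "corr x t \<Longrightarrow> corr y u \<Longrightarrow> corr (\<lambda>l. x l \<otimes>\<^bsub>A\<^esub> y l) (\<lambda>l. t l \<otimes>\<^bsub>T\<^esub> u l)"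
  by (rule corr_op[where f = "\<lambda>a b. a \<otimes>\<^bsub>A\<^esub> b" and g = "\<lambda>a b. a \<otimes>\<^bsub>T\<^esub> b"])
    (auto simp: corr_def intro!: A.cauchy_op[where f = "\<lambda>a b. a \<otimes>\<^bsub>A\<^esub> b"] T.cauchy_op[where f = "\<lambda>a b. a \<otimes>\<^bsub>T\<^esub> b"]
      A.N_mult_diff T.N_mult_diff mult)

lemma corr_diff: "corr x t \<Longrightarrow> corr y u \<Longrightarrow> corr (\<lambda>l. x l \<ominus>\<^bsub>A\<^esub> y l) (\<lambda>l. t l \<ominus>\<^bsub>T\<^esub> u l)"
  by (rule corr_op[where f = "\<lambda>a b. a \<ominus>\<^bsub>A\<^esub> b" and g = "\<lambda>a b. a \<ominus>\<^bsub>T\<^esub> b"])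
    (auto simp: corr_def intro!: A.cauchy_op[where f = "\<lambda>a b. a \<ominus>\<^bsub>A\<^esub> b"] T.cauchy_op[where f = "\<lambda>a b. a \<ominus>\<^bsub>T\<^esub> b"]
      A.N_diff_diff T.N_diff_diff diff)

lemma corr_rank:
  assumes "corr x t"
  shows "(\<lambda>l. N (x l) - M (t l)) \<longlonglongrightarrow> 0"
proof (rule LIMSEQ_I)
  fix \<epsilon> :: real assume \<epsilon>: "\<epsilon> > 0"
  obtain L where L: "\<And>l. l \<ge> L \<Longrightarrow> \<forall>\<^sub>F k in sequentially. M (\<psi> k (x l) \<ominus>\<^bsub>T\<^esub> t l) < \<epsilon>/2"
    using assms \<epsilon> unfolding corr_def by (meson half_gt_zero)
  have c: "x l \<in> carrier A" "t l \<in> carrier T" for l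
    using assms A.cauchy_sequencesD(1) T.cauchy_sequencesD(1) by (auto simp: corr_def)
  have "norm (N (x l) - M (t l) - 0) < \<epsilon>" if l: "l \<ge> L" for l
  proof -
    have "(\<lambda>k. \<bar>M (\<psi> k (x l)) - M (t l)\<bar>) \<longlonglongrightarrow> \<bar>N (x l) - M (t l)\<bar>"
      by (intro tendsto_intros rank c)
    moreover have "\<forall>\<^sub>F k in sequentially. \<bar>M (\<psi> k (x l)) - M (t l)\<bar> \<le> \<epsilon>/2"
      using L[OF l]
    proof eventually_elim
      case (elim k)
      have "\<bar>M (\<psi> k (x l)) - M (t l)\<bar> \<le> M (\<psi> k (x l) \<ominus>\<^bsub>T\<^esub> t l)"
        by (intro T.N_diff_ge closed c)
      with elim show ?case by linarith
    qed
    ultimately have "\<bar>N (x l) - M (t l)\<bar> \<le> \<epsilon>/2" by (rule tendsto_upperbound) simp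
    then show ?thesis using \<epsilon> by simp
  qed
  then show "\<exists>no. \<forall>n\<ge>no. norm (N (x n) - M (t n) - 0) < \<epsilon>" by blast
qed

lemma corr_null_iff:
  assumes "corr x t"
  shows "x \<in> null_sequences A N \<longleftrightarrow> t \<in> null_sequences T M"
proof -
  have c: "x l \<in> carrier A" "t l \<in> carrier T" for l
    using assms A.cauchy_sequencesD(1) T.cauchy_sequencesD(1) by (auto simp: corr_def)
  have "(\<lambda>l. N (x l)) \<longlonglongrightarrow> 0 \<longleftrightarrow> (\<lambda>l. M (t l)) \<longlonglongrightarrow> 0"
  proof
    assume "(\<lambda>l. N (x l)) \<longlonglongrightarrow> 0"
    from tendsto_diff[OF this corr_rank[OF assms]] show "(\<lambda>l. M (t l)) \<longlonglongrightarrow> 0" by simp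
  next
    assume "(\<lambda>l. M (t l)) \<longlonglongrightarrow> 0"
    from tendsto_add[OF corr_rank[OF assms] this] show "(\<lambda>l. N (x l)) \<longlonglongrightarrow> 0" by simp
  qed
  then show ?thesis using c by (auto simp: null_sequences_def)
qed

lemma corr_ex:
  assumes x: "x \<in> cauchy_sequences A N"
  shows "\<exists>t. corr x t"
proof -
  have c: "x l \<in> carrier A" for l using A.cauchy_sequencesD(1)[OF x] .
  have "\<exists>K. \<forall>k\<ge>K. \<forall>k'\<ge>K. M (\<psi> k (x l) \<ominus>\<^bsub>T\<^esub> \<psi> k' (x l)) < 1 / real (Suc l)" for l
    by (rule cauchy[OF c]) simp
  then obtain K where K: "\<And>l k k'. k \<ge> K l \<Longrightarrow> k' \<ge> K l \<Longrightarrow> M (\<psi> k (x l) \<ominus>\<^bsub>T\<^esub> \<psi> k' (x l)) < 1 / real (Suc l)"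
    by metis
  define t where "t l = \<psi> (K l) (x l)" for l
  have ct: "t l \<in> carrier T" for l by (simp add: t_def closed c)
  have "t \<in> cauchy_sequences T M"
  proof (rule T.cauchy_sequencesI[OF ct])
    fix \<epsilon> :: real assume \<epsilon>: "\<epsilon> > 0"
    obtain L where L: "\<And>l. l \<ge> L \<Longrightarrow> 1 / real (Suc l) < \<epsilon>/3" using inverse_Suc_less[of "\<epsilon>/3"] \<epsilon> by auto
    obtain L' where L': "\<And>l l'. l \<ge> L' \<Longrightarrow> l' \<ge> L' \<Longrightarrow> N (x l \<ominus>\<^bsub>A\<^esub> x l') < \<epsilon>/3"
      using A.cauchy_sequencesD(2)[OF x, of "\<epsilon>/3"] \<epsilon> by auto
    have "M (t l \<ominus>\<^bsub>T\<^esub> t l') < \<epsilon>" if l: "l \<ge> max L L'" "l' \<ge> max L L'" for l l'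
    proof -
      have "(\<lambda>k. M (\<psi> k (x l \<ominus>\<^bsub>A\<^esub> x l'))) \<longlonglongrightarrow> N (x l \<ominus>\<^bsub>A\<^esub> x l')" by (rule rank) (simp add: c)
      moreover have "N (x l \<ominus>\<^bsub>A\<^esub> x l') < \<epsilon>/3" using L'[of l l'] l by simp
      ultimately have "\<forall>\<^sub>F k in sequentially. M (\<psi> k (x l \<ominus>\<^bsub>A\<^esub> x l')) < \<epsilon>/3" by (rule order_tendstoD(2))
      then have "\<forall>\<^sub>F k in sequentially. M (t l \<ominus>\<^bsub>T\<^esub> t l') < \<epsilon>"
        using diff[OF c[of l] c[of l']] eventually_ge_at_top[of "K l"] eventually_ge_at_top[of "K l'"]
      proof eventually_elim
        case (elim k)
        have "M (t l \<ominus>\<^bsub>T\<^esub> t l') \<le> M (t l \<ominus>\<^bsub>T\<^esub> \<psi> k (x l)) + M (\<psi> k (x l) \<ominus>\<^bsub>T\<^esub> t l')"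
          by (intro T.N_triangle ct closed c)
        also have "M (\<psi> k (x l) \<ominus>\<^bsub>T\<^esub> t l') \<le> M (\<psi> k (x l) \<ominus>\<^bsub>T\<^esub> \<psi> k (x l')) + M (\<psi> k (x l') \<ominus>\<^bsub>T\<^esub> t l')"
          by (intro T.N_triangle ct closed c)
        also have "M (t l \<ominus>\<^bsub>T\<^esub> \<psi> k (x l)) < \<epsilon>/3"
          using K[of l "K l" k] elim(3) L[of l] l by (simp add: t_def)
        also have "M (\<psi> k (x l') \<ominus>\<^bsub>T\<^esub> t l') < \<epsilon>/3"
          using K[of l' k "K l'"] elim(4) L[of l'] l by (simp add: t_def)
        also have "M (\<psi> k (x l) \<ominus>\<^bsub>T\<^esub> \<psi> k (x l')) < \<epsilon>/3" using elim by simp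
        finally show ?case by simp
      qed
      then show ?thesis by simp
    qed
    then show "\<exists>K. \<forall>m\<ge>K. \<forall>n\<ge>K. M (t m \<ominus>\<^bsub>T\<^esub> t n) < \<epsilon>" by blast
  qed
  moreover have "\<exists>L. \<forall>l\<ge>L. \<forall>\<^sub>F k in sequentially. M (\<psi> k (x l) \<ominus>\<^bsub>T\<^esub> t l) < \<epsilon>" if \<epsilon>: "\<epsilon> > 0" for \<epsilon>
  proof -
    obtain L where L: "\<And>l. l \<ge> L \<Longrightarrow> 1 / real (Suc l) < \<epsilon>" using inverse_Suc_less[OF \<epsilon>] by auto
    have "\<forall>\<^sub>F k in sequentially. M (\<psi> k (x l) \<ominus>\<^bsub>T\<^esub> t l) < \<epsilon>" if "l \<ge> L" for l
      using eventually_ge_at_top[of "K l"]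
    proof eventually_elim
      case (elim k)
      show ?case using K[OF elim order_refl] L[OF that] by (simp add: t_def)
    qed
    then show ?thesis by blast
  qed
  ultimately show ?thesis using x unfolding corr_def by blast
qed

lemma corr_surj:
  assumes t: "t \<in> cauchy_sequences T M"
  shows "\<exists>x. corr x t"
proof -
  have ct: "t l \<in> carrier T" for l using T.cauchy_sequencesD(1)[OF t] .
  have "\<exists>x\<in>carrier A. \<forall>\<^sub>F k in sequentially. M (\<psi> k x \<ominus>\<^bsub>T\<^esub> t l) < 1 / real (Suc l)" for l
    by (rule dense[OF ct]) simp
  then obtain x where c: "\<And>l. x l \<in> carrier A"
    and x: "\<And>l. \<forall>\<^sub>F k in sequentially. M (\<psi> k (x l) \<ominus>\<^bsub>T\<^esub> t l) < 1 / real (Suc l)" by metis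
  have "x \<in> cauchy_sequences A N"
  proof (rule A.cauchy_sequencesI[OF c])
    fix \<epsilon> :: real assume \<epsilon>: "\<epsilon> > 0"
    obtain L where L: "\<And>l. l \<ge> L \<Longrightarrow> 1 / real (Suc l) < \<epsilon>/4" using inverse_Suc_less[of "\<epsilon>/4"] \<epsilon> by auto
    obtain L' where L': "\<And>l l'. l \<ge> L' \<Longrightarrow> l' \<ge> L' \<Longrightarrow> M (t l \<ominus>\<^bsub>T\<^esub> t l') < \<epsilon>/4"
      using T.cauchy_sequencesD(2)[OF t, of "\<epsilon>/4"] \<epsilon> by auto
    have "N (x l \<ominus>\<^bsub>A\<^esub> x l') < \<epsilon>" if l: "l \<ge> max L L'" "l' \<ge> max L L'" for l l'
    proof -
      have "\<forall>\<^sub>F k in sequentially. M (\<psi> k (x l \<ominus>\<^bsub>A\<^esub> x l')) \<le> 3 * \<epsilon> / 4"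
        using diff[OF c[of l] c[of l']] x[of l] x[of l']
      proof eventually_elim
        case (elim k)
        have "M (\<psi> k (x l) \<ominus>\<^bsub>T\<^esub> \<psi> k (x l')) \<le> M (\<psi> k (x l) \<ominus>\<^bsub>T\<^esub> t l) + M (t l \<ominus>\<^bsub>T\<^esub> \<psi> k (x l'))"
          by (intro T.N_triangle ct closed c)
        also have "M (t l \<ominus>\<^bsub>T\<^esub> \<psi> k (x l')) \<le> M (t l \<ominus>\<^bsub>T\<^esub> t l') + M (t l' \<ominus>\<^bsub>T\<^esub> \<psi> k (x l'))"
          by (intro T.N_triangle ct closed c)
        also have "M (t l' \<ominus>\<^bsub>T\<^esub> \<psi> k (x l')) = M (\<psi> k (x l') \<ominus>\<^bsub>T\<^esub> t l')"
          by (intro T.N_diff_commute ct closed c)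
        also have "M (\<psi> k (x l) \<ominus>\<^bsub>T\<^esub> t l) < \<epsilon>/4" using elim(2) L[of l] l by simp
        also have "M (\<psi> k (x l') \<ominus>\<^bsub>T\<^esub> t l') < \<epsilon>/4" using elim(3) L[of l'] l by simp
        also have "M (t l \<ominus>\<^bsub>T\<^esub> t l') < \<epsilon>/4" using L'[of l l'] l by simp
        finally show ?case using elim(1) by simp
      qed
      moreover have "(\<lambda>k. M (\<psi> k (x l \<ominus>\<^bsub>A\<^esub> x l'))) \<longlonglongrightarrow> N (x l \<ominus>\<^bsub>A\<^esub> x l')"
        by (rule rank) (simp add: c)
      ultimately have "N (x l \<ominus>\<^bsub>A\<^esub> x l') \<le> 3 * \<epsilon> / 4"
        by (intro tendsto_upperbound) auto
      then show ?thesis using \<epsilon> by simp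
    qed
    then show "\<exists>K. \<forall>m\<ge>K. \<forall>n\<ge>K. N (x m \<ominus>\<^bsub>A\<^esub> x n) < \<epsilon>" by blast
  qed
  moreover have "\<exists>L. \<forall>l\<ge>L. \<forall>\<^sub>F k in sequentially. M (\<psi> k (x l) \<ominus>\<^bsub>T\<^esub> t l) < \<epsilon>" if \<epsilon>: "\<epsilon> > 0" for \<epsilon>
  proof -
    obtain L where L: "\<And>l. l \<ge> L \<Longrightarrow> 1 / real (Suc l) < \<epsilon>" using inverse_Suc_less[OF \<epsilon>] by auto
    have "\<forall>\<^sub>F k in sequentially. M (\<psi> k (x l) \<ominus>\<^bsub>T\<^esub> t l) < \<epsilon>" if "l \<ge> L" for l
      using x[of l]
    proof eventually_elim
      case (elim k)
      with L[OF that] show ?case by linarith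
    qed
    then show ?thesis by blast
  qed
  ultimately show ?thesis using t unfolding corr_def by blast
qed

lemma corr_const:
  assumes "a \<in> carrier A" "b \<in> carrier T" "(\<lambda>k. M (\<psi> k a \<ominus>\<^bsub>T\<^esub> b)) \<longlonglongrightarrow> 0"
  shows "corr (\<lambda>l. a) (\<lambda>l. b)"
proof -
  have "\<forall>\<^sub>F k in sequentially. M (\<psi> k a \<ominus>\<^bsub>T\<^esub> b) < \<epsilon>" if "\<epsilon> > 0" for \<epsilon>
    by (rule order_tendstoD(2)[OF assms(3) that])
  then show ?thesis
    unfolding corr_def using A.cauchy_const[OF assms(1)] T.cauchy_const[OF assms(2)] by blast
qed

text \<open>
  Modulo null sequences the correspondence is the graph of an isomorphism: it respects the operations,
  it preserves ranks, and every Cauchy sequence on either side corresponds to one on the other side.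
\<close>

theorem completion_isomorphic:
  "\<exists>\<Phi>\<in>ring_iso (completion A N) (completion T M). \<forall>a\<in>carrier A. \<forall>b\<in>carrier T.
     (\<lambda>k. M (\<psi> k a \<ominus>\<^bsub>T\<^esub> b)) \<longlonglongrightarrow> 0 \<longrightarrow> \<Phi> (completion_map A N a) = completion_map T M b"
proof -
  let ?CA = "cauchy_ring A N" and ?CT = "cauchy_ring T M"
  let ?cl = "\<lambda>t. null_sequences T M +>\<^bsub>?CT\<^esub> t"
  define h where "h x = ?cl (SOME t. corr x t)" for x
  have h: "h x = ?cl t" if "corr x t" for x t
  proof -
    define u where "u = (SOME t. corr x t)"
    have u: "corr x u" unfolding u_def by (rule someI[of "corr x", OF that])
    have x: "\<And>l. x l \<in> carrier A" using that A.cauchy_sequencesD(1) by (auto simp: corr_def)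
    have "(\<lambda>l. x l \<ominus>\<^bsub>A\<^esub> x l) = (\<lambda>l. \<zero>\<^bsub>A\<^esub>)" using x by (simp add: A.minus_eq A.r_neg)
    then have "(\<lambda>l. u l \<ominus>\<^bsub>T\<^esub> t l) \<in> null_sequences T M"
      using corr_null_iff[OF corr_diff[OF u that]] A.null_zero by simp
    then show ?thesis
      using T.coset_eq_iff[of u t] u that unfolding h_def u_def[symmetric] by (simp add: corr_def)
  qed
  note clhom = T.coset_hom
  have ex: "\<exists>t. corr x t \<and> t \<in> cauchy_sequences T M" if "x \<in> cauchy_sequences A N" for x
    using corr_ex[OF that] by (auto simp: corr_def)
  have hom: "h \<in> Ring.ring_hom ?CA (completion T M)"
  proof (rule ring_hom_memI)
    fix x assume "x \<in> carrier ?CA"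
    then obtain t where t: "corr x t" "t \<in> cauchy_sequences T M" using ex by auto
    show "h x \<in> carrier (completion T M)" using ring_hom_closed[OF clhom] t h by simp
    fix y assume "y \<in> carrier ?CA"
    then obtain u where u: "corr y u" "u \<in> cauchy_sequences T M" using ex by auto
    show "h (x \<otimes>\<^bsub>?CA\<^esub> y) = h x \<otimes>\<^bsub>completion T M\<^esub> h y"
      using h[OF corr_mult[OF t(1) u(1)]] h[OF t(1)] h[OF u(1)] ring_hom_mult[OF clhom, of t u] t u by simp
    show "h (x \<oplus>\<^bsub>?CA\<^esub> y) = h x \<oplus>\<^bsub>completion T M\<^esub> h y"
      using h[OF corr_add[OF t(1) u(1)]] h[OF t(1)] h[OF u(1)] ring_hom_add[OF clhom, of t u] t u by simp
  next
    show "h \<one>\<^bsub>?CA\<^esub> = \<one>\<^bsub>completion T M\<^esub>"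
      using h[OF corr_const[OF _ _ one]] ring_hom_one[OF clhom] by simp
  qed
  interpret h: ring_hom_ring ?CA "completion T M" h
    by (rule ring_hom_ringI2[OF A.ring_cauchy_ring T.ring_completion hom])
  have surj: "h ` carrier ?CA = carrier (completion T M)"
  proof (intro equalityI subsetI)
    fix y assume "y \<in> carrier (completion T M)"
    then obtain t where t: "t \<in> cauchy_sequences T M" "y = ?cl t"
      unfolding T.carrier_completion by blast
    obtain x where x: "corr x t" using corr_surj[OF t(1)] by blast
    then have "x \<in> carrier ?CA" "y = h x" using h[OF x] t by (simp_all add: corr_def)
    then show "y \<in> h ` carrier ?CA" by blast
  next
    fix y assume "y \<in> h ` carrier ?CA"
    then show "y \<in> carrier (completion T M)" using h.hom_closed by blast
  qed
  have ker: "a_kernel ?CA (completion T M) h = null_sequences A N"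
  proof -
    have "h x = null_sequences T M \<longleftrightarrow> x \<in> null_sequences A N" if xc: "x \<in> cauchy_sequences A N" for x
    proof -
      obtain t where t: "corr x t" "t \<in> cauchy_sequences T M" using ex[OF xc] by blast
      show ?thesis
        by (simp only: h[OF t(1)] T.coset_null_iff[OF t(2)] corr_null_iff[OF t(1)])
    qed
    then show ?thesis
      unfolding a_kernel_def' T.zero_completion A.cauchy_ring_simps using A.null_subset by blast
  qed
  have iso: "(\<lambda>X. the_elem (h ` X)) \<in> ring_iso (completion A N) (completion T M)"
    using h.FactRing_iso_set[OF surj] unfolding ker by (simp add: completion_def)
  have "the_elem (h ` completion_map A N a) = completion_map T M b"
    if "a \<in> carrier A" "b \<in> carrier T" "(\<lambda>k. M (\<psi> k a \<ominus>\<^bsub>T\<^esub> b)) \<longlonglongrightarrow> 0" for a b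
  proof -
    have "the_elem (h ` completion_map A N a) = h (\<lambda>n. a)"
      using h.the_elem_simp[of "\<lambda>n. a"] A.cauchy_const[OF that(1)] unfolding ker completion_map_def by simp
    then show ?thesis using h[OF corr_const[OF that]] by (simp add: completion_map_def)
  qed
  then show ?thesis by (intro bexI[OF _ iso] ballI impI)
qed

end

section \<open>Weighted Bratteli diagrams\<close>

text \<open>
  With \<open>W\<close> and \<open>Y\<close> for the sums of \<open>w j * d j\<close> and \<open>w j * y j\<close>, expand the sum of the nonnegative
  numbers \<open>w j / d j * (W * y j - Y * d j)\<^sup>2\<close>.
\<close>

lemma weighted_Cauchy_Schwarz:
  fixes w y d :: "'i \<Rightarrow> real"
  assumes "finite J" and w: "\<And>j. j \<in> J \<Longrightarrow> 0 \<le> w j" and d: "\<And>j. j \<in> J \<Longrightarrow> 0 < d j"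
  shows "(\<Sum>j\<in>J. w j * y j)\<^sup>2 \<le> (\<Sum>j\<in>J. w j * d j) * (\<Sum>j\<in>J. w j * (y j)\<^sup>2 / d j)"
proof -
  let ?W = "\<Sum>j\<in>J. w j * d j" and ?Y = "\<Sum>j\<in>J. w j * y j" and ?Z = "\<Sum>j\<in>J. w j * (y j)\<^sup>2 / d j"
  have W0: "0 \<le> ?W" using w d by (intro sum_nonneg) (simp add: less_imp_le)
  show ?thesis
  proof (cases "?W = 0")
    case True
    have "w j * d j = 0" if "j \<in> J" for j
    proof -
      have "\<forall>j\<in>J. w j * d j = 0"
        using True sum_nonneg_eq_0_iff[OF assms(1), of "\<lambda>j. w j * d j"] w d by (simp add: less_imp_le)
      then show ?thesis using that by blast
    qed
    then have "w j = 0" if "j \<in> J" for j using that d[OF that] by fastforce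
    then have "?Y = 0" by (intro sum.neutral) simp
    then show ?thesis using True by simp
  next
    case False
    with W0 have W: "0 < ?W" by simp
    have "0 \<le> (\<Sum>j\<in>J. w j / d j * (?W * y j - ?Y * d j)\<^sup>2)"
      using w d by (intro sum_nonneg mult_nonneg_nonneg divide_nonneg_pos) auto
    also have "\<dots> = (\<Sum>j\<in>J. ?W\<^sup>2 * (w j * (y j)\<^sup>2 / d j) - 2 * ?W * ?Y * (w j * y j) + ?Y\<^sup>2 * (w j * d j))"
    proof (intro sum.cong refl)
      fix j assume "j \<in> J"
      then have "d j \<noteq> 0" using d by fastforce
      then show "w j / d j * (?W * y j - ?Y * d j)\<^sup>2 = ?W\<^sup>2 * (w j * (y j)\<^sup>2 / d j) - 2 * ?W * ?Y * (w j * y j) + ?Y\<^sup>2 * (w j * d j)"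
        by (simp add: power2_eq_square field_simps)
    qed
    also have "\<dots> = ?W\<^sup>2 * ?Z - 2 * ?W * ?Y * ?Y + ?Y\<^sup>2 * ?W"
      by (simp only: sum.distrib sum_subtractf sum_distrib_left)
    also have "\<dots> = ?W * (?W * ?Z - ?Y\<^sup>2)" by (simp add: power2_eq_square algebra_simps)
    finally have "0 \<le> ?W * ?Z - ?Y\<^sup>2" using W by (simp add: zero_le_mult_iff)
    then show ?thesis by simp
  qed
qed

definition id_labelling :: "nat list \<Rightarrow> labelling" where
  "id_labelling ns = ((\<lambda>r. r), \<lambda>r s. r \<in> brows ns \<and> s \<in> brows ns \<and> fst r = fst s)"

lemma total_id_labelling: "total_labelling ns ns (id_labelling ns)"
proof -
  have "labelling ns ns (id_labelling ns)"
    unfolding id_labelling_def by (rule labellingI) auto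
  then show ?thesis by (simp add: total_labelling_def id_labelling_def)
qed

lemma pull_id_labelling: "x \<in> bmats ns \<Longrightarrow> pull (id_labelling ns) x = x"
proof (intro ext)
  fix r s assume x: "x \<in> bmats ns"
  show "pull (id_labelling ns) x r s = x r s"
    using bmats_zero[OF x, of r s] by (auto simp: pull_def id_labelling_def)
qed

text \<open>
  A sequence of finite products of matrix rings and block diagonal homomorphisms with limit \<open>A\<close>.
  The maps \<open>\<beta> n\<close> to the limit need not be injective, but the elements of their kernels vanish in
  all blocks of positive weight.
\<close>

locale standard_system = pseudo_rank_ring A N for A (structure) and N +
  fixes \<iota> :: "'d::division_ring \<Rightarrow> 'a" and ns :: "nat \<Rightarrow> nat list"
    and L :: "nat \<Rightarrow> labelling" and \<beta> :: "nat \<Rightarrow> 'd bmat \<Rightarrow> 'a"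
  assumes sizes: "sizes (ns n)"
    and total: "total_labelling (ns (Suc n)) (ns n) (L n)"
    and hom: "\<beta> n \<in> Ring.ring_hom (block_ring TYPE('d) (ns n)) A"
    and step: "x \<in> bmats (ns n) \<Longrightarrow> \<beta> (Suc n) (pull (L n) x) = \<beta> n x"
    and exhaust: "a \<in> carrier A \<Longrightarrow> \<exists>n. a \<in> \<beta> n ` bmats (ns n)"
    and scal: "\<beta> n (bdiag (brows (ns n)) d) = \<iota> d"
begin

lemma beta_closed [simp]: "x \<in> bmats (ns n) \<Longrightarrow> \<beta> n x \<in> carrier A"
  using ring_hom_closed[OF hom, of x n] by simp

lemma beta_mult: "x \<in> bmats (ns n) \<Longrightarrow> y \<in> bmats (ns n) \<Longrightarrow> \<beta> n (bmult (ns n) x y) = \<beta> n x \<otimes> \<beta> n y"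
  using ring_hom_mult[OF hom, of x n y] by simp

lemma beta_add: "x \<in> bmats (ns n) \<Longrightarrow> y \<in> bmats (ns n) \<Longrightarrow> \<beta> n (badd x y) = \<beta> n x \<oplus> \<beta> n y"
  using ring_hom_add[OF hom, of x n y] by simp

lemma beta_one: "\<beta> n (bdiag (brows (ns n)) 1) = \<one>"
  using ring_hom_one[OF hom, of n] by simp

lemma beta_zero: "\<beta> n (\<lambda>r s. 0) = \<zero>"
  using ring_hom_zero[OF hom ring_block_ring ring_axioms, of n] by simp

lemma beta_diff:
  assumes "x \<in> bmats (ns n)" "y \<in> bmats (ns n)"
  shows "\<beta> n (bdiff x y) = \<beta> n x \<ominus> \<beta> n y"
proof -
  have "badd (bdiff x y) y = x" by (simp add: badd_def bdiff_def)
  then have eq: "\<beta> n x = \<beta> n (bdiff x y) \<oplus> \<beta> n y" using beta_add[of "bdiff x y" n y] assms by simp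
  have "\<beta> n x \<ominus> \<beta> n y = \<beta> n (bdiff x y) \<oplus> (\<beta> n y \<oplus> (\<ominus> \<beta> n y))"
    unfolding minus_eq eq using assms by (intro a_assoc) auto
  also have "\<dots> = \<beta> n (bdiff x y)" using assms by (simp add: r_neg)
  finally show ?thesis ..
qed

lemma rank_like_beta: "rank_like (ns n) (\<lambda>x. N (\<beta> n x))"
  unfolding rank_like_def
proof (intro conjI ballI impI)
  fix x y :: "'d bmat" assume x: "x \<in> bmats (ns n)" and y: "y \<in> bmats (ns n)"
  show "N (\<beta> n (bmult (ns n) x y)) \<le> N (\<beta> n x)" "N (\<beta> n (bmult (ns n) x y)) \<le> N (\<beta> n y)"
    unfolding beta_mult[OF x y] using x y by (simp_all add: N_mult)
  show "N (\<beta> n (badd x y)) \<le> N (\<beta> n x) + N (\<beta> n y)"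
    unfolding beta_add[OF x y] using x y by (simp add: N_add)
next
  fix e f :: "'d bmat" assume e: "e \<in> bmats (ns n)" and f: "f \<in> bmats (ns n)"
    and 1: "bmult (ns n) e e = e" and 2: "bmult (ns n) f f = f"
    and 3: "bmult (ns n) e f = (\<lambda>r s. 0)" and 4: "bmult (ns n) f e = (\<lambda>r s. 0)"
  have "N (\<beta> n e \<oplus> \<beta> n f) = N (\<beta> n e) + N (\<beta> n f)"
  proof (rule N_orthogonal)
    show "\<beta> n e \<in> idempotents A" "\<beta> n f \<in> idempotents A"
      using beta_mult[OF e e] beta_mult[OF f f] 1 2 e f by (simp_all add: idempotents_def)
    show "\<beta> n e \<otimes> \<beta> n f = \<zero>" "\<beta> n f \<otimes> \<beta> n e = \<zero>"
      using beta_mult[OF e f] beta_mult[OF f e] 3 4 beta_zero by simp_all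
  qed
  then show "N (\<beta> n (badd e f)) = N (\<beta> n e) + N (\<beta> n f)" unfolding beta_add[OF e f] .
qed

definition wt :: "nat \<Rightarrow> nat \<Rightarrow> real" where
  "wt n i = weight (\<lambda>x. N (\<beta> n x)) i"

lemma size_pos: "i < length (ns n) \<Longrightarrow> 0 < ns n ! i"
  using sizes[of n] by (simp add: sizes_def)

lemma bunit_in: "i < length (ns n) \<Longrightarrow> bunit (i, 0) (i, 0) \<in> bmats (ns n)"
  by (intro bunit_closed) (auto simp: brows_def size_pos)

lemma wt_eq: "wt n i = N (\<beta> n (bunit (i, 0) (i, 0)))"
  by (simp add: wt_def weight_def)

lemma wt_nonneg: "i < length (ns n) \<Longrightarrow> 0 \<le> wt n i"
  unfolding wt_def by (rule weight_nonneg[OF rank_like_beta]) (simp_all add: size_pos)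

lemma N_beta: "x \<in> bmats (ns n) \<Longrightarrow> N (\<beta> n x) = (\<Sum>i<length (ns n). real (brank (ns n) i x) * wt n i)"
  unfolding wt_def by (rule rank_like_eq[OF rank_like_beta])

lemma sum_wt: "(\<Sum>i<length (ns n). wt n i * real (ns n ! i)) = 1"
  using rank_like_sum_weights[OF rank_like_beta, of n] by (simp add: beta_one N_one wt_def mult.commute)

primrec trans :: "nat \<Rightarrow> nat \<Rightarrow> labelling" where
  "trans m 0 = id_labelling (ns m)"
| "trans m (Suc k) = lcomp (trans m k) (L (m + k))"

lemma total_trans: "total_labelling (ns (m + k)) (ns m) (trans m k)"
proof (induction k)
  case 0
  show ?case by (simp add: total_id_labelling)
next
  case (Suc k)
  show ?case using total_labelling_lcomp[OF Suc total[of "m + k"]] by simp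
qed

lemma labelling_trans: "labelling (ns (m + k)) (ns m) (trans m k)"
  using total_trans[of m k] by (simp add: total_labelling_def)

lemma pull_trans_closed [simp]: "pull (trans m k) x \<in> bmats (ns (m + k))"
  by (rule pull_closed[OF labelling_trans])

lemma pull_trans_add: "x \<in> bmats (ns m) \<Longrightarrow> pull (trans m (k + l)) x = pull (trans (m + k) l) (pull (trans m k) x)"
  by (induction l) (simp_all add: pull_lcomp pull_id_labelling add.assoc)

lemma beta_trans: "x \<in> bmats (ns m) \<Longrightarrow> \<beta> (m + k) (pull (trans m k) x) = \<beta> m x"
  by (induction k) (simp_all add: pull_lcomp pull_id_labelling step)

lemma beta_image_mono:
  assumes "m \<le> n"
  shows "\<beta> m ` bmats (ns m) \<subseteq> \<beta> n ` bmats (ns n)"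
proof
  fix a assume "a \<in> \<beta> m ` bmats (ns m)"
  then obtain x where x: "x \<in> bmats (ns m)" "a = \<beta> m x" by blast
  obtain k where k: "n = m + k" using assms le_Suc_ex by blast
  have "a = \<beta> n (pull (trans m k) x)" "pull (trans m k) x \<in> bmats (ns n)"
    using beta_trans[OF x(1), of k] pull_trans_closed[of m k x] x(2) k by simp_all
  then show "a \<in> \<beta> n ` bmats (ns n)" by blast
qed

lemma common_level: "a \<in> carrier A \<Longrightarrow> \<exists>n. \<forall>k\<ge>n. a \<in> \<beta> k ` bmats (ns k)"
  using exhaust[of a] beta_image_mono by blast

text \<open>
  The number of copies of the block \<open>i\<close> of the level \<open>m\<close> in the block \<open>j\<close> of the level \<open>m + k\<close>.
\<close>

definition cop :: "nat \<Rightarrow> nat \<Rightarrow> nat \<Rightarrow> nat \<Rightarrow> nat" where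
  "cop m k i j = copies (ns (m + k)) (trans m k) i j"

lemma brank_trans:
  "j < length (ns (m + k)) \<Longrightarrow> x \<in> bmats (ns m) \<Longrightarrow>
    brank (ns (m + k)) j (pull (trans m k) x) = (\<Sum>i<length (ns m). cop m k i j * brank (ns m) i x)"
  unfolding cop_def by (rule brank_pull[OF labelling_trans]) (auto simp: size_pos)

lemma brank_trans_bunit:
  "j < length (ns (m + k)) \<Longrightarrow>
    brank (ns (m + k)) j (pull (trans m k) (bunit (i, 0) (i, 0) :: 'd bmat)) = cop m k i j"
  unfolding cop_def copies_def by (rule brank_pull_bunit[OF labelling_trans]) (auto simp: size_pos)

lemma cop_add:
  assumes "j' < length (ns (m + k + l))" "i < length (ns m)"
  shows "cop m (k + l) i j' = (\<Sum>j<length (ns (m + k)). cop m k i j * cop (m + k) l j j')"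
proof -
  have "cop m (k + l) i j' = brank (ns (m + k + l)) j' (pull (trans m (k + l)) (bunit (i, 0) (i, 0) :: 'd bmat))"
    using brank_trans_bunit[of j' m "k + l" i] assms by (simp add: add.assoc)
  also have "\<dots> = brank (ns (m + k + l)) j' (pull (trans (m + k) l) (pull (trans m k) (bunit (i, 0) (i, 0) :: 'd bmat)))"
    by (subst pull_trans_add[OF bunit_in[OF assms(2)]]) simp
  also have "\<dots> = (\<Sum>j<length (ns (m + k)). cop (m + k) l j j' * cop m k i j)"
    using assms by (subst brank_trans) (simp_all add: brank_trans_bunit)
  finally show ?thesis by (simp add: mult.commute)
qed

lemma wt_trans: "i < length (ns m) \<Longrightarrow> wt m i = (\<Sum>j<length (ns (m + k)). real (cop m k i j) * wt (m + k) j)"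
  using weight_pull[OF rank_like_beta labelling_trans, of m k i]
  by (simp add: wt_def weight_def beta_trans bunit_in cop_def)

lemma sum_cop: "j < length (ns (m + k)) \<Longrightarrow> (\<Sum>i<length (ns m). cop m k i j * ns m ! i) = ns (m + k) ! j"
  unfolding cop_def by (rule copies_total[OF total_trans]) (auto simp: size_pos)

section \<open>Concentration for extremal pseudo-rank functions\<close>

text \<open>
  With probability \<open>wt n j * ns n ! j\<close> for the block \<open>j\<close> of the \<open>n\<close>-th level, the normalized ranks of
  a fixed element form a reverse martingale.  If \<open>a\<close> and \<open>b\<close> are the ranks of two elements in the
  blocks of the level \<open>n\<close>, then \<open>push n l a\<close> and \<open>push n l b\<close> are those at the level \<open>n + l\<close>, and
  \<open>corr_form\<close> is the expectation of the product of the normalized ranks.  It decreases with \<open>l\<close> for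
  \<open>a = b\<close>, and converges in general by polarization.
\<close>

definition push :: "nat \<Rightarrow> nat \<Rightarrow> (nat \<Rightarrow> real) \<Rightarrow> nat \<Rightarrow> real" where
  "push n l a j = (\<Sum>i<length (ns n). a i * real (cop n l i j))"

definition corr_form :: "nat \<Rightarrow> nat \<Rightarrow> (nat \<Rightarrow> real) \<Rightarrow> (nat \<Rightarrow> real) \<Rightarrow> real" where
  "corr_form n l a b = (\<Sum>j<length (ns (n + l)). wt (n + l) j * (push n l a j * push n l b j) / real (ns (n + l) ! j))"

lemma push_Suc:
  assumes "j' < length (ns (n + Suc l))"
  shows "push n (Suc l) a j' = (\<Sum>j<length (ns (n + l)). real (cop (n + l) 1 j j') * push n l a j)"
proof -
  have "push n (Suc l) a j' = (\<Sum>i<length (ns n). \<Sum>j<length (ns (n + l)). a i * (real (cop n l i j) * real (cop (n + l) 1 j j')))"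
    unfolding push_def using cop_add[of j' n l 1] assms
    by (intro sum.cong refl) (simp add: sum_distrib_left)
  also have "\<dots> = (\<Sum>j<length (ns (n + l)). \<Sum>i<length (ns n). a i * (real (cop n l i j) * real (cop (n + l) 1 j j')))"
    by (rule sum.swap)
  finally show ?thesis by (simp add: push_def sum_distrib_left mult_ac)
qed

lemma corr_form_nonneg: "0 \<le> corr_form n l a a"
  unfolding corr_form_def
  by (intro sum_nonneg divide_nonneg_nonneg mult_nonneg_nonneg[OF wt_nonneg zero_le_square]) auto

lemma corr_form_Suc_le: "corr_form n (Suc l) a a \<le> corr_form n l a a"
proof -
  let ?c = "\<lambda>j j'. real (cop (n + l) 1 j j')" and ?d = "\<lambda>j. real (ns (n + l) ! j)"
  let ?f = "push n l a" and ?J = "{..<length (ns (n + l))}" and ?J' = "{..<length (ns (n + Suc l))}"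
  have "corr_form n (Suc l) a a \<le> (\<Sum>j'\<in>?J'. wt (n + Suc l) j' * (\<Sum>j\<in>?J. ?c j j' * (?f j)\<^sup>2 / ?d j))"
    unfolding corr_form_def
  proof (rule sum_mono)
    fix j' assume j': "j' \<in> ?J'"
    let ?d' = "real (ns (n + Suc l) ! j')"
    have d': "0 < ?d'" using j' size_pos[of j' "n + Suc l"] by simp
    have "(push n (Suc l) a j')\<^sup>2 \<le> (\<Sum>j\<in>?J. ?c j j' * ?d j) * (\<Sum>j\<in>?J. ?c j j' * (?f j)\<^sup>2 / ?d j)"
      using j' push_Suc[of j' n l a] weighted_Cauchy_Schwarz[of ?J "\<lambda>j. ?c j j'" ?d ?f] size_pos by simp
    also have "(\<Sum>j\<in>?J. ?c j j' * ?d j) = ?d'"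
      using sum_cop[of j' "n + l" 1] j' by (simp flip: of_nat_mult of_nat_sum)
    finally have "(push n (Suc l) a j')\<^sup>2 / ?d' \<le> (\<Sum>j\<in>?J. ?c j j' * (?f j)\<^sup>2 / ?d j)"
      using d' by (simp add: pos_divide_le_eq mult.commute)
    then have "wt (n + Suc l) j' * ((push n (Suc l) a j')\<^sup>2 / ?d') \<le> wt (n + Suc l) j' * (\<Sum>j\<in>?J. ?c j j' * (?f j)\<^sup>2 / ?d j)"
      using wt_nonneg[of j' "n + Suc l"] j' by (intro mult_left_mono) auto
    then show "wt (n + Suc l) j' * (push n (Suc l) a j' * push n (Suc l) a j') / ?d' \<le>
        wt (n + Suc l) j' * (\<Sum>j\<in>?J. ?c j j' * (?f j)\<^sup>2 / ?d j)"
      by (simp add: power2_eq_square)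
  qed
  also have "\<dots> = (\<Sum>j'\<in>?J'. \<Sum>j\<in>?J. wt (n + Suc l) j' * (?c j j' * (?f j)\<^sup>2 / ?d j))"
    by (simp only: sum_distrib_left)
  also have "\<dots> = (\<Sum>j\<in>?J. \<Sum>j'\<in>?J'. wt (n + Suc l) j' * (?c j j' * (?f j)\<^sup>2 / ?d j))"
    by (rule sum.swap)
  also have "\<dots> = (\<Sum>j\<in>?J. (\<Sum>j'\<in>?J'. ?c j j' * wt (n + Suc l) j') * ((?f j)\<^sup>2 / ?d j))"
    unfolding sum_distrib_right by (intro sum.cong refl) simp
  also have "\<dots> = (\<Sum>j\<in>?J. wt (n + l) j * ((?f j)\<^sup>2 / ?d j))"
    using wt_trans[of _ "n + l" 1] by (intro sum.cong refl) simp
  also have "\<dots> = corr_form n l a a" by (simp add: corr_form_def power2_eq_square)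
  finally show ?thesis .
qed

lemma corr_form_square_convergent: "convergent (\<lambda>l. corr_form n l a a)"
proof -
  have "decseq (\<lambda>l. corr_form n l a a)" by (rule decseq_SucI) (rule corr_form_Suc_le)
  then show ?thesis
    by (rule decseq_convergent[of _ 0]) (auto simp: corr_form_nonneg intro: convergentI)
qed

lemma corr_form_convergent: "convergent (\<lambda>l. corr_form n l a b)"
proof -
  have p: "push n l (\<lambda>i. a i + b i) j = push n l a j + push n l b j" 
    "push n l (\<lambda>i. a i - b i) j = push n l a j - push n l b j" for l j
    by (simp_all add: push_def distrib_right left_diff_distrib sum.distrib sum_subtractf)
  have pol: "w * (p * q) / d = (w * ((p + q) * (p + q)) / d - w * ((p - q) * (p - q)) / d) / 4" for w p q d :: real
  proof -
    have "w * ((p + q) * (p + q)) - w * ((p - q) * (p - q)) = 4 * (w * (p * q))" by (simp add: algebra_simps)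
    then show ?thesis by (simp add: diff_divide_distrib[symmetric])
  qed
  have "corr_form n l a b = (corr_form n l (\<lambda>i. a i + b i) (\<lambda>i. a i + b i) - corr_form n l (\<lambda>i. a i - b i) (\<lambda>i. a i - b i)) / 4" for l
    unfolding corr_form_def p sum_subtractf[symmetric] sum_divide_distrib
    by (intro sum.cong refl) (rule pol)
  then have eq: "(\<lambda>l. corr_form n l a b) = (\<lambda>l. (corr_form n l (\<lambda>i. a i + b i) (\<lambda>i. a i + b i) - corr_form n l (\<lambda>i. a i - b i) (\<lambda>i. a i - b i)) / 4)"
    by (rule ext)
  show ?thesis unfolding eq
    using tendsto_divide[OF tendsto_diff[OF
        convergent_LIMSEQ_iff[THEN iffD1, OF corr_form_square_convergent[of n "\<lambda>i. a i + b i"]]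
        convergent_LIMSEQ_iff[THEN iffD1, OF corr_form_square_convergent[of n "\<lambda>i. a i - b i"]]] tendsto_const[of 4]]
    by (auto intro: convergentI)
qed

text \<open>A section of \<open>\<beta> n\<close> up to elements of rank zero: the blocks of weight zero are erased.\<close>

definition red :: "nat \<Rightarrow> 'd bmat \<Rightarrow> 'd bmat" where
  "red n x = (\<lambda>r s. if wt n (fst r) = 0 then 0 else x r s)"

definition rep :: "nat \<Rightarrow> 'a \<Rightarrow> 'd bmat" where
  "rep n a = red n (SOME x. x \<in> bmats (ns n) \<and> \<beta> n x = a)"

lemma red_closed [simp]: "x \<in> bmats (ns n) \<Longrightarrow> red n x \<in> bmats (ns n)"
  by (rule bmatsI) (auto simp: red_def bmats_def split: if_splits)

lemma red_eq:
  assumes x: "x \<in> bmats (ns n)" and y: "y \<in> bmats (ns n)" and eq: "\<beta> n x = \<beta> n y"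
  shows "red n x = red n y"
proof (intro ext)
  fix r s
  have "N (\<beta> n (bdiff x y)) = 0"
    using beta_diff[OF x y] eq y by (simp add: minus_eq r_neg N_zero)
  then have "(\<Sum>i<length (ns n). real (brank (ns n) i (bdiff x y)) * wt n i) = 0"
    using N_beta[of "bdiff x y" n] x y by simp
  then have 0: "\<forall>i\<in>{..<length (ns n)}. real (brank (ns n) i (bdiff x y)) * wt n i = 0"
    by (subst (asm) sum_nonneg_eq_0_iff) (auto simp: wt_nonneg)
  show "red n x r s = red n y r s"
  proof (cases "r \<in> brows (ns n) \<and> s \<in> brows (ns n) \<and> fst r = fst s \<and> wt n (fst r) \<noteq> 0")
    case True
    then have "fst r < length (ns n)" by (auto simp: brows_def)
    then have "brank (ns n) (fst r) (bdiff x y) = 0" using 0 True by force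
    then have z: "\<forall>r'\<in>block (ns n) (fst r). \<forall>s'\<in>block (ns n) (fst r). bdiff x y r' s' = 0"
      by (rule iffD1[OF brank_eq_0_iff])
    have "r \<in> block (ns n) (fst r)" "s \<in> block (ns n) (fst r)" unfolding block_def using True by auto
    with z have "bdiff x y r s = 0" by blast
    then show ?thesis by (simp add: red_def bdiff_def)
  next
    case False
    show ?thesis
    proof (cases "wt n (fst r) = 0")
      case F: False
      then have out: "r \<notin> brows (ns n) \<or> s \<notin> brows (ns n) \<or> fst r \<noteq> fst s" using False by blast
      show ?thesis by (simp add: red_def bmats_zero[OF x out] bmats_zero[OF y out])
    qed (simp add: red_def)
  qed
qed

lemma rep_beta: "x \<in> bmats (ns n) \<Longrightarrow> rep n (\<beta> n x) = red n x"
proof -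
  assume x: "x \<in> bmats (ns n)"
  define y where "y = (SOME y. y \<in> bmats (ns n) \<and> \<beta> n y = \<beta> n x)"
  have "y \<in> bmats (ns n) \<and> \<beta> n y = \<beta> n x" unfolding y_def by (rule someI[of _ x]) (simp add: x)
  then show ?thesis using red_eq[of y n x] x by (simp add: rep_def y_def[symmetric])
qed

lemma red_mult: "x \<in> bmats (ns n) \<Longrightarrow> red n (bmult (ns n) x y) = bmult (ns n) (red n x) (red n y)"
proof (intro ext)
  fix r s assume x: "x \<in> bmats (ns n)"
  show "red n (bmult (ns n) x y) r s = bmult (ns n) (red n x) (red n y) r s"
  proof (cases "wt n (fst r) = 0")
    case True
    then have 0: "red n x r t * red n y t s = 0" for t by (simp add: red_def)
    show ?thesis unfolding bmult_def 0 using True by (simp add: red_def)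
  next
    case False
    have eq: "x r t * y t s = red n x r t * red n y t s" for t
    proof (cases "fst t = fst r")
      case True
      then show ?thesis using False by (simp add: red_def)
    next
      case F: False
      then have "x r t = 0" using bmats_zero[OF x, of r t] by auto
      then show ?thesis by (simp add: red_def)
    qed
    have "red n (bmult (ns n) x y) r s = bmult (ns n) x y r s" using False by (simp add: red_def)
    also have "\<dots> = bmult (ns n) (red n x) (red n y) r s"
      unfolding bmult_def by (rule sum.cong[OF refl eq])
    finally show ?thesis .
  qed
qed

lemma red_add: "red n (badd x y) = badd (red n x) (red n y)"
  by (auto simp: red_def badd_def fun_eq_iff)

lemma red_zero: "red n (\<lambda>r s. 0) = (\<lambda>r s. 0)"
  by (auto simp: red_def)

lemma rep_closed:
  assumes "a \<in> \<beta> n ` bmats (ns n)"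
  shows "rep n a \<in> bmats (ns n)"
  using assms rep_beta by auto

lemma rep_mult:
  assumes "a \<in> \<beta> n ` bmats (ns n)" "b \<in> \<beta> n ` bmats (ns n)"
  shows "rep n (a \<otimes> b) = bmult (ns n) (rep n a) (rep n b)"
proof -
  obtain x y where x: "x \<in> bmats (ns n)" "a = \<beta> n x" and y: "y \<in> bmats (ns n)" "b = \<beta> n y" using assms by blast
  have "a \<otimes> b = \<beta> n (bmult (ns n) x y)" using beta_mult[OF x(1) y(1)] x y by simp
  then show ?thesis using rep_beta[of "bmult (ns n) x y" n] x y by (simp add: rep_beta red_mult)
qed

lemma rep_add:
  assumes "a \<in> \<beta> n ` bmats (ns n)" "b \<in> \<beta> n ` bmats (ns n)"
  shows "rep n (a \<oplus> b) = badd (rep n a) (rep n b)"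
proof -
  obtain x y where x: "x \<in> bmats (ns n)" "a = \<beta> n x" and y: "y \<in> bmats (ns n)" "b = \<beta> n y" using assms by blast
  have "a \<oplus> b = \<beta> n (badd x y)" using beta_add[OF x(1) y(1)] x y by simp
  then show ?thesis using rep_beta[of "badd x y" n] x y by (simp add: rep_beta red_add)
qed

lemma rep_zero: "rep n \<zero> = (\<lambda>r s. 0)"
  using rep_beta[OF zero_bmats, of n] by (simp add: beta_zero red_zero)

lemma wt_brank_red:
  assumes "j < length (ns n)"
  shows "wt n j * real (brank (ns n) j (red n x)) = wt n j * real (brank (ns n) j x)"
proof (cases "wt n j = 0")
  case False
  have "brank (ns n) j (red n x) = brank (ns n) j x"
    unfolding brank_def by (rule mrank_cong) (use False in \<open>auto simp: red_def block_def\<close>)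
  then show ?thesis by simp
qed simp

text \<open>
  The rank of \<open>a\<close> with the weights multiplied by \<open>c n j\<close>.  If \<open>c\<close> is nonnegative and this converges for
  all \<open>a\<close>, to a positive number for \<open>a = 1\<close>, then the normalized limit is a pseudo-rank function, as
  the required relations hold at all late levels.
\<close>

definition reweighted :: "(nat \<Rightarrow> nat \<Rightarrow> real) \<Rightarrow> nat \<Rightarrow> 'a \<Rightarrow> real" where
  "reweighted c n a = (\<Sum>j<length (ns n). c n j * (wt n j * real (brank (ns n) j (rep n a))))"

lemma reweighted_mono:
  assumes c: "\<And>n j. j < length (ns n) \<Longrightarrow> 0 \<le> c n j"
    and le: "\<And>j. j < length (ns n) \<Longrightarrow> brank (ns n) j (rep n a) \<le> brank (ns n) j (rep n b)"
  shows "reweighted c n a \<le> reweighted c n b"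
  unfolding reweighted_def
  by (intro sum_mono mult_left_mono) (use c le wt_nonneg in auto)

lemma reweighted_limit:
  assumes c: "\<And>n j. j < length (ns n) \<Longrightarrow> 0 \<le> c n j"
    and lim: "\<And>a. a \<in> carrier A \<Longrightarrow> (\<lambda>n. reweighted c n a) \<longlonglongrightarrow> G a"
    and pos: "0 < G \<one>"
  shows "(\<lambda>a\<in>carrier A. G a / G \<one>) \<in> pseudo_rank_functions A"
proof -
  have ev: "\<forall>\<^sub>F n in sequentially. a \<in> \<beta> n ` bmats (ns n)" if "a \<in> carrier A" for a
    using common_level[OF that] by (simp add: eventually_sequentially)
  have mult_le: "G (a \<otimes> b) \<le> G a" "G (a \<otimes> b) \<le> G b" if a: "a \<in> carrier A" and b: "b \<in> carrier A" for a b
  proof -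
    have "\<forall>\<^sub>F n in sequentially. reweighted c n (a \<otimes> b) \<le> reweighted c n a \<and> reweighted c n (a \<otimes> b) \<le> reweighted c n b"
      using ev[OF a] ev[OF b]
    proof eventually_elim
      case (elim n)
      have r: "rep n a \<in> bmats (ns n)" "rep n b \<in> bmats (ns n)" using rep_closed elim by auto
      show ?case
        using rank_like_mult[OF rank_like_brank r] 
        by (intro conjI reweighted_mono c) (auto simp: rep_mult[OF elim])
    qed
    then have e: "\<forall>\<^sub>F n in sequentially. reweighted c n (a \<otimes> b) \<le> reweighted c n a"
      "\<forall>\<^sub>F n in sequentially. reweighted c n (a \<otimes> b) \<le> reweighted c n b"
      by (auto elim: eventually_mono)
    show "G (a \<otimes> b) \<le> G a" "G (a \<otimes> b) \<le> G b"
      using tendsto_le[OF sequentially_bot lim[OF a] lim[of "a \<otimes> b"] e(1)]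
        tendsto_le[OF sequentially_bot lim[OF b] lim[of "a \<otimes> b"] e(2)] a b by auto
  qed
  have add_le: "G (a \<oplus> b) \<le> G a + G b" if a: "a \<in> carrier A" and b: "b \<in> carrier A" for a b
  proof -
    have "\<forall>\<^sub>F n in sequentially. reweighted c n (a \<oplus> b) \<le> reweighted c n a + reweighted c n b"
      using ev[OF a] ev[OF b]
    proof eventually_elim
      case (elim n)
      have r: "rep n a \<in> bmats (ns n)" "rep n b \<in> bmats (ns n)" using rep_closed elim by auto
      have "c n j * (wt n j * real (brank (ns n) j (rep n (a \<oplus> b)))) \<le>
         c n j * (wt n j * real (brank (ns n) j (rep n a))) + c n j * (wt n j * real (brank (ns n) j (rep n b)))"
        if j: "j < length (ns n)" for j
      proof -
        have "real (brank (ns n) j (rep n (a \<oplus> b))) \<le> real (brank (ns n) j (rep n a)) + real (brank (ns n) j (rep n b))"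
          unfolding rep_add[OF elim] by (rule rank_like_add[OF rank_like_brank r])
        then have "c n j * wt n j * real (brank (ns n) j (rep n (a \<oplus> b))) \<le>
          c n j * wt n j * (real (brank (ns n) j (rep n a)) + real (brank (ns n) j (rep n b)))"
          using c[OF j] wt_nonneg[OF j] by (intro mult_left_mono) auto
        then show ?thesis by (simp add: algebra_simps)
      qed
      then show ?case unfolding reweighted_def sum.distrib[symmetric] by (intro sum_mono) auto
    qed
    then show ?thesis using tendsto_le[OF sequentially_bot tendsto_add[OF lim[OF a] lim[OF b]] lim[of "a \<oplus> b"]] a b by simp
  qed
  have orth: "G (e \<oplus> f) = G e + G f" if e: "e \<in> idempotents A" and f: "f \<in> idempotents A"
    and ef: "e \<otimes> f = \<zero>" "f \<otimes> e = \<zero>" for e f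
  proof -
    have ce: "e \<in> carrier A" "e \<otimes> e = e" and cf: "f \<in> carrier A" "f \<otimes> f = f" using e f by (auto simp: idempotents_def)
    have "\<forall>\<^sub>F n in sequentially. reweighted c n (e \<oplus> f) = reweighted c n e + reweighted c n f"
      using ev[OF ce(1)] ev[OF cf(1)]
    proof eventually_elim
      case (elim n)
      have r: "rep n e \<in> bmats (ns n)" "rep n f \<in> bmats (ns n)" using rep_closed elim by auto
      have p: "bmult (ns n) (rep n e) (rep n e) = rep n e" "bmult (ns n) (rep n f) (rep n f) = rep n f"
        "bmult (ns n) (rep n e) (rep n f) = (\<lambda>r s. 0)" "bmult (ns n) (rep n f) (rep n e) = (\<lambda>r s. 0)"
        using rep_mult[OF elim(1,1)] rep_mult[OF elim(2,2)] rep_mult[OF elim] rep_mult[OF elim(2,1)] ce cf ef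
        by (simp_all add: rep_zero)
      have "real (brank (ns n) j (rep n (e \<oplus> f))) = real (brank (ns n) j (rep n e)) + real (brank (ns n) j (rep n f))" for j
        unfolding rep_add[OF elim] using rank_like_brank[of "ns n" j] r p unfolding rank_like_def by blast
      then show ?case by (simp add: reweighted_def distrib_left sum.distrib)
    qed
    then have "\<forall>\<^sub>F n in sequentially. reweighted c n e + reweighted c n f = reweighted c n (e \<oplus> f)"
      by eventually_elim (rule sym)
    then have "(\<lambda>n. reweighted c n (e \<oplus> f)) \<longlonglongrightarrow> G e + G f"
      by (rule Lim_transform_eventually[OF tendsto_add[OF lim[OF ce(1)] lim[OF cf(1)]]])
    then show ?thesis using LIMSEQ_unique[OF lim[of "e \<oplus> f"]] ce cf by simp
  qed
  have range: "0 \<le> G a" "G a \<le> G \<one>" if "a \<in> carrier A" for a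
  proof -
    have "0 \<le> reweighted c n a" for n
      unfolding reweighted_def by (intro sum_nonneg mult_nonneg_nonneg) (auto simp: c wt_nonneg)
    then show "0 \<le> G a" by (intro LIMSEQ_le_const[OF lim[OF that]]) auto
    show "G a \<le> G \<one>" using mult_le(1)[of \<one> a] that by simp
  qed
  show ?thesis
    unfolding pseudo_rank_functions_def
  proof (intro CollectI conjI ballI impI)
    show "(\<lambda>a\<in>carrier A. G a / G \<one>) \<in> carrier A \<rightarrow>\<^sub>E {0..1}" using range pos by auto
    show "(\<lambda>a\<in>carrier A. G a / G \<one>) \<one> = 1" using pos by simp
    fix a b assume ab: "a \<in> carrier A" "b \<in> carrier A"
    show "(\<lambda>a\<in>carrier A. G a / G \<one>) (a \<oplus> b) \<le> (\<lambda>a\<in>carrier A. G a / G \<one>) a + (\<lambda>a\<in>carrier A. G a / G \<one>) b"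
      using ab add_le[OF ab] pos by (simp add: divide_right_mono flip: add_divide_distrib)
    show "(\<lambda>a\<in>carrier A. G a / G \<one>) (a \<otimes> b) \<le> (\<lambda>a\<in>carrier A. G a / G \<one>) a"
      "(\<lambda>a\<in>carrier A. G a / G \<one>) (a \<otimes> b) \<le> (\<lambda>a\<in>carrier A. G a / G \<one>) b"
      using ab mult_le[OF ab] pos by (simp_all add: divide_right_mono)
  next
    fix e f assume ef: "e \<in> idempotents A" "f \<in> idempotents A" "e \<otimes> f = \<zero>" "f \<otimes> e = \<zero>"
    then have "e \<in> carrier A" "f \<in> carrier A" by (auto simp: idempotents_def)
    then show "(\<lambda>a\<in>carrier A. G a / G \<one>) (e \<oplus> f) = (\<lambda>a\<in>carrier A. G a / G \<one>) e + (\<lambda>a\<in>carrier A. G a / G \<one>) f"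
      using orth[OF ef] by (simp add: add_divide_distrib)
  qed
qed

end

context standard_system
begin

lemma cop_le: "i < length (ns m) \<Longrightarrow> j < length (ns (m + k)) \<Longrightarrow> cop m k i j \<le> ns (m + k) ! j"
proof -
  assume i: "i < length (ns m)" and j: "j < length (ns (m + k))"
  have "cop m k i j \<le> cop m k i j * ns m ! i" using size_pos[OF i] by simp
  also have "\<dots> \<le> (\<Sum>i<length (ns m). cop m k i j * ns m ! i)"
    by (rule member_le_sum) (use i in auto)
  finally show ?thesis by (simp add: sum_cop[OF j])
qed

lemma reweighted_beta:
  assumes "x \<in> bmats (ns n)"
  shows "reweighted c n (\<beta> n x) = (\<Sum>j<length (ns n). c n j * (wt n j * real (brank (ns n) j x)))"
  unfolding reweighted_def rep_beta[OF assms]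
  by (intro sum.cong refl) (simp only: wt_brank_red lessThan_iff)

text \<open>
  The second moment of the normalized rank \<open>cop m k i j / ns (m + k) ! j\<close>, in the blocks \<open>j\<close> of the
  level \<open>m + k\<close>, of a minimal idempotent in the block \<open>i\<close> of the level \<open>m\<close>.
\<close>

definition second_moment :: "nat \<Rightarrow> nat \<Rightarrow> nat \<Rightarrow> real" where
  "second_moment m i k = (\<Sum>j<length (ns (m + k)). wt (m + k) j * (real (cop m k i j))\<^sup>2 / real (ns (m + k) ! j))"

lemma second_moment_ge:
  assumes i: "i < length (ns m)"
  shows "(wt m i)\<^sup>2 \<le> second_moment m i k"
proof -
  have "(wt m i)\<^sup>2 = (\<Sum>j<length (ns (m + k)). wt (m + k) j * real (cop m k i j))\<^sup>2"
    using wt_trans[OF i, of k] by (simp add: mult.commute)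
  also have "\<dots> \<le> (\<Sum>j<length (ns (m + k)). wt (m + k) j * real (ns (m + k) ! j)) * second_moment m i k"
    unfolding second_moment_def by (rule weighted_Cauchy_Schwarz) (auto simp: wt_nonneg size_pos)
  finally show ?thesis by (simp add: sum_wt)
qed

lemma second_moment_le:
  assumes i: "i < length (ns m)"
  shows "second_moment m i k \<le> wt m i"
proof -
  have "second_moment m i k \<le> (\<Sum>j<length (ns (m + k)). real (cop m k i j) * wt (m + k) j)"
    unfolding second_moment_def
  proof (rule sum_mono)
    fix j assume "j \<in> {..<length (ns (m + k))}"
    then have j: "j < length (ns (m + k))" by simp
    have "(real (cop m k i j))\<^sup>2 \<le> real (cop m k i j) * real (ns (m + k) ! j)"
      unfolding power2_eq_square using cop_le[OF i j] by (intro mult_left_mono) auto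
    then have "(real (cop m k i j))\<^sup>2 / real (ns (m + k) ! j) \<le> real (cop m k i j)"
      using size_pos[OF j] by (simp add: pos_divide_le_eq)
    from mult_left_mono[OF this wt_nonneg[OF j]]
    show "wt (m + k) j * (real (cop m k i j))\<^sup>2 / real (ns (m + k) ! j) \<le> real (cop m k i j) * wt (m + k) j"
      by (simp add: mult.commute)
  qed
  then show ?thesis using wt_trans[OF i, of k] by simp
qed

text \<open>
  Reweighting the blocks by the normalized rank of a minimal idempotent \<open>e\<close> and by its complement
  splits \<open>N\<close> into a convex combination, so both normalized parts agree.  Evaluated at \<open>e\<close> itself this
  says that the second moment of the normalized rank of \<open>e\<close> is the square of its mean in the limit.
\<close>

lemma second_moment_tendsto:
  assumes ext: "extremal_pseudo_rank_function A N" and i: "i < length (ns m)"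
  shows "second_moment m i \<longlonglongrightarrow> (wt m i)\<^sup>2"
proof -
  have w01: "0 \<le> wt m i" "wt m i \<le> 1"
    using wt_nonneg[OF i] N_range(2)[OF beta_closed[OF bunit_in[OF i]]] by (simp_all add: wt_eq)
  consider "wt m i = 0" | "wt m i = 1" | "0 < wt m i" "wt m i < 1" using w01 by linarith
  then show ?thesis
  proof cases
    case 1
    then have k: "second_moment m i k = (wt m i)\<^sup>2" for k
      using second_moment_ge[OF i, of k] second_moment_le[OF i, of k] by simp
    have eq: "second_moment m i = (\<lambda>k. (wt m i)\<^sup>2)" by (rule HOL.ext) (rule k)
    show ?thesis unfolding eq by (rule tendsto_const)
  next
    case 2
    then have k: "second_moment m i k = (wt m i)\<^sup>2" for k
      using second_moment_ge[OF i, of k] second_moment_le[OF i, of k] by simp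
    have eq: "second_moment m i = (\<lambda>k. (wt m i)\<^sup>2)" by (rule HOL.ext) (rule k)
    show ?thesis unfolding eq by (rule tendsto_const)
  next
    case 3
    \<comment> \<open>the normalized rank of the minimal idempotent of the block \<open>i\<close>\<close>
    define c1 where "c1 n j = (if m \<le> n then real (cop m (n - m) i j) / real (ns n ! j) else 0)" for n j
    define c2 where "c2 n j = 1 - c1 n j" for n j
    have c1: "0 \<le> c1 n j" for n j by (simp add: c1_def)
    have c2: "0 \<le> c2 n j" if j: "j < length (ns n)" for n j
    proof (cases "m \<le> n")
      case True
      then have "cop m (n - m) i j \<le> ns n ! j" using cop_le[OF i, of j "n - m"] j by simp
      then show ?thesis using True size_pos[OF j] by (simp add: c2_def c1_def)
    qed (simp add: c2_def c1_def)
    define G1 where "G1 a = lim (\<lambda>n. reweighted c1 n a)" for a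
    have lim1: "(\<lambda>n. reweighted c1 n a) \<longlonglongrightarrow> G1 a" if a: "a \<in> carrier A" for a
    proof -
      obtain k0 where "a \<in> \<beta> (m + k0) ` bmats (ns (m + k0))"
        using common_level[OF a] by (meson le_add2)
      then obtain b where b: "b \<in> bmats (ns (m + k0))" "a = \<beta> (m + k0) b" by blast
      have eq: "reweighted c1 (l + (m + k0)) a =
          corr_form (m + k0) l (\<lambda>i'. real (cop m k0 i i')) (\<lambda>i'. real (brank (ns (m + k0)) i' b))" for l
      proof -
        let ?n = "m + k0 + l"
        have "a = \<beta> ?n (pull (trans (m + k0) l) b)" using beta_trans[OF b(1), of l] b(2) by simp
        then have "reweighted c1 ?n a = (\<Sum>j<length (ns ?n). c1 ?n j * (wt ?n j * real (brank (ns ?n) j (pull (trans (m + k0) l) b))))"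
          using reweighted_beta[OF pull_trans_closed[of "m + k0" l b], of c1] by simp
        also have "\<dots> = corr_form (m + k0) l (\<lambda>i'. real (cop m k0 i i')) (\<lambda>i'. real (brank (ns (m + k0)) i' b))"
          unfolding corr_form_def
        proof (intro sum.cong refl)
          fix j assume "j \<in> {..<length (ns ?n)}"
          then have j: "j < length (ns ?n)" by simp
          have "real (brank (ns ?n) j (pull (trans (m + k0) l) b)) = push (m + k0) l (\<lambda>i'. real (brank (ns (m + k0)) i' b)) j"
            using brank_trans[OF j b(1)] by (simp add: push_def mult.commute)
          moreover have "real (cop m (k0 + l) i j) = push (m + k0) l (\<lambda>i'. real (cop m k0 i i')) j"
            using cop_add[OF j i] by (simp add: push_def)
          moreover have "c1 ?n j = real (cop m (k0 + l) i j) / real (ns ?n ! j)" by (simp add: c1_def add.assoc)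
          ultimately show "c1 ?n j * (wt ?n j * real (brank (ns ?n) j (pull (trans (m + k0) l) b))) =
              wt ?n j * (push (m + k0) l (\<lambda>i'. real (cop m k0 i i')) j * push (m + k0) l (\<lambda>i'. real (brank (ns (m + k0)) i' b)) j) /
              real (ns ?n ! j)" by simp
        qed
        finally show ?thesis by (simp add: add.commute)
      qed
      have "convergent (\<lambda>l. reweighted c1 (l + (m + k0)) a)" unfolding eq by (rule corr_form_convergent)
      then obtain g where "(\<lambda>l. reweighted c1 (l + (m + k0)) a) \<longlonglongrightarrow> g" by (auto simp: convergent_def)
      then have "(\<lambda>n. reweighted c1 n a) \<longlonglongrightarrow> g" by (rule LIMSEQ_offset)
      then show ?thesis unfolding G1_def using limI by force
    qed
    define G2 where "G2 a = N a - G1 a" for a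
    have lim2: "(\<lambda>n. reweighted c2 n a) \<longlonglongrightarrow> G2 a" if a: "a \<in> carrier A" for a
    proof -
      obtain n0 where n0: "\<And>n. n \<ge> n0 \<Longrightarrow> a \<in> \<beta> n ` bmats (ns n)" using common_level[OF a] by blast
      have "N a - reweighted c1 n a = reweighted c2 n a" if n: "n \<ge> n0" for n
      proof -
        obtain b where b: "b \<in> bmats (ns n)" "a = \<beta> n b" using n0[OF n] by blast
        show ?thesis
          by (simp add: b(2) reweighted_beta[OF b(1)] N_beta[OF b(1)] c2_def left_diff_distrib sum_subtractf mult.commute)
      qed
      then have "\<forall>\<^sub>F n in sequentially. N a - reweighted c1 n a = reweighted c2 n a"
        by (auto simp: eventually_sequentially)
      then show ?thesis
        unfolding G2_def by (rule Lim_transform_eventually[OF tendsto_diff[OF tendsto_const lim1[OF a]]])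
    qed
    have c1one: "reweighted c1 (k + m) \<one> = wt m i" for k
    proof -
      have "reweighted c1 (m + k) (\<beta> (m + k) (bdiag (brows (ns (m + k))) 1)) = (\<Sum>j<length (ns (m + k)). real (cop m k i j) * wt (m + k) j)"
        unfolding reweighted_beta[OF bdiag_closed[OF subset_refl]]
      proof (intro sum.cong refl)
        fix j assume "j \<in> {..<length (ns (m + k))}"
        then have j: "j < length (ns (m + k))" by simp
        show "c1 (m + k) j * (wt (m + k) j * real (brank (ns (m + k)) j (bdiag (brows (ns (m + k))) 1 :: 'd bmat))) = real (cop m k i j) * wt (m + k) j"
          using brank_one[OF j, where 'a = 'd] size_pos[OF j] by (simp add: c1_def)
      qed
      then show ?thesis using wt_trans[OF i, of k] by (simp add: beta_one add.commute)
    qed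
    have "(\<lambda>n. reweighted c1 n \<one>) \<longlonglongrightarrow> wt m i"
      by (rule LIMSEQ_offset[of _ m]) (simp only: c1one tendsto_const)
    then have G1one: "G1 \<one> = wt m i" using LIMSEQ_unique[OF lim1[OF one_closed]] by simp
    then have G2one: "G2 \<one> = 1 - wt m i" by (simp add: G2_def N_one)
    let ?P = "\<lambda>a\<in>carrier A. G1 a / G1 \<one>" and ?Q = "\<lambda>a\<in>carrier A. G2 a / G2 \<one>"
    have P: "?P \<in> pseudo_rank_functions A"
      by (rule reweighted_limit[OF c1 lim1]) (use 3 G1one in auto)
    have Q: "?Q \<in> pseudo_rank_functions A"
      by (rule reweighted_limit[OF c2 lim2]) (use 3 G2one in auto)
    \<comment> \<open>\<open>N\<close> is the convex combination with coefficients \<open>wt m i\<close> and \<open>1 - wt m i\<close>\<close>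
    have conv: "\<forall>x\<in>carrier A. N x = (1 - (1 - wt m i)) * ?P x + (1 - wt m i) * ?Q x"
      using 3 by (simp add: G1one G2_def N_one)
    have extreme: "P = Q" if "P \<in> pseudo_rank_functions A" "Q \<in> pseudo_rank_functions A" "0 < t" "t < 1"
      "\<forall>x\<in>carrier A. N x = (1 - t) * P x + t * Q x" for P Q :: "'a \<Rightarrow> real" and t
      using ext that unfolding extremal_pseudo_rank_function_def by blast
    have PQ: "?P = ?Q"
      by (rule extreme[OF P Q _ _ conv]) (use 3 in simp_all)
    let ?e = "\<beta> m (bunit (i, 0) (i, 0))"
    have e: "?e \<in> carrier A" by (simp add: bunit_in[OF i])
    have "G1 ?e / wt m i = (wt m i - G1 ?e) / (1 - wt m i)"
      using fun_cong[OF PQ, of ?e] e by (simp add: G1one G2_def N_one wt_eq[symmetric])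
    then have G1e: "G1 ?e = (wt m i)\<^sup>2"
      using 3 by (simp add: field_simps power2_eq_square)
    have "reweighted c1 (k + m) ?e = second_moment m i k" for k
    proof -
      have "reweighted c1 (m + k) ?e = reweighted c1 (m + k) (\<beta> (m + k) (pull (trans m k) (bunit (i, 0) (i, 0))))"
        by (simp add: beta_trans bunit_in[OF i])
      also have "\<dots> = second_moment m i k"
        unfolding reweighted_beta[OF pull_trans_closed] second_moment_def
        by (intro sum.cong refl) (simp add: brank_trans_bunit c1_def power2_eq_square)
      finally show ?thesis by (simp add: add.commute)
    qed
    then show ?thesis using LIMSEQ_ignore_initial_segment[OF lim1[OF e], of m] G1e by simp
  qed
qed

text \<open>
  The variance of the normalized rank tends to \<open>0\<close>, and it bounds the square of the mean deviation by
  the Cauchy-Schwarz inequality.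
\<close>

lemma concentration:
  assumes ext: "extremal_pseudo_rank_function A N" and i: "i < length (ns m)"
  shows "(\<lambda>k. \<Sum>j<length (ns (m + k)). wt (m + k) j * \<bar>real (cop m k i j) - wt m i * real (ns (m + k) ! j)\<bar>) \<longlonglongrightarrow> 0"
proof -
  define X where "X k = (\<Sum>j<length (ns (m + k)). wt (m + k) j * \<bar>real (cop m k i j) - wt m i * real (ns (m + k) ! j)\<bar>)" for k
  have X0: "0 \<le> X k" for k unfolding X_def by (intro sum_nonneg mult_nonneg_nonneg) (auto simp: wt_nonneg)
  have X2: "(X k)\<^sup>2 \<le> second_moment m i k - (wt m i)\<^sup>2" for k
  proof -
    let ?J = "{..<length (ns (m + k))}" and ?w = "wt (m + k)" and ?d = "\<lambda>j. real (ns (m + k) ! j)"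
      and ?c = "\<lambda>j. real (cop m k i j)" and ?W = "wt m i"
    have "(X k)\<^sup>2 \<le> (\<Sum>j\<in>?J. ?w j * ?d j) * (\<Sum>j\<in>?J. ?w j * \<bar>?c j - ?W * ?d j\<bar>\<^sup>2 / ?d j)"
      unfolding X_def by (rule weighted_Cauchy_Schwarz) (auto simp: wt_nonneg size_pos)
    also have "\<dots> = (\<Sum>j\<in>?J. ?w j * (?c j - ?W * ?d j)\<^sup>2 / ?d j)" by (simp add: sum_wt)
    also have "\<dots> = (\<Sum>j\<in>?J. ?w j * (?c j)\<^sup>2 / ?d j - 2 * ?W * (?c j * ?w j) + ?W\<^sup>2 * (?w j * ?d j))"
    proof (intro sum.cong refl)
      fix j assume "j \<in> ?J"
      then have "?d j \<noteq> 0" using size_pos[of j "m + k"] by simp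
      then show "?w j * (?c j - ?W * ?d j)\<^sup>2 / ?d j = ?w j * (?c j)\<^sup>2 / ?d j - 2 * ?W * (?c j * ?w j) + ?W\<^sup>2 * (?w j * ?d j)"
        by (simp add: power2_eq_square field_simps)
    qed
    also have "\<dots> = second_moment m i k - 2 * ?W * (\<Sum>j\<in>?J. ?c j * ?w j) + ?W\<^sup>2 * (\<Sum>j\<in>?J. ?w j * ?d j)"
      by (simp only: sum.distrib sum_subtractf sum_distrib_left second_moment_def)
    also have "\<dots> = second_moment m i k - ?W\<^sup>2"
      using wt_trans[OF i, of k] by (simp add: sum_wt power2_eq_square)
    finally show ?thesis .
  qed
  have "(\<lambda>k. sqrt (second_moment m i k - (wt m i)\<^sup>2)) \<longlonglongrightarrow> sqrt ((wt m i)\<^sup>2 - (wt m i)\<^sup>2)"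
    by (intro tendsto_real_sqrt tendsto_diff second_moment_tendsto[OF ext i] tendsto_const)
  then have "(\<lambda>k. sqrt (second_moment m i k - (wt m i)\<^sup>2)) \<longlonglongrightarrow> 0" by simp
  moreover have "X k \<le> sqrt (second_moment m i k - (wt m i)\<^sup>2)" for k by (rule real_le_rsqrt[OF X2])
  ultimately have "X \<longlonglongrightarrow> 0"
    using tendsto_sandwich[of "\<lambda>k. 0" X sequentially "\<lambda>k. sqrt (second_moment m i k - (wt m i)\<^sup>2)" 0] X0 by simp
  then show ?thesis unfolding X_def .
qed

section \<open>Blocks of bounded size\<close>

lemma sum_wt_decseq: "decseq (\<lambda>n. \<Sum>j<length (ns n). wt n j)"
proof (rule decseq_SucI)
  fix n
  have "(\<Sum>j<length (ns (Suc n)). wt (Suc n) j) \<le> (\<Sum>j<length (ns (Suc n)). \<Sum>i<length (ns n). real (cop n 1 i j) * wt (Suc n) j)"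
  proof (rule sum_mono)
    fix j assume "j \<in> {..<length (ns (Suc n))}"
    then have j: "j < length (ns (n + 1))" by simp
    have "(\<Sum>i<length (ns n). cop n 1 i j) \<noteq> 0"
    proof
      assume "(\<Sum>i<length (ns n). cop n 1 i j) = 0"
      then have "(\<Sum>i<length (ns n). cop n 1 i j * ns n ! i) = 0" by simp
      from trans[OF sym[OF sum_cop[OF j]] this] show False using size_pos[OF j] by simp
    qed
    then have "1 \<le> (\<Sum>i<length (ns n). cop n 1 i j)" by linarith
    then have "real 1 \<le> real (\<Sum>i<length (ns n). cop n 1 i j)" by (simp only: of_nat_le_iff)
    then have "1 \<le> (\<Sum>i<length (ns n). real (cop n 1 i j))" by (simp only: of_nat_sum of_nat_1)
    from mult_right_mono[OF this wt_nonneg[OF j]]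
    show "wt (Suc n) j \<le> (\<Sum>i<length (ns n). real (cop n 1 i j) * wt (Suc n) j)"
      by (simp add: sum_distrib_right)
  qed
  also have "\<dots> = (\<Sum>i<length (ns n). \<Sum>j<length (ns (Suc n)). real (cop n 1 i j) * wt (Suc n) j)"
    by (rule sum.swap)
  also have "\<dots> = (\<Sum>i<length (ns n). wt n i)"
    using wt_trans[of _ n 1] by (intro sum.cong refl) simp
  finally show "(\<Sum>j<length (ns (Suc n)). wt (Suc n) j) \<le> (\<Sum>j<length (ns n). wt n j)" .
qed

text \<open>
  If blocks of size at most \<open>K\<close> keep a positive probability, then normalized ranks take their
  values in the finite set of fractions with denominator at most \<open>K\<close> with positive
  probability.  As they concentrate at \<open>N a\<close>, this number is such a fraction.
\<close>

lemma finite_range_if_bounded_blocks: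
  assumes ext: "extremal_pseudo_rank_function A N"
    and nz: "\<not> (\<lambda>n. \<Sum>j<length (ns n). wt n j) \<longlonglongrightarrow> 0"
  shows "finite (N ` carrier A)"
proof -
  define s where "s n = (\<Sum>j<length (ns n). wt n j)" for n
  have s0: "0 \<le> s n" for n unfolding s_def by (intro sum_nonneg) (simp add: wt_nonneg)
  have dec: "decseq s" using sum_wt_decseq unfolding s_def .
  obtain \<delta> where \<delta>: "s \<longlonglongrightarrow> \<delta>" "\<And>n. \<delta> \<le> s n"
    using decseq_convergent[OF dec, of 0] s0 by blast
  have "0 \<le> \<delta>" by (rule LIMSEQ_le_const[OF \<delta>(1)]) (use s0 in auto)
  moreover have "\<delta> \<noteq> 0" using nz \<delta>(1) unfolding s_def by auto
  ultimately have \<delta>0: "0 < \<delta>" by simp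
  obtain K :: nat where K: "2 / \<delta> < real K" using reals_Archimedean2 by blast
  have K0: "0 < real K" using K \<delta>0 by (meson divide_pos_pos less_trans zero_less_numeral)
  have small: "\<delta> / 2 \<le> (\<Sum>j | j < length (ns n) \<and> ns n ! j \<le> K. wt n j)" for n
  proof -
    have "s n = (\<Sum>j | j < length (ns n) \<and> ns n ! j \<le> K. wt n j) + (\<Sum>j | j < length (ns n) \<and> \<not> ns n ! j \<le> K. wt n j)"
      unfolding s_def by (subst sum.union_disjoint[symmetric]) (auto intro!: sum.cong)
    moreover have "(\<Sum>j | j < length (ns n) \<and> \<not> ns n ! j \<le> K. wt n j) \<le> \<delta> / 2"
    proof -
      have "(\<Sum>j | j < length (ns n) \<and> \<not> ns n ! j \<le> K. wt n j) \<le> (\<Sum>j | j < length (ns n) \<and> \<not> ns n ! j \<le> K. wt n j * real (ns n ! j) / K)"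
      proof (rule sum_mono)
        fix j assume "j \<in> {j. j < length (ns n) \<and> \<not> ns n ! j \<le> K}"
        then have "wt n j * real K \<le> wt n j * real (ns n ! j)" by (intro mult_left_mono wt_nonneg) auto
        then show "wt n j \<le> wt n j * real (ns n ! j) / K" using K0 by (simp add: pos_le_divide_eq)
      qed
      also have "\<dots> \<le> (\<Sum>j<length (ns n). wt n j * real (ns n ! j) / K)"
        by (rule sum_mono2) (auto simp: wt_nonneg)
      also have "\<dots> = 1 / K" by (simp add: sum_divide_distrib[symmetric] sum_wt)
      also have "\<dots> \<le> \<delta> / 2" using K K0 \<delta>0 by (simp add: field_simps)
      finally show ?thesis .
    qed
    ultimately show ?thesis using \<delta>(2)[of n] by simp
  qed
  \<comment> \<open>blocks of size at most \<open>K\<close> have total weight at least \<open>\<delta> / 2\<close>, and normalized ranks in them lie in \<open>F\<close>\<close>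
  define F where "F = (\<lambda>(p, q). real p / real q) ` ({..K} \<times> {..K})"
  have "finite F" by (simp add: F_def)
  moreover have "N a \<in> F" if a: "a \<in> carrier A" for a
  proof (rule ccontr)
    assume nF: "N a \<notin> F"
    define \<eta> where "\<eta> = Min ((\<lambda>f. \<bar>f - N a\<bar>) ` F)"
    have Fne: "F \<noteq> {}" by (auto simp: F_def)
    have "\<eta> \<in> (\<lambda>f. \<bar>f - N a\<bar>) ` F" unfolding \<eta>_def by (rule Min_in) (use \<open>finite F\<close> Fne in auto)
    then have \<eta>0: "0 < \<eta>" using nF by auto
    have \<eta>: "\<eta> \<le> \<bar>f - N a\<bar>" if "f \<in> F" for f
      unfolding \<eta>_def by (rule Min_le) (use \<open>finite F\<close> that in auto)
    obtain m b where b: "b \<in> bmats (ns m)" "a = \<beta> m b" using exhaust[OF a] by blast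
    have Na: "N a = (\<Sum>i<length (ns m). real (brank (ns m) i b) * wt m i)" using N_beta[OF b(1)] b(2) by simp
    define X where "X i k = (\<Sum>j<length (ns (m + k)). wt (m + k) j * \<bar>real (cop m k i j) - wt m i * real (ns (m + k) ! j)\<bar>)" for i k
    have "(\<lambda>k. \<Sum>i<length (ns m). real (brank (ns m) i b) * X i k) \<longlonglongrightarrow> (\<Sum>i<length (ns m). real (brank (ns m) i b) * 0)"
      unfolding X_def by (intro tendsto_sum tendsto_mult tendsto_const concentration[OF ext]) simp
    then have l: "(\<lambda>k. \<Sum>i<length (ns m). real (brank (ns m) i b) * X i k) \<longlonglongrightarrow> 0" by simp
    have "\<eta> * (\<delta> / 2) \<le> (\<Sum>i<length (ns m). real (brank (ns m) i b) * X i k)" for k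
    proof -
      let ?n = "m + k"
      let ?r = "\<lambda>j. real (brank (ns ?n) j (pull (trans m k) b))"
      have "\<eta> * (\<delta> / 2) \<le> \<eta> * (\<Sum>j | j < length (ns ?n) \<and> ns ?n ! j \<le> K. wt ?n j)"
        using \<eta>0 small by (intro mult_left_mono) auto
      also have "\<dots> \<le> (\<Sum>j | j < length (ns ?n) \<and> ns ?n ! j \<le> K. wt ?n j * \<bar>?r j - N a * real (ns ?n ! j)\<bar>)"
        unfolding sum_distrib_left
      proof (rule sum_mono)
        fix j assume "j \<in> {j. j < length (ns ?n) \<and> ns ?n ! j \<le> K}"
        then have j: "j < length (ns ?n)" "ns ?n ! j \<le> K" by auto
        have d: "0 < ns ?n ! j" using size_pos[OF j(1)] .
        have "brank (ns ?n) j (pull (trans m k) b) \<le> K" using brank_le[OF j(1), of "pull (trans m k) b"] j(2) by simp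
        then have "?r j / real (ns ?n ! j) \<in> F" using j(2) unfolding F_def by force
        then have "\<eta> \<le> \<bar>?r j / real (ns ?n ! j) - N a\<bar>" by (rule \<eta>)
        also have "?r j / real (ns ?n ! j) - N a = (?r j - N a * real (ns ?n ! j)) / real (ns ?n ! j)"
          using d by (simp add: field_simps)
        finally have "\<eta> * real (ns ?n ! j) \<le> \<bar>?r j - N a * real (ns ?n ! j)\<bar>"
          using d by (simp add: pos_le_divide_eq)
        moreover have "\<eta> * 1 \<le> \<eta> * real (ns ?n ! j)" using \<eta>0 d by (intro mult_left_mono) auto
        ultimately have "\<eta> \<le> \<bar>?r j - N a * real (ns ?n ! j)\<bar>" by linarith
        from mult_left_mono[OF this wt_nonneg[OF j(1)]]
        show "\<eta> * wt ?n j \<le> wt ?n j * \<bar>?r j - N a * real (ns ?n ! j)\<bar>" by (simp add: mult.commute)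
      qed
      also have "\<dots> \<le> (\<Sum>j<length (ns ?n). wt ?n j * \<bar>?r j - N a * real (ns ?n ! j)\<bar>)"
        by (rule sum_mono2) (auto simp: wt_nonneg)
      also have "\<dots> \<le> (\<Sum>j<length (ns ?n). \<Sum>i<length (ns m). real (brank (ns m) i b) *
           (wt ?n j * \<bar>real (cop m k i j) - wt m i * real (ns ?n ! j)\<bar>))"
      proof (rule sum_mono)
        fix j assume "j \<in> {..<length (ns ?n)}"
        then have j: "j < length (ns ?n)" by simp
        have "?r j - N a * real (ns ?n ! j) = (\<Sum>i<length (ns m). real (brank (ns m) i b) * (real (cop m k i j) - wt m i * real (ns ?n ! j)))"
        proof -
          have "?r j = (\<Sum>i<length (ns m). real (brank (ns m) i b) * real (cop m k i j))"
            using brank_trans[OF j b(1)] by (simp add: mult.commute)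
          moreover have "N a * real (ns ?n ! j) = (\<Sum>i<length (ns m). real (brank (ns m) i b) * (wt m i * real (ns ?n ! j)))"
            by (simp add: Na sum_distrib_right mult.assoc)
          ultimately show ?thesis by (simp add: right_diff_distrib sum_subtractf)
        qed
        then have "\<bar>?r j - N a * real (ns ?n ! j)\<bar> \<le> (\<Sum>i<length (ns m). \<bar>real (brank (ns m) i b) * (real (cop m k i j) - wt m i * real (ns ?n ! j))\<bar>)"
          by (simp only:) (rule sum_abs)
        from mult_left_mono[OF this wt_nonneg[OF j]]
        show "wt ?n j * \<bar>?r j - N a * real (ns ?n ! j)\<bar> \<le> (\<Sum>i<length (ns m). real (brank (ns m) i b) *
           (wt ?n j * \<bar>real (cop m k i j) - wt m i * real (ns ?n ! j)\<bar>))"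
          by (simp add: sum_distrib_left abs_mult mult_ac)
      qed
      also have "\<dots> = (\<Sum>i<length (ns m). real (brank (ns m) i b) * X i k)"
        unfolding X_def sum_distrib_left by (rule sum.swap)
      finally show ?thesis .
    qed
    then have "\<eta> * (\<delta> / 2) \<le> 0" by (intro LIMSEQ_le_const[OF l]) auto
    then show False using \<eta>0 \<delta>0 by (simp add: mult_le_0_iff)
  qed
  ultimately show ?thesis using finite_subset[of "N ` carrier A" F] by blast
qed

end

text \<open>
  With an inner inverse \<open>x\<close> of \<open>y\<close>, the idempotent \<open>g = exey\<close> generates the same left ideal as \<open>y\<close>, so
  \<open>N g = N y\<close>.  As \<open>y(e - y)\<close> has rank \<open>0\<close>, so has \<open>g(e - y)\<close>, and therefore \<open>N (e - y) \<le> N (e - g)\<close>.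
\<close>

lemma (in pseudo_rank_ring) rank_corner:
  assumes e: "e \<in> carrier R" "e \<otimes> e = e" and y: "y \<in> carrier R" "e \<otimes> y = y" "y \<otimes> e = y"
    and yy: "N (y \<otimes> y \<ominus> y) = 0" and x: "x \<in> carrier R" "y = y \<otimes> x \<otimes> y"
  shows "N y + N (e \<ominus> y) \<le> N e"
proof -
  define x' where "x' = e \<otimes> x \<otimes> e"
  define g where "g = x' \<otimes> y"
  have x': "x' \<in> carrier R" using e x by (simp add: x'_def)
  have g: "g \<in> carrier R" using x' y by (simp add: g_def)
  have "y \<otimes> x' \<otimes> y = (y \<otimes> e) \<otimes> x \<otimes> (e \<otimes> y)" using e x(1) y(1) unfolding x'_def by (simp add: m_assoc)
  then have yxy: "y \<otimes> x' \<otimes> y = y" using x(2) y by simp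
  have "e \<otimes> x' = (e \<otimes> e) \<otimes> x \<otimes> e" using e(1) x(1) by (simp add: x'_def m_assoc)
  then have ex: "e \<otimes> x' = x'" using e by (simp add: x'_def)
  have gg: "g \<otimes> g = g"
  proof -
    have "g \<otimes> g = x' \<otimes> (y \<otimes> x' \<otimes> y)" using x' y by (simp add: g_def m_assoc)
    then show ?thesis by (simp add: yxy g_def)
  qed
  have eg: "e \<otimes> g = g" using ex e x' y(1) by (simp add: g_def m_assoc[symmetric])
  have ge: "g \<otimes> e = g" using e x' y by (simp add: g_def m_assoc)
  have "N y \<le> N g"
  proof -
    have "y = y \<otimes> g" using yxy x' y by (simp add: g_def m_assoc)
    then show ?thesis using N_mult(2)[OF y(1) g] by simp
  qed
  have eg': "e \<ominus> g \<in> carrier R" using e g by simp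
  have 1: "g \<otimes> (e \<ominus> g) = \<zero>" "(e \<ominus> g) \<otimes> g = \<zero>"
    using e(1) g by (simp_all add: minus_eq r_distr l_distr r_minus l_minus gg eg ge r_neg)
  have 2: "(e \<ominus> g) \<otimes> (e \<ominus> g) = e \<ominus> g"
  proof -
    have "(e \<ominus> g) \<otimes> (e \<ominus> g) = e \<otimes> (e \<ominus> g) \<ominus> g \<otimes> (e \<ominus> g)"
      using e(1) g eg' by (simp add: minus_eq l_distr l_minus)
    also have "\<dots> = e \<otimes> (e \<ominus> g)" using 1 e(1) eg' by (simp add: minus_eq)
    also have "\<dots> = e \<ominus> g" using e g by (simp add: minus_eq r_distr r_minus eg)
    finally show ?thesis .
  qed
  have "g \<oplus> (e \<ominus> g) = e" using e(1) g by (simp add: minus_eq a_lcomm r_neg)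
  then have Neg: "N e = N g + N (e \<ominus> g)"
    using N_orthogonal[of g "e \<ominus> g"] g eg' gg 1 2 by (simp add: idempotents_def)
  define b where "b = e \<ominus> y"
  have b: "b \<in> carrier R" using e y by (simp add: b_def)
  have eb: "e \<otimes> b = b" using e y by (simp add: b_def minus_eq r_distr r_minus)
  have "b = g \<otimes> b \<oplus> (e \<ominus> g) \<otimes> b"
  proof -
    have "g \<otimes> b \<oplus> (e \<ominus> g) \<otimes> b = g \<otimes> b \<oplus> (b \<ominus> g \<otimes> b)"
      using e(1) g b by (simp add: minus_eq l_distr l_minus eb)
    also have "\<dots> = b" using g b by (simp add: minus_eq a_lcomm r_neg)
    finally show ?thesis ..
  qed
  then have "N b \<le> N (g \<otimes> b) + N ((e \<ominus> g) \<otimes> b)"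
    using N_add[of "g \<otimes> b" "(e \<ominus> g) \<otimes> b"] g b eg' by simp
  moreover have "N (g \<otimes> b) \<le> N (y \<otimes> b)"
    using N_mult(2)[of x' "y \<otimes> b"] x' y(1) b by (simp add: g_def m_assoc)
  moreover have "y \<otimes> b = \<ominus> (y \<otimes> y \<ominus> y)"
    using e y by (simp add: b_def minus_eq r_distr r_minus minus_add a_comm)
  then have "N (y \<otimes> b) = 0" using N_minus[of "y \<otimes> y \<ominus> y"] yy y(1) by simp
  moreover have "N ((e \<ominus> g) \<otimes> b) \<le> N (e \<ominus> g)" using N_mult(1)[OF eg' b] .
  ultimately show ?thesis using Neg \<open>N y \<le> N g\<close> unfolding b_def by linarith
qed

context standard_system
begin

lemma regular: "a \<in> carrier A \<Longrightarrow> \<exists>x\<in>carrier A. a = a \<otimes> x \<otimes> a"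
proof -
  assume "a \<in> carrier A"
  then obtain n b where b: "b \<in> bmats (ns n)" "a = \<beta> n b" using exhaust by blast
  obtain y where y: "y \<in> bmats (ns n)" "b = bmult (ns n) (bmult (ns n) b y) b"
    using block_ring_regular[OF b(1)] by blast
  have "\<beta> n b = \<beta> n b \<otimes> \<beta> n y \<otimes> \<beta> n b"
    using arg_cong[OF y(2), of "\<beta> n"] b(1) y(1) by (simp add: beta_mult)
  then show ?thesis using b y(1) by auto
qed

text \<open>
  If \<open>N\<close> takes finitely many values, idempotents of least positive rank are abelian: modulo elements
  of rank zero, an idempotent of their corner has rank \<open>0\<close> or the full rank.
\<close>

lemma abelian_idempotent_if_finite_range:
  assumes fin: "finite (N ` carrier A)"
  shows "\<exists>e. abelian_idempotent (completion A N) e \<and> e \<noteq> \<zero>\<^bsub>completion A N\<^esub>"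
proof -
  let ?Q = "completion A N" and ?C = "cauchy_ring A N"
  let ?cl = "\<lambda>s. null_sequences A N +>\<^bsub>?C\<^esub> s"
  define V where "V = {v \<in> N ` carrier A. 0 < v}"
  have finV: "finite V" using fin by (simp add: V_def)
  have "1 \<in> V" using N_one one_closed by (force simp: V_def)
  define \<mu> where "\<mu> = Min V"
  have \<mu>V: "\<mu> \<in> V" unfolding \<mu>_def by (rule Min_in) (use finV \<open>1 \<in> V\<close> in auto)
  have \<mu>0: "0 < \<mu>" using \<mu>V by (simp add: V_def)
  have small: "N a = 0" if "a \<in> carrier A" "N a < \<mu>" for a
  proof (rule ccontr)
    assume "N a \<noteq> 0"
    then have "N a \<in> V" using that N_range(1)[OF that(1)] by (simp add: V_def)
    then have "\<mu> \<le> N a" unfolding \<mu>_def by (intro Min_le finV)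
    then show False using that by simp
  qed
  obtain x0 where x0: "x0 \<in> carrier A" "N x0 = \<mu>" using \<mu>V by (auto simp: V_def)
  obtain n b where b: "b \<in> bmats (ns n)" "x0 = \<beta> n b" using exhaust[OF x0(1)] by blast
  have "\<exists>i<length (ns n). real (brank (ns n) i b) * wt n i \<noteq> 0"
  proof (rule ccontr)
    assume "\<not> ?thesis"
    then have "N x0 = 0" using N_beta[OF b(1)] b(2) by (simp add: sum.neutral)
    then show False using x0 \<mu>0 by simp
  qed
  then obtain i where i: "i < length (ns n)" "brank (ns n) i b \<noteq> 0" "wt n i \<noteq> 0" by auto
  define e where "e = \<beta> n (bunit (i, 0) (i, 0))"
  have e: "e \<in> carrier A" by (simp add: e_def bunit_in[OF i(1)])
  have "(i, 0) \<in> brows (ns n)" using i(1) size_pos by (simp add: brows_def)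
  then have ee: "e \<otimes> e = e"
    using beta_mult[OF bunit_in[OF i(1)] bunit_in[OF i(1)]] by (simp add: e_def bunit_mult)
  have "wt n i \<le> real (brank (ns n) i b) * wt n i"
    using i mult_right_mono[of 1 "real (brank (ns n) i b)" "wt n i"] wt_nonneg[OF i(1)] by simp
  also have "\<dots> \<le> (\<Sum>i<length (ns n). real (brank (ns n) i b) * wt n i)"
    by (rule member_le_sum) (use i in \<open>auto simp: wt_nonneg\<close>)
  also have "\<dots> = \<mu>" using N_beta[OF b(1)] b(2) x0 by simp
  finally have "N e \<le> \<mu>" by (simp add: e_def wt_eq)
  moreover have "N e \<noteq> 0" using i(3) by (simp add: e_def wt_eq)
  ultimately have Ne: "N e = \<mu>" using small[OF e] by fastforce
  define e' where "e' = completion_map A N e"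
  interpret Q: ring ?Q by (rule ring_completion)
  note clhom = coset_hom and cmap = completion_map_hom
  have e': "e' \<in> carrier ?Q" "e' \<otimes>\<^bsub>?Q\<^esub> e' = e'"
    using ring_hom_closed[OF cmap e] ring_hom_mult[OF cmap e e] ee by (simp_all add: e'_def)
  have e'cl: "e' = ?cl (\<lambda>n. e)" by (simp add: e'_def completion_map_def)
  have "e' \<noteq> \<zero>\<^bsub>?Q\<^esub>"
  proof
    assume "e' = \<zero>\<^bsub>?Q\<^esub>"
    then have "(\<lambda>n. e) \<in> null_sequences A N"
      using coset_null_iff[OF cauchy_const[OF e]] by (simp add: e'cl zero_completion)
    then have "(\<lambda>n::nat. N e) \<longlonglongrightarrow> 0" by (simp add: null_sequences_def)
    then show False using LIMSEQ_unique[OF _ tendsto_const[of "N e"]] Ne \<mu>0 by fastforce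
  qed
  moreover have "f = \<zero>\<^bsub>?Q\<^esub> \<or> f = e'" if f: "f \<in> idempotents (corner_ring ?Q e')" for f
  proof -
    have ff: "f \<otimes>\<^bsub>?Q\<^esub> f = f" and "f \<in> (\<lambda>x. e' \<otimes>\<^bsub>?Q\<^esub> x \<otimes>\<^bsub>?Q\<^esub> e') ` carrier ?Q"
      using f by (simp_all add: idempotents_def corner_ring_def)
    then obtain g where g: "g \<in> carrier ?Q" "f = e' \<otimes>\<^bsub>?Q\<^esub> g \<otimes>\<^bsub>?Q\<^esub> e'" by blast
    obtain s where s: "s \<in> cauchy_sequences A N" "g = ?cl s" using g(1) unfolding carrier_completion by blast
    have sA: "s k \<in> carrier A" for k using cauchy_sequencesD(1)[OF s(1)] .
    define t where "t k = e \<otimes> s k \<otimes> e" for k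
    have tA: "t k \<in> carrier A" for k using e sA by (simp add: t_def)
    have es: "(\<lambda>k. e \<otimes> s k) \<in> cauchy_sequences A N"
      by (rule cauchy_op[OF cauchy_const[OF e] s(1)]) (simp_all add: N_mult_diff)
    have t: "t \<in> cauchy_sequences A N"
      unfolding t_def by (rule cauchy_op[OF es cauchy_const[OF e]]) (simp_all add: N_mult_diff)
    have ft: "f = ?cl t"
      using ring_hom_mult[OF clhom, of "\<lambda>k. e" s] ring_hom_mult[OF clhom, of "\<lambda>k. e \<otimes> s k" "\<lambda>k. e"]
        cauchy_const[OF e] s es unfolding g(2) e'cl by (simp add: t_def[abs_def])
    have tt: "(\<lambda>k. t k \<otimes> t k) \<in> cauchy_sequences A N"
      by (rule cauchy_op[OF t t, where f = "\<lambda>a b. a \<otimes> b"]) (simp_all add: N_mult_diff)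
    have "?cl (\<lambda>k. t k \<otimes> t k) = ?cl t"
      using ring_hom_mult[OF clhom, of t t] t ff by (simp add: ft)
    then have "(\<lambda>k. t k \<otimes> t k \<ominus> t k) \<in> null_sequences A N" using coset_eq_iff[OF tt t] by simp
    then have "(\<lambda>k. N (t k \<otimes> t k \<ominus> t k)) \<longlonglongrightarrow> 0" by (simp add: null_sequences_def)
    from order_tendstoD(2)[OF this \<mu>0] obtain K1 where K1: "\<And>k. k \<ge> K1 \<Longrightarrow> N (t k \<otimes> t k \<ominus> t k) < \<mu>"
      by (auto simp: eventually_sequentially)
    obtain K2 where K2: "\<And>k l. k \<ge> K2 \<Longrightarrow> l \<ge> K2 \<Longrightarrow> N (t k \<ominus> t l) < \<mu>"
      using cauchy_sequencesD(2)[OF t \<mu>0] by blast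
    \<comment> \<open>ranks below \<open>\<mu>\<close> vanish, so the sequence \<open>t\<close> in the corner of \<open>e\<close> is constant from \<open>K\<close> on, up to rank \<open>0\<close>\<close>
    define K where "K = max K1 K2"
    define y where "y = t K"
    have y: "y \<in> carrier A" by (simp add: y_def tA)
    have yy: "N (y \<otimes> y \<ominus> y) = 0" using K1[of K] by (intro small) (simp_all add: y_def tA K_def)
    have ty: "N (t k \<ominus> y) = 0" if "k \<ge> K" for k
      using K2[of k K] that by (intro small) (simp_all add: y_def tA K_def)
    have "e \<otimes> y = (e \<otimes> e) \<otimes> s K \<otimes> e" using e sA by (simp add: y_def t_def m_assoc)
    then have ey: "e \<otimes> y = y" by (simp add: ee y_def t_def)
    have ye: "y \<otimes> e = y" using e sA ee by (simp add: y_def t_def m_assoc)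
    obtain x where x: "x \<in> carrier A" "y = y \<otimes> x \<otimes> y" using regular[OF y] by blast
    have le: "N y + N (e \<ominus> y) \<le> \<mu>" using rank_corner[OF e ee y ey ye yy x] Ne by simp
    show ?thesis
    proof (cases "N y = 0")
      case True
      have "N (t k) = 0" if "k \<ge> K" for k
        using N_diff_ge[OF tA[of k] y] ty[OF that] True by simp
      then have "(\<lambda>k. N (t k)) \<longlonglongrightarrow> 0"
        by (intro tendsto_eventually) (auto simp: eventually_sequentially)
      then have "t \<in> null_sequences A N" using tA by (auto simp: null_sequences_def)
      then show ?thesis using coset_null_iff[OF t] by (simp add: ft zero_completion)
    next
      case False
      then have "\<not> N y < \<mu>" using small[OF y] by blast
      moreover have "0 \<le> N (e \<ominus> y)" using e y by (intro N_range) simp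
      ultimately have ey0: "N (e \<ominus> y) = 0" using le by linarith
      have "N (t k \<ominus> e) = 0" if "k \<ge> K" for k
      proof -
        have "N (t k \<ominus> e) \<le> N (t k \<ominus> y) + N (y \<ominus> e)" by (intro N_triangle tA y e)
        also have "\<dots> = 0" using ty[OF that] ey0 N_diff_commute[OF e y] by simp
        finally show ?thesis using N_range(1)[of "t k \<ominus> e"] tA e by fastforce
      qed
      then have "(\<lambda>k. N (t k \<ominus> e)) \<longlonglongrightarrow> 0"
        by (intro tendsto_eventually) (auto simp: eventually_sequentially)
      then have "(\<lambda>k. t k \<ominus> e) \<in> null_sequences A N" using tA e by (auto simp: null_sequences_def)
      then show ?thesis using coset_eq_iff[OF t cauchy_const[OF e]] by (simp add: ft e'cl)
    qed
  qed
  moreover have "central (corner_ring ?Q e') \<zero>\<^bsub>?Q\<^esub>" "central (corner_ring ?Q e') e'"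
  proof -
    have 1: "\<zero>\<^bsub>?Q\<^esub> = e' \<otimes>\<^bsub>?Q\<^esub> \<zero>\<^bsub>?Q\<^esub> \<otimes>\<^bsub>?Q\<^esub> e'" "e' = e' \<otimes>\<^bsub>?Q\<^esub> e' \<otimes>\<^bsub>?Q\<^esub> e'" using e' by simp_all
    have 2: "e' \<otimes>\<^bsub>?Q\<^esub> (e' \<otimes>\<^bsub>?Q\<^esub> x \<otimes>\<^bsub>?Q\<^esub> e') = (e' \<otimes>\<^bsub>?Q\<^esub> x \<otimes>\<^bsub>?Q\<^esub> e') \<otimes>\<^bsub>?Q\<^esub> e'" if "x \<in> carrier ?Q" for x
    proof -
      have "e' \<otimes>\<^bsub>?Q\<^esub> (e' \<otimes>\<^bsub>?Q\<^esub> x \<otimes>\<^bsub>?Q\<^esub> e') = (e' \<otimes>\<^bsub>?Q\<^esub> e') \<otimes>\<^bsub>?Q\<^esub> x \<otimes>\<^bsub>?Q\<^esub> e'"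
        using e'(1) that by (simp add: Q.m_assoc)
      moreover have "(e' \<otimes>\<^bsub>?Q\<^esub> x \<otimes>\<^bsub>?Q\<^esub> e') \<otimes>\<^bsub>?Q\<^esub> e' = e' \<otimes>\<^bsub>?Q\<^esub> x \<otimes>\<^bsub>?Q\<^esub> (e' \<otimes>\<^bsub>?Q\<^esub> e')"
        using e'(1) that by (simp add: Q.m_assoc)
      ultimately show ?thesis by (simp add: e'(2))
    qed
    show "central (corner_ring ?Q e') \<zero>\<^bsub>?Q\<^esub>"
      using 1(1) e'(1) by (auto simp: central_def corner_ring_def intro!: image_eqI[of _ _ "\<zero>\<^bsub>?Q\<^esub>"])
    show "central (corner_ring ?Q e') e'"
      using 1(2) 2 e'(1) by (auto simp: central_def corner_ring_def intro!: image_eqI[of _ _ e'])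
  qed
  ultimately show ?thesis
    using e' unfolding abelian_idempotent_def by (intro exI[of _ e']) (auto simp: idempotents_def)
qed

theorem sum_wt_tendsto_0:
  assumes "extremal_pseudo_rank_function A N"
    and "\<And>e. abelian_idempotent (completion A N) e \<Longrightarrow> e = \<zero>\<^bsub>completion A N\<^esub>"
  shows "(\<lambda>n. \<Sum>j<length (ns n). wt n j) \<longlonglongrightarrow> 0"
proof (rule ccontr)
  assume "\<not> ?thesis"
  from abelian_idempotent_if_finite_range[OF finite_range_if_bounded_blocks[OF assms(1) this]]
  obtain e where e: "abelian_idempotent (completion A N) e" "e \<noteq> \<zero>\<^bsub>completion A N\<^esub>" by (elim exE conjE)
  show False using assms(2)[OF e(1)] e(2) by (rule notE[rotated])
qed

end

section \<open>Approximate intertwining\<close>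

lemma eventually_inverse_power_less:
  assumes "(0::real) < \<epsilon>"
  shows "\<forall>\<^sub>F h in sequentially. C / 2 ^ h < \<epsilon>"
proof -
  have "(\<lambda>h. C * (1 / 2) ^ h) \<longlonglongrightarrow> C * 0"
    by (intro tendsto_mult tendsto_const LIMSEQ_realpow_zero) auto
  then have "(\<lambda>h. C / 2 ^ h) \<longlonglongrightarrow> 0" by (simp add: power_divide)
  then show ?thesis by (rule order_tendstoD(2)) (rule assms)
qed

locale intertwining = A: standard_system A N \<iota> nsA LA \<beta>A + T: standard_system T M \<kappa> nsT LT \<beta>T
  for A (structure) and N and \<iota> :: "'d::division_ring \<Rightarrow> 'a" and nsA LA \<beta>A
    and T (structure) and M and \<kappa> :: "'d \<Rightarrow> 'c" and nsT LT \<beta>T +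
  assumes nsT: "nsT m = [2 ^ m]"
    and rank_T: "t \<in> carrier T \<Longrightarrow> M t = 0 \<Longrightarrow> t = \<zero>\<^bsub>T\<^esub>"
    and extremal: "extremal_pseudo_rank_function A N"
    and small_blocks: "(\<lambda>n. \<Sum>j<length (nsA n). A.wt n j) \<longlonglongrightarrow> 0"
begin

lemma wt_T: "T.wt m 0 = 1 / 2 ^ m"
  using T.sum_wt[of m] by (simp add: nsT field_simps)

lemma cop_T: "T.cop m h 0 0 = 2 ^ h"
  using T.sum_cop[of 0 m h] by (simp add: nsT power_add)

lemma fst_brows_T: "r \<in> brows (nsT m) \<Longrightarrow> fst r = 0"
  by (auto simp: brows_def nsT)

lemma block_T: "block (nsT m) 0 = brows (nsT m)"
  using fst_brows_T unfolding block_def by blast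

lemma sum_wt_T: "Z \<subseteq> brows (nsT m) \<Longrightarrow> (\<Sum>r\<in>Z. T.wt m (fst r)) = real (card Z) / 2 ^ m"
proof -
  assume Z: "Z \<subseteq> brows (nsT m)"
  have "(\<Sum>r\<in>Z. T.wt m (fst r)) = (\<Sum>r\<in>Z. 1 / 2 ^ m)"
  proof (intro sum.cong refl)
    fix r assume "r \<in> Z"
    then have "r \<in> brows (nsT m)" using Z by blast
    then show "T.wt m (fst r) = 1 / 2 ^ m" by (simp add: fst_brows_T wt_T)
  qed
  then show ?thesis by simp
qed

text \<open>
  A labelling that embeds the level \<open>n\<close> of \<open>A\<close> in the level \<open>m\<close> of the dyadic system, decreases
  ranks, and leaves at most a fraction \<open>\<epsilon>\<close> of the rows uncovered.
\<close>

definition good :: "nat \<Rightarrow> nat \<Rightarrow> labelling \<Rightarrow> real \<Rightarrow> bool" where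
  "good n m \<theta> \<epsilon> \<longleftrightarrow> labelling (nsT m) (nsA n) \<theta> \<and>
     (\<forall>i<length (nsA n). real (copies (nsT m) \<theta> i 0) / 2 ^ m \<le> A.wt n i) \<and>
     (\<Sum>i<length (nsA n). (A.wt n i - real (copies (nsT m) \<theta> i 0) / 2 ^ m) * real (nsA n ! i)) \<le> \<epsilon>"

text \<open>
  The passage from a good labelling to the next one, through a labelling that embeds the level
  \<open>m\<close> of the dyadic system in the level \<open>n'\<close> of \<open>A\<close>: both triangles commute approximately.
\<close>

definition link :: "nat \<Rightarrow> nat \<Rightarrow> labelling \<Rightarrow> nat \<Rightarrow> nat \<Rightarrow> labelling \<Rightarrow> labelling \<Rightarrow> real \<Rightarrow> real \<Rightarrow> bool" where
  "link n m \<theta> n' m' \<theta>' \<chi> \<epsilon> \<delta> \<longleftrightarrow> n < n' \<and> m < m' \<and> labelling (nsA n') (nsT m) \<chi> \<and>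
     (\<exists>Z\<subseteq>brows (nsA n'). agree_off (nsA n') (lcomp \<theta> \<chi>) (A.trans n (n' - n)) Z \<and>
        (\<Sum>r\<in>Z. A.wt n' (fst r)) \<le> \<epsilon> + \<delta>) \<and>
     (\<exists>Z\<subseteq>brows (nsT m'). agree_off (nsT m') (lcomp \<chi> \<theta>') (T.trans m (m' - m)) Z \<and>
        (\<Sum>r\<in>Z. T.wt m' (fst r)) \<le> \<delta>)"

text \<open>
  Each block \<open>l\<close> of a late level of \<open>A\<close> receives as many copies of the dyadic block as fit into it.
  Let \<open>D l\<close> be its size.  By concentration it contains about \<open>wt n i * D l\<close> copies of the block \<open>i\<close> of
  the level \<open>n\<close>, whereas the dyadic copies provide about \<open>D l * (s i / 2 ^ m)\<close>, where \<open>s i\<close> is the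
  number of copies of \<open>i\<close> under \<open>\<theta>\<close>.  The exceptional rows thus have three sources: the deviation in
  the concentration, the defect \<open>\<epsilon>\<close> of \<open>\<theta>\<close>, and the rounding by at most one dyadic copy per block,
  of weight at most \<open>2 ^ m\<close> times the total weight of the blocks.
\<close>

lemma embed_dyadic_level:
  assumes g: "good n m \<theta> \<epsilon>" and \<delta>: "0 < \<delta>" and \<epsilon>: "0 \<le> \<epsilon>"
  shows "\<exists>k>0. \<exists>\<chi> Z. labelling (nsA (n + k)) (nsT m) \<chi> \<and>
     (\<forall>l<length (nsA (n + k)). copies (nsA (n + k)) \<chi> 0 l = nsA (n + k) ! l div 2 ^ m) \<and>
     Z \<subseteq> brows (nsA (n + k)) \<and> agree_off (nsA (n + k)) (lcomp \<theta> \<chi>) (A.trans n k) Z \<and>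
     (\<Sum>r\<in>Z. A.wt (n + k) (fst r)) \<le> \<epsilon> + \<delta> \<and>
     2 ^ m * (\<Sum>j<length (nsA (n + k)). A.wt (n + k) j) \<le> \<delta>"
proof -
  define s where "s i = copies (nsT m) \<theta> i 0" for i
  define d where "d i = real (nsA n ! i)" for i
  let ?I = "{..<length (nsA n)}"
  have lab: "labelling (nsT m) (nsA n) \<theta>" and s_le: "\<And>i. i < length (nsA n) \<Longrightarrow> real (s i) / 2 ^ m \<le> A.wt n i"
    and def: "(\<Sum>i\<in>?I. (A.wt n i - real (s i) / 2 ^ m) * d i) \<le> \<epsilon>"
    using g by (auto simp: good_def s_def d_def)
  define X where "X i k = (\<Sum>j<length (nsA (n + k)). A.wt (n + k) j *
      \<bar>real (A.cop n k i j) - A.wt n i * real (nsA (n + k) ! j)\<bar>)" for i k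
  define S where "S k = (\<Sum>j<length (nsA (n + k)). A.wt (n + k) j)" for k
  have X_lim: "X i \<longlonglongrightarrow> 0" if "i \<in> ?I" for i
    unfolding X_def using A.concentration[OF extremal] that by simp
  have S_lim: "S \<longlonglongrightarrow> 0"
    unfolding S_def using LIMSEQ_ignore_initial_segment[OF small_blocks, of n] by (simp add: add.commute)
  have "(\<lambda>k. (\<Sum>i\<in>?I. d i * X i k) + 2 ^ m * S k) \<longlonglongrightarrow> (\<Sum>i\<in>?I. d i * 0) + 2 ^ m * 0"
    by (intro tendsto_add tendsto_sum tendsto_mult tendsto_const S_lim X_lim)
  then have "(\<lambda>k. (\<Sum>i\<in>?I. d i * X i k) + 2 ^ m * S k) \<longlonglongrightarrow> 0" by simp
  from order_tendstoD(2)[OF this \<delta>] eventually_gt_at_top[of 0]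
  have "\<forall>\<^sub>F k in sequentially. 0 < k \<and> (\<Sum>i\<in>?I. d i * X i k) + 2 ^ m * S k < \<delta>"
    by eventually_elim simp
  then obtain k where k: "0 < k" "(\<Sum>i\<in>?I. d i * X i k) + 2 ^ m * S k < \<delta>"
    by (auto simp: eventually_sequentially)
  let ?n = "n + k"
  let ?J = "{..<length (nsA ?n)}"
  define D where "D l = real (nsA ?n ! l)" for l
  define u where "u l = nsA ?n ! l div 2 ^ m" for l
  have X0: "0 \<le> X i k" for i unfolding X_def by (intro sum_nonneg mult_nonneg_nonneg) (auto simp: A.wt_nonneg)
  obtain \<chi> Z where \<chi>: "labelling (nsA ?n) (nsT m) \<chi>"
    and cop: "\<forall>j<length (nsT m). \<forall>l<length (nsA ?n). copies (nsA ?n) \<chi> j l = u l"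
    and Z: "Z \<subseteq> brows (nsA ?n)" "agree_off (nsA ?n) (lcomp \<theta> \<chi>) (A.trans n k) Z"
    and cZ: "\<forall>l<length (nsA ?n). card (Z \<inter> block (nsA ?n) l) \<le>
       (\<Sum>i<length (nsA n). nsA n ! i * (copies (nsA ?n) (A.trans n k) i l - (\<Sum>j<length (nsT m). u l * copies (nsT m) \<theta> i j)))"
    using matching[OF A.total_trans[of n k] lab A.sizes T.sizes, of "\<lambda>j l. u l"]
    by (auto simp: nsT u_def)
  have bnd: "real (A.cop n k i l - u l * s i) \<le> \<bar>real (A.cop n k i l) - A.wt n i * D l\<bar>
      + D l * (A.wt n i - real (s i) / 2 ^ m) + real (s i)"
    if i: "i < length (nsA n)" and l: "l < length (nsA ?n)" for i l
  proof -
    have nn: "0 \<le> D l * (A.wt n i - real (s i) / 2 ^ m)" using s_le[OF i] by (simp add: D_def)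
    have "nsA ?n ! l = 2 ^ m * u l + nsA ?n ! l mod 2 ^ m" by (simp add: u_def)
    moreover have "nsA ?n ! l mod 2 ^ m < 2 ^ m" by simp
    ultimately have "nsA ?n ! l \<le> 2 ^ m * u l + 2 ^ m" by linarith
    then have "real (nsA ?n ! l) \<le> real (2 ^ m * u l + 2 ^ m)" by (simp only: of_nat_le_iff)
    then have "D l \<le> 2 ^ m * real (u l) + 2 ^ m" by (simp add: D_def)
    then have "D l / 2 ^ m \<le> real (u l) + 1" by (simp add: field_simps)
    then have "(D l / 2 ^ m - real (u l)) * real (s i) \<le> 1 * real (s i)" by (intro mult_right_mono) auto
    then have us: "D l * (real (s i) / 2 ^ m) - real (u l) * real (s i) \<le> real (s i)"
      by (simp add: left_diff_distrib)
    have "real (A.cop n k i l) - real (u l) * real (s i) =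
        (real (A.cop n k i l) - A.wt n i * D l) + D l * (A.wt n i - real (s i) / 2 ^ m)
        + (D l * (real (s i) / 2 ^ m) - real (u l) * real (s i))"
      by (simp add: algebra_simps)
    also have "\<dots> \<le> \<bar>real (A.cop n k i l) - A.wt n i * D l\<bar> + D l * (A.wt n i - real (s i) / 2 ^ m) + real (s i)"
      using us by linarith
    finally have *: "real (A.cop n k i l) - real (u l) * real (s i) \<le> \<bar>real (A.cop n k i l) - A.wt n i * D l\<bar>
        + D l * (A.wt n i - real (s i) / 2 ^ m) + real (s i)" .
    show ?thesis
    proof (cases "u l * s i \<le> A.cop n k i l")
      case True
      then show ?thesis using * by (simp add: of_nat_diff)
    next
      case False
      then have "A.cop n k i l - u l * s i = 0" by simp
      then show ?thesis using nn by simp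
    qed
  qed
  have sd: "(\<Sum>i\<in>?I. d i * real (s i)) \<le> 2 ^ m"
  proof -
    have "(\<Sum>i\<in>?I. d i * (real (s i) / 2 ^ m)) \<le> (\<Sum>i\<in>?I. A.wt n i * d i)"
    proof (rule sum_mono)
      fix i assume "i \<in> ?I"
      then have "d i * (real (s i) / 2 ^ m) \<le> d i * A.wt n i" by (intro mult_left_mono s_le) (auto simp: d_def)
      then show "d i * (real (s i) / 2 ^ m) \<le> A.wt n i * d i" by (simp only: mult.commute)
    qed
    also have "\<dots> = 1" using A.sum_wt[of n] by (simp add: d_def)
    finally have "(\<Sum>i\<in>?I. d i * real (s i)) / 2 ^ m \<le> 1" by (simp add: sum_divide_distrib)
    then show ?thesis by (simp add: pos_divide_le_eq)
  qed
  have "(\<Sum>r\<in>Z. A.wt ?n (fst r)) = (\<Sum>r\<in>brows (nsA ?n). if r \<in> Z then A.wt ?n (fst r) else 0)"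
    by (rule sum.mono_neutral_cong_left) (use Z(1) in auto)
  also have "\<dots> = (\<Sum>l\<in>?J. \<Sum>r\<in>block (nsA ?n) l. if r \<in> Z then A.wt ?n (fst r) else 0)"
    by (rule sum_brows)
  also have "\<dots> = (\<Sum>l\<in>?J. A.wt ?n l * real (card (Z \<inter> block (nsA ?n) l)))"
  proof (intro sum.cong refl)
    fix l
    have "(\<Sum>r\<in>block (nsA ?n) l. if r \<in> Z then A.wt ?n (fst r) else 0) = (\<Sum>r\<in>Z \<inter> block (nsA ?n) l. A.wt ?n l)"
      by (rule sum.mono_neutral_cong_right) (auto simp: block_def)
    then show "(\<Sum>r\<in>block (nsA ?n) l. if r \<in> Z then A.wt ?n (fst r) else 0) = A.wt ?n l * real (card (Z \<inter> block (nsA ?n) l))"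
      by simp
  qed
  also have "\<dots> \<le> (\<Sum>l\<in>?J. A.wt ?n l * (\<Sum>i\<in>?I. d i * (\<bar>real (A.cop n k i l) - A.wt n i * D l\<bar>
      + D l * (A.wt n i - real (s i) / 2 ^ m) + real (s i))))"
  proof (intro sum_mono mult_left_mono)
    fix l assume "l \<in> ?J"
    then have l: "l < length (nsA ?n)" by simp
    have "card (Z \<inter> block (nsA ?n) l) \<le> (\<Sum>i\<in>?I. nsA n ! i * (A.cop n k i l - u l * s i))"
      using cZ l by (simp add: nsT A.cop_def s_def)
    then have "real (card (Z \<inter> block (nsA ?n) l)) \<le> (\<Sum>i\<in>?I. d i * real (A.cop n k i l - u l * s i))"
      unfolding d_def by (simp flip: of_nat_mult of_nat_sum)
    also have "\<dots> \<le> (\<Sum>i\<in>?I. d i * (\<bar>real (A.cop n k i l) - A.wt n i * D l\<bar>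
      + D l * (A.wt n i - real (s i) / 2 ^ m) + real (s i)))"
      by (intro sum_mono mult_left_mono bnd l) (auto simp: d_def)
    finally show "real (card (Z \<inter> block (nsA ?n) l)) \<le> (\<Sum>i\<in>?I. d i * (\<bar>real (A.cop n k i l) - A.wt n i * D l\<bar>
      + D l * (A.wt n i - real (s i) / 2 ^ m) + real (s i)))" .
    show "0 \<le> A.wt ?n l" by (rule A.wt_nonneg[OF l])
  qed
  also have "\<dots> = (\<Sum>l\<in>?J. (\<Sum>i\<in>?I. d i * (A.wt ?n l * \<bar>real (A.cop n k i l) - A.wt n i * D l\<bar>))
      + (A.wt ?n l * D l) * (\<Sum>i\<in>?I. (A.wt n i - real (s i) / 2 ^ m) * d i) + A.wt ?n l * (\<Sum>i\<in>?I. d i * real (s i)))"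
    by (simp add: distrib_left sum.distrib sum_distrib_left mult_ac)
  also have "\<dots> = (\<Sum>i\<in>?I. d i * X i k) + (\<Sum>l\<in>?J. A.wt ?n l * D l) * (\<Sum>i\<in>?I. (A.wt n i - real (s i) / 2 ^ m) * d i)
      + S k * (\<Sum>i\<in>?I. d i * real (s i))"
  proof -
    have "(\<Sum>l\<in>?J. \<Sum>i\<in>?I. d i * (A.wt ?n l * \<bar>real (A.cop n k i l) - A.wt n i * D l\<bar>)) = (\<Sum>i\<in>?I. d i * X i k)"
      unfolding X_def D_def sum_distrib_left by (rule sum.swap)
    then show ?thesis by (simp only: sum.distrib sum_distrib_right[symmetric] S_def)
  qed
  also have "\<dots> \<le> (\<Sum>i\<in>?I. d i * X i k) + \<epsilon> + S k * 2 ^ m"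
  proof -
    have "(\<Sum>l\<in>?J. A.wt ?n l * D l) = 1" using A.sum_wt[of ?n] by (simp add: D_def)
    moreover have "0 \<le> S k" unfolding S_def by (intro sum_nonneg) (simp add: A.wt_nonneg)
    then have "S k * (\<Sum>i\<in>?I. d i * real (s i)) \<le> S k * 2 ^ m" using sd by (intro mult_left_mono)
    ultimately show ?thesis using def by simp
  qed
  finally have bound: "(\<Sum>r\<in>Z. A.wt ?n (fst r)) \<le> \<epsilon> + \<delta>" using k(2) by (simp add: mult.commute)
  have "0 \<le> (\<Sum>i\<in>?I. d i * X i k)" using X0 by (intro sum_nonneg) (simp add: d_def)
  then have "2 ^ m * S k \<le> \<delta>" using k(2) by linarith
  then show ?thesis
    using k(1) \<chi> cop Z bound unfolding S_def u_def
    by (intro exI[of _ k] conjI exI[of _ \<chi>] exI[of _ Z]) (auto simp: nsT)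
qed

text \<open>
  A late dyadic level receives \<open>wt n j * 2 ^ (m + h)\<close> copies of the block \<open>j\<close>, rounded down.  The
  rounding costs a fraction of at most the sum of all block sizes divided by \<open>2 ^ (m + h)\<close>.  The rows of
  the blocks that \<open>\<chi>\<close> leaves uncovered are fewer than \<open>2 ^ m\<close> in each block, so their weight
  is at most \<open>2 ^ m\<close> times the total weight of the blocks.
\<close>

lemma embed_in_dyadic_level:
  assumes \<chi>: "labelling (nsA n) (nsT m) \<chi>"
    and cop: "\<And>l. l < length (nsA n) \<Longrightarrow> copies (nsA n) \<chi> 0 l = nsA n ! l div 2 ^ m"
    and S: "2 ^ m * (\<Sum>j<length (nsA n). A.wt n j) \<le> \<delta>" and \<delta>: "0 < \<delta>"
  shows "\<exists>h>0. \<exists>\<theta> Z. good n (m + h) \<theta> \<delta> \<and> Z \<subseteq> brows (nsT (m + h)) \<and>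
     agree_off (nsT (m + h)) (lcomp \<chi> \<theta>) (T.trans m h) Z \<and> (\<Sum>r\<in>Z. T.wt (m + h) (fst r)) \<le> 2 * \<delta>"
proof -
  let ?J = "{..<length (nsA n)}"
  define D where "D j = real (nsA n ! j)" for j
  define u where "u j = nsA n ! j div 2 ^ m" for j
  obtain h where h: "0 < h" "(\<Sum>j\<in>?J. D j) / 2 ^ h < \<delta>"
    using eventually_conj[OF eventually_gt_at_top[of 0] eventually_inverse_power_less[OF \<delta>, of "\<Sum>j\<in>?J. D j"]]
    by (auto simp: eventually_sequentially)
  let ?m = "m + h"
  define v where "v j = nat \<lfloor>A.wt n j * 2 ^ ?m\<rfloor>" for j
  have v: "real (v j) \<le> A.wt n j * 2 ^ ?m" "A.wt n j * 2 ^ ?m - 1 \<le> real (v j)" if "j < length (nsA n)" for j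
    using A.wt_nonneg[OF that] by (auto simp: v_def)
  have D0: "0 \<le> (\<Sum>j\<in>?J. D j)" by (intro sum_nonneg) (simp add: D_def)
  have "(\<Sum>j\<in>?J. D j) / 2 ^ ?m \<le> (\<Sum>j\<in>?J. D j) / 2 ^ h"
    using D0 by (intro divide_left_mono) (auto simp: power_add)
  then have D\<delta>: "(\<Sum>j\<in>?J. D j) / 2 ^ ?m \<le> \<delta>" using h(2) by linarith
  have "real (\<Sum>j\<in>?J. v j * nsA n ! j) \<le> 2 ^ ?m"
  proof -
    have "real (\<Sum>j\<in>?J. v j * nsA n ! j) = (\<Sum>j\<in>?J. real (v j) * D j)" by (simp add: D_def)
    also have "\<dots> \<le> (\<Sum>j\<in>?J. (A.wt n j * 2 ^ ?m) * D j)"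
      by (intro sum_mono mult_right_mono v) (auto simp: D_def)
    also have "\<dots> = 2 ^ ?m * (\<Sum>j\<in>?J. A.wt n j * D j)" by (simp add: sum_distrib_left mult_ac)
    also have "\<dots> = 2 ^ ?m" using A.sum_wt[of n] by (simp add: D_def)
    finally show ?thesis .
  qed
  then have "real (\<Sum>j\<in>?J. v j * nsA n ! j) \<le> real (2 ^ ?m)" by simp
  then have vs: "(\<Sum>j\<in>?J. v j * nsA n ! j) \<le> 2 ^ ?m" by (simp only: of_nat_le_iff)
  obtain \<theta> Z where \<theta>: "labelling (nsT ?m) (nsA n) \<theta>"
    and c\<theta>: "\<forall>j<length (nsA n). \<forall>l<length (nsT ?m). copies (nsT ?m) \<theta> j l = v j"
    and Z: "Z \<subseteq> brows (nsT ?m)" "agree_off (nsT ?m) (lcomp \<chi> \<theta>) (T.trans m h) Z"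
    and cZ: "\<forall>l<length (nsT ?m). card (Z \<inter> block (nsT ?m) l) \<le>
       (\<Sum>i<length (nsT m). nsT m ! i * (copies (nsT ?m) (T.trans m h) i l - (\<Sum>j<length (nsA n). v j * copies (nsA n) \<chi> i j)))"
    using matching[OF T.total_trans[of m h] \<chi> T.sizes A.sizes, of "\<lambda>j l. v j"] vs
    by (auto simp: nsT)
  have c\<theta>': "copies (nsT ?m) \<theta> j 0 = v j" if "j < length (nsA n)" for j
    using c\<theta> that by (simp add: nsT)
  have "(\<Sum>j\<in>?J. (A.wt n j - real (v j) / 2 ^ ?m) * D j) \<le> (\<Sum>j\<in>?J. (1 / 2 ^ ?m) * D j)"
  proof (intro sum_mono mult_right_mono)
    fix j assume "j \<in> ?J"
    then have "A.wt n j * 2 ^ ?m - 1 \<le> real (v j)" by (intro v) simp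
    then have "(A.wt n j * 2 ^ ?m - 1) / 2 ^ ?m \<le> real (v j) / 2 ^ ?m" by (rule divide_right_mono) simp
    then show "A.wt n j - real (v j) / 2 ^ ?m \<le> 1 / 2 ^ ?m" by (simp add: diff_divide_distrib)
  qed (simp add: D_def)
  also have "\<dots> = (\<Sum>j\<in>?J. D j) / 2 ^ ?m" by (simp add: sum_divide_distrib)
  finally have "(\<Sum>j\<in>?J. (A.wt n j - real (v j) / 2 ^ ?m) * D j) \<le> \<delta>" using D\<delta> by linarith
  moreover have "real (v j) / 2 ^ ?m \<le> A.wt n j" if "j < length (nsA n)" for j
    using v(1)[OF that] by (simp add: pos_divide_le_eq)
  ultimately have good: "good n ?m \<theta> \<delta>"
    using \<theta> by (simp add: good_def c\<theta>' D_def)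
  have "card Z \<le> 2 ^ m * (2 ^ h - (\<Sum>j\<in>?J. v j * u j))"
  proof -
    have "Z \<inter> block (nsT ?m) 0 = Z" using Z(1) by (auto simp: block_T)
    moreover have "(\<Sum>j\<in>?J. v j * copies (nsA n) \<chi> 0 j) = (\<Sum>j\<in>?J. v j * u j)"
      by (intro sum.cong refl) (simp add: cop u_def)
    ultimately show ?thesis using cZ cop_T[of m h] by (simp add: nsT T.cop_def)
  qed
  then have "real (card Z) \<le> real (2 ^ m * (2 ^ h - (\<Sum>j\<in>?J. v j * u j)))" by (simp only: of_nat_le_iff)
  also have "\<dots> \<le> 2 ^ ?m * \<delta> + (\<Sum>j\<in>?J. D j)"
  proof (cases "(\<Sum>j\<in>?J. v j * u j) \<le> 2 ^ h")
    case False
    then have "2 ^ h - (\<Sum>j\<in>?J. v j * u j) = 0" by simp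
    then show ?thesis using \<delta> D0 by simp
  next
    case True
    have "2 ^ ?m - 2 ^ ?m * (2 ^ m * (\<Sum>j\<in>?J. A.wt n j)) - (\<Sum>j\<in>?J. D j)
        = (\<Sum>j\<in>?J. 2 ^ ?m * A.wt n j * (D j - 2 ^ m) - D j)"
    proof -
      have "(\<Sum>j\<in>?J. 2 ^ ?m * A.wt n j * (D j - 2 ^ m) - D j)
          = (\<Sum>j\<in>?J. 2 ^ ?m * (A.wt n j * D j) - 2 ^ ?m * (2 ^ m * A.wt n j) - D j)"
        by (intro sum.cong refl) (simp add: algebra_simps)
      also have "\<dots> = 2 ^ ?m * (\<Sum>j\<in>?J. A.wt n j * D j) - 2 ^ ?m * (2 ^ m * (\<Sum>j\<in>?J. A.wt n j)) - (\<Sum>j\<in>?J. D j)"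
        by (simp only: sum_subtractf sum_distrib_left)
      finally show ?thesis using A.sum_wt[of n] by (simp add: D_def)
    qed
    also have "\<dots> \<le> (\<Sum>j\<in>?J. real (v j) * real (u j) * 2 ^ m)"
    proof (rule sum_mono)
      fix j assume j: "j \<in> ?J"
      have "nsA n ! j = 2 ^ m * u j + nsA n ! j mod 2 ^ m" by (simp add: u_def)
      moreover have "nsA n ! j mod 2 ^ m < 2 ^ m" by simp
      ultimately have "nsA n ! j \<le> 2 ^ m * u j + 2 ^ m" "2 ^ m * u j \<le> nsA n ! j" by linarith+
      then have "real (nsA n ! j) \<le> real (2 ^ m * u j + 2 ^ m)" "real (2 ^ m * u j) \<le> real (nsA n ! j)"
        by (simp_all only: of_nat_le_iff)
      then have u: "D j - 2 ^ m \<le> real (u j) * 2 ^ m" "real (u j) * 2 ^ m \<le> D j" by (simp_all add: D_def mult.commute)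
      have w: "0 \<le> 2 ^ ?m * A.wt n j" using A.wt_nonneg j by simp
      have "2 ^ ?m * A.wt n j * (D j - 2 ^ m) - D j \<le> 2 ^ ?m * A.wt n j * (real (u j) * 2 ^ m) - real (u j) * 2 ^ m"
        using mult_left_mono[OF u(1) w] u(2) by linarith
      also have "\<dots> = (A.wt n j * 2 ^ ?m - 1) * (real (u j) * 2 ^ m)" by (simp add: algebra_simps)
      also have "\<dots> \<le> real (v j) * (real (u j) * 2 ^ m)"
        by (intro mult_right_mono v) (use j in auto)
      finally show "2 ^ ?m * A.wt n j * (D j - 2 ^ m) - D j \<le> real (v j) * real (u j) * 2 ^ m" by (simp add: mult.assoc)
    qed
    also have "\<dots> = 2 ^ m * real (\<Sum>j\<in>?J. v j * u j)" by (simp add: sum_distrib_left mult_ac)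
    finally have "2 ^ ?m - 2 ^ m * real (\<Sum>j\<in>?J. v j * u j) \<le> 2 ^ ?m * (2 ^ m * (\<Sum>j\<in>?J. A.wt n j)) + (\<Sum>j\<in>?J. D j)"
      by linarith
    moreover have "2 ^ ?m * (2 ^ m * (\<Sum>j\<in>?J. A.wt n j)) \<le> 2 ^ ?m * \<delta>" using S by (intro mult_left_mono) auto
    moreover have "real (2 ^ m * (2 ^ h - (\<Sum>j\<in>?J. v j * u j))) = 2 ^ ?m - 2 ^ m * real (\<Sum>j\<in>?J. v j * u j)"
      using True by (simp only: of_nat_mult of_nat_diff) (simp add: power_add right_diff_distrib)
    ultimately show ?thesis by linarith
  qed
  finally have "real (card Z) / 2 ^ ?m \<le> (2 ^ ?m * \<delta> + (\<Sum>j\<in>?J. D j)) / 2 ^ ?m" by (rule divide_right_mono) simp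
  also have "\<dots> = \<delta> + (\<Sum>j\<in>?J. D j) / 2 ^ ?m" by (simp add: add_divide_distrib)
  finally have "(\<Sum>r\<in>Z. T.wt ?m (fst r)) \<le> 2 * \<delta>" using D\<delta> by (simp add: sum_wt_T[OF Z(1)])
  then show ?thesis using h(1) good Z by blast
qed

lemma link_ex:
  assumes g: "good n m \<theta> \<epsilon>" and \<delta>: "0 < \<delta>" and \<epsilon>: "0 \<le> \<epsilon>"
  shows "\<exists>n' m' \<theta>' \<chi>. good n' m' \<theta>' \<delta> \<and> link n m \<theta> n' m' \<theta>' \<chi> \<epsilon> \<delta>"
proof -
  have \<delta>2: "0 < \<delta> / 2" using \<delta> by simp
  obtain k \<chi> Z where k: "0 < k" and \<chi>: "labelling (nsA (n + k)) (nsT m) \<chi>"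
    and cop: "\<forall>l<length (nsA (n + k)). copies (nsA (n + k)) \<chi> 0 l = nsA (n + k) ! l div 2 ^ m"
    and Z: "Z \<subseteq> brows (nsA (n + k))" "agree_off (nsA (n + k)) (lcomp \<theta> \<chi>) (A.trans n k) Z"
     "(\<Sum>r\<in>Z. A.wt (n + k) (fst r)) \<le> \<epsilon> + \<delta> / 2"
    and S: "2 ^ m * (\<Sum>j<length (nsA (n + k)). A.wt (n + k) j) \<le> \<delta> / 2"
    using embed_dyadic_level[OF g \<delta>2 \<epsilon>] by blast
  obtain h \<theta>' Z' where h: "0 < h" and g': "good (n + k) (m + h) \<theta>' (\<delta> / 2)"
    and Z': "Z' \<subseteq> brows (nsT (m + h))" "agree_off (nsT (m + h)) (lcomp \<chi> \<theta>') (T.trans m h) Z'"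
     "(\<Sum>r\<in>Z'. T.wt (m + h) (fst r)) \<le> 2 * (\<delta> / 2)"
    using embed_in_dyadic_level[OF \<chi> _ S \<delta>2] cop by blast
  have "good (n + k) (m + h) \<theta>' \<delta>" using g' \<delta> by (simp add: good_def)
  moreover have "link n m \<theta> (n + k) (m + h) \<theta>' \<chi> \<epsilon> \<delta>"
  proof -
    have "(\<Sum>r\<in>Z. A.wt (n + k) (fst r)) \<le> \<epsilon> + \<delta>" "(\<Sum>r\<in>Z'. T.wt (m + h) (fst r)) \<le> \<delta>"
      using Z(3) Z'(3) \<delta> by linarith+
    moreover have "n + k - n = k" "m + h - m = h" by simp_all
    ultimately show ?thesis unfolding link_def using k h \<chi> Z(1,2) Z'(1,2) by (metis less_add_same_cancel1)
  qed
  ultimately show ?thesis by blast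
qed

text \<open>
  The construction starts with nothing covered, which is a defect of \<open>1\<close>.
\<close>

lemma good_empty: "good 0 0 ((\<lambda>r. r), \<lambda>r s. False) 1"
proof -
  have "labelling (nsT 0) (nsA 0) ((\<lambda>r. r), \<lambda>r s. False)" by (rule labellingI) auto
  then show ?thesis using A.sum_wt[of 0] by (simp add: good_def copies_def A.wt_nonneg)
qed

lemma intertwining_sequence:
  "\<exists>n m \<theta> \<chi>. \<forall>k. good (n k) (m k) (\<theta> k) ((1/2) ^ k) \<and>
     link (n k) (m k) (\<theta> k) (n (Suc k)) (m (Suc k)) (\<theta> (Suc k)) (\<chi> k) ((1/2) ^ k) ((1/2) ^ Suc k)"
proof -
  define P where "P k s = good (fst s) (fst (snd s)) (snd (snd s)) ((1/2) ^ k)" for k and s :: "nat \<times> nat \<times> labelling"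
  define Q where "Q k s s' = (\<exists>\<chi>. link (fst s) (fst (snd s)) (snd (snd s)) (fst s') (fst (snd s')) (snd (snd s')) \<chi> ((1/2) ^ k) ((1/2) ^ Suc k))"
    for k and s s' :: "nat \<times> nat \<times> labelling"
  have "\<exists>f. \<forall>k. P k (f k) \<and> Q k (f k) (f (Suc k))"
  proof (rule dependent_nat_choice)
    show "\<exists>s. P 0 s" using good_empty unfolding P_def by (intro exI[of _ "(0, 0, ((\<lambda>r. r), \<lambda>r s. False))"]) simp
    fix s k assume "P k s"
    then have "good (fst s) (fst (snd s)) (snd (snd s)) ((1/2) ^ k)" by (simp add: P_def)
    from link_ex[OF this, of "(1/2) ^ Suc k"]
    obtain n' m' \<theta>' \<chi> where "good n' m' \<theta>' ((1/2) ^ Suc k)"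
      "link (fst s) (fst (snd s)) (snd (snd s)) n' m' \<theta>' \<chi> ((1/2) ^ k) ((1/2) ^ Suc k)" by auto
    then have "P (Suc k) (n', m', \<theta>') \<and> Q k s (n', m', \<theta>')" unfolding P_def Q_def fst_conv snd_conv by blast
    then show "\<exists>s'. P (Suc k) s' \<and> Q k s s'" by blast
  qed
  then obtain f where f: "\<And>k. P k (f k)" "\<And>k. Q k (f k) (f (Suc k))" by blast
  from f(2) obtain \<chi> where "\<And>k. link (fst (f k)) (fst (snd (f k))) (snd (snd (f k))) (fst (f (Suc k)))
      (fst (snd (f (Suc k)))) (snd (snd (f (Suc k)))) (\<chi> k) ((1/2) ^ k) ((1/2) ^ Suc k)"
    unfolding Q_def by metis
  with f(1) have all: "\<forall>k. good (fst (f k)) (fst (snd (f k))) (snd (snd (f k))) ((1/2) ^ k) \<and>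
      link (fst (f k)) (fst (snd (f k))) (snd (snd (f k))) (fst (f (Suc k)))
        (fst (snd (f (Suc k)))) (snd (snd (f (Suc k)))) (\<chi> k) ((1/2) ^ k) ((1/2) ^ Suc k)"
    unfolding P_def by blast
  show ?thesis
    by (rule exI[of _ "\<lambda>k. fst (f k)"], rule exI[of _ "\<lambda>k. fst (snd (f k))"],
      rule exI[of _ "\<lambda>k. snd (snd (f k))"], rule exI[of _ \<chi>]) (rule all)
qed

end

lemma (in standard_system) dist_agree_off:
  assumes "labelling (ns n) bs K" "labelling (ns n) bs K'" "Z \<subseteq> brows (ns n)" "agree_off (ns n) K K' Z"
  shows "N (\<beta> n (pull K x) \<ominus> \<beta> n (pull K' x)) \<le> 2 * (\<Sum>r\<in>Z. wt n (fst r))"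
proof -
  have "\<beta> n (pull K x) \<ominus> \<beta> n (pull K' x) = \<beta> n (bdiff (pull K x) (pull K' x))"
    by (intro beta_diff[symmetric] pull_closed[OF assms(1)] pull_closed[OF assms(2)])
  then show ?thesis using rank_agree_off[OF rank_like_beta assms, of x] by (simp add: wt_def)
qed

context intertwining
begin

lemma good_rank:
  assumes g: "good n m \<theta> \<epsilon>" and b: "b \<in> bmats (nsA n)"
  shows "M (\<beta>T m (pull \<theta> b)) \<le> N (\<beta>A n b)" and "N (\<beta>A n b) - \<epsilon> \<le> M (\<beta>T m (pull \<theta> b))"
proof -
  let ?I = "{..<length (nsA n)}"
  have lab: "labelling (nsT m) (nsA n) \<theta>"
    and le: "\<And>i. i \<in> ?I \<Longrightarrow> real (copies (nsT m) \<theta> i 0) / 2 ^ m \<le> A.wt n i"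
    and def: "(\<Sum>i\<in>?I. (A.wt n i - real (copies (nsT m) \<theta> i 0) / 2 ^ m) * real (nsA n ! i)) \<le> \<epsilon>"
    using g by (auto simp: good_def)
  have "weight (\<lambda>x. M (\<beta>T m (pull \<theta> x))) i = real (copies (nsT m) \<theta> i 0) / 2 ^ m" for i
    using weight_pull[OF T.rank_like_beta lab, of i] wt_T[of m] by (simp add: nsT T.wt_def)
  then have M: "M (\<beta>T m (pull \<theta> b)) = (\<Sum>i\<in>?I. real (brank (nsA n) i b) * (real (copies (nsT m) \<theta> i 0) / 2 ^ m))"
    using rank_like_eq[OF rank_like_pull[OF T.rank_like_beta lab] b] by simp
  have N: "N (\<beta>A n b) = (\<Sum>i\<in>?I. real (brank (nsA n) i b) * A.wt n i)" by (rule A.N_beta[OF b])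
  show "M (\<beta>T m (pull \<theta> b)) \<le> N (\<beta>A n b)"
    unfolding M N by (intro sum_mono mult_left_mono le) simp_all
  have "N (\<beta>A n b) - M (\<beta>T m (pull \<theta> b)) =
      (\<Sum>i\<in>?I. (A.wt n i - real (copies (nsT m) \<theta> i 0) / 2 ^ m) * real (brank (nsA n) i b))"
    unfolding M N sum_subtractf[symmetric] by (intro sum.cong refl) (simp add: algebra_simps)
  also have "\<dots> \<le> (\<Sum>i\<in>?I. (A.wt n i - real (copies (nsT m) \<theta> i 0) / 2 ^ m) * real (nsA n ! i))"
    using le brank_le by (intro sum_mono mult_left_mono) auto
  finally show "N (\<beta>A n b) - \<epsilon> \<le> M (\<beta>T m (pull \<theta> b))" using def by linarith
qed

lemma good_diff_le:
  assumes g: "good n m \<theta> \<epsilon>" and b: "b \<in> bmats (nsA n)" "b' \<in> bmats (nsA n)"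
  shows "M (\<beta>T m (pull \<theta> b) \<ominus>\<^bsub>T\<^esub> \<beta>T m (pull \<theta> b')) \<le> N (\<beta>A n b \<ominus>\<^bsub>A\<^esub> \<beta>A n b')"
proof -
  have lab: "labelling (nsT m) (nsA n) \<theta>" using g by (simp add: good_def)
  have "\<beta>T m (pull \<theta> b) \<ominus>\<^bsub>T\<^esub> \<beta>T m (pull \<theta> b') = \<beta>T m (pull \<theta> (bdiff b b'))"
    unfolding pull_bdiff by (rule T.beta_diff[symmetric]) (intro pull_closed[OF lab])+
  moreover have "\<beta>A n b \<ominus>\<^bsub>A\<^esub> \<beta>A n b' = \<beta>A n (bdiff b b')"
    by (rule A.beta_diff[symmetric]) (rule b)+
  ultimately show ?thesis using good_rank(1)[OF g, of "bdiff b b'"] b by simp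
qed

lemma link_back:
  assumes l: "link n m \<theta> n' m' \<theta>' \<chi> \<epsilon> \<delta>" and g': "good n' m' \<theta>' \<delta>" and c: "c \<in> bmats (nsT m)"
  shows "M (\<beta>T m' (pull \<theta>' (pull \<chi> c)) \<ominus>\<^bsub>T\<^esub> \<beta>T m c) \<le> 2 * \<delta>"
proof -
  have \<chi>: "labelling (nsA n') (nsT m) \<chi>" and lt: "m < m'" using l by (auto simp: link_def)
  from l obtain Z where Z: "Z \<subseteq> brows (nsT m')" "agree_off (nsT m') (lcomp \<chi> \<theta>') (T.trans m (m' - m)) Z"
      "(\<Sum>r\<in>Z. T.wt m' (fst r)) \<le> \<delta>" unfolding link_def by blast
  have lab': "labelling (nsT m') (nsA n') \<theta>'" using g' by (simp add: good_def)
  have m': "m + (m' - m) = m'" using lt by simp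
  have "\<beta>T m c = \<beta>T m' (pull (T.trans m (m' - m)) c)" using T.beta_trans[OF c, of "m' - m"] by (simp add: m')
  moreover have "labelling (nsT m') (nsT m) (T.trans m (m' - m))" using T.labelling_trans[of m "m' - m"] by (simp add: m')
  ultimately show ?thesis
    using T.dist_agree_off[OF labelling_lcomp[OF \<chi> lab'] _ Z(1,2), of c] Z(3) by (simp add: pull_lcomp)
qed

text \<open>
  Compare both maps with the detour through the level \<open>m\<close> and back: the first triangle is moved to the
  dyadic side by \<open>\<theta>'\<close>, which decreases ranks, and the second triangle is \<open>link_back\<close>.
\<close>

lemma link_forth:
  assumes g: "good n m \<theta> \<epsilon>" and l: "link n m \<theta> n' m' \<theta>' \<chi> \<epsilon> \<delta>" and g': "good n' m' \<theta>' \<delta>"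
    and b: "b \<in> bmats (nsA n)"
  shows "M (\<beta>T m' (pull \<theta>' (pull (A.trans n (n' - n)) b)) \<ominus>\<^bsub>T\<^esub> \<beta>T m (pull \<theta> b)) \<le> 2 * \<epsilon> + 4 * \<delta>"
proof -
  have \<chi>: "labelling (nsA n') (nsT m) \<chi>" and lt: "n < n'" using l by (auto simp: link_def)
  from l obtain Z where Z: "Z \<subseteq> brows (nsA n')" "agree_off (nsA n') (lcomp \<theta> \<chi>) (A.trans n (n' - n)) Z"
      "(\<Sum>r\<in>Z. A.wt n' (fst r)) \<le> \<epsilon> + \<delta>" unfolding link_def by blast
  have lab: "labelling (nsT m) (nsA n) \<theta>" using g by (simp add: good_def)
  have lab': "labelling (nsT m') (nsA n') \<theta>'" using g' by (simp add: good_def)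
  have n': "n + (n' - n) = n'" using lt by simp
  have labt: "labelling (nsA n') (nsA n) (A.trans n (n' - n))" using A.labelling_trans[of n "n' - n"] by (simp add: n')
  let ?c = "pull \<theta> b"
  let ?b1 = "pull (A.trans n (n' - n)) b" and ?e = "pull \<chi> ?c"
  have cl: "?b1 \<in> bmats (nsA n')" "?e \<in> bmats (nsA n')" "?c \<in> bmats (nsT m)"
    by (intro pull_closed[OF labt] pull_closed[OF \<chi>] pull_closed[OF lab])+
  have clT: "\<beta>T m' (pull \<theta>' x) \<in> carrier T" for x by (intro T.beta_closed pull_closed[OF lab'])
  have "M (\<beta>T m' (pull \<theta>' ?b1) \<ominus>\<^bsub>T\<^esub> \<beta>T m' (pull \<theta>' ?e)) \<le> N (\<beta>A n' ?b1 \<ominus>\<^bsub>A\<^esub> \<beta>A n' ?e)"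
    by (rule good_diff_le[OF g' cl(1,2)])
  also have "\<dots> = N (\<beta>A n' ?e \<ominus>\<^bsub>A\<^esub> \<beta>A n' ?b1)" by (intro A.N_diff_commute A.beta_closed cl)
  also have "\<dots> \<le> 2 * (\<Sum>r\<in>Z. A.wt n' (fst r))"
    using A.dist_agree_off[OF labelling_lcomp[OF lab \<chi>] labt Z(1,2), of b] by (simp add: pull_lcomp)
  also have "\<dots> \<le> 2 * (\<epsilon> + \<delta>)" using Z(3) by simp
  finally have 1: "M (\<beta>T m' (pull \<theta>' ?b1) \<ominus>\<^bsub>T\<^esub> \<beta>T m' (pull \<theta>' ?e)) \<le> 2 * (\<epsilon> + \<delta>)" by simp
  have 2: "M (\<beta>T m' (pull \<theta>' ?b1) \<ominus>\<^bsub>T\<^esub> \<beta>T m ?c) \<le>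
     M (\<beta>T m' (pull \<theta>' ?b1) \<ominus>\<^bsub>T\<^esub> \<beta>T m' (pull \<theta>' ?e)) + M (\<beta>T m' (pull \<theta>' ?e) \<ominus>\<^bsub>T\<^esub> \<beta>T m ?c)"
    by (intro T.N_triangle clT T.beta_closed cl)
  have "2 * (\<epsilon> + \<delta>) + 2 * \<delta> = 2 * \<epsilon> + 4 * \<delta>" by simp
  then show ?thesis using order_trans[OF 2 add_mono[OF 1 link_back[OF l g' cl(3)]]] by simp
qed

lemma good_scalar:
  assumes g: "good n m \<theta> \<epsilon>"
  shows "M (\<beta>T m (pull \<theta> (bdiag (brows (nsA n)) d)) \<ominus>\<^bsub>T\<^esub> \<kappa> d) \<le> \<epsilon>"
proof -
  have lab: "labelling (nsT m) (nsA n) \<theta>" using g by (simp add: good_def)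
  define U where "U = {r. snd \<theta> r r}"
  let ?B = "brows (nsT m)"
  have U: "U \<subseteq> ?B" using labellingD(1)[OF lab] unfolding U_def by blast
  let ?W = "?B - U"
  have pd: "pull \<theta> (bdiag (brows (nsA n)) d) = bdiag U d" for d unfolding U_def by (rule pull_bdiag_brows[OF lab])
  have "\<beta>T m (bdiag U d) \<ominus>\<^bsub>T\<^esub> \<kappa> d = \<beta>T m (bdiff (bdiag U d) (bdiag ?B d))"
    unfolding T.scal[of m d, symmetric] using U by (intro T.beta_diff[symmetric] bdiag_closed) auto
  also have "bdiff (bdiag U d) (bdiag ?B d) = bmult (nsT m) (bdiag ?W (- d)) (bdiag ?W 1)"
    by (subst bdiag_mult_bdiag) (use U in \<open>auto simp: bdiff_def bdiag_def fun_eq_iff\<close>)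
  finally have "M (\<beta>T m (bdiag U d) \<ominus>\<^bsub>T\<^esub> \<kappa> d) \<le> M (\<beta>T m (bdiag ?W 1))"
    using rank_like_mult(2)[OF T.rank_like_beta[of m], of "bdiag ?W (- d)" "bdiag ?W 1"] by simp
  also have "M (\<beta>T m (bdiag ?W 1)) = M (\<beta>T m (bdiag ?B 1)) - M (\<beta>T m (bdiag U 1))"
    using rank_like_bdiag[OF T.rank_like_beta[of m], of ?W] rank_like_bdiag[OF T.rank_like_beta[of m], of ?B]
      rank_like_bdiag[OF T.rank_like_beta[of m], of U] sum_diff[of ?B U] U by simp
  also have "M (\<beta>T m (bdiag ?B 1)) = 1" by (simp add: T.beta_one T.N_one)
  also have "1 - M (\<beta>T m (bdiag U 1)) \<le> \<epsilon>"
    using good_rank(2)[OF g, of "bdiag (brows (nsA n)) 1"] by (simp add: pd A.beta_one A.N_one)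
  finally show ?thesis by (simp add: pd)
qed

text \<open>
  The asymptotic isomorphism sends \<open>a\<close> to the image under the labelling \<open>\<theta> k\<close> of a preimage of \<open>a\<close> at
  the level \<open>n k\<close> of \<open>A\<close>.  Two preimages differ by an element of rank \<open>0\<close>, the labelling does not
  increase ranks, and \<open>M\<close> is faithful; so the choice is irrelevant.  The images form a Cauchy sequence as the
  errors of the links are summable, and by \<open>link_back\<close> they come close to every element of \<open>T\<close>.
\<close>

theorem completions_isomorphic:
  "\<exists>\<Phi>\<in>ring_iso (completion A N) (completion T M). \<forall>d. \<Phi> (completion_map A N (\<iota> d)) = completion_map T M (\<kappa> d)"
proof -
  obtain n m :: "nat \<Rightarrow> nat" and \<theta> \<chi> where
    *: "\<forall>k. good (n k) (m k) (\<theta> k) ((1/2) ^ k) \<and>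
     link (n k) (m k) (\<theta> k) (n (Suc k)) (m (Suc k)) (\<theta> (Suc k)) (\<chi> k) ((1/2) ^ k) ((1/2) ^ Suc k)"
    using intertwining_sequence by blast
  define \<epsilon> :: "nat \<Rightarrow> real" where "\<epsilon> k = (1/2) ^ k" for k
  have \<epsilon>Suc: "\<epsilon> (Suc k) = \<epsilon> k / 2" and \<epsilon>0: "0 < \<epsilon> k" for k by (simp_all add: \<epsilon>_def)
  have good: "good (n k) (m k) (\<theta> k) (\<epsilon> k)"
    and link: "link (n k) (m k) (\<theta> k) (n (Suc k)) (m (Suc k)) (\<theta> (Suc k)) (\<chi> k) (\<epsilon> k) (\<epsilon> (Suc k))" for k
    using * unfolding \<epsilon>_def by blast+
  have \<epsilon>lim: "\<epsilon> \<longlonglongrightarrow> 0" unfolding \<epsilon>_def by (rule LIMSEQ_realpow_zero) auto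
  have lab: "labelling (nsT (m k)) (nsA (n k)) (\<theta> k)" for k using good[of k] by (simp add: good_def)
  have labc: "labelling (nsA (n (Suc k))) (nsT (m k)) (\<chi> k)" for k using link[of k] by (simp add: link_def)
  have nSuc: "n k < n (Suc k)" "m k < m (Suc k)" for k using link[of k] by (simp_all add: link_def)
  have nk: "k \<le> n k" "k \<le> m k" for k
    using nSuc by (induction k) (auto intro: le_less_trans simp: Suc_le_eq)
  define im where "im k = \<beta>A (n k) ` bmats (nsA (n k))" for k
  have imSuc: "im k \<subseteq> im (Suc k)" for k
    unfolding im_def using A.beta_image_mono nSuc(1)[of k] by simp
  have im_mono: "im k \<subseteq> im l" if "k \<le> l" for k l
    by (rule lift_Suc_mono_le[of im, OF imSuc that])
  have im_ex: "\<exists>K. \<forall>k\<ge>K. a \<in> im k" if a: "a \<in> carrier A" for a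
  proof -
    obtain K where K: "\<And>j. j \<ge> K \<Longrightarrow> a \<in> \<beta>A j ` bmats (nsA j)" using A.common_level[OF a] by blast
    have "a \<in> im k" if "k \<ge> K" for k unfolding im_def using K[of "n k"] nk(1)[of k] that by simp
    then show ?thesis by blast
  qed
  have im_ev: "\<forall>\<^sub>F k in sequentially. a \<in> im k" if "a \<in> carrier A" for a
    using im_ex[OF that] by (simp add: eventually_sequentially)
  define \<phi> where "\<phi> k b = \<beta>T (m k) (pull (\<theta> k) b)" for k b
  have \<phi>_closed: "\<phi> k b \<in> carrier T" for k b
    unfolding \<phi>_def by (intro T.beta_closed pull_closed[OF lab])
  define \<psi> where "\<psi> k a = (if a \<in> im k then \<phi> k (SOME b. b \<in> bmats (nsA (n k)) \<and> \<beta>A (n k) b = a) else \<zero>\<^bsub>T\<^esub>)" for k a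
  have \<psi>: "\<psi> k (\<beta>A (n k) b) = \<phi> k b" if b: "b \<in> bmats (nsA (n k))" for k b
  proof -
    define b' where "b' = (SOME b'. b' \<in> bmats (nsA (n k)) \<and> \<beta>A (n k) b' = \<beta>A (n k) b)"
    have b': "b' \<in> bmats (nsA (n k)) \<and> \<beta>A (n k) b' = \<beta>A (n k) b"
      unfolding b'_def by (rule someI[of _ b]) (simp add: b)
    have bA: "\<beta>A (n k) b \<in> carrier A" by (rule A.beta_closed[OF b])
    have "N (\<beta>A (n k) b' \<ominus>\<^bsub>A\<^esub> \<beta>A (n k) b) = 0"
      using b' bA by (simp add: A.minus_eq A.r_neg A.N_zero)
    then have "M (\<phi> k b' \<ominus>\<^bsub>T\<^esub> \<phi> k b) \<le> 0"
      using good_diff_le[OF good[of k], of b' b] b b' by (simp add: \<phi>_def)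
    moreover have cl: "\<phi> k b' \<ominus>\<^bsub>T\<^esub> \<phi> k b \<in> carrier T" by (intro T.minus_closed \<phi>_closed)
    ultimately have z: "\<phi> k b' \<ominus>\<^bsub>T\<^esub> \<phi> k b = \<zero>\<^bsub>T\<^esub>"
      using T.N_range(1)[OF cl] by (intro rank_T[OF cl]) linarith
    have "\<phi> k b' = (\<phi> k b' \<ominus>\<^bsub>T\<^esub> \<phi> k b) \<oplus>\<^bsub>T\<^esub> \<phi> k b"
      using \<phi>_closed by (simp add: T.minus_eq T.a_assoc T.l_neg)
    then have "\<phi> k b' = \<phi> k b" using z \<phi>_closed by simp
    moreover have "\<beta>A (n k) b \<in> im k" using b by (simp add: im_def)
    ultimately show ?thesis by (simp add: \<psi>_def b'_def[symmetric])
  qed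
  have \<psi>_closed: "\<psi> k a \<in> carrier T" for k a by (simp add: \<psi>_def \<phi>_closed)
  have \<psi>_add: "\<psi> k (a \<oplus>\<^bsub>A\<^esub> a') = \<psi> k a \<oplus>\<^bsub>T\<^esub> \<psi> k a'" and \<psi>_mult: "\<psi> k (a \<otimes>\<^bsub>A\<^esub> a') = \<psi> k a \<otimes>\<^bsub>T\<^esub> \<psi> k a'"
    if "a \<in> im k" "a' \<in> im k" for k a a'
  proof -
    obtain b b' where b: "b \<in> bmats (nsA (n k))" "a = \<beta>A (n k) b" and b': "b' \<in> bmats (nsA (n k))" "a' = \<beta>A (n k) b'"
      using \<open>a \<in> im k\<close> \<open>a' \<in> im k\<close> unfolding im_def by blast
    have p: "pull (\<theta> k) x \<in> bmats (nsT (m k))" for k and x :: "'d bmat" by (rule pull_closed[OF lab])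
    have "a \<oplus>\<^bsub>A\<^esub> a' = \<beta>A (n k) (badd b b')" "a \<otimes>\<^bsub>A\<^esub> a' = \<beta>A (n k) (bmult (nsA (n k)) b b')"
      using A.beta_add[OF b(1) b'(1)] A.beta_mult[OF b(1) b'(1)] b b' by simp_all
    then show "\<psi> k (a \<oplus>\<^bsub>A\<^esub> a') = \<psi> k a \<oplus>\<^bsub>T\<^esub> \<psi> k a'" "\<psi> k (a \<otimes>\<^bsub>A\<^esub> a') = \<psi> k a \<otimes>\<^bsub>T\<^esub> \<psi> k a'"
      using \<psi>[OF b(1)] \<psi>[OF b'(1)] \<psi>[OF badd_closed[OF b(1) b'(1)]] \<psi>[OF bmult_closed[OF b(1) b'(1)]]
        T.beta_add[OF p[of k b] p[of k b']] T.beta_mult[OF p[of k b] p[of k b']]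
      by (simp_all add: b(2) b'(2) \<phi>_def pull_badd pull_bmult[OF lab b(1)])
  qed
  have \<psi>_rank: "\<bar>M (\<psi> k a) - N a\<bar> \<le> \<epsilon> k" if a: "a \<in> im k" for k a
  proof -
    obtain b where b: "b \<in> bmats (nsA (n k))" "a = \<beta>A (n k) b" using a unfolding im_def by blast
    show ?thesis using good_rank[OF good[of k] b(1)] \<psi>[OF b(1)] by (simp add: b(2) \<phi>_def)
  qed
  have \<psi>_step: "M (\<psi> (Suc k) a \<ominus>\<^bsub>T\<^esub> \<psi> k a) \<le> 4 * \<epsilon> k" if a: "a \<in> im k" for k a
  proof -
    obtain b where b: "b \<in> bmats (nsA (n k))" "a = \<beta>A (n k) b" using a unfolding im_def by blast
    let ?t = "A.trans (n k) (n (Suc k) - n k)"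
    have n': "n k + (n (Suc k) - n k) = n (Suc k)" using nSuc(1)[of k] by simp
    have "pull ?t b \<in> bmats (nsA (n (Suc k)))" "\<beta>A (n (Suc k)) (pull ?t b) = a"
      using A.pull_trans_closed[of "n k" "n (Suc k) - n k" b] A.beta_trans[OF b(1), of "n (Suc k) - n k"] by (simp_all add: n' b(2))
    then have "\<psi> (Suc k) a = \<phi> (Suc k) (pull ?t b)" using \<psi>[of "pull ?t b" "Suc k"] by simp
    moreover have "\<psi> k a = \<phi> k b" using \<psi>[OF b(1)] b(2) by simp
    ultimately show ?thesis
      using link_forth[OF good[of k] link[of k] good[of "Suc k"] b(1)] by (simp add: \<phi>_def \<epsilon>Suc)
  qed
  have \<psi>_far: "M (\<psi> (k + j) a \<ominus>\<^bsub>T\<^esub> \<psi> k a) \<le> 8 * \<epsilon> k - 8 * \<epsilon> (k + j)" if a: "a \<in> im k" for k j a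
  proof (induction j)
    case 0
    show ?case using \<psi>_closed[of k a] by (simp add: T.minus_eq T.r_neg T.N_zero)
  next
    case (Suc j)
    have "a \<in> im (k + j)" using a im_mono[of k "k + j"] by auto
    then have "M (\<psi> (k + Suc j) a \<ominus>\<^bsub>T\<^esub> \<psi> (k + j) a) \<le> 4 * \<epsilon> (k + j)" using \<psi>_step by simp
    moreover have "M (\<psi> (k + Suc j) a \<ominus>\<^bsub>T\<^esub> \<psi> k a) \<le> M (\<psi> (k + Suc j) a \<ominus>\<^bsub>T\<^esub> \<psi> (k + j) a) + M (\<psi> (k + j) a \<ominus>\<^bsub>T\<^esub> \<psi> k a)"
      by (intro T.N_triangle \<psi>_closed)
    moreover have "\<epsilon> (k + Suc j) = \<epsilon> (k + j) / 2" using \<epsilon>Suc[of "k + j"] by simp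
    ultimately show ?case using Suc.IH by simp
  qed
  have \<psi>_near: "M (\<psi> l a \<ominus>\<^bsub>T\<^esub> \<psi> k a) \<le> 8 * \<epsilon> k" if "a \<in> im k" "k \<le> l" for k l a
    using \<psi>_far[OF that(1), of "l - k"] \<epsilon>0[of l] that(2) by simp
  have scal: "(\<lambda>k. M (\<psi> k (\<iota> d) \<ominus>\<^bsub>T\<^esub> \<kappa> d)) \<longlonglongrightarrow> 0" for d
  proof (rule tendsto_sandwich[of "\<lambda>k. 0" _ _ \<epsilon>])
    have \<kappa>: "\<kappa> d \<in> carrier T" using T.scal[of 0 d] T.beta_closed[OF bdiag_closed[OF subset_refl], of 0 d] by simp
    show "\<forall>\<^sub>F k in sequentially. 0 \<le> M (\<psi> k (\<iota> d) \<ominus>\<^bsub>T\<^esub> \<kappa> d)"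
      by (intro always_eventually allI T.N_range T.minus_closed \<psi>_closed \<kappa>)
    have "M (\<psi> k (\<iota> d) \<ominus>\<^bsub>T\<^esub> \<kappa> d) \<le> \<epsilon> k" for k
      using good_scalar[OF good[of k], of d] \<psi>[OF bdiag_closed[OF subset_refl], of k d] by (simp add: A.scal \<phi>_def)
    then show "\<forall>\<^sub>F k in sequentially. M (\<psi> k (\<iota> d) \<ominus>\<^bsub>T\<^esub> \<kappa> d) \<le> \<epsilon> k" by simp
  qed (auto simp: \<epsilon>lim)
  have \<iota>1: "\<iota> 1 = \<one>\<^bsub>A\<^esub>" using A.scal[of 0 1] A.beta_one[of 0] by simp
  have \<kappa>1: "\<kappa> 1 = \<one>\<^bsub>T\<^esub>" using T.scal[of 0 1] T.beta_one[of 0] by simp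
  interpret iso: asymptotic_isomorphism A N T M \<psi>
  proof
    fix x k show "\<psi> k x \<in> carrier T" by (rule \<psi>_closed)
  next
    fix x y assume "x \<in> carrier A" "y \<in> carrier A"
    then have e: "\<forall>\<^sub>F k in sequentially. x \<in> im k \<and> y \<in> im k" by (intro eventually_conj im_ev)
    show "\<forall>\<^sub>F k in sequentially. \<psi> k (x \<oplus>\<^bsub>A\<^esub> y) = \<psi> k x \<oplus>\<^bsub>T\<^esub> \<psi> k y"
      using e by eventually_elim (rule \<psi>_add, auto)
    show "\<forall>\<^sub>F k in sequentially. \<psi> k (x \<otimes>\<^bsub>A\<^esub> y) = \<psi> k x \<otimes>\<^bsub>T\<^esub> \<psi> k y"
      using e by eventually_elim (rule \<psi>_mult, auto)
  next
    show "(\<lambda>k. M (\<psi> k \<one>\<^bsub>A\<^esub> \<ominus>\<^bsub>T\<^esub> \<one>\<^bsub>T\<^esub>)) \<longlonglongrightarrow> 0" using scal[of 1] by (simp only: \<iota>1 \<kappa>1)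
  next
    fix x assume x: "x \<in> carrier A"
    have "\<forall>\<^sub>F k in sequentially. norm (M (\<psi> k x) - N x) \<le> norm (\<epsilon> k) * 1"
      using im_ev[OF x] by eventually_elim (use \<psi>_rank \<epsilon>0 in \<open>simp add: less_imp_le\<close>)
    then have "(\<lambda>k. M (\<psi> k x) - N x) \<longlonglongrightarrow> 0" by (rule tendsto_0_le[OF \<epsilon>lim])
    then show "(\<lambda>k. M (\<psi> k x)) \<longlonglongrightarrow> N x" by (rule LIM_zero_cancel)
  next
    fix x and e :: real assume x: "x \<in> carrier A" and e: "0 < e"
    obtain K1 where K1: "\<forall>k\<ge>K1. x \<in> im k" using im_ex[OF x] by blast
    have "0 < e / 16" using e by simp
    then obtain K2 where K2: "\<And>k. k \<ge> K2 \<Longrightarrow> \<epsilon> k < e / 16"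
      using order_tendstoD(2)[OF \<epsilon>lim, of "e / 16"] by (auto simp: eventually_sequentially)
    define K where "K = max K1 K2"
    have K: "x \<in> im K" "\<epsilon> K < e / 16" using K1 K2[of K] by (auto simp: K_def)
    have "M (\<psi> k x \<ominus>\<^bsub>T\<^esub> \<psi> l x) < e" if kl: "k \<ge> K" "l \<ge> K" for k l
    proof -
      have "M (\<psi> k x \<ominus>\<^bsub>T\<^esub> \<psi> l x) \<le> M (\<psi> k x \<ominus>\<^bsub>T\<^esub> \<psi> K x) + M (\<psi> K x \<ominus>\<^bsub>T\<^esub> \<psi> l x)"
        by (intro T.N_triangle \<psi>_closed)
      moreover have "M (\<psi> K x \<ominus>\<^bsub>T\<^esub> \<psi> l x) = M (\<psi> l x \<ominus>\<^bsub>T\<^esub> \<psi> K x)" by (intro T.N_diff_commute \<psi>_closed)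
      ultimately show ?thesis using \<psi>_near[OF K(1) kl(1)] \<psi>_near[OF K(1) kl(2)] K(2) by linarith
    qed
    then show "\<exists>K. \<forall>k\<ge>K. \<forall>l\<ge>K. M (\<psi> k x \<ominus>\<^bsub>T\<^esub> \<psi> l x) < e" by blast
  next
    fix t and e :: real assume t: "t \<in> carrier T" and e: "0 < e"
    obtain K1 where K1: "\<And>j. j \<ge> K1 \<Longrightarrow> t \<in> \<beta>T j ` bmats (nsT j)" using T.common_level[OF t] by blast
    have "0 < e / 10" using e by simp
    then obtain K2 where K2: "\<And>k. k \<ge> K2 \<Longrightarrow> \<epsilon> k < e / 10"
      using order_tendstoD(2)[OF \<epsilon>lim, of "e / 10"] by (auto simp: eventually_sequentially)
    define K where "K = max K1 K2"
    have "K1 \<le> m K" using nk(2)[of K] by (simp add: K_def)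
    then obtain c where c: "c \<in> bmats (nsT (m K))" "t = \<beta>T (m K) c" using K1[of "m K"] by blast
    let ?b = "pull (\<chi> K) c"
    have b: "?b \<in> bmats (nsA (n (Suc K)))" by (rule pull_closed[OF labc])
    define x where "x = \<beta>A (n (Suc K)) ?b"
    have x: "x \<in> carrier A" "x \<in> im (Suc K)" using b by (auto simp: x_def im_def)
    have "\<psi> (Suc K) x = \<phi> (Suc K) ?b" unfolding x_def by (rule \<psi>[OF b])
    then have near: "M (\<psi> (Suc K) x \<ominus>\<^bsub>T\<^esub> t) \<le> 2 * \<epsilon> (Suc K)"
      using link_back[OF link[of K] good[of "Suc K"] c(1)] by (simp add: \<phi>_def c(2))
    have "M (\<psi> l x \<ominus>\<^bsub>T\<^esub> t) < e" if l: "l \<ge> Suc K" for l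
    proof -
      have "M (\<psi> l x \<ominus>\<^bsub>T\<^esub> t) \<le> M (\<psi> l x \<ominus>\<^bsub>T\<^esub> \<psi> (Suc K) x) + M (\<psi> (Suc K) x \<ominus>\<^bsub>T\<^esub> t)"
        by (intro T.N_triangle \<psi>_closed t)
      moreover have "\<epsilon> (Suc K) < e / 10" using K2[of "Suc K"] by (simp add: K_def)
      ultimately show ?thesis using \<psi>_near[OF x(2) l] near by linarith
    qed
    then have "\<forall>\<^sub>F k in sequentially. M (\<psi> k x \<ominus>\<^bsub>T\<^esub> t) < e" unfolding eventually_sequentially by blast
    then show "\<exists>x\<in>carrier A. \<forall>\<^sub>F k in sequentially. M (\<psi> k x \<ominus>\<^bsub>T\<^esub> t) < e" using x(1) by blast
  qed
  obtain \<Phi> where \<Phi>: "\<Phi> \<in> ring_iso (completion A N) (completion T M)"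
    and *: "\<And>a b. a \<in> carrier A \<Longrightarrow> b \<in> carrier T \<Longrightarrow> (\<lambda>k. M (\<psi> k a \<ominus>\<^bsub>T\<^esub> b)) \<longlonglongrightarrow> 0 \<Longrightarrow> \<Phi> (completion_map A N a) = completion_map T M b"
    using iso.completion_isomorphic by blast
  have "\<Phi> (completion_map A N (\<iota> d)) = completion_map T M (\<kappa> d)" for d
  proof (rule *[OF _ _ scal])
    show "\<iota> d \<in> carrier A" using A.scal[of 0 d] A.beta_closed[OF bdiag_closed[OF subset_refl], of 0 d] by simp
    show "\<kappa> d \<in> carrier T" using T.scal[of 0 d] T.beta_closed[OF bdiag_closed[OF subset_refl], of 0 d] by simp
  qed
  then show ?thesis using \<Phi> by blast
qed

end

section \<open>Direct limits of sequences of rings\<close>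

text \<open>
  Two elements have the same class in the limit if and only if they agree at some later stage, and any
  finitely many classes have representatives at a common stage.  The ring axioms are thus inherited
  from the stages.
\<close>

locale ring_sequence =
  fixes R :: "nat \<Rightarrow> 'b ring" and \<phi> :: "nat \<Rightarrow> 'b \<Rightarrow> 'b"
  assumes ring: "ring (R n)" and hom: "\<phi> n \<in> Ring.ring_hom (R n) (R (Suc n))"
begin

abbreviation emb :: "nat \<Rightarrow> 'b \<Rightarrow> (nat \<times> 'b) set" where
  "emb n x \<equiv> limit_class R \<phi> n x"

lemma transition_hom: "transition \<phi> n k \<in> Ring.ring_hom (R n) (R (n + k))"
proof (induction k)
  case 0
  show ?case by (rule ring_hom_memI) simp_all
next
  case (Suc k)
  have "transition \<phi> n (Suc k) = \<phi> (n + k) \<circ> transition \<phi> n k" by (rule ext) simp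
  then show ?case using ring_hom_trans[OF Suc hom] by (simp only: add_Suc_right)
qed

lemma transition_closed: "x \<in> carrier (R n) \<Longrightarrow> transition \<phi> n k x \<in> carrier (R (n + k))"
  by (rule ring_hom_closed[OF transition_hom])

lemma transition_add: "transition \<phi> n (j + k) x = transition \<phi> (n + j) k (transition \<phi> n j x)"
  by (induction k) (simp_all add: add.assoc)

lemma transition_later:
  assumes "n + j = m + k" "transition \<phi> n j x = transition \<phi> m k y"
  shows "transition \<phi> n (j + l) x = transition \<phi> m (k + l) y"
  using assms by (simp add: transition_add)

lemma mem_emb: "(m, y) \<in> emb n x \<longleftrightarrow> y \<in> carrier (R m) \<and>
    (\<exists>j k. n + j = m + k \<and> transition \<phi> n j x = transition \<phi> m k y)"
  by (simp add: limit_class_def)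

lemma mem_emb_self: "x \<in> carrier (R n) \<Longrightarrow> (n, x) \<in> emb n x"
  unfolding mem_emb by blast

lemma emb_eqI:
  assumes "n + j = m + k" "transition \<phi> n j x = transition \<phi> m k y"
  shows "emb n x = emb m y"
proof -
  have *: "(l, z) \<in> emb m y"
    if nm: "n + j = m + k" "transition \<phi> n j x = transition \<phi> m k y" and z: "(l, z) \<in> emb n x" for n m j k x y l z
  proof -
    from z obtain j' k' where z: "z \<in> carrier (R l)" and l: "n + j' = l + k'" "transition \<phi> n j' x = transition \<phi> l k' z"
      unfolding mem_emb by blast
    have "transition \<phi> m (k + j') y = transition \<phi> n (j + j') x" by (rule transition_later[OF nm, symmetric])
    also have "\<dots> = transition \<phi> n (j' + j) x" by (simp add: add.commute)
    also have "\<dots> = transition \<phi> l (k' + j) z" by (rule transition_later[OF l])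
    finally have "transition \<phi> m (k + j') y = transition \<phi> l (k' + j) z" .
    moreover have "m + (k + j') = l + (k' + j)" using nm(1) l(1) by simp
    ultimately show ?thesis unfolding mem_emb using z by blast
  qed
  show ?thesis
  proof (intro equalityI subsetI)
    fix q assume "q \<in> emb n x"
    then show "q \<in> emb m y" using *[OF assms, of "fst q" "snd q"] by simp
  next
    fix q assume "q \<in> emb m y"
    then show "q \<in> emb n x" using *[OF assms[symmetric], of "fst q" "snd q"] by simp
  qed
qed

lemma emb_eqD:
  assumes "x \<in> carrier (R n)" "emb n x = emb m y"
  shows "\<exists>j k. n + j = m + k \<and> transition \<phi> n j x = transition \<phi> m k y"
proof -
  have "(n, x) \<in> emb m y" using mem_emb_self[OF assms(1)] assms(2) by simp
  then obtain j k where "m + j = n + k" "transition \<phi> m j y = transition \<phi> n k x" unfolding mem_emb by blast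
  then show ?thesis by metis
qed

lemma emb_transition: "emb (n + k) (transition \<phi> n k x) = emb n x"
  by (rule emb_eqI[of _ 0 _ k]) simp_all

text \<open>
  The operations of the limit are well defined, as two representatives of each operand agree from
  some stage on.
\<close>

lemma emb_operation:
  assumes cl: "\<And>n x y. x \<in> carrier (R n) \<Longrightarrow> y \<in> carrier (R n) \<Longrightarrow> g n x y \<in> carrier (R n)"
    and tr: "\<And>n k x y. x \<in> carrier (R n) \<Longrightarrow> y \<in> carrier (R n) \<Longrightarrow>
      transition \<phi> n k (g n x y) = g (n + k) (transition \<phi> n k x) (transition \<phi> n k y)"
    and x: "x \<in> carrier (R n)" and y: "y \<in> carrier (R n)"
  shows "\<Union>{emb l (g l x' y') | l x' y'. (l, x') \<in> emb n x \<and> (l, y') \<in> emb n y} = emb n (g n x y)"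
proof -
  have "emb l (g l x' y') = emb n (g n x y)" if x': "(l, x') \<in> emb n x" and y': "(l, y') \<in> emb n y" for l x' y'
  proof -
    from x' obtain j k where 1: "x' \<in> carrier (R l)" "n + j = l + k" "transition \<phi> n j x = transition \<phi> l k x'"
      unfolding mem_emb by blast
    from y' obtain j' k' where 2: "y' \<in> carrier (R l)" "n + j' = l + k'" "transition \<phi> n j' y = transition \<phi> l k' y'"
      unfolding mem_emb by blast
    have jk: "j' + j = j + j'" "k' + j = k + j'" using 1(2) 2(2) by simp_all
    have "transition \<phi> n (j + j') (g n x y) = g (n + (j + j')) (transition \<phi> n (j + j') x) (transition \<phi> n (j + j') y)"
      by (rule tr[OF x y])
    also have "\<dots> = g (n + (j + j')) (transition \<phi> l (k + j') x') (transition \<phi> l (k + j') y')"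
      using transition_later[OF 1(2,3), of j'] transition_later[OF 2(2,3), of j] by (simp add: jk)
    also have "n + (j + j') = l + (k + j')" using 1(2) by simp
    also have "g (l + (k + j')) (transition \<phi> l (k + j') x') (transition \<phi> l (k + j') y') = transition \<phi> l (k + j') (g l x' y')"
      by (rule tr[OF 1(1) 2(1), symmetric])
    finally have "transition \<phi> n (j + j') (g n x y) = transition \<phi> l (k + j') (g l x' y')" .
    moreover have "n + (j + j') = l + (k + j')" using 1(2) by simp
    ultimately show ?thesis by (metis emb_eqI)
  qed
  then have "{emb l (g l x' y') | l x' y'. (l, x') \<in> emb n x \<and> (l, y') \<in> emb n y} = {emb n (g n x y)}"
    using mem_emb_self[OF x] mem_emb_self[OF y] by blast
  then show ?thesis by simp
qed

abbreviation limit_ring :: "(nat \<times> 'b) set ring" where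
  "limit_ring \<equiv> direct_limit R \<phi>"

lemma emb_closed: "x \<in> carrier (R n) \<Longrightarrow> emb n x \<in> carrier limit_ring"
  by (auto simp: direct_limit_def)

lemma emb_mult:
  assumes "x \<in> carrier (R n)" "y \<in> carrier (R n)"
  shows "emb n x \<otimes>\<^bsub>limit_ring\<^esub> emb n y = emb n (x \<otimes>\<^bsub>R n\<^esub> y)"
proof -
  have "emb n x \<otimes>\<^bsub>limit_ring\<^esub> emb n y = \<Union>{emb l (x' \<otimes>\<^bsub>R l\<^esub> y') | l x' y'. (l, x') \<in> emb n x \<and> (l, y') \<in> emb n y}"
    by (simp add: direct_limit_def)
  also have "\<dots> = emb n (x \<otimes>\<^bsub>R n\<^esub> y)"
    by (rule emb_operation[where g = "\<lambda>l x y. x \<otimes>\<^bsub>R l\<^esub> y", OF _ ring_hom_mult[OF transition_hom] assms])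
      (rule monoid.m_closed[OF ring.is_monoid[OF ring]])
  finally show ?thesis .
qed

lemma emb_add:
  assumes "x \<in> carrier (R n)" "y \<in> carrier (R n)"
  shows "emb n x \<oplus>\<^bsub>limit_ring\<^esub> emb n y = emb n (x \<oplus>\<^bsub>R n\<^esub> y)"
proof -
  have "emb n x \<oplus>\<^bsub>limit_ring\<^esub> emb n y = \<Union>{emb l (x' \<oplus>\<^bsub>R l\<^esub> y') | l x' y'. (l, x') \<in> emb n x \<and> (l, y') \<in> emb n y}"
    by (simp add: direct_limit_def)
  also have "\<dots> = emb n (x \<oplus>\<^bsub>R n\<^esub> y)"
    by (rule emb_operation[where g = "\<lambda>l x y. x \<oplus>\<^bsub>R l\<^esub> y", OF _ ring_hom_add[OF transition_hom] assms])
      (rule abelian_monoid.a_closed[OF abelian_group.axioms(1)[OF ring.is_abelian_group[OF ring]]])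
  finally show ?thesis .
qed

lemma emb_one: "emb n \<one>\<^bsub>R n\<^esub> = \<one>\<^bsub>limit_ring\<^esub>"
  using emb_transition[of 0 n "\<one>\<^bsub>R 0\<^esub>"] ring_hom_one[OF transition_hom, of 0 n]
  by (simp add: direct_limit_def)

lemma emb_zero: "emb n \<zero>\<^bsub>R n\<^esub> = \<zero>\<^bsub>limit_ring\<^esub>"
  using emb_transition[of 0 n "\<zero>\<^bsub>R 0\<^esub>"] ring_hom_zero[OF transition_hom ring ring, of 0 n]
  by (simp add: direct_limit_def)

lemma emb_hom: "emb n \<in> Ring.ring_hom (R n) limit_ring"
  by (rule ring_hom_memI) (simp_all add: emb_closed emb_mult emb_add emb_one)

lemma emb_step: "emb (Suc n) (\<phi> n x) = emb n x"
  using emb_transition[of n 1 x] by simp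

lemma emb_cofinal:
  assumes "X \<in> carrier limit_ring"
  shows "\<exists>n. \<forall>m\<ge>n. X \<in> emb m ` carrier (R m)"
proof -
  obtain n x where x: "x \<in> carrier (R n)" "X = emb n x" using assms by (auto simp: direct_limit_def)
  have "X \<in> emb m ` carrier (R m)" if "m \<ge> n" for m
  proof -
    obtain k where "m = n + k" using \<open>m \<ge> n\<close> le_Suc_ex by blast
    then show ?thesis using emb_transition[of n k x] transition_closed[OF x(1), of k] x(2) by auto
  qed
  then show ?thesis by blast
qed

lemma emb_common:
  assumes "X \<in> carrier limit_ring" "Y \<in> carrier limit_ring" "Z \<in> carrier limit_ring"
  obtains n x y z where "x \<in> carrier (R n)" "y \<in> carrier (R n)" "z \<in> carrier (R n)"
    "X = emb n x" "Y = emb n y" "Z = emb n z"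
proof -
  obtain n1 n2 n3 where "\<forall>m\<ge>n1. X \<in> emb m ` carrier (R m)" "\<forall>m\<ge>n2. Y \<in> emb m ` carrier (R m)"
    "\<forall>m\<ge>n3. Z \<in> emb m ` carrier (R m)"
    using emb_cofinal[OF assms(1)] emb_cofinal[OF assms(2)] emb_cofinal[OF assms(3)] by blast
  then have "X \<in> emb (n1 + n2 + n3) ` carrier (R (n1 + n2 + n3))" "Y \<in> emb (n1 + n2 + n3) ` carrier (R (n1 + n2 + n3))"
    "Z \<in> emb (n1 + n2 + n3) ` carrier (R (n1 + n2 + n3))" by auto
  then show ?thesis using that by blast
qed

lemma ring_direct_limit: "ring limit_ring"
proof (rule ringI)
  show "abelian_group limit_ring"
  proof (rule abelian_groupI)
    fix X Y Z assume XYZ: "X \<in> carrier limit_ring" "Y \<in> carrier limit_ring" "Z \<in> carrier limit_ring"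
    then obtain n x y z where *: "x \<in> carrier (R n)" "y \<in> carrier (R n)" "z \<in> carrier (R n)"
      and eq: "X = emb n x" "Y = emb n y" "Z = emb n z" by (rule emb_common)
    interpret Rn: ring "R n" by (rule ring)
    show "X \<oplus>\<^bsub>limit_ring\<^esub> Y \<oplus>\<^bsub>limit_ring\<^esub> Z = X \<oplus>\<^bsub>limit_ring\<^esub> (Y \<oplus>\<^bsub>limit_ring\<^esub> Z)"
      unfolding eq using * by (simp add: emb_add Rn.a_assoc)
  next
    fix X Y assume XY: "X \<in> carrier limit_ring" "Y \<in> carrier limit_ring"
    then obtain n x y z where *: "x \<in> carrier (R n)" "y \<in> carrier (R n)" "z \<in> carrier (R n)"
      and eq: "X = emb n x" "Y = emb n y" "Y = emb n z"
      using emb_common[OF XY XY(2)] by metis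
    interpret Rn: ring "R n" by (rule ring)
    show "X \<oplus>\<^bsub>limit_ring\<^esub> Y \<in> carrier limit_ring" "X \<oplus>\<^bsub>limit_ring\<^esub> Y = Y \<oplus>\<^bsub>limit_ring\<^esub> X"
      unfolding eq(1,2) using *(1,2) by (simp_all add: emb_add emb_closed Rn.a_comm)
  next
    interpret R0: ring "R 0" by (rule ring)
    show "\<zero>\<^bsub>limit_ring\<^esub> \<in> carrier limit_ring" using emb_zero[of 0] emb_closed[of "\<zero>\<^bsub>R 0\<^esub>" 0] by simp
  next
    fix X assume X: "X \<in> carrier limit_ring"
    then obtain n x where *: "x \<in> carrier (R n)" and eq: "X = emb n x"
      using emb_common[OF X X X] by metis
    interpret Rn: ring "R n" by (rule ring)
    show "\<zero>\<^bsub>limit_ring\<^esub> \<oplus>\<^bsub>limit_ring\<^esub> X = X" unfolding eq emb_zero[of n, symmetric] using * by (simp add: emb_add)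
    have "emb n (\<ominus>\<^bsub>R n\<^esub> x) \<oplus>\<^bsub>limit_ring\<^esub> X = \<zero>\<^bsub>limit_ring\<^esub>"
      unfolding eq emb_zero[of n, symmetric] using * by (simp add: emb_add Rn.l_neg)
    then show "\<exists>Y\<in>carrier limit_ring. Y \<oplus>\<^bsub>limit_ring\<^esub> X = \<zero>\<^bsub>limit_ring\<^esub>" using emb_closed[OF Rn.a_inv_closed[OF *]] by blast
  qed
  show "monoid limit_ring"
  proof (rule monoidI)
    fix X Y Z assume XYZ: "X \<in> carrier limit_ring" "Y \<in> carrier limit_ring" "Z \<in> carrier limit_ring"
    then obtain n x y z where *: "x \<in> carrier (R n)" "y \<in> carrier (R n)" "z \<in> carrier (R n)"
      and eq: "X = emb n x" "Y = emb n y" "Z = emb n z" by (rule emb_common)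
    interpret Rn: ring "R n" by (rule ring)
    show "X \<otimes>\<^bsub>limit_ring\<^esub> Y \<otimes>\<^bsub>limit_ring\<^esub> Z = X \<otimes>\<^bsub>limit_ring\<^esub> (Y \<otimes>\<^bsub>limit_ring\<^esub> Z)"
      unfolding eq using * by (simp add: emb_mult Rn.m_assoc)
  next
    fix X Y assume XY: "X \<in> carrier limit_ring" "Y \<in> carrier limit_ring"
    then obtain n x y z where *: "x \<in> carrier (R n)" "y \<in> carrier (R n)" "z \<in> carrier (R n)"
      and eq: "X = emb n x" "Y = emb n y" "Y = emb n z"
      using emb_common[OF XY XY(2)] by metis
    interpret Rn: ring "R n" by (rule ring)
    show "X \<otimes>\<^bsub>limit_ring\<^esub> Y \<in> carrier limit_ring" unfolding eq(1,2) using *(1,2) by (simp add: emb_mult emb_closed)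
  next
    interpret R0: ring "R 0" by (rule ring)
    show "\<one>\<^bsub>limit_ring\<^esub> \<in> carrier limit_ring" using emb_one[of 0] emb_closed[of "\<one>\<^bsub>R 0\<^esub>" 0] by simp
  next
    fix X assume X: "X \<in> carrier limit_ring"
    then obtain n x where *: "x \<in> carrier (R n)" and eq: "X = emb n x"
      using emb_common[OF X X X] by metis
    interpret Rn: ring "R n" by (rule ring)
    show "\<one>\<^bsub>limit_ring\<^esub> \<otimes>\<^bsub>limit_ring\<^esub> X = X" "X \<otimes>\<^bsub>limit_ring\<^esub> \<one>\<^bsub>limit_ring\<^esub> = X"
      unfolding eq emb_one[of n, symmetric] using * by (simp_all add: emb_mult)
  qed
next
  fix X Y Z assume XYZ: "X \<in> carrier limit_ring" "Y \<in> carrier limit_ring" "Z \<in> carrier limit_ring"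
  then obtain n x y z where *: "x \<in> carrier (R n)" "y \<in> carrier (R n)" "z \<in> carrier (R n)"
    and eq: "X = emb n x" "Y = emb n y" "Z = emb n z" by (rule emb_common)
  interpret Rn: ring "R n" by (rule ring)
  show "(X \<oplus>\<^bsub>limit_ring\<^esub> Y) \<otimes>\<^bsub>limit_ring\<^esub> Z = X \<otimes>\<^bsub>limit_ring\<^esub> Z \<oplus>\<^bsub>limit_ring\<^esub> Y \<otimes>\<^bsub>limit_ring\<^esub> Z"
    "Z \<otimes>\<^bsub>limit_ring\<^esub> (X \<oplus>\<^bsub>limit_ring\<^esub> Y) = Z \<otimes>\<^bsub>limit_ring\<^esub> X \<oplus>\<^bsub>limit_ring\<^esub> Z \<otimes>\<^bsub>limit_ring\<^esub> Y"
    unfolding eq using * by (simp_all add: emb_add emb_mult Rn.l_distr Rn.r_distr)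
qed

end

section \<open>Matrix rings and their products\<close>

definition block_matrix :: "nat list \<Rightarrow> nat \<Rightarrow> 'd::division_ring bmat \<Rightarrow> 'd mat" where
  "block_matrix ns i x = mat (ns ! i) (ns ! i) (\<lambda>(p, q). x (i, p) (i, q))"

definition matrix_list :: "nat list \<Rightarrow> 'd::division_ring bmat \<Rightarrow> 'd mat list" where
  "matrix_list ns x = map (\<lambda>i. block_matrix ns i x) [0..<length ns]"

lemma matrix_ring_simps [simp]:
  "carrier (matrix_ring T n) = carrier_mat n n" "monoid.mult (matrix_ring T n) = (*)"
  "one (matrix_ring T n) = 1\<^sub>m n" "zero (matrix_ring T n) = 0\<^sub>m n n" "add (matrix_ring T n) = (+)"
  by (simp_all add: matrix_ring_def ring_mat_simps)

lemma block_matrix_closed: "block_matrix ns i x \<in> carrier_mat (ns ! i) (ns ! i)"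
  by (simp add: block_matrix_def)

lemma block_matrix_bdiag:
  "i < length ns \<Longrightarrow> block_matrix ns i (bdiag (brows ns) d) = scalar_matrix (ns ! i) d"
  by (rule eq_matI) (auto simp: block_matrix_def bdiag_def scalar_matrix_def brows_def)

lemma block_matrix_hom:
  assumes i: "i < length ns"
  shows "block_matrix ns i \<in> Ring.ring_hom (block_ring TYPE('d::division_ring) ns) (matrix_ring TYPE('d) (ns ! i))"
proof (rule ring_hom_memI)
  fix x y :: "'d bmat"
  assume "x \<in> carrier (block_ring TYPE('d) ns)" "y \<in> carrier (block_ring TYPE('d) ns)"
  then have x: "x \<in> bmats ns" and y: "y \<in> bmats ns" by simp_all
  have sum: "bmult ns x y (i, p) s = (\<Sum>t\<in>{0..<ns ! i}. x (i, p) (i, t) * y (i, t) s)" for p s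
  proof -
    have "bmult ns x y (i, p) s = (\<Sum>t\<in>Pair i ` {..<ns ! i}. x (i, p) t * y t s)"
      using bmult_block[OF x, of "(i, p)" i y s] i by (simp add: block_eq)
    also have "\<dots> = (\<Sum>t\<in>{..<ns ! i}. x (i, p) (i, t) * y (i, t) s)"
      by (subst sum.reindex) (auto simp: inj_on_def)
    finally show ?thesis by (simp add: lessThan_atLeast0)
  qed
  have "block_matrix ns i (bmult ns x y) = block_matrix ns i x * block_matrix ns i y"
    by (rule eq_matI) (simp_all add: block_matrix_def scalar_prod_def sum)
  then show "block_matrix ns i (x \<otimes>\<^bsub>block_ring TYPE('d) ns\<^esub> y) =
      block_matrix ns i x \<otimes>\<^bsub>matrix_ring TYPE('d) (ns ! i)\<^esub> block_matrix ns i y" by simp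
  have "block_matrix ns i (badd x y) = block_matrix ns i x + block_matrix ns i y"
    by (rule eq_matI) (simp_all add: block_matrix_def badd_def)
  then show "block_matrix ns i (x \<oplus>\<^bsub>block_ring TYPE('d) ns\<^esub> y) =
      block_matrix ns i x \<oplus>\<^bsub>matrix_ring TYPE('d) (ns ! i)\<^esub> block_matrix ns i y" by simp
next
  have "block_matrix ns i (bdiag (brows ns) 1) = (1\<^sub>m (ns ! i) :: 'd mat)"
    using i by (simp only: block_matrix_bdiag) (rule eq_matI, auto simp: scalar_matrix_def)
  then show "block_matrix ns i \<one>\<^bsub>block_ring TYPE('d) ns\<^esub> = \<one>\<^bsub>matrix_ring TYPE('d) (ns ! i)\<^esub>" by simp
qed (simp add: block_matrix_closed)

text \<open>
  The products of lists of rings are iterated binary products, so homomorphisms into them are built up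
  one factor at a time.
\<close>

lemma ring_hom_RDirProd_list:
  "list_all2 (\<lambda>f R. f \<in> Ring.ring_hom S R) fs Rs \<Longrightarrow> (\<lambda>x. map (\<lambda>f. f x) fs) \<in> Ring.ring_hom S (RDirProd_list Rs)"
proof (induction fs Rs rule: list_all2_induct)
  case Nil
  show ?case by (rule ring_hom_memI) (simp_all add: monoid.defs)
next
  case (Cons f fs R Rs)
  have "(\<lambda>x. (f x, map (\<lambda>f. f x) fs)) \<in> Ring.ring_hom S (RDirProd R (RDirProd_list Rs))"
    using ring_hom_memE[OF Cons(1)] ring_hom_memE[OF Cons(3)]
    by (intro ring_hom_memI) (simp_all add: RDirProd_def DirProd_def monoid.defs)
  from ring_hom_trans[OF this RDirProd_list_hom1] show ?case by (simp add: comp_def)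
qed

lemma matrix_list_iso:
  "matrix_list ns \<in> ring_iso (block_ring TYPE('d::division_ring) ns) (RDirProd_list (map (matrix_ring TYPE('d)) ns))"
  (is "_ \<in> ring_iso ?B ?P")
proof -
  have "(\<lambda>x. map (\<lambda>f. f x) (map (block_matrix ns) [0..<length ns])) \<in> Ring.ring_hom ?B ?P"
    by (rule ring_hom_RDirProd_list) (auto simp: list_all2_conv_all_nth block_matrix_hom)
  then have hom: "matrix_list ns \<in> Ring.ring_hom ?B ?P"
    by (simp add: matrix_list_def[abs_def] comp_def)
  have "bij_betw (matrix_list ns) (bmats ns) (carrier ?P)"
    unfolding bij_betw_def
  proof
    show "inj_on (matrix_list ns :: 'd bmat \<Rightarrow> _) (bmats ns)"
    proof (rule inj_onI)
      fix x y :: "'d bmat" assume x: "x \<in> bmats ns" and y: "y \<in> bmats ns" and eq: "matrix_list ns x = matrix_list ns y"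
      have "x (i, p) (i, q) = y (i, p) (i, q)" if "i < length ns" "p < ns ! i" "q < ns ! i" for i p q
      proof -
        have "matrix_list ns x ! i = matrix_list ns y ! i" using eq by simp
        then have "block_matrix ns i x = block_matrix ns i y" using that by (simp add: matrix_list_def)
        then have "block_matrix ns i x $$ (p, q) = block_matrix ns i y $$ (p, q)" by simp
        then show ?thesis using that by (simp add: block_matrix_def)
      qed
      then have *: "x r s = y r s" if "r \<in> brows ns" "s \<in> brows ns" "fst r = fst s" for r s
        using that by (cases r; cases s) (auto simp: brows_def)
      show "x = y"
      proof (intro ext)
        fix r s show "x r s = y r s" using *[of r s] bmats_zero[OF x, of r s] bmats_zero[OF y, of r s] by metis
      qed
    qed
    show "matrix_list ns ` bmats ns = carrier ?P"
    proof (intro equalityI subsetI)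
      fix Ms :: "'d mat list" assume "Ms \<in> matrix_list ns ` bmats ns"
      then show "Ms \<in> carrier ?P" using ring_hom_closed[OF hom] by auto
    next
      fix Ms :: "'d mat list" assume Ms: "Ms \<in> carrier ?P"
      have len: "length Ms = length ns" and M: "Ms ! i \<in> carrier_mat (ns ! i) (ns ! i)" if "i < length ns" for i
        using RDirProd_list_carrier_mem[OF Ms] that by simp_all
      have len: "length Ms = length ns" using RDirProd_list_carrier_mem(1)[OF Ms] by simp
      define x where "x r s = (if r \<in> brows ns \<and> s \<in> brows ns \<and> fst r = fst s then (Ms ! fst r) $$ (snd r, snd s) else 0)" for r s
      have "x \<in> bmats ns" by (rule bmatsI) (auto simp: x_def split: if_splits)
      moreover have "Ms = matrix_list ns x"
      proof (rule nth_equalityI)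
        fix i assume i: "i < length Ms"
        have "Ms ! i = block_matrix ns i x"
          by (rule eq_matI) (use M[of i] i len in \<open>auto simp: block_matrix_def x_def brows_def\<close>)
        then show "Ms ! i = matrix_list ns x ! i" using i len by (simp add: matrix_list_def)
      qed (simp add: len matrix_list_def)
      ultimately show "Ms \<in> matrix_list ns ` bmats ns" by blast
    qed
  qed
  then show ?thesis using hom by (simp add: ring_iso_def)
qed

lemma matrix_list_bdiag: "matrix_list ns (bdiag (brows ns) d) = map (\<lambda>n. scalar_matrix n d) ns"
  by (rule nth_equalityI) (simp_all add: matrix_list_def block_matrix_bdiag)

lemma matricial_D_ring_block_ring:
  fixes R :: "('a, 'm) ring_scheme" and \<kappa> :: "'d::division_ring \<Rightarrow> 'a"
  assumes "matricial_D_ring R \<kappa>"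
  shows "\<exists>ns e. sizes ns \<and> e \<in> ring_iso (block_ring TYPE('d) ns) R \<and> (\<forall>d. e (bdiag (brows ns) d) = \<kappa> d)"
proof -
  obtain ns f where ns: "ns \<noteq> []" "\<forall>n\<in>set ns. 0 < n" and R: "ring R" and \<kappa>: "\<kappa> \<in> Ring.ring_hom (type_ring TYPE('d)) R"
    and f: "f \<in> Ring.ring_hom R (RDirProd_list (map (matrix_ring TYPE('d)) ns))"
      "(\<lambda>d. map (\<lambda>n. scalar_matrix n d) ns) = f \<circ> \<kappa>"
      "bij_betw f (carrier R) (carrier (RDirProd_list (map (matrix_ring TYPE('d)) ns)))"
    using assms unfolding matricial_D_ring_def D_ring_isomorphic_def D_ring_def D_ring_hom_def by blast
  let ?g = "inv_into (carrier R) f"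
  have "f \<in> ring_iso R (RDirProd_list (map (matrix_ring TYPE('d)) ns))" using f by (simp add: ring_iso_def)
  then have "?g \<in> ring_iso (RDirProd_list (map (matrix_ring TYPE('d)) ns)) R" by (rule ring_iso_set_sym[OF R])
  from ring_iso_set_trans[OF matrix_list_iso this]
  have "?g \<circ> matrix_list ns \<in> ring_iso (block_ring TYPE('d) ns) R" .
  moreover have "(?g \<circ> matrix_list ns) (bdiag (brows ns) d) = \<kappa> d" for d
  proof -
    have "\<kappa> d \<in> carrier R" using ring_hom_closed[OF \<kappa>, of d] by (simp add: type_ring_def)
    then have "?g (f (\<kappa> d)) = \<kappa> d" by (rule inv_into_f_f[OF bij_betw_imp_inj_on[OF f(3)]])
    then show ?thesis using fun_cong[OF f(2), of d] by (simp add: matrix_list_bdiag)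
  qed
  moreover have "sizes ns" using ns by (simp add: sizes_def)
  ultimately show ?thesis by blast
qed

section \<open>Ultramatricial rings as weighted Bratteli diagrams\<close>

text \<open>
  After conjugating the homomorphisms of the sequence one after the other, they all put copies of
  blocks along the diagonal.  The conjugations are by matrices with central entries and thus do not
  move the scalars.
\<close>

lemma ultramatricial_standard_system:
  fixes A :: "('a, 'm) ring_scheme" and \<iota> :: "'d::division_ring \<Rightarrow> 'a"
  assumes "ultramatricial_D_ring A \<iota>" and N: "N \<in> pseudo_rank_functions A"
  shows "\<exists>ns L \<beta>. standard_system A N \<iota> ns L \<beta>"
proof -
  obtain R :: "nat \<Rightarrow> 'd mat list ring" and \<kappa> \<phi> where mat: "\<And>n. matricial_D_ring (R n) (\<kappa> n)"
    and \<phi>: "\<And>n. \<phi> n \<in> D_ring_hom (R n) (\<kappa> n) (R (Suc n)) (\<kappa> (Suc n))"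
    and iso: "D_ring_isomorphic A \<iota> (direct_limit R \<phi>) (direct_limit_structure R \<phi> \<kappa>)"
    using assms(1) unfolding ultramatricial_D_ring_def by blast
  have ringR: "ring (R n)" for n
    using mat[of n] by (auto simp: matricial_D_ring_def D_ring_isomorphic_def D_ring_def)
  have \<phi>hom: "\<phi> n \<in> Ring.ring_hom (R n) (R (Suc n))" and \<phi>\<kappa>: "\<kappa> (Suc n) d = \<phi> n (\<kappa> n d)" for n d
    using \<phi>[of n] by (auto simp: D_ring_hom_def)
  interpret ring_sequence R \<phi> by (rule ring_sequence.intro) (rule ringR \<phi>hom)+
  have ringA: "ring A" and \<iota>: "\<iota> \<in> Ring.ring_hom (type_ring TYPE('d)) A" using iso by (auto simp: D_ring_isomorphic_def D_ring_def)
  obtain h where h: "h \<in> Ring.ring_hom A limit_ring" "direct_limit_structure R \<phi> \<kappa> = h \<circ> \<iota>"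
      "bij_betw h (carrier A) (carrier limit_ring)"
    using iso unfolding D_ring_isomorphic_def D_ring_hom_def by blast
  define \<Theta> where "\<Theta> = inv_into (carrier A) h"
  have \<Theta>: "\<Theta> \<in> ring_iso limit_ring A"
    unfolding \<Theta>_def using h by (intro ring_iso_set_sym[OF ringA]) (simp add: ring_iso_def)
  have \<Theta>\<iota>: "\<Theta> (emb 0 (\<kappa> 0 d)) = \<iota> d" for d
  proof -
    have "\<iota> d \<in> carrier A" using ring_hom_closed[OF \<iota>, of d] by (simp add: type_ring_def)
    then have "\<Theta> (h (\<iota> d)) = \<iota> d" unfolding \<Theta>_def by (rule inv_into_f_f[OF bij_betw_imp_inj_on[OF h(3)]])
    then show ?thesis using fun_cong[OF h(2), of d] by (simp add: direct_limit_structure_def)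
  qed
  have emb\<kappa>: "emb n (\<kappa> n d) = emb 0 (\<kappa> 0 d)" for n d
    by (induction n) (simp_all add: \<phi>\<kappa> emb_step)
  obtain ns e where sizes: "\<And>n. sizes (ns n)" and e: "\<And>n. e n \<in> ring_iso (block_ring TYPE('d) (ns n)) (R n)"
    and e\<kappa>: "\<And>n d. e n (bdiag (brows (ns n)) d) = \<kappa> n d"
    using matricial_D_ring_block_ring[OF mat] by metis
  define B where "B n = block_ring TYPE('d) (ns n)" for n
  have B [simp]: "carrier (B n) = bmats (ns n)" "monoid.mult (B n) = bmult (ns n)" "one (B n) = bdiag (brows (ns n)) 1"
    "add (B n) = badd" for n by (simp_all add: B_def)
  have e: "e n \<in> ring_iso (B n) (R n)" for n using e by (simp add: B_def)
  then have ehom: "e n \<in> Ring.ring_hom (B n) (R n)" and ebij: "bij_betw (e n) (bmats (ns n)) (carrier (R n))" for n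
    by (simp_all add: ring_iso_def)
  define e' where "e' n = inv_into (carrier (B n)) (e n)" for n
  have e': "e' n \<in> Ring.ring_hom (R n) (B n)" for n
    using ring_iso_set_sym[OF _ e[of n]] ring_block_ring[of "TYPE('d)" "ns n"] by (simp add: e'_def B_def ring_iso_def)
  have e'e: "e' n (e n x) = x" if "x \<in> bmats (ns n)" for n x
    using inv_into_f_f[OF bij_betw_imp_inj_on[OF ebij] that] by (simp add: e'_def)
  have ee': "e n (e' n y) = y" if "y \<in> carrier (R n)" for n y
    using f_inv_into_f[of y "e n" "bmats (ns n)"] ebij[of n] that by (simp add: e'_def bij_betw_def)
  define f where "f n = e' (Suc n) \<circ> (\<phi> n \<circ> e n)" for n
  have fhom: "f n \<in> Ring.ring_hom (B n) (B (Suc n))" for n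
    unfolding f_def by (intro ring_hom_trans[OF _ e'] ring_hom_trans[OF ehom \<phi>hom])
  have ef: "e (Suc n) (f n x) = \<phi> n (e n x)" if "x \<in> bmats (ns n)" for n x
    unfolding f_def comp_def using that
    by (intro ee' ring_hom_closed[OF \<phi>hom] ring_hom_closed[OF ehom]) simp
  have fscal: "f n (bdiag (brows (ns n)) d) = bdiag (brows (ns (Suc n))) d" for n d
    unfolding f_def comp_def e\<kappa> \<phi>\<kappa>[symmetric] using e'e[of "bdiag (brows (ns (Suc n))) d" "Suc n"] by (simp add: e\<kappa>)
  define \<alpha> where "\<alpha> n = \<Theta> \<circ> (emb n \<circ> e n)" for n
  have \<alpha>hom: "\<alpha> n \<in> Ring.ring_hom (B n) A" for n
    unfolding \<alpha>_def using \<Theta> by (intro ring_hom_trans[OF ring_hom_trans[OF ehom emb_hom]]) (simp add: ring_iso_def)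
  have \<alpha>step: "\<alpha> (Suc n) (f n x) = \<alpha> n x" if "x \<in> bmats (ns n)" for n x
    by (simp add: \<alpha>_def ef[OF that] emb_step)
  have \<alpha>scal: "\<alpha> n (bdiag (brows (ns n)) d) = \<iota> d" for n d
    using \<Theta>\<iota>[of d] emb\<kappa>[of n d] by (simp add: \<alpha>_def e\<kappa>)
  define unit where "unit n p \<longleftrightarrow> fst p \<in> central_bmats (ns n) \<and> snd p \<in> central_bmats (ns n) \<and>
     bmult (ns n) (fst p) (snd p) = bdiag (brows (ns n)) 1 \<and> bmult (ns n) (snd p) (fst p) = bdiag (brows (ns n)) 1"
    for n and p :: "'d bmat \<times> 'd bmat"
  define ad where "ad n p x = bmult (ns n) (fst p) (bmult (ns n) x (snd p))" for n and p :: "'d bmat \<times> 'd bmat" and x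
  have cl: "fst p \<in> bmats (ns n)" "snd p \<in> bmats (ns n)" if "unit n p" for n p
    using that by (simp_all add: unit_def central_bmats_def)
  have ad_scal: "ad n p (bdiag (brows (ns n)) d) = bdiag (brows (ns n)) d" if "unit n p" for n p d
  proof -
    have "ad n p (bdiag (brows (ns n)) d) = bmult (ns n) (bmult (ns n) (fst p) (bdiag (brows (ns n)) d)) (snd p)"
      by (simp add: ad_def bmult_assoc)
    also have "bmult (ns n) (fst p) (bdiag (brows (ns n)) d) = bmult (ns n) (bdiag (brows (ns n)) d) (fst p)"
      using that by (intro central_bmats_commute) (simp add: unit_def)
    also have "bmult (ns n) \<dots> (snd p) = bmult (ns n) (bdiag (brows (ns n)) d) (bmult (ns n) (fst p) (snd p))"
      by (rule bmult_assoc)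
    also have "\<dots> = bdiag (brows (ns n)) d" using that by (simp add: unit_def)
    finally show ?thesis .
  qed
  have ad_hom: "ad n p \<in> Ring.ring_hom (B n) (B n)" if p: "unit n p" for n p
  proof (rule ring_hom_memI)
    fix x y assume "x \<in> carrier (B n)" "y \<in> carrier (B n)"
    then have x: "x \<in> bmats (ns n)" and y: "y \<in> bmats (ns n)" by simp_all
    have "bmult (ns n) (ad n p x) (ad n p y) =
        bmult (ns n) (fst p) (bmult (ns n) x (bmult (ns n) (bmult (ns n) (snd p) (fst p)) (bmult (ns n) y (snd p))))"
      by (simp add: ad_def bmult_assoc)
    also have "\<dots> = ad n p (bmult (ns n) x y)" using p cl[OF p] y by (simp add: unit_def ad_def bmult_assoc)
    finally show "ad n p (x \<otimes>\<^bsub>B n\<^esub> y) = ad n p x \<otimes>\<^bsub>B n\<^esub> ad n p y" by simp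
    show "ad n p (x \<oplus>\<^bsub>B n\<^esub> y) = ad n p x \<oplus>\<^bsub>B n\<^esub> ad n p y"
      by (simp add: ad_def bmult_badd_left bmult_badd_right)
  next
    fix x assume "x \<in> carrier (B n)"
    then show "ad n p x \<in> carrier (B n)" using cl[OF p] by (simp add: ad_def)
  next
    show "ad n p \<one>\<^bsub>B n\<^esub> = \<one>\<^bsub>B n\<^esub>" using ad_scal[OF p, of 1] by simp
  qed
  have "\<exists>g. \<forall>n. unit n (g n) \<and> (\<exists>L. total_labelling (ns (Suc n)) (ns n) L \<and>
      (\<forall>x\<in>bmats (ns n). f n (ad n (g n) x) = ad (Suc n) (g (Suc n)) (pull L x)))"
  proof (rule dependent_nat_choice)
    have "unit 0 (bdiag (brows (ns 0)) 1, bdiag (brows (ns 0)) 1)"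
      by (simp add: unit_def central_bmats_def) (simp add: bdiag_def)
    then show "\<exists>p. unit 0 p" by blast
  next
    fix p n assume p: "unit n p"
    let ?f = "f n \<circ> ad n p"
    have "?f \<in> Ring.ring_hom (block_ring TYPE('d) (ns n)) (block_ring TYPE('d) (ns (Suc n)))"
      using ring_hom_trans[OF ad_hom[OF p] fhom] by (simp add: B_def)
    moreover have "?f (bdiag (brows (ns n)) d) = bdiag (brows (ns (Suc n))) d" for d
      by (simp add: ad_scal[OF p] fscal)
    ultimately obtain L W W' where L: "total_labelling (ns (Suc n)) (ns n) L"
      and "W \<in> central_bmats (ns (Suc n))" "W' \<in> central_bmats (ns (Suc n))"
        "bmult (ns (Suc n)) W W' = bdiag (brows (ns (Suc n))) 1" "bmult (ns (Suc n)) W' W = bdiag (brows (ns (Suc n))) 1"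
      and eq: "\<forall>x\<in>bmats (ns n). ?f x = bmult (ns (Suc n)) W (bmult (ns (Suc n)) (pull L x) W')"
      using D_hom_conjugate_standard[OF sizes sizes, of ?f n "Suc n"] by blast
    then have "unit (Suc n) (W, W')" by (simp add: unit_def)
    moreover have "\<forall>x\<in>bmats (ns n). f n (ad n p x) = ad (Suc n) (W, W') (pull L x)" using eq by (simp add: ad_def)
    ultimately show "\<exists>q. unit (Suc n) q \<and> (\<exists>L. total_labelling (ns (Suc n)) (ns n) L \<and>
        (\<forall>x\<in>bmats (ns n). f n (ad n p x) = ad (Suc n) q (pull L x)))" using L by blast
  qed
  then obtain g where g: "\<And>n. unit n (g n)" and "\<And>n. \<exists>L. total_labelling (ns (Suc n)) (ns n) L \<and>
      (\<forall>x\<in>bmats (ns n). f n (ad n (g n) x) = ad (Suc n) (g (Suc n)) (pull L x))"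
    by blast
  then obtain L where L: "\<And>n. total_labelling (ns (Suc n)) (ns n) (L n)"
    and fL: "\<And>n x. x \<in> bmats (ns n) \<Longrightarrow> f n (ad n (g n) x) = ad (Suc n) (g (Suc n)) (pull (L n) x)"
    by metis
  have adcl: "ad n (g n) x \<in> bmats (ns n)" if "x \<in> bmats (ns n)" for n x
    using cl[OF g] that by (simp add: ad_def)
  define \<beta> where "\<beta> n = \<alpha> n \<circ> ad n (g n)" for n
  have "standard_system A N \<iota> ns L \<beta>"
  proof (intro standard_system.intro pseudo_rank_ring.intro pseudo_rank_ring_axioms.intro standard_system_axioms.intro)
    show "ring A" by (rule ringA)
    show "N \<in> pseudo_rank_functions A" by (rule N)
    fix n
    show "sizes (ns n)" by (rule sizes)
    show "total_labelling (ns (Suc n)) (ns n) (L n)" by (rule L)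
    show "\<beta> n \<in> Ring.ring_hom (block_ring TYPE('d) (ns n)) A"
      using ring_hom_trans[OF ad_hom[OF g] \<alpha>hom] by (simp add: \<beta>_def B_def)
    show "\<beta> n (bdiag (brows (ns n)) d) = \<iota> d" for d
      by (simp add: \<beta>_def ad_scal[OF g] \<alpha>scal)
    show "\<beta> (Suc n) (pull (L n) x) = \<beta> n x" if x: "x \<in> bmats (ns n)" for x
      using \<alpha>step[OF adcl[OF x]] by (simp add: \<beta>_def fL[OF x])
  next
    fix a assume "a \<in> carrier A"
    then have "h a \<in> carrier limit_ring" "\<Theta> (h a) = a"
      using h(3) by (auto simp: \<Theta>_def bij_betw_def)
    then obtain n y where y: "y \<in> carrier (R n)" "a = \<Theta> (emb n y)" using emb_cofinal[of "h a"] by (metis image_iff le_refl)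
    define z where "z = e' n y"
    have z: "z \<in> bmats (ns n)" using ring_hom_closed[OF e', of y n] y(1) by (simp add: z_def)
    define x where "x = bmult (ns n) (snd (g n)) (bmult (ns n) z (fst (g n)))"
    have x: "x \<in> bmats (ns n)" using cl[OF g] z by (simp add: x_def)
    have "ad n (g n) x = bmult (ns n) (bmult (ns n) (fst (g n)) (snd (g n))) (bmult (ns n) z (bmult (ns n) (fst (g n)) (snd (g n))))"
      by (simp add: ad_def x_def bmult_assoc)
    then have "ad n (g n) x = z" using g[of n] z by (simp add: unit_def)
    then have "\<beta> n x = a" using y ee'[OF y(1)] by (simp add: \<beta>_def \<alpha>_def z_def)
    then show "\<exists>n. a \<in> \<beta> n ` bmats (ns n)" using x by blast
  qed
  then show ?thesis by blast
qed

section \<open>The dyadic limit\<close>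

text \<open>
  The map \<open>x \<mapsto> diag(x, x)\<close> comes from the labelling that numbers the rows of both copies in the same
  way: the quotient of a row index by \<open>2 ^ m\<close> is the copy, the remainder is the row in the copy.
\<close>

definition dyadic_labelling :: "nat \<Rightarrow> labelling" where
  "dyadic_labelling m = ((\<lambda>r. (0, snd r mod 2 ^ m)),
     \<lambda>r s. r \<in> brows [2 ^ Suc m] \<and> s \<in> brows [2 ^ Suc m] \<and> snd r div 2 ^ m = snd s div 2 ^ m)"

lemma brows_single: "r \<in> brows [k] \<longleftrightarrow> fst r = 0 \<and> snd r < k"
  by (cases r) (auto simp: brows_def)

lemma total_dyadic_labelling: "total_labelling [2 ^ Suc m] [2 ^ m] (dyadic_labelling m)"
proof -
  have "labelling [2 ^ Suc m] [2 ^ m] (dyadic_labelling m)"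
    unfolding dyadic_labelling_def
  proof (rule labellingI, goal_cases)
    case (1 r s)
    then show ?case by (auto simp: brows_single)
  next
    case (2 r s t)
    then show ?case by simp
  next
    case (3 r s)
    then have "snd r div 2 ^ m = snd s div 2 ^ m" "snd r mod 2 ^ m = snd s mod 2 ^ m" by auto
    then have "snd r = snd s" by (metis div_mult_mod_eq)
    then show ?case using 3 by (auto simp: brows_single prod_eq_iff)
  next
    case (4 r \<rho>)
    let ?s = "(0, snd r div 2 ^ m * 2 ^ m + snd \<rho>)"
    have \<rho>: "snd \<rho> < 2 ^ m" "fst \<rho> = 0" using 4 by (auto simp: brows_single)
    have "snd r < 2 * 2 ^ m" using 4 by (simp add: brows_single)
    then have "snd r div 2 ^ m < 2" by (rule less_mult_imp_div_less)
    then have "snd r div 2 ^ m * 2 ^ m \<le> 1 * 2 ^ m" by (intro mult_le_mono1) simp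
    then have "snd r div 2 ^ m * 2 ^ m + snd \<rho> < 2 * 2 ^ m" using \<rho>(1) by linarith
    then have "?s \<in> brows [2 ^ Suc m]" by (simp only: brows_single fst_conv snd_conv power_Suc)
    moreover have "snd ?s div 2 ^ m = snd r div 2 ^ m" "(0, snd ?s mod 2 ^ m) = \<rho>"
      using \<rho> by (simp_all add: prod_eq_iff)
    ultimately show ?case using 4 by (intro exI[of _ ?s]) simp
  qed
  then show ?thesis by (auto simp: total_labelling_def dyadic_labelling_def)
qed

lemma labelling_dyadic_labelling: "labelling [2 ^ Suc m] [2 ^ m] (dyadic_labelling m)"
  using total_dyadic_labelling[of m] by (simp add: total_labelling_def)

lemma block_diagonal_pull:
  "block_diagonal m (block_matrix [2 ^ m] 0 x) = block_matrix [2 ^ Suc m] 0 (pull (dyadic_labelling m) x)"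
proof (rule eq_matI)
  fix p q assume "p < dim_row (block_matrix [2 ^ Suc m] 0 (pull (dyadic_labelling m) x))"
    "q < dim_col (block_matrix [2 ^ Suc m] 0 (pull (dyadic_labelling m) x))"
  then have pq: "p < 2 * 2 ^ m" "q < 2 * 2 ^ m" by (simp_all add: block_matrix_def)
  have dm: "p mod 2 ^ m = (if p < 2 ^ m then p else p - 2 ^ m)" "p div 2 ^ m = (if p < 2 ^ m then 0 else 1)"
    if "p < 2 * 2 ^ m" for p :: nat
    using that by (auto simp: mod_if le_div_geq le_mod_geq not_less)
  show "block_diagonal m (block_matrix [2 ^ m] 0 x) $$ (p, q) = block_matrix [2 ^ Suc m] 0 (pull (dyadic_labelling m) x) $$ (p, q)"
    using pq by (auto simp: block_diagonal_def block_matrix_def pull_def dyadic_labelling_def brows_single dm)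
qed (simp_all add: block_diagonal_def block_matrix_def)

lemma block_matrix_single_iso:
  "block_matrix [k] 0 \<in> ring_iso (block_ring TYPE('d::division_ring) [k]) (matrix_ring TYPE('d) k)"
proof -
  let ?h = "block_matrix [k] 0 :: 'd bmat \<Rightarrow> 'd mat"
  have bij: "bij_betw (matrix_list [k]) (bmats [k]) (carrier (RDirProd_list [matrix_ring TYPE('d) k]))"
    using matrix_list_iso[of "[k]", where ?'d = 'd] by (simp add: ring_iso_def)
  have ml: "matrix_list [k] x = [?h x]" for x by (simp add: matrix_list_def)
  have "bij_betw ?h (bmats [k]) (carrier_mat k k)"
    unfolding bij_betw_def
  proof
    show "inj_on ?h (bmats [k])"
      using bij_betw_imp_inj_on[OF bij] by (auto simp: inj_on_def ml)
    show "?h ` bmats [k] = carrier_mat k k"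
    proof (intro equalityI subsetI)
      fix M :: "'d mat" assume "M \<in> carrier_mat k k"
      then have "[M] \<in> carrier (RDirProd_list [matrix_ring TYPE('d) k])"
        by (intro RDirProd_list_carrier_memI) simp_all
      then have "[M] \<in> matrix_list [k] ` bmats [k]" using bij by (simp add: bij_betw_def)
      then show "M \<in> ?h ` bmats [k]" by (auto simp: ml)
    next
      fix M assume "M \<in> ?h ` bmats [k]"
      then show "M \<in> carrier_mat k k" using block_matrix_closed[of "[k]" 0] by auto
    qed
  qed
  then show ?thesis using block_matrix_hom[of 0 "[k]", where ?'d = 'd] by (simp add: ring_iso_def)
qed

lemma ring_matrix_ring: "ring (matrix_ring TYPE('d::division_ring) k)"
proof -
  have "block_matrix [k] 0 (\<lambda>r s. 0) = (0\<^sub>m k k :: 'd mat)" by (rule eq_matI) (simp_all add: block_matrix_def)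
  then show ?thesis
    using ring.ring_iso_imp_img_ring[OF ring_block_ring block_matrix_single_iso[where ?'d = 'd, of k]]
    by (simp add: matrix_ring_def ring_mat_def)
qed

lemma block_matrix_surj:
  assumes "M \<in> carrier_mat k k"
  obtains x where "x \<in> bmats [k]" "M = block_matrix [k] 0 (x :: 'd::division_ring bmat)"
  using block_matrix_single_iso[of k, where ?'d = 'd] assms by (auto simp: ring_iso_def bij_betw_def)

lemma ring_sequence_dyadic: "ring_sequence (\<lambda>n. matrix_ring TYPE('d::division_ring) (2 ^ n)) block_diagonal"
proof (rule ring_sequence.intro)
  fix n
  show "ring (matrix_ring TYPE('d) (2 ^ n))" by (rule ring_matrix_ring)
  let ?R = "\<lambda>n. matrix_ring TYPE('d) (2 ^ n)" and ?\<mu> = "\<lambda>n. block_matrix [2 ^ n] 0 :: 'd bmat \<Rightarrow> 'd mat"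
  let ?p = "pull (dyadic_labelling n) :: 'd bmat \<Rightarrow> 'd bmat"
  note L = labelling_dyadic_labelling[of n]
  have hom: "?\<mu> n \<in> Ring.ring_hom (block_ring TYPE('d) [2 ^ n]) (?R n)" for n
    using block_matrix_single_iso[where ?'d = 'd] by (simp add: ring_iso_def)
  have mult: "?\<mu> n (bmult [2 ^ n] x y) = ?\<mu> n x * ?\<mu> n y" and add: "?\<mu> n (badd x y) = ?\<mu> n x + ?\<mu> n y"
    if "x \<in> bmats [2 ^ n]" "y \<in> bmats [2 ^ n]" for n x y
    using ring_hom_mult[OF hom, of x n y] ring_hom_add[OF hom, of x n y] that by simp_all
  have one: "?\<mu> n (bdiag (brows [2 ^ n]) 1) = 1\<^sub>m (2 ^ n)" for n using ring_hom_one[OF hom, of n] by simp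
  show "block_diagonal n \<in> Ring.ring_hom (?R n) (?R (Suc n))"
  proof (rule ring_hom_memI)
    fix X Y assume "X \<in> carrier (?R n)" "Y \<in> carrier (?R n)"
    then have XY: "X \<in> carrier_mat (2 ^ n) (2 ^ n)" "Y \<in> carrier_mat (2 ^ n) (2 ^ n)" by simp_all
    obtain x where x: "x \<in> bmats [2 ^ n]" "X = ?\<mu> n x" by (rule block_matrix_surj[OF XY(1)])
    obtain y where y: "y \<in> bmats [2 ^ n]" "Y = ?\<mu> n y" by (rule block_matrix_surj[OF XY(2)])
    have "block_diagonal n (X * Y) = block_diagonal n X * block_diagonal n Y"
      "block_diagonal n (X + Y) = block_diagonal n X + block_diagonal n Y"
      unfolding x y mult[OF x(1) y(1), symmetric] add[OF x(1) y(1), symmetric] block_diagonal_pull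
        pull_bmult[OF L x(1)] pull_badd
      by (rule mult[OF pull_closed[OF L] pull_closed[OF L]] add[OF pull_closed[OF L] pull_closed[OF L]])+
    then show "block_diagonal n (X \<otimes>\<^bsub>?R n\<^esub> Y) = block_diagonal n X \<otimes>\<^bsub>?R (Suc n)\<^esub> block_diagonal n Y"
      "block_diagonal n (X \<oplus>\<^bsub>?R n\<^esub> Y) = block_diagonal n X \<oplus>\<^bsub>?R (Suc n)\<^esub> block_diagonal n Y" by simp_all
  next
    fix X assume "X \<in> carrier (?R n)"
    then show "block_diagonal n X \<in> carrier (?R (Suc n))" by (auto simp: block_diagonal_def)
  next
    have "block_diagonal n (1\<^sub>m (2 ^ n)) = (1\<^sub>m (2 ^ Suc n) :: 'd mat)"
      unfolding one[symmetric] block_diagonal_pull pull_total[OF total_dyadic_labelling] ..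
    then show "block_diagonal n \<one>\<^bsub>?R n\<^esub> = \<one>\<^bsub>?R (Suc n)\<^esub>" by simp
  qed
qed

text \<open>
  The maps of the stages to the limit, on matrices in block diagonal form with a single block.
\<close>

definition dyadic_emb :: "nat \<Rightarrow> 'd::division_ring bmat \<Rightarrow> (nat \<times> 'd mat) set" where
  "dyadic_emb m x = limit_class (\<lambda>n. matrix_ring TYPE('d) (2 ^ n)) block_diagonal m (block_matrix [2 ^ m] 0 x)"

lemma dyadic_emb_hom: "dyadic_emb m \<in> Ring.ring_hom (block_ring TYPE('d::division_ring) [2 ^ m]) (dyadic_limit TYPE('d))"
proof -
  interpret ring_sequence "\<lambda>n. matrix_ring TYPE('d) (2 ^ n)" block_diagonal by (rule ring_sequence_dyadic)
  have "block_matrix [2 ^ m] 0 \<in> Ring.ring_hom (block_ring TYPE('d) [2 ^ m]) (matrix_ring TYPE('d) (2 ^ m))"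
    using block_matrix_single_iso[where ?'d = 'd] by (simp add: ring_iso_def)
  from ring_hom_trans[OF this emb_hom] show ?thesis
    by (simp add: dyadic_limit_def dyadic_emb_def[abs_def] comp_def)
qed

lemma dyadic_emb_step:
  fixes x :: "'d::division_ring bmat"
  shows "dyadic_emb (Suc m) (pull (dyadic_labelling m) x) = dyadic_emb m x"
proof -
  interpret ring_sequence "\<lambda>n. matrix_ring TYPE('d) (2 ^ n)" block_diagonal by (rule ring_sequence_dyadic)
  show ?thesis by (simp only: dyadic_emb_def block_diagonal_pull[symmetric] emb_step)
qed

lemma dyadic_emb_cofinal:
  assumes "t \<in> carrier (dyadic_limit TYPE('d::division_ring))"
  shows "\<exists>n. \<forall>m\<ge>n. t \<in> dyadic_emb m ` bmats [2 ^ m]"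
proof -
  interpret ring_sequence "\<lambda>n. matrix_ring TYPE('d) (2 ^ n)" block_diagonal by (rule ring_sequence_dyadic)
  have "block_matrix [2 ^ m] 0 ` bmats [2 ^ m] = (carrier_mat (2 ^ m) (2 ^ m) :: 'd mat set)" for m
    using block_matrix_single_iso[of "2 ^ m", where ?'d = 'd] by (simp add: ring_iso_def bij_betw_def)
  then have "emb m ` (block_matrix [2 ^ m] 0 ` bmats [2 ^ m]) = emb m ` carrier (matrix_ring TYPE('d) (2 ^ m))" for m
    by (simp only: matrix_ring_simps)
  then have "dyadic_emb m ` bmats [2 ^ m] = emb m ` carrier (matrix_ring TYPE('d) (2 ^ m))" for m
    by (simp only: image_image dyadic_emb_def[abs_def])
  then show ?thesis using emb_cofinal[of t] assms by (simp add: dyadic_limit_def)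
qed

lemma dyadic_emb_bdiag: "dyadic_emb m (bdiag (brows [2 ^ m]) d) = dyadic_limit_structure d"
proof (induction m)
  case 0
  have "block_matrix [2 ^ 0] 0 (bdiag (brows [2 ^ 0]) d) = scalar_matrix (2 ^ 0) d"
    using block_matrix_bdiag[of 0 "[2 ^ 0]" d] by simp
  then show ?case by (simp only: dyadic_emb_def dyadic_limit_structure_def direct_limit_structure_def)
next
  case (Suc m)
  show ?case using dyadic_emb_step[of m "bdiag (brows [2 ^ m]) d"]
    by (simp only: Suc pull_total[OF total_dyadic_labelling])
qed

lemma dyadic_standard_system:
  assumes "M \<in> pseudo_rank_functions (dyadic_limit TYPE('d::division_ring))"
  shows "standard_system (dyadic_limit TYPE('d)) M dyadic_limit_structure (\<lambda>m. [2 ^ m]) dyadic_labelling dyadic_emb"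
proof (intro standard_system.intro pseudo_rank_ring.intro pseudo_rank_ring_axioms.intro standard_system_axioms.intro)
  interpret ring_sequence "\<lambda>n. matrix_ring TYPE('d) (2 ^ n)" block_diagonal by (rule ring_sequence_dyadic)
  show "ring (dyadic_limit TYPE('d))" unfolding dyadic_limit_def by (rule ring_direct_limit)
  show "M \<in> pseudo_rank_functions (dyadic_limit TYPE('d))" by (rule assms)
  fix n
  show "sizes [2 ^ n]" by (simp add: sizes_def)
  show "total_labelling [2 ^ Suc n] [2 ^ n] (dyadic_labelling n)" by (rule total_dyadic_labelling)
  show "dyadic_emb n \<in> Ring.ring_hom (block_ring TYPE('d) [2 ^ n]) (dyadic_limit TYPE('d))" by (rule dyadic_emb_hom)
  show "dyadic_emb (Suc n) (pull (dyadic_labelling n) x) = dyadic_emb n x" for x :: "'d bmat" by (rule dyadic_emb_step)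
  show "dyadic_emb n (bdiag (brows [2 ^ n]) d) = dyadic_limit_structure d" for d :: 'd by (rule dyadic_emb_bdiag)
next
  fix t assume "t \<in> carrier (dyadic_limit TYPE('d))"
  then show "\<exists>n. t \<in> dyadic_emb n ` bmats [2 ^ n]" using dyadic_emb_cofinal[of t] by blast
qed

primrec dyadic_pull :: "nat \<Rightarrow> nat \<Rightarrow> 'd::division_ring bmat \<Rightarrow> 'd bmat" where
  "dyadic_pull m 0 x = x"
| "dyadic_pull m (Suc k) x = pull (dyadic_labelling (m + k)) (dyadic_pull m k x)"

lemma dyadic_pull_closed: "x \<in> bmats [2 ^ m] \<Longrightarrow> dyadic_pull m k x \<in> bmats [2 ^ (m + k)]"
  using pull_closed[OF labelling_dyadic_labelling] by (induction k) simp_all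

lemma transition_block_diagonal:
  "transition block_diagonal m k (block_matrix [2 ^ m] 0 x) = block_matrix [2 ^ (m + k)] 0 (dyadic_pull m k x)"
proof (induction k)
  case (Suc k)
  show ?case using block_diagonal_pull[of "m + k" "dyadic_pull m k x"] by (simp add: Suc)
qed simp

lemma brank_dyadic_labelling:
  assumes x: "x \<in> bmats [2 ^ m]"
  shows "brank [2 ^ Suc m] 0 (pull (dyadic_labelling m) x) = 2 * brank [2 ^ m] 0 x"
proof -
  have "copies [2 ^ Suc m] (dyadic_labelling m) 0 0 * 2 ^ m = 2 * 2 ^ m"
    using copies_total[OF total_dyadic_labelling, of 0 m] by simp
  then have "copies [2 ^ Suc m] (dyadic_labelling m) 0 0 = 2" by simp
  then show ?thesis using brank_pull[OF labelling_dyadic_labelling _ _ x, of 0] by simp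
qed

lemma brank_dyadic_pull: "x \<in> bmats [2 ^ m] \<Longrightarrow> brank [2 ^ (m + k)] 0 (dyadic_pull m k x) = 2 ^ k * brank [2 ^ m] 0 x"
proof (induction k)
  case (Suc k)
  show ?case
    using brank_dyadic_labelling[OF dyadic_pull_closed[OF Suc.prems, of k]] Suc by simp
qed simp

lemma dyadic_pull_inj:
  assumes "x \<in> bmats [2 ^ m]" "y \<in> bmats [2 ^ m]" "dyadic_pull m k x = dyadic_pull m k y"
  shows "x = y"
  using assms(3)
proof (induction k)
  case (Suc k)
  let ?x = "dyadic_pull m k x" and ?y = "dyadic_pull m k y"
  have "?x r s = ?y r s" for r s
  proof (cases "r \<in> brows [2 ^ (m + k)] \<and> s \<in> brows [2 ^ (m + k)]")
    case True
    then have rs: "fst r = 0" "fst s = 0" "snd r < 2 ^ (m + k)" "snd s < 2 ^ (m + k)" by (simp_all add: brows_single)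
    have "pull (dyadic_labelling (m + k)) z r s = z r s" for z :: "'a bmat"
    proof -
      have "r = (0, snd r)" "s = (0, snd s)" using rs by (simp_all add: prod_eq_iff)
      then show ?thesis using rs by (simp add: pull_def dyadic_labelling_def brows_single)
    qed
    then show ?thesis using Suc.prems by (metis dyadic_pull.simps(2))
  next
    case False
    then show ?thesis
      using bmats_zero[OF dyadic_pull_closed[OF assms(1)], of r k s] bmats_zero[OF dyadic_pull_closed[OF assms(2)], of r k s]
      by auto
  qed
  then show ?case by (intro Suc.IH ext)
qed simp

lemma dyadic_emb_eqD:
  fixes x y :: "'d::division_ring bmat"
  assumes x: "x \<in> bmats [2 ^ m]" and y: "y \<in> bmats [2 ^ n]" and eq: "dyadic_emb m x = dyadic_emb n y"
  shows "\<exists>j k. m + j = n + k \<and> dyadic_pull m j x = dyadic_pull n k y"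
proof -
  interpret ring_sequence "\<lambda>n. matrix_ring TYPE('d) (2 ^ n)" block_diagonal by (rule ring_sequence_dyadic)
  have "block_matrix [2 ^ m] 0 x \<in> carrier (matrix_ring TYPE('d) (2 ^ m))"
    using block_matrix_closed[of "[2 ^ m]" 0 x] by simp
  from emb_eqD[OF this eq[unfolded dyadic_emb_def]] obtain j k where jk: "m + j = n + k"
    and "block_matrix [2 ^ (m + j)] 0 (dyadic_pull m j x) = block_matrix [2 ^ (n + k)] 0 (dyadic_pull n k y)"
    unfolding transition_block_diagonal by blast
  then have "block_matrix [2 ^ (m + j)] 0 (dyadic_pull m j x) = block_matrix [2 ^ (m + j)] 0 (dyadic_pull n k y)" by simp
  moreover have "dyadic_pull m j x \<in> bmats [2 ^ (m + j)]" "dyadic_pull n k y \<in> bmats [2 ^ (m + j)]"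
    using dyadic_pull_closed[OF x, of j] dyadic_pull_closed[OF y, of k] jk by simp_all
  ultimately have "dyadic_pull m j x = dyadic_pull n k y"
    using block_matrix_single_iso[of "2 ^ (m + j)", where ?'d = 'd] by (auto simp: ring_iso_def bij_betw_def dest: inj_onD)
  then show ?thesis using jk by blast
qed

lemma dyadic_emb_inj:
  assumes "x \<in> bmats [2 ^ m]" "y \<in> bmats [2 ^ m]" "dyadic_emb m x = dyadic_emb m y"
  shows "x = y"
  using dyadic_emb_eqD[OF assms] dyadic_pull_inj[OF assms(1,2)] by auto

lemma dyadic_emb_brank:
  assumes x: "x \<in> bmats [2 ^ m]" and y: "y \<in> bmats [2 ^ n]" and eq: "dyadic_emb m x = dyadic_emb n y"
  shows "real (brank [2 ^ m] 0 x) / 2 ^ m = real (brank [2 ^ n] 0 y) / 2 ^ n"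
proof -
  obtain j k where jk: "m + j = n + k" "dyadic_pull m j x = dyadic_pull n k y" using dyadic_emb_eqD[OF assms] by blast
  have "real (brank [2 ^ m] 0 x) / 2 ^ m = real (2 ^ j * brank [2 ^ m] 0 x) / 2 ^ (m + j)" by (simp add: power_add)
  also have "2 ^ j * brank [2 ^ m] 0 x = brank [2 ^ (m + j)] 0 (dyadic_pull m j x)"
    using brank_dyadic_pull[OF x, of j] by simp
  also have "\<dots> = brank [2 ^ (n + k)] 0 (dyadic_pull n k y)" by (simp only: jk)
  also have "\<dots> = 2 ^ k * brank [2 ^ n] 0 y" by (rule brank_dyadic_pull[OF y])
  also have "real (2 ^ k * brank [2 ^ n] 0 y) / 2 ^ (m + j) = real (brank [2 ^ n] 0 y) / 2 ^ n"
    by (simp add: jk(1) power_add)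
  finally show ?thesis .
qed

text \<open>
  The rank of a matrix of size \<open>2 ^ m\<close>, divided by \<open>2 ^ m\<close>: the embedding into the next stage doubles
  both.  Idempotents and orthogonality are seen at a single stage, as the stages are embedded
  injectively.
\<close>

lemma dyadic_rank_function_exists: "\<exists>M. M \<in> rank_functions (dyadic_limit TYPE('d::division_ring))"
proof -
  let ?T = "dyadic_limit TYPE('d)"
  define M where "M = restrict (\<lambda>t. THE v. \<exists>m x. (x :: 'd bmat) \<in> bmats [2 ^ m] \<and> t = dyadic_emb m x \<and>
      v = real (brank [2 ^ m] 0 x) / 2 ^ m) (carrier ?T)"
  have cl: "dyadic_emb m x \<in> carrier ?T" if "x \<in> bmats [2 ^ m]" for m x
    using ring_hom_closed[OF dyadic_emb_hom, of x m] that by simp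
  have M: "M (dyadic_emb m x) = real (brank [2 ^ m] 0 x) / 2 ^ m" if x: "x \<in> bmats [2 ^ m]" for m x
  proof -
    have "(THE v. \<exists>n y. (y :: 'd bmat) \<in> bmats [2 ^ n] \<and> dyadic_emb m x = dyadic_emb n y \<and>
      v = real (brank [2 ^ n] 0 y) / 2 ^ n) = real (brank [2 ^ m] 0 x) / 2 ^ m"
    proof (rule the_equality)
      fix v assume "\<exists>n y. (y :: 'd bmat) \<in> bmats [2 ^ n] \<and> dyadic_emb m x = dyadic_emb n y \<and> v = real (brank [2 ^ n] 0 y) / 2 ^ n"
      then show "v = real (brank [2 ^ m] 0 x) / 2 ^ m" using dyadic_emb_brank[OF x] by auto
    qed (use x in blast)
    then show ?thesis using cl[OF x] by (simp add: M_def)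
  qed
  have common: "\<exists>m x y. x \<in> bmats [2 ^ m] \<and> y \<in> bmats [2 ^ m] \<and> a = dyadic_emb m x \<and> b = dyadic_emb m y"
    if ab: "a \<in> carrier ?T" "b \<in> carrier ?T" for a b
  proof -
    obtain n n' where n: "\<And>m. m \<ge> n \<Longrightarrow> a \<in> dyadic_emb m ` bmats [2 ^ m]" "\<And>m. m \<ge> n' \<Longrightarrow> b \<in> dyadic_emb m ` bmats [2 ^ m]"
      using dyadic_emb_cofinal[OF ab(1)] dyadic_emb_cofinal[OF ab(2)] by blast
    show ?thesis using n(1)[of "n + n'"] n(2)[of "n + n'"] by auto
  qed
  have mult: "dyadic_emb m x \<otimes>\<^bsub>?T\<^esub> dyadic_emb m y = dyadic_emb m (bmult [2 ^ m] x y)"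
    and add: "dyadic_emb m x \<oplus>\<^bsub>?T\<^esub> dyadic_emb m y = dyadic_emb m (badd x y)"
    if "x \<in> bmats [2 ^ m]" "y \<in> bmats [2 ^ m]" for m x y
    using ring_hom_mult[OF dyadic_emb_hom, of x m y] ring_hom_add[OF dyadic_emb_hom, of x m y] that by simp_all
  have one: "\<one>\<^bsub>?T\<^esub> = dyadic_emb m (bdiag (brows [2 ^ m]) 1)" for m
    using ring_hom_one[OF dyadic_emb_hom, of m, where ?'d1 = 'd] by simp
  have ringT: "ring ?T"
    unfolding dyadic_limit_def by (rule ring_sequence.ring_direct_limit[OF ring_sequence_dyadic])
  have zero: "\<zero>\<^bsub>?T\<^esub> = dyadic_emb m (\<lambda>r s. 0)" for m
    using ring_hom_zero[OF dyadic_emb_hom ring_block_ring ringT, of m] by simp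
  have rl: "rank_like [2 ^ m] (\<lambda>x. real (brank [2 ^ m] 0 (x :: 'd bmat)))" for m by (rule rank_like_brank)
  have "M \<in> pseudo_rank_functions ?T"
    unfolding pseudo_rank_functions_def
  proof (intro CollectI conjI ballI impI)
    have "M t \<in> {0..1}" if t: "t \<in> carrier ?T" for t
    proof -
      obtain m x where x: "x \<in> bmats [2 ^ m]" "t = dyadic_emb m x" using common[OF t t] by blast
      have "real (brank [2 ^ m] 0 x) \<le> real (2 ^ m)" using brank_le[of 0 "[2 ^ m]" x] by (intro of_nat_mono) simp
      then show ?thesis using M[OF x(1)] x(2) by simp
    qed
    then show "M \<in> carrier ?T \<rightarrow>\<^sub>E {0..1}" by (intro PiE_I) (auto simp: M_def)
    have "brank [2 ^ 0] 0 (bdiag (brows [2 ^ 0]) (1 :: 'd)) = 1" using brank_one[of 0 "[2 ^ 0]"] by simp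
    then show "M \<one>\<^bsub>?T\<^esub> = 1" using M[of "bdiag (brows [2 ^ 0]) 1" 0] by (simp add: one[of 0])
  next
    fix a b assume "a \<in> carrier ?T" "b \<in> carrier ?T"
    then obtain m x y where x: "x \<in> bmats [2 ^ m]" and y: "y \<in> bmats [2 ^ m]" and ab: "a = dyadic_emb m x" "b = dyadic_emb m y"
      using common by blast
    show "M (a \<oplus>\<^bsub>?T\<^esub> b) \<le> M a + M b"
      using rank_like_add[OF rl x y] x y by (simp add: ab add M flip: add_divide_distrib) (simp add: divide_right_mono)
    show "M (a \<otimes>\<^bsub>?T\<^esub> b) \<le> M a" "M (a \<otimes>\<^bsub>?T\<^esub> b) \<le> M b"
      using rank_like_mult[OF rl x y] x y by (simp_all add: ab mult M divide_right_mono)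
  next
    fix e f assume "e \<in> idempotents ?T" "f \<in> idempotents ?T" and 0: "e \<otimes>\<^bsub>?T\<^esub> f = \<zero>\<^bsub>?T\<^esub>" "f \<otimes>\<^bsub>?T\<^esub> e = \<zero>\<^bsub>?T\<^esub>"
    then have ef: "e \<in> carrier ?T" "f \<in> carrier ?T" and 1: "e \<otimes>\<^bsub>?T\<^esub> e = e" "f \<otimes>\<^bsub>?T\<^esub> f = f"
      by (simp_all add: idempotents_def)
    obtain m x y where x: "x \<in> bmats [2 ^ m]" and y: "y \<in> bmats [2 ^ m]" and eq: "e = dyadic_emb m x" "f = dyadic_emb m y"
      using common[OF ef] by blast
    have "bmult [2 ^ m] x x = x" "bmult [2 ^ m] y y = y"
      using 1 x y by (auto intro!: dyadic_emb_inj simp: eq mult)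
    moreover have "bmult [2 ^ m] x y = (\<lambda>r s. 0)" "bmult [2 ^ m] y x = (\<lambda>r s. 0)"
      using 0 x y by (auto intro!: dyadic_emb_inj simp: eq mult zero[of m])
    ultimately have "real (brank [2 ^ m] 0 (badd x y)) = real (brank [2 ^ m] 0 x) + real (brank [2 ^ m] 0 y)"
      using rl[of m] x y unfolding rank_like_def by blast
    then show "M (e \<oplus>\<^bsub>?T\<^esub> f) = M e + M f"
      using x y by (simp add: eq add M add_divide_distrib)
  qed
  moreover have "a = \<zero>\<^bsub>?T\<^esub>" if a: "a \<in> carrier ?T" "M a = 0" for a
  proof -
    obtain m x where x: "x \<in> bmats [2 ^ m]" "a = dyadic_emb m x" using common[OF a(1) a(1)] by blast
    then have "brank [2 ^ m] 0 x = 0" using a(2) by (simp add: M)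
    then have "\<forall>r\<in>block [2 ^ m] 0. \<forall>s\<in>block [2 ^ m] 0. x r s = 0" by (simp only: brank_eq_0_iff)
    moreover have "block [2 ^ m] 0 = brows [2 ^ m]" by (auto simp: block_def brows_single)
    ultimately have "x r s = 0" if "r \<in> brows [2 ^ m]" "s \<in> brows [2 ^ m]" for r s using that by simp
    then have "x r s = 0" for r s using bmats_zero[OF x(1), of r s] by blast
    then have "x = (\<lambda>r s. 0)" by (intro ext)
    then show ?thesis by (simp add: x(2) zero[of m])
  qed
  ultimately show ?thesis unfolding rank_functions_def by blast
qed

text \<open>All weights of the dyadic limit are forced: the only block of the level \<open>m\<close> has weight \<open>1 / 2 ^ m\<close>.\<close>

lemma dyadic_pseudo_rank_function_unique:
  assumes M: "M \<in> pseudo_rank_functions (dyadic_limit TYPE('d::division_ring))"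
    and M': "M' \<in> pseudo_rank_functions (dyadic_limit TYPE('d))"
  shows "M = M'"
proof -
  let ?T = "dyadic_limit TYPE('d)"
  have val: "P (dyadic_emb m x) = real (brank [2 ^ m] 0 x) / 2 ^ m"
    if P: "P \<in> pseudo_rank_functions ?T" and x: "x \<in> bmats [2 ^ m]" for P m x
  proof -
    interpret standard_system ?T P dyadic_limit_structure "\<lambda>m. [2 ^ m]" dyadic_labelling dyadic_emb
      by (rule dyadic_standard_system[OF P])
    show ?thesis using N_beta[OF x] sum_wt[of m] by (simp add: field_simps)
  qed
  have eq: "M t = M' t" if t: "t \<in> carrier ?T" for t
  proof -
    obtain m x where x: "x \<in> bmats [2 ^ m]" "t = dyadic_emb m x" using dyadic_emb_cofinal[OF t] by blast
    then show ?thesis by (simp add: val[OF M] val[OF M'])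
  qed
  have "M \<in> carrier ?T \<rightarrow>\<^sub>E {0..1}" "M' \<in> carrier ?T \<rightarrow>\<^sub>E {0..1}"
    using M M' by (simp_all add: pseudo_rank_functions_def)
  then show "M = M'" by (rule PiE_ext) (rule eq)
qed

lemma dyadic_rank: "dyadic_rank TYPE('d::division_ring) \<in> rank_functions (dyadic_limit TYPE('d))"
proof -
  have "\<exists>!M. M \<in> rank_functions (dyadic_limit TYPE('d))"
    using dyadic_rank_function_exists dyadic_pseudo_rank_function_unique by (auto simp: rank_functions_def)
  from theI'[OF this] show ?thesis by (simp only: dyadic_rank_def)
qed

section \<open>Uniqueness of the completion\<close>

lemma (in standard_system) D_ring_completion: "D_ring (completion A N) (completion_map A N \<circ> \<iota>)"
proof -
  have "(\<lambda>d. \<beta> 0 (bdiag (brows (ns 0)) d)) \<in> Ring.ring_hom (type_ring TYPE('d)) A"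
  proof (rule ring_hom_memI)
    fix c d :: 'd
    let ?D = "bdiag (brows (ns 0)) :: 'd \<Rightarrow> 'd bmat"
    have "?D (c * d) = bmult (ns 0) (?D c) (?D d)" by (simp add: bdiag_mult_bdiag)
    then show "\<beta> 0 (?D (c \<otimes>\<^bsub>type_ring TYPE('d)\<^esub> d)) = \<beta> 0 (?D c) \<otimes> \<beta> 0 (?D d)"
      using beta_mult[of "?D c" 0 "?D d"] by (simp add: type_ring_def)
    have "?D (c + d) = badd (?D c) (?D d)" by (auto simp: bdiag_def badd_def fun_eq_iff)
    then show "\<beta> 0 (?D (c \<oplus>\<^bsub>type_ring TYPE('d)\<^esub> d)) = \<beta> 0 (?D c) \<oplus> \<beta> 0 (?D d)"
      using beta_add[of "?D c" 0 "?D d"] by (simp add: type_ring_def)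
  qed (simp_all add: type_ring_def beta_one)
  then have "\<iota> \<in> Ring.ring_hom (type_ring TYPE('d)) A" by (simp add: scal)
  from ring_hom_trans[OF this completion_map_hom] show ?thesis
    by (simp add: D_ring_def ring_completion)
qed

theorem theorem3p2:
  fixes A :: "('a, 'm) ring_scheme"
    and \<iota> :: "'d::division_ring \<Rightarrow> 'a"
    and N :: "'a \<Rightarrow> real"
  assumes "ultramatricial_D_ring A \<iota>"
    and "extremal_pseudo_rank_function A N"
    and "continuous_factor (completion A N)"
  shows "D_ring_isomorphic (completion A N) (completion_map A N \<circ> \<iota>)
           (M_D TYPE('d)) M_D_structure"
proof -
  let ?T = "dyadic_limit TYPE('d)" and ?M = "dyadic_rank TYPE('d)"
  have N: "N \<in> pseudo_rank_functions A" using assms(2) by (simp add: extremal_pseudo_rank_function_def)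
  have M: "?M \<in> pseudo_rank_functions ?T" using dyadic_rank[where ?'d = 'd] by (simp add: rank_functions_def)
  obtain ns L \<beta> where sA: "standard_system A N \<iota> ns L \<beta>"
    using ultramatricial_standard_system[OF assms(1) N] by blast
  have no_abelian: "e = \<zero>\<^bsub>completion A N\<^esub>" if "abelian_idempotent (completion A N) e" for e
    using assms(3) that by (auto simp: continuous_factor_def type_II_f_def type_II_def)
  interpret intertwining A N \<iota> ns L \<beta> ?T ?M dyadic_limit_structure "\<lambda>m. [2 ^ m]" dyadic_labelling dyadic_emb
  proof (intro intertwining.intro intertwining_axioms.intro)
    show "standard_system A N \<iota> ns L \<beta>" by (rule sA)
    show "standard_system ?T ?M dyadic_limit_structure (\<lambda>m. [2 ^ m]) dyadic_labelling dyadic_emb"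
      by (rule dyadic_standard_system[OF M])
    show "t = \<zero>\<^bsub>?T\<^esub>" if "t \<in> carrier ?T" "?M t = 0" for t
      using dyadic_rank[where ?'d = 'd] that by (simp add: rank_functions_def)
    show "extremal_pseudo_rank_function A N" by (rule assms(2))
    show "(\<lambda>n. \<Sum>j<length (ns n). standard_system.wt N \<beta> n j) \<longlonglongrightarrow> 0"
      by (rule standard_system.sum_wt_tendsto_0[OF sA assms(2) no_abelian])
  qed simp
  obtain \<Phi> where \<Phi>: "\<Phi> \<in> ring_iso (completion A N) (completion ?T ?M)"
    and scal: "\<And>d. \<Phi> (completion_map A N (\<iota> d)) = completion_map ?T ?M (dyadic_limit_structure d)"
    using completions_isomorphic by blast
  have str: "M_D_structure = completion_map ?T ?M \<circ> dyadic_limit_structure" by (rule M_D_structure_def)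
  have "\<Phi> \<in> D_ring_hom (completion A N) (completion_map A N \<circ> \<iota>) (M_D TYPE('d)) M_D_structure"
    using \<Phi> by (auto simp: D_ring_hom_def ring_iso_def M_D_def str scal)
  moreover have "bij_betw \<Phi> (carrier (completion A N)) (carrier (M_D TYPE('d)))"
    using \<Phi> by (simp add: ring_iso_def M_D_def)
  ultimately show ?thesis
    using A.D_ring_completion T.D_ring_completion unfolding D_ring_isomorphic_def M_D_def str by blast
qed

end
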